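(* Let $\Omega\subset\mathbb{R}^n$ be an open set, let $\phi\in\Phi_w(\Omega)$ be a generalized weak $\Phi$-function satisfying Assumptions (A), (aInc) and (aDec), and let $(\psi_\epsilon)_{\epsilon>0}$ be a family of functions such that $\psi_\epsilon\in L^1(0,\infty)$, $\psi_\epsilon\ge 0$, $\int_0^\infty\psi_\epsilon(r)\,dr=1$ for every $\epsilon>0$, and $\lim_{\epsilon\to0^+}\int_\gamma^\infty\psi_\epsilon(r)\,dr=0$ for every $\gamma>0$. Then for every $f\in L^1_{\rm loc}(\Omega)$, $$\nabla f\in L^{\phi(\cdot)}(\Omega;\mathbb{R}^n)\quad\Longleftrightarrow\quad \limsup_{\epsilon\to0^+}\varrho^\epsilon_{\#,\Omega}(f)<\infty .$$ Moreover, there is a constant $C\ge1$, independent of $f$, such that in this case $$\tfrac1C\,\varrho_{\phi(\cdot),\Omega}(c_n|\nabla f|)\le\liminf_{\epsilon\to0^+}\varrho^\epsilon_{\#,\Omega}(f)\le\limsup_{\epsilon\to0^+}\varrho^\epsilon_{\#,\Omega}(f)\le C\,\varrho_{\phi(\cdot),\Omega}(c_n|\nabla f|)$$ and $$\tfrac1C\,c_n\|\nabla f\|_{\phi(\cdot),\Omega}\le\liminf_{\epsilon\to0^+}\|f\|^\epsilon_{\#,\Omega}\le\limsup_{\epsilon\to0^+}\|f\|^\epsilon_{\#,\Omega}\le C\,c_n\|\nabla f\|_{\phi(\cdot),\Omega},$$ where $c_n:=\frac{1}{|B(0,1)|}\int_{B(0,1)}|x\cdot e_1|\,dx$.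
   Context: "Increasing" means nondecreasing. $B(x,r)$ is the open ball. A function $g:D\subset\mathbb{R}\to[0,\infty]$ is almost increasing (with constant $c>0$) if $g(t_1)\le c\,g(t_2)$ for all $t_1\le t_2$ in $D$, and almost decreasing (with constant $c>0$) if $g(t_1)\ge c\,g(t_2)$ for all $t_1\le t_2$ in $D$. A weak $\Phi$-function is an increasing function $\phi:[0,\infty)\to[0,\infty]$ with $\phi(0)=\lim_{t\to0^+}\phi(t)=0$, $\lim_{t\to\infty}\phi(t)=\infty$, and $t\mapsto\phi(t)/t$ almost increasing. $\Phi_w(\Omega)$ is the set of $\phi:\Omega\times[0,\infty)\to[0,\infty]$ such that $\phi(\cdot,t)$ is Lebesgue measurable for every $t\ge0$ and $\phi(x,\cdot)$ is a weak $\Phi$-function for every $x\in\Omega$, with the constant of almost-monotonicity of $t\mapsto\phi(x,t)/t$ independent of $x$. $\phi^{-1}(x,s):=\inf\{t\ge0:\phi(x,t)\ge s\}$ is the left-continuous generalized inverse in the second variable. (aInc): there is $\phi_\uparrow>1$ such that for a.e. $x\in\Omega$ the map $s\mapsto s^{-\phi_\uparrow}\phi(x,s)$ is almost increasing with constant independent of $x$. (aDec): there is $\phi_\downarrow>1$ such that for a.e. $x\in\Omega$ the map $s\mapsto s^{-\phi_\downarrow}\phi(x,s)$ is almost decreasing with constant independent of $x$. (A): there exist $\beta,\sigma>0$ for which all of the following hold: (A0) $\phi(x,\beta\sigma)\le1\le\phi(x,\sigma)$ for all $x\in\Omega$; (A1) $\phi(x,\beta t)\le\phi(y,t)$ for every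 ball $B\subset\Omega$, all $x,y\in B$ and all $t\in[\sigma,\phi^{-1}(y,1/|B|)]$; (A2) there is $h\in L^1(\Omega)\cap L^\infty(\Omega)$ such that $\phi(x,\beta t)\le\phi(y,t)+h(x)+h(y)$ for a.e. $x,y\in\Omega$ and all $t\in[0,\sigma]$. For measurable $g$ on $\Omega$: $\varrho_{\phi(\cdot),\Omega}(g):=\int_\Omega\phi(x,|g(x)|)\,dx$; $L^{\phi(\cdot)}(\Omega)$ is the set of measurable $g$ with $\varrho_{\phi(\cdot),\Omega}(\lambda g)<\infty$ for some $\lambda>0$; $\|g\|_{\phi(\cdot),\Omega}:=\inf\{\lambda>0:\varrho_{\phi(\cdot),\Omega}(g/\lambda)\le1\}$. For vector-valued functions use the Euclidean norm $|\cdot|$ of the values. $\nabla f$ is the weak (distributional) gradient; "$\nabla f\in L^{\phi(\cdot)}$" means that it exists as a function and lies in this space. For $r>0$, $\Omega_r:=\{x\in\Omega:\operatorname{dist}(x,\partial\Omega)>r\}$ (with $\Omega_r=\mathbb{R}^n$ if $\Omega=\mathbb{R}^n$). For $f\in L^1_{\rm loc}(\Omega)$ and $x\in\Omega_r$, $$f_{B(x,r)}:=\frac{1}{|B(x,r)|}\int_{B(x,r)}f\,dy,\qquad M^\#_{B(x,r)}f:=\frac{1}{|B(x,r)|}\int_{B(x,r)}|f(y)-f_{B(x,r)}|\,dy,$$ $$\varrho^\epsilon_{\#,\Omega}(f):=\int_0^\infty\int_{\Omega_r}\phi\big(x,\tfrac1rM^\#_{B(x,r)}f\big)\,dx\,\psi_\epsilon(r)\,dr,\qquad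 \|f\|^\epsilon_{\#,\Omega}:=\inf\{\lambda>0:\varrho^\epsilon_{\#,\Omega}(f/\lambda)\le1\}.$$ *)

theory Defs
  imports "HOL-Analysis.Analysis"
begin

subsection \<open>Generalized weak Phi-functions\<close>

definition almost_increasing_on :: "real set \<Rightarrow> real \<Rightarrow> (real \<Rightarrow> ennreal) \<Rightarrow> bool" where
  "almost_increasing_on D c g \<longleftrightarrow> (\<forall>t1\<in>D. \<forall>t2\<in>D. t1 \<le> t2 \<longrightarrow> g t1 \<le> ennreal c * g t2)"

definition almost_decreasing_on :: "real set \<Rightarrow> real \<Rightarrow> (real \<Rightarrow> ennreal) \<Rightarrow> bool" where
  "almost_decreasing_on D c g \<longleftrightarrow> (\<forall>t1\<in>D. \<forall>t2\<in>D. t1 \<le> t2 \<longrightarrow> ennreal c * g t2 \<le> g t1)"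

text \<open>A function on \<open>[0,\<infinity>)\<close> is a function on the reals of which only the values at
  nonnegative arguments matter; quotients by \<open>t\<close> and negative powers of \<open>t\<close> are considered
  for \<open>t > 0\<close>. The constant \<open>c\<close> of almost-monotonicity is a parameter, so that it can be
  required to be uniform in \<open>x\<close> below.\<close>

definition weak_Phi_function_with :: "real \<Rightarrow> (real \<Rightarrow> ennreal) \<Rightarrow> bool" where
  "weak_Phi_function_with c \<phi> \<longleftrightarrow>
     mono_on {0..} \<phi> \<and> \<phi> 0 = 0 \<and> (\<phi> \<longlongrightarrow> 0) (at_right 0) \<and> (\<phi> \<longlongrightarrow> \<infinity>) at_top \<and>
     almost_increasing_on {0<..} c (\<lambda>t. \<phi> t / ennreal t)"

definition Phi_w :: "'a::euclidean_space set \<Rightarrow> ('a \<Rightarrow> real \<Rightarrow> ennreal) set" where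
  "Phi_w \<Omega> = {\<phi>. (\<forall>t\<ge>0. (\<lambda>x. \<phi> x t) \<in> borel_measurable (lebesgue_on \<Omega>)) \<and>
                  (\<exists>c>0. \<forall>x\<in>\<Omega>. weak_Phi_function_with c (\<phi> x))}"

definition left_inverse :: "('a \<Rightarrow> real \<Rightarrow> ennreal) \<Rightarrow> 'a \<Rightarrow> ennreal \<Rightarrow> ennreal" where
  "left_inverse \<phi> x s = Inf {ennreal t | t. 0 \<le> t \<and> s \<le> \<phi> x t}"

definition aInc :: "'a::euclidean_space set \<Rightarrow> ('a \<Rightarrow> real \<Rightarrow> ennreal) \<Rightarrow> bool" where
  "aInc \<Omega> \<phi> \<longleftrightarrow> (\<exists>p>1. \<exists>c>0. AE x in lebesgue_on \<Omega>.
     almost_increasing_on {0<..} c (\<lambda>s. ennreal (s powr (- p)) * \<phi> x s))"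

definition aDec :: "'a::euclidean_space set \<Rightarrow> ('a \<Rightarrow> real \<Rightarrow> ennreal) \<Rightarrow> bool" where
  "aDec \<Omega> \<phi> \<longleftrightarrow> (\<exists>p>1. \<exists>c>0. AE x in lebesgue_on \<Omega>.
     almost_decreasing_on {0<..} c (\<lambda>s. ennreal (s powr (- p)) * \<phi> x s))"

definition assm_A0 :: "'a::euclidean_space set \<Rightarrow> ('a \<Rightarrow> real \<Rightarrow> ennreal) \<Rightarrow> real \<Rightarrow> real \<Rightarrow> bool" where
  "assm_A0 \<Omega> \<phi> \<beta> \<sigma> \<longleftrightarrow> (\<forall>x\<in>\<Omega>. \<phi> x (\<beta> * \<sigma>) \<le> 1 \<and> 1 \<le> \<phi> x \<sigma>)"

definition assm_A1 :: "'a::euclidean_space set \<Rightarrow> ('a \<Rightarrow> real \<Rightarrow> ennreal) \<Rightarrow> real \<Rightarrow> real \<Rightarrow> bool" where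
  "assm_A1 \<Omega> \<phi> \<beta> \<sigma> \<longleftrightarrow>
     (\<forall>z r. 0 < r \<and> ball z r \<subseteq> \<Omega> \<longrightarrow>
        (\<forall>x\<in>ball z r. \<forall>y\<in>ball z r. \<forall>t.
           \<sigma> \<le> t \<and> ennreal t \<le> left_inverse \<phi> y (1 / emeasure lebesgue (ball z r)) \<longrightarrow>
           \<phi> x (\<beta> * t) \<le> \<phi> y t))"

text \<open>The sign of \<open>h\<close> is not prescribed, hence the inequality is stated in the extended reals.\<close>

definition assm_A2 :: "'a::euclidean_space set \<Rightarrow> ('a \<Rightarrow> real \<Rightarrow> ennreal) \<Rightarrow> real \<Rightarrow> real \<Rightarrow> bool" where
  "assm_A2 \<Omega> \<phi> \<beta> \<sigma> \<longleftrightarrow>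
     (\<exists>h :: 'a \<Rightarrow> real. integrable (lebesgue_on \<Omega>) h \<and> (\<exists>M. AE x in lebesgue_on \<Omega>. \<bar>h x\<bar> \<le> M) \<and>
        (AE x in lebesgue_on \<Omega>. AE y in lebesgue_on \<Omega>. \<forall>t\<in>{0..\<sigma>}.
           enn2ereal (\<phi> x (\<beta> * t)) \<le> enn2ereal (\<phi> y t) + ereal (h x) + ereal (h y)))"

definition assm_A :: "'a::euclidean_space set \<Rightarrow> ('a \<Rightarrow> real \<Rightarrow> ennreal) \<Rightarrow> bool" where
  "assm_A \<Omega> \<phi> \<longleftrightarrow>
     (\<exists>\<beta>>0. \<exists>\<sigma>>0. assm_A0 \<Omega> \<phi> \<beta> \<sigma> \<and> assm_A1 \<Omega> \<phi> \<beta> \<sigma> \<and> assm_A2 \<Omega> \<phi> \<beta> \<sigma>)"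


subsection \<open>Modular, generalized Orlicz space and Luxemburg norm\<close>

definition modular ::
    "'a::euclidean_space set \<Rightarrow> ('a \<Rightarrow> real \<Rightarrow> ennreal) \<Rightarrow> ('a \<Rightarrow> 'b::real_normed_vector) \<Rightarrow> ennreal" where
  "modular \<Omega> \<phi> g = (\<integral>\<^sup>+x. \<phi> x (norm (g x)) \<partial>lebesgue_on \<Omega>)"

definition Lphi ::
    "'a::euclidean_space set \<Rightarrow> ('a \<Rightarrow> real \<Rightarrow> ennreal) \<Rightarrow> ('a \<Rightarrow> 'b::real_normed_vector) set" where
  "Lphi \<Omega> \<phi> = {g \<in> borel_measurable (lebesgue_on \<Omega>). \<exists>l>0. modular \<Omega> \<phi> (\<lambda>x. l *\<^sub>R g x) < \<infinity>}"

definition Lphi_norm ::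
    "'a::euclidean_space set \<Rightarrow> ('a \<Rightarrow> real \<Rightarrow> ennreal) \<Rightarrow> ('a \<Rightarrow> 'b::real_normed_vector) \<Rightarrow> ennreal" where
  "Lphi_norm \<Omega> \<phi> g = Inf {ennreal l | l. 0 < l \<and> modular \<Omega> \<phi> (\<lambda>x. g x /\<^sub>R l) \<le> 1}"


subsection \<open>Local integrability and weak gradients\<close>

definition locally_integrable ::
    "'a::euclidean_space set \<Rightarrow> ('a \<Rightarrow> 'b::{banach, second_countable_topology}) \<Rightarrow> bool" where
  "locally_integrable \<Omega> f \<longleftrightarrow> (\<forall>K. compact K \<and> K \<subseteq> \<Omega> \<longrightarrow> integrable (lebesgue_on K) f)"

primrec k_times_cont_diff :: "nat \<Rightarrow> ('a::euclidean_space \<Rightarrow> real) \<Rightarrow> bool" where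
  "k_times_cont_diff 0 g \<longleftrightarrow> continuous_on UNIV g"
| "k_times_cont_diff (Suc k) g \<longleftrightarrow> g differentiable_on UNIV \<and>
     (\<forall>b\<in>Basis. k_times_cont_diff k (\<lambda>x. frechet_derivative g (at x) b))"

definition test_function :: "'a::euclidean_space set \<Rightarrow> ('a \<Rightarrow> real) \<Rightarrow> bool" where
  "test_function \<Omega> \<eta> \<longleftrightarrow> (\<forall>k. k_times_cont_diff k \<eta>) \<and>
     compact (closure {x. \<eta> x \<noteq> 0}) \<and> closure {x. \<eta> x \<noteq> 0} \<subseteq> \<Omega>"

definition weak_gradient ::
    "'a::euclidean_space set \<Rightarrow> ('a \<Rightarrow> real) \<Rightarrow> ('a \<Rightarrow> 'a) \<Rightarrow> bool" where
  "weak_gradient \<Omega> f G \<longleftrightarrow> locally_integrable \<Omega> G \<and>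
     (\<forall>\<eta>. test_function \<Omega> \<eta> \<longrightarrow> (\<forall>b\<in>Basis.
        (LINT x|lebesgue_on \<Omega>. f x * frechet_derivative \<eta> (at x) b) =
        - (LINT x|lebesgue_on \<Omega>. (G x \<bullet> b) * \<eta> x)))"


subsection \<open>The sharp modular and norm\<close>

text \<open>The case distinction is needed because \<^term>\<open>infdist x {} = 0\<close>.\<close>

definition inner_part :: "'a::euclidean_space set \<Rightarrow> real \<Rightarrow> 'a set" where
  "inner_part \<Omega> r = (if \<Omega> = UNIV then UNIV else {x\<in>\<Omega>. r < infdist x (frontier \<Omega>)})"

definition ball_average :: "('a::euclidean_space \<Rightarrow> real) \<Rightarrow> 'a \<Rightarrow> real \<Rightarrow> real" where
  "ball_average f x r = (LINT y|lebesgue_on (ball x r). f y) / measure lebesgue (ball x r)"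

definition sharp_average :: "('a::euclidean_space \<Rightarrow> real) \<Rightarrow> 'a \<Rightarrow> real \<Rightarrow> real" where
  "sharp_average f x r = ball_average (\<lambda>y. \<bar>f y - ball_average f x r\<bar>) x r"

text \<open>Here \<open>\<psi>\<close> is a single weight, to be instantiated with a member of the family.\<close>

definition sharp_modular ::
    "'a::euclidean_space set \<Rightarrow> ('a \<Rightarrow> real \<Rightarrow> ennreal) \<Rightarrow> (real \<Rightarrow> real) \<Rightarrow> ('a \<Rightarrow> real) \<Rightarrow> ennreal" where
  "sharp_modular \<Omega> \<phi> \<psi> f =
     (\<integral>\<^sup>+r. (\<integral>\<^sup>+x. \<phi> x (1 / r * sharp_average f x r) \<partial>lebesgue_on (inner_part \<Omega> r)) * ennreal (\<psi> r)
        \<partial>lebesgue_on {0<..})"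

definition sharp_norm ::
    "'a::euclidean_space set \<Rightarrow> ('a \<Rightarrow> real \<Rightarrow> ennreal) \<Rightarrow> (real \<Rightarrow> real) \<Rightarrow> ('a \<Rightarrow> real) \<Rightarrow> ennreal" where
  "sharp_norm \<Omega> \<phi> \<psi> f = Inf {ennreal l | l. 0 < l \<and> sharp_modular \<Omega> \<phi> \<psi> (\<lambda>x. f x / l) \<le> 1}"

text \<open>The value does not depend on the choice of the coordinate direction \<open>k\<close>.\<close>

definition c_dim :: "'n::finite \<Rightarrow> real" where
  "c_dim k = ball_average (\<lambda>x :: real ^ 'n. \<bar>x \<bullet> axis k 1\<bar>) 0 1"

end

theory Submission imports Defs begin

text \<open>Let \<open>\<eta>\<^sub>r\<close> be a smooth mollifier supported in the ball of radius \<open>r\<close>.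

  Upper bound: joining two points of \<open>B(x,r)\<close> by a segment gives the Poincare inequality
  \<open>M\<^sup># f / r \<le> K \<cdot> avg |\<nabla>f|\<close> on the ball. A substitute for Jensen's inequality, obtained from (A) and the
  almost monotonicity of \<open>t \<mapsto> \<phi>(x,t)/t\<close>, bounds \<open>\<phi>(x, \<cdot>)\<close> of this average by \<open>avg u + u\<close> for one
  integrable \<open>u\<close>. As ball averages converge in \<open>L\<^sup>1\<close>, and almost everywhere along subsequences, the slice
  integrals \<open>r \<mapsto> \<integral> \<phi>(x, M\<^sup># f / r) dx\<close> are bounded, and dominated convergence bounds their upper limit
  at \<open>r = 0\<close> by the modular of a multiple of \<open>|\<nabla>f|\<close>.

  Lower bound: \<open>\<nabla>\<eta>\<^sub>r\<close> has mean zero, so \<open>|f * \<nabla>\<eta>\<^sub>r| \<le> K \<cdot> M\<^sup># f / r\<close>; if \<open>f\<close> has a weak gradient, then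
  \<open>f * \<nabla>\<eta>\<^sub>r = \<nabla>f * \<eta>\<^sub>r\<close> and Fatou's lemma applies.

  Existence of the gradient: if the slice integrals stay bounded along some \<open>r\<^sub>j \<rightarrow> 0\<close>, then (aInc) makes
  \<open>f * \<nabla>\<eta>\<^sub>r\<close> uniformly integrable with respect to a suitable finite measure, and a weak cluster point in
  \<open>L\<^sup>1\<close> is the weak gradient.

  The weights \<open>\<psi>\<^sub>\<epsilon>\<close> concentrate at \<open>0\<close>, so bounds for the lower and upper limits of the slice integrals
  carry over to the sharp modular; the bounds for the norms follow by rescaling \<open>f\<close>.\<close>

subsection \<open>Continuity of translations in \<open>L\<^sup>1\<close>\<close>

text \<open>Three obstacles shape the proof. First, \<phi> is neither convex nor continuous in its
  second argument, so neither Jensen nor passage to the limit under \<phi> is available. Both gaps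
  are closed with slack: arguments are enlarged or reduced by a fixed factor, and doubling, the
  content of (aDec), turns the factor into a constant. The number c_n is the value of M^# f / r for
  affine f of slope one; here it is one more constant absorbed by doubling, so only its positivity
  enters. Second, (A1) compares \<phi> at two points only below 1 / |B|. The substitute for Jensen
  therefore demands a small modular, which a division of the gradient arranges and doubling undoes.
  Third, its majorant avg u + u moves with the radius; subtracting a multiple of |avg u - u|, which
  vanishes in L^1, leaves the fixed majorant that a reverse Fatou lemma needs. For existence,
  \<Omega> may have infinite measure; a bounded, positive, integrable weight makes the measure
  finite and, being bounded below on compact sets, can be divided out against test
  functions.\<close>

lemma nn_integral_lborel_translate:
  fixes F :: "'a::euclidean_space \<Rightarrow> ennreal"
  assumes [measurable]: "F \<in> borel_measurable borel"
  shows "(\<integral>\<^sup>+x. F (c + x) \<partial>lborel) = (\<integral>\<^sup>+x. F x \<partial>lborel)"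
  by (subst lborel_distr_plus[of c, symmetric]) (simp add: nn_integral_distr)

lemma nn_integral_lborel_affine:
  fixes F :: "'a::euclidean_space \<Rightarrow> ennreal" and c :: real
  assumes [measurable]: "F \<in> borel_measurable borel" and c: "c \<noteq> 0"
  shows "(\<integral>\<^sup>+x. F x \<partial>lborel) = ennreal (\<bar>c\<bar>^DIM('a)) * (\<integral>\<^sup>+x. F (t + c *\<^sub>R x) \<partial>lborel)"
  by (subst lborel_affine[OF c, of t])
     (simp add: nn_integral_density nn_integral_distr nn_integral_cmult)

lemma integral_lborel_affine:
  fixes F :: "'a::euclidean_space \<Rightarrow> 'b::{banach, second_countable_topology}" and c :: real
  assumes [measurable]: "F \<in> borel_measurable borel" and c: "c \<noteq> 0"
  shows "(\<integral>x. F x \<partial>lborel) = \<bar>c\<bar>^DIM('a) *\<^sub>R (\<integral>x. F (t + c *\<^sub>R x) \<partial>lborel)"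
  by (subst lborel_affine[OF c, of t]) (simp add: integral_density integral_distr)

lemma integrable_lborel_affine:
  fixes F :: "'a::euclidean_space \<Rightarrow> 'b::{banach, second_countable_topology}" and c :: real
  assumes F: "integrable lborel F" and c: "c \<noteq> 0"
  shows "integrable lborel (\<lambda>x. F (t + c *\<^sub>R x))"
proof -
  have [measurable]: "F \<in> borel_measurable borel" using borel_measurable_integrable[OF F] by simp
  have "ennreal (\<bar>c\<bar>^DIM('a)) * (\<integral>\<^sup>+x. norm (F (t + c *\<^sub>R x)) \<partial>lborel) < \<infinity>"
    using F nn_integral_lborel_affine[of "\<lambda>x. ennreal (norm (F x))" c t] c
    by (simp add: integrable_iff_bounded)
  then show ?thesis
    using c by (auto simp: integrable_iff_bounded ennreal_mult_less_top)
qed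

lemma ennreal_pos_obtains_real:
  assumes "0 < (a::ennreal)" obtains e where "0 < e" "ennreal e < a"
proof (cases a)
  case (real r)
  with assms show ?thesis by (intro that[of "r/2"]) (auto simp: ennreal_less_iff)
next
  case top
  then show ?thesis by (intro that[of 1]) auto
qed

lemma tendsto_0_le_ennreal:
  fixes f g :: "'a \<Rightarrow> ennreal"
  assumes "\<And>x. f x \<le> g x" "(g \<longlongrightarrow> 0) F"
  shows "(f \<longlongrightarrow> 0) F"
  by (rule tendsto_sandwich[OF _ _ tendsto_const assms(2)]) (auto intro: assms always_eventually)

text \<open>For x in the open set \<open>U\<close> the point x + h stays in \<open>U\<close> once h
  is small, so the indicators tend to 0 pointwise; the finite measure of \<open>U\<close> provides
  the dominating function.\<close>

lemma L1_translation_open: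
  fixes U :: "'a::euclidean_space set"
  assumes U: "open U" "emeasure lborel U < \<infinity>"
  shows "((\<lambda>h. emeasure lborel {x\<in>U. x + h \<notin> U}) \<longlongrightarrow> 0) (at 0)"
proof (subst tendsto_at_iff_sequentially, intro allI impI)
  fix X :: "nat \<Rightarrow> 'a" assume X: "\<forall>i. X i \<in> UNIV - {0}" "X \<longlonglongrightarrow> 0"
  have [measurable]: "U \<in> sets borel" using U by simp
  have "(\<lambda>n. \<integral>\<^sup>+x. indicator {x\<in>U. x + X n \<notin> U} x \<partial>lborel) \<longlonglongrightarrow> (\<integral>\<^sup>+x. 0 \<partial>(lborel :: 'a measure))"
  proof (rule nn_integral_dominated_convergence[where w="indicator U"])
    show "AE x in lborel. (\<lambda>n. indicator {x\<in>U. x + X n \<notin> U} x :: ennreal) \<longlonglongrightarrow> 0"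
    proof (rule AE_I2)
      fix x
      show "(\<lambda>n. indicator {x\<in>U. x + X n \<notin> U} x :: ennreal) \<longlonglongrightarrow> 0"
      proof (cases "x \<in> U")
        case True
        have "(\<lambda>n. x + X n) \<longlonglongrightarrow> x + 0" by (intro tendsto_intros X)
        then have "eventually (\<lambda>n. x + X n \<in> U) sequentially"
          using U True by (auto intro: topological_tendstoD)
        then show ?thesis by (intro tendsto_eventually) (auto elim: eventually_mono)
      qed simp
    qed
    show "(\<integral>\<^sup>+x. indicator U x \<partial>lborel) < \<infinity>" using U by simp
  qed (auto simp: indicator_def)
  then show "((\<lambda>h. emeasure lborel {x\<in>U. x + h \<notin> U}) \<circ> X) \<longlonglongrightarrow> 0"
    by (simp add: comp_def)
qed

text \<open>The two indicators differ where x leaves \<open>U\<close> or enters it. The entering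
  points are a translate of the points that leave \<open>U\<close> under - h, so the one-sided
  estimate applies twice.\<close>

lemma L1_translation_indicator_open:
  fixes U :: "'a::euclidean_space set"
  assumes U: "open U" "emeasure lborel U < \<infinity>"
  shows "((\<lambda>h. \<integral>\<^sup>+x. ennreal \<bar>indicator U (x + h) - indicator U x\<bar> \<partial>lborel) \<longlongrightarrow> 0) (at 0)"
proof -
  have [measurable]: "U \<in> sets borel" using U by simp
  have eq: "(\<integral>\<^sup>+x. ennreal \<bar>indicator U (x + h) - indicator U x\<bar> \<partial>lborel)
     = emeasure lborel {x\<in>U. x + - h \<notin> U} + emeasure lborel {x\<in>U. x + h \<notin> U}" for h
  proof -
    have "(\<integral>\<^sup>+x. ennreal \<bar>indicator U (x + h) - indicator U x\<bar> \<partial>lborel)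
      = (\<integral>\<^sup>+x. indicator {x\<in>U. x + - h \<notin> U} (h + x) + indicator {x\<in>U. x + h \<notin> U} x \<partial>lborel)"
      by (intro nn_integral_cong) (auto simp: indicator_def add.commute)
    also have "\<dots> = (\<integral>\<^sup>+x. indicator {x\<in>U. x + - h \<notin> U} (h + x) \<partial>lborel) + emeasure lborel {x\<in>U. x + h \<notin> U}"
      by (subst nn_integral_add) auto
    also have "(\<integral>\<^sup>+x. indicator {x\<in>U. x + - h \<notin> U} (h + x) \<partial>lborel) = emeasure lborel {x\<in>U. x + - h \<notin> U}"
      by (subst nn_integral_lborel_translate) auto
    finally show ?thesis .
  qed
  have "((\<lambda>h. emeasure lborel {x\<in>U. x + - h \<notin> U}) \<longlongrightarrow> 0) (at (0::'a))"
    using L1_translation_open[OF U]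
    by (rule filterlim_compose) (auto simp: filterlim_at intro!: tendsto_eq_intros simp: eventually_at_filter)
  from tendsto_add[OF this L1_translation_open[OF U]] show ?thesis
    unfolding eq by simp
qed

text \<open>The difference of u and v enters at x and at x + h, and translation invariance makes
  both contributions equal.\<close>

lemma L1_translation_perturb:
  fixes u v :: "'a::euclidean_space \<Rightarrow> 'b::{banach, second_countable_topology}"
  assumes [measurable]: "u \<in> borel_measurable borel" "v \<in> borel_measurable borel"
  shows "(\<integral>\<^sup>+x. ennreal (norm (u (x + h) - u x)) \<partial>lborel)
    \<le> (\<integral>\<^sup>+x. ennreal (norm (v (x + h) - v x)) \<partial>lborel) + 2 * (\<integral>\<^sup>+x. ennreal (norm (u x - v x)) \<partial>lborel)"
proof -
  have "(\<integral>\<^sup>+x. ennreal (norm (u (x + h) - u x)) \<partial>lborel) \<le>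
     (\<integral>\<^sup>+x. ennreal (norm (v (x + h) - v x)) + ennreal (norm (u (h + x) - v (h + x))) + ennreal (norm (u x - v x)) \<partial>lborel)"
  proof (rule nn_integral_mono)
    fix x
    have "u (x + h) - u x = (v (x + h) - v x) + (u (h + x) - v (h + x)) - (u x - v x)"
      by (simp add: add.commute)
    then have "norm (u (x + h) - u x) \<le> norm (v (x + h) - v x) + norm (u (h + x) - v (h + x)) + norm (u x - v x)"
      apply (simp only:)
      using norm_triangle_ineq4[of "(v (x + h) - v x) + (u (h + x) - v (h + x))" "u x - v x"]
        norm_triangle_ineq[of "v (x + h) - v x" "u (h + x) - v (h + x)"] by linarith
    then show "ennreal (norm (u (x + h) - u x)) \<le> ennreal (norm (v (x + h) - v x)) + ennreal (norm (u (h + x) - v (h + x))) + ennreal (norm (u x - v x))"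
      by (simp flip: ennreal_plus)
  qed
  also have "\<dots> = (\<integral>\<^sup>+x. ennreal (norm (v (x + h) - v x)) \<partial>lborel) + (\<integral>\<^sup>+x. ennreal (norm (u (h + x) - v (h + x))) \<partial>lborel) + (\<integral>\<^sup>+x. ennreal (norm (u x - v x)) \<partial>lborel)"
    by (simp add: nn_integral_add)
  also have "(\<integral>\<^sup>+x. ennreal (norm (u (h + x) - v (h + x))) \<partial>lborel) = (\<integral>\<^sup>+x. ennreal (norm (u x - v x)) \<partial>lborel)"
    by (rule nn_integral_lborel_translate[of "\<lambda>x. ennreal (norm (u x - v x))"]) simp
  finally show ?thesis by (simp add: mult_2 add.assoc)
qed

text \<open>An e / 3 argument: the functions with continuous translations are closed under L^1
  limits, so a dense class suffices.\<close>

lemma L1_translation_approx: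
  fixes u :: "'a::euclidean_space \<Rightarrow> 'b::{banach, second_countable_topology}"
  assumes [measurable]: "u \<in> borel_measurable borel"
    and approx: "\<And>e. 0 < e \<Longrightarrow> \<exists>v \<in> borel_measurable borel. 
      ((\<lambda>h. \<integral>\<^sup>+x. ennreal (norm (v (x + h) - v x)) \<partial>lborel) \<longlongrightarrow> 0) (at 0) \<and>
      (\<integral>\<^sup>+x. ennreal (norm (u x - v x)) \<partial>lborel) < ennreal e"
  shows "((\<lambda>h. \<integral>\<^sup>+x. ennreal (norm (u (x + h) - u x)) \<partial>lborel) \<longlongrightarrow> 0) (at 0)"
proof (rule order_tendstoI)
  fix a :: ennreal assume "0 < a"
  then obtain e where e: "0 < e" "ennreal e < a"
    by (rule ennreal_pos_obtains_real)
  obtain v where [measurable]: "v \<in> borel_measurable borel" and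
    v: "((\<lambda>h. \<integral>\<^sup>+x. ennreal (norm (v (x + h) - v x)) \<partial>lborel) \<longlongrightarrow> 0) (at 0)"
      "(\<integral>\<^sup>+x. ennreal (norm (u x - v x)) \<partial>lborel) < ennreal (e/3)"
    using approx[of "e/3"] e by auto
  have "eventually (\<lambda>h. (\<integral>\<^sup>+x. ennreal (norm (v (x + h) - v x)) \<partial>lborel) < ennreal (e/3)) (at 0)"
    using order_tendstoD(2)[OF v(1), of "ennreal (e/3)"] e by simp
  then show "eventually (\<lambda>h. (\<integral>\<^sup>+x. ennreal (norm (u (x + h) - u x)) \<partial>lborel) < a) (at 0)"
  proof eventually_elim
    case (elim h)
    have "(\<integral>\<^sup>+x. ennreal (norm (u (x + h) - u x)) \<partial>lborel) \<le> ennreal (e/3) + 2 * ennreal (e/3)"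
      using L1_translation_perturb[of u v h] elim v(2)
      by (smt (verit) \<open>u \<in> borel_measurable borel\<close> \<open>v \<in> borel_measurable borel\<close> add_mono less_imp_le mult_left_mono order_trans zero_le)
    also have "\<dots> = ennreal e"
      using e by (simp add: ennreal_mult' [symmetric] flip: ennreal_plus ennreal_numeral)
    finally show ?case using e by simp
  qed
qed simp

lemma L1_translation_scaleR:
  fixes v :: "'a::euclidean_space \<Rightarrow> real" and c :: "'b::{banach, second_countable_topology}"
  assumes [measurable]: "v \<in> borel_measurable borel"
    and v: "((\<lambda>h. \<integral>\<^sup>+x. ennreal \<bar>v (x + h) - v x\<bar> \<partial>lborel) \<longlongrightarrow> 0) (at 0)"
  shows "((\<lambda>h. \<integral>\<^sup>+x. ennreal (norm (v (x + h) *\<^sub>R c - v x *\<^sub>R c)) \<partial>lborel) \<longlongrightarrow> 0) (at 0)"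
proof -
  have "(\<integral>\<^sup>+x. ennreal (norm (v (x + h) *\<^sub>R c - v x *\<^sub>R c)) \<partial>lborel) =
     (\<integral>\<^sup>+x. ennreal \<bar>v (x + h) - v x\<bar> \<partial>lborel) * ennreal (norm c)" for h
    by (subst nn_integral_multc[symmetric])
       (auto simp: ennreal_mult' [symmetric] mult.commute simp flip: scaleR_diff_left ennreal_mult'' intro!: nn_integral_cong)
  moreover have "((\<lambda>h. ennreal (norm c) * (\<integral>\<^sup>+x. ennreal \<bar>v (x + h) - v x\<bar> \<partial>lborel)) \<longlongrightarrow> ennreal (norm c) * 0) (at 0)"
    by (rule ennreal_tendsto_cmult[OF _ v]) simp
  ultimately show ?thesis by (simp add: mult.commute)
qed

text \<open>Induction over integrable functions. Outer regularity reduces an indicator to that of an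
  open set, sums follow from the triangle inequality, and in the limit case the domination by 2 |f|
  yields L^1 approximation.\<close>

lemma L1_translation_tendsto:
  fixes u :: "'a::euclidean_space \<Rightarrow> 'b::{banach, second_countable_topology}"
  assumes "integrable lborel u"
  shows "((\<lambda>h. \<integral>\<^sup>+x. ennreal (norm (u (x + h) - u x)) \<partial>lborel) \<longlongrightarrow> 0) (at 0)"
  using assms
proof (induction rule: integrable_induct)
  case (base A c)
  then have [measurable]: "A \<in> sets borel" by simp
  show ?case
  proof (rule L1_translation_scaleR)
    show "((\<lambda>h. \<integral>\<^sup>+ x. ennreal \<bar>indicat_real A (x + h) - indicat_real A x\<bar> \<partial>lborel) \<longlongrightarrow> 0) (at 0)"
      unfolding real_norm_def[symmetric]
    proof (rule L1_translation_approx)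
      fix e :: real assume "0 < e"
      then obtain U where U: "open U" "A \<subseteq> U" "emeasure lborel (U - A) < ennreal e"
        using outer_regular_lborel[of A e] base by auto
      have [measurable]: "U \<in> sets borel" using U by simp
      have "emeasure lborel U = emeasure lborel A + emeasure lborel (U - A)"
        using U by (subst plus_emeasure) (auto intro!: arg_cong[where f="emeasure _"])
      then have "emeasure lborel U < \<infinity>" using base U(3) by (auto simp: less_top intro: order.strict_trans)
      moreover have "(\<integral>\<^sup>+ x. ennreal (norm (indicat_real A x - indicat_real U x)) \<partial>lborel) = emeasure lborel (U - A)"
        using U by (subst nn_integral_indicator[symmetric], simp, intro nn_integral_cong)
          (auto simp: indicator_def)
      ultimately show "\<exists>v\<in>borel_measurable borel.
         ((\<lambda>h. \<integral>\<^sup>+ x. ennreal (norm (v (x + h) - v x)) \<partial>lborel) \<longlongrightarrow> 0) (at 0) \<and>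
         (\<integral>\<^sup>+ x. ennreal (norm (indicat_real A x - v x)) \<partial>lborel) < ennreal e"
        using L1_translation_indicator_open[OF U(1)] U(3) by (intro bexI[of _ "indicator U"]) auto
    qed simp
  qed simp
next
  case (add f g)
  have [measurable]: "f \<in> borel_measurable borel" "g \<in> borel_measurable borel"
    using add borel_measurable_integrable by auto
  have "(\<integral>\<^sup>+ x. ennreal (norm (f (x + h) + g (x + h) - (f x + g x))) \<partial>lborel) \<le>
     (\<integral>\<^sup>+ x. ennreal (norm (f (x + h) - f x)) \<partial>lborel) + (\<integral>\<^sup>+ x. ennreal (norm (g (x + h) - g x)) \<partial>lborel)" for h
  proof -
    have "(\<integral>\<^sup>+ x. ennreal (norm (f (x + h) + g (x + h) - (f x + g x))) \<partial>lborel) \<le>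
      (\<integral>\<^sup>+ x. ennreal (norm (f (x + h) - f x)) + ennreal (norm (g (x + h) - g x)) \<partial>lborel)"
      by (intro nn_integral_mono) (simp add: norm_diff_triangle_ineq flip: ennreal_plus)
    then show ?thesis by (simp add: nn_integral_add)
  qed
  moreover have "((\<lambda>h. (\<integral>\<^sup>+ x. ennreal (norm (f (x + h) - f x)) \<partial>lborel) +
      (\<integral>\<^sup>+ x. ennreal (norm (g (x + h) - g x)) \<partial>lborel)) \<longlongrightarrow> 0) (at 0)"
    using tendsto_add[OF add(3,4)] by simp
  ultimately show ?case
    by (rule tendsto_0_le_ennreal)
next
  case (lim f s)
  have [measurable]: "f \<in> borel_measurable borel" "\<And>i. s i \<in> borel_measurable borel"
    using lim borel_measurable_integrable by auto
  show ?case
  proof (rule L1_translation_approx)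
    fix e :: real assume "0 < e"
    have "(\<lambda>i. \<integral>\<^sup>+ x. ennreal (norm (f x - s i x)) \<partial>lborel) \<longlonglongrightarrow> (\<integral>\<^sup>+ x. 0 \<partial>(lborel :: 'a measure))"
    proof (rule nn_integral_dominated_convergence[where w="\<lambda>x. 3 * ennreal (norm (f x))"])
      show "AE x in lborel. ennreal (norm (f x - s i x)) \<le> 3 * ennreal (norm (f x))" for i
      proof (rule AE_I2)
        fix x
        have "norm (f x - s i x) \<le> 3 * norm (f x)"
        proof -
          have "norm (s i x) \<le> 2 * norm (f x)" using lim.hyps by simp
          then show ?thesis using norm_triangle_ineq4[of "f x" "s i x"] by linarith
        qed
        then show "ennreal (norm (f x - s i x)) \<le> 3 * ennreal (norm (f x))"
          by (simp add: ennreal_mult' [symmetric] flip: ennreal_numeral)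
      qed
      show "(\<integral>\<^sup>+ x. 3 * ennreal (norm (f x)) \<partial>lborel) < \<infinity>"
        using lim.hyps by (simp add: nn_integral_cmult integrable_iff_bounded ennreal_mult_less_top)
      show "AE x in lborel. (\<lambda>i. ennreal (norm (f x - s i x))) \<longlonglongrightarrow> 0"
        using lim.hyps by (auto intro!: AE_I2 tendsto_eq_intros simp: ennreal_0[symmetric] simp del: ennreal_0)
    qed auto
    then have "eventually (\<lambda>i. (\<integral>\<^sup>+ x. ennreal (norm (f x - s i x)) \<partial>lborel) < ennreal e) sequentially"
      using order_tendstoD(2)[of _ 0 _ "ennreal e"] \<open>0 < e\<close> by simp
    then obtain i where "(\<integral>\<^sup>+ x. ennreal (norm (f x - s i x)) \<partial>lborel) < ennreal e"
      by (auto simp: eventually_sequentially)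
    then show "\<exists>v\<in>borel_measurable borel.
            ((\<lambda>h. \<integral>\<^sup>+ x. ennreal (norm (v (x + h) - v x)) \<partial>lborel) \<longlongrightarrow> 0) (at 0) \<and>
            (\<integral>\<^sup>+ x. ennreal (norm (f x - v x)) \<partial>lborel) < ennreal e"
      using lim.IH[of i] by (intro bexI[of _ "s i"]) auto
  qed simp
qed

subsection \<open>Averaging kernels\<close>

text \<open>Covers both the normalized indicator of a ball, used for the upper bound, and the smooth
  mollifier, used for the lower bound, so that one approximation theory serves both. Boundedness
  keeps the product with an integrable function integrable.\<close>

definition averaging_kernel :: "real \<Rightarrow> ('a::euclidean_space \<Rightarrow> real) \<Rightarrow> bool" where
  "averaging_kernel r k \<longleftrightarrow> k \<in> borel_measurable borel \<and> (\<forall>w. 0 \<le> k w) \<and> (\<exists>B. \<forall>w. k w \<le> B) \<and>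
     (\<forall>w. r < norm w \<longrightarrow> k w = 0) \<and> (\<integral>\<^sup>+w. ennreal (k w) \<partial>lborel) = 1"

definition kconv :: "('a::euclidean_space \<Rightarrow> real) \<Rightarrow> ('a \<Rightarrow> 'b::{banach, second_countable_topology}) \<Rightarrow> 'a \<Rightarrow> 'b" where
  "kconv k u x = (\<integral>y. k (x - y) *\<^sub>R u y \<partial>lborel)"

lemma averaging_kernelD:
  assumes "averaging_kernel r k"
  shows "k \<in> borel_measurable borel" "\<And>w. 0 \<le> k w" "\<And>w. r < norm w \<Longrightarrow> k w = 0"
    "(\<integral>\<^sup>+w. ennreal (k w) \<partial>lborel) = 1" "integrable lborel k" "(\<integral>w. k w \<partial>lborel) = 1"
proof -
  show k: "k \<in> borel_measurable borel" "\<And>w. 0 \<le> k w" "\<And>w. r < norm w \<Longrightarrow> k w = 0"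
    "(\<integral>\<^sup>+w. ennreal (k w) \<partial>lborel) = 1"
    using assms by (auto simp: averaging_kernel_def)
  show "integrable lborel k" using k by (simp add: integrable_iff_bounded)
  show "(\<integral>w. k w \<partial>lborel) = 1"
    using k by (subst integral_eq_nn_integral) auto
qed

lemma kconv_measurable [measurable]:
  assumes [measurable]: "k \<in> borel_measurable borel" "u \<in> borel_measurable borel"
  shows "kconv k u \<in> borel_measurable borel"
proof -
  have "(\<lambda>x. \<integral>y. k (x - y) *\<^sub>R u y \<partial>lborel) \<in> borel_measurable borel"
    by measurable
  then show ?thesis by (simp add: kconv_def[abs_def])
qed

text \<open>Locality is what permits replacing a locally integrable function by its truncation to a
  compact set.\<close>

lemma kconv_cong_ball:
  assumes k: "averaging_kernel r k" and uv: "\<And>y. y \<in> cball x r \<Longrightarrow> u y = v y"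
  shows "kconv k u x = kconv k v x"
  unfolding kconv_def
proof (rule Bochner_Integration.integral_cong[OF refl])
  fix y
  show "k (x - y) *\<^sub>R u y = k (x - y) *\<^sub>R v y"
    using uv[of y] averaging_kernelD(3)[OF k, of "x - y"] by (cases "y \<in> cball x r") (auto simp: dist_norm)
qed

lemma integrable_kernel_mult:
  fixes u :: "'a::euclidean_space \<Rightarrow> 'b::{banach, second_countable_topology}"
  assumes k: "averaging_kernel r k" and u: "integrable lborel u"
  shows "integrable lborel (\<lambda>y. k (x - y) *\<^sub>R u y)"
proof -
  obtain B where B: "\<And>w. k w \<le> B" using k by (auto simp: averaging_kernel_def)
  have [measurable]: "k \<in> borel_measurable borel" "u \<in> borel_measurable borel"
    using averaging_kernelD[OF k] borel_measurable_integrable[OF u] by auto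
  have i: "integrable lborel (\<lambda>y. B * norm (u y))" using integrable_norm[OF u] by simp
  show ?thesis
  proof (rule Bochner_Integration.integrable_bound[OF i])
    show "AE y in lborel. norm (k (x - y) *\<^sub>R u y) \<le> norm (B * norm (u y))"
    proof (rule AE_I2)
      fix y
      have "\<bar>k (x - y)\<bar> \<le> \<bar>B\<bar>" using averaging_kernelD(2)[OF k, of "x - y"] B[of "x - y"] by auto
      then show "norm (k (x - y) *\<^sub>R u y) \<le> norm (B * norm (u y))"
        by (simp add: abs_mult mult_right_mono)
    qed
  qed simp
qed

text \<open>If the integrand is not integrable, the Bochner integral is 0 by convention and the
  bound is trivial.\<close>

lemma norm_kconv_le:
  "ennreal (norm (kconv k u x)) \<le> (\<integral>\<^sup>+y. ennreal (\<bar>k (x - y)\<bar> * norm (u y)) \<partial>lborel)"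
proof (cases "integrable lborel (\<lambda>y. k (x - y) *\<^sub>R u y)")
  case True
  from integral_norm_bound_ennreal[OF True] show ?thesis by (simp add: kconv_def)
qed (simp add: kconv_def not_integrable_integral_eq)

text \<open>Tonelli: integrated in x first, the kernel contributes its unit mass.\<close>

lemma nn_integral_kernel_average:
  assumes k: "averaging_kernel r k" and [measurable]: "g \<in> borel_measurable borel"
  shows "(\<integral>\<^sup>+x. \<integral>\<^sup>+y. ennreal (k (x - y)) * g y \<partial>lborel \<partial>lborel) = (\<integral>\<^sup>+y. g y \<partial>lborel)"
proof -
  have [measurable]: "k \<in> borel_measurable borel" using averaging_kernelD[OF k] by auto
  have "(\<integral>\<^sup>+x. \<integral>\<^sup>+y. ennreal (k (x - y)) * g y \<partial>lborel \<partial>lborel) =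
        (\<integral>\<^sup>+y. \<integral>\<^sup>+x. ennreal (k (x - y)) * g y \<partial>lborel \<partial>lborel)"
    by (rule lborel_pair.Fubini') simp
  also have "\<dots> = (\<integral>\<^sup>+y. g y \<partial>lborel)"
  proof (rule nn_integral_cong)
    fix y
    have "(\<integral>\<^sup>+x. ennreal (k (x - y)) * g y \<partial>lborel) = (\<integral>\<^sup>+x. ennreal (k (- y + x)) \<partial>lborel) * g y"
      by (simp add: nn_integral_multc)
    also have "(\<integral>\<^sup>+x. ennreal (k (- y + x)) \<partial>lborel) = 1"
      using nn_integral_lborel_translate[of "\<lambda>x. ennreal (k x)" "-y"] averaging_kernelD(4)[OF k] by simp
    finally show "(\<integral>\<^sup>+x. ennreal (k (x - y)) * g y \<partial>lborel) = g y" by simp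
  qed
  finally show ?thesis .
qed

text \<open>After the substitution w = x - y and by unit mass, \<open>kconv k u x - u x\<close> is
  the \<open>k\<close>-average of the differences u (x - w) - u x. The kernel vanishes for |w| > r,
  so only shifts of length at most r enter.\<close>

lemma kconv_L1_le:
  fixes u :: "'a::euclidean_space \<Rightarrow> 'b::{banach, second_countable_topology}"
  assumes k: "averaging_kernel r k" and u: "integrable lborel u"
    and E: "\<And>h. norm h \<le> r \<Longrightarrow> (\<integral>\<^sup>+x. ennreal (norm (u (x + h) - u x)) \<partial>lborel) \<le> E"
  shows "(\<integral>\<^sup>+x. ennreal (norm (kconv k u x - u x)) \<partial>lborel) \<le> E"
proof -
  note kD = averaging_kernelD[OF k]
  have [measurable]: "k \<in> borel_measurable borel" "u \<in> borel_measurable borel"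
    using kD borel_measurable_integrable[OF u] by auto
  have "ennreal (norm (kconv k u x - u x)) \<le> (\<integral>\<^sup>+w. ennreal (k w) * ennreal (norm (u (x - w) - u x)) \<partial>lborel)" for x
  proof -
    have i1: "integrable lborel (\<lambda>w. k w *\<^sub>R u (x - w))"
      using integrable_lborel_affine[OF integrable_kernel_mult[OF k u, of x], of "-1" x] by simp
    have i2: "integrable lborel (\<lambda>w. k w *\<^sub>R u x)"
      using kD(5) by simp
    have "kconv k u x = (\<integral>w. k w *\<^sub>R u (x - w) \<partial>lborel)"
      unfolding kconv_def using integral_lborel_affine[of "\<lambda>y. k (x - y) *\<^sub>R u y" "-1" x] by simp
    moreover have "u x = (\<integral>w. k w *\<^sub>R u x \<partial>lborel)" using kD(5,6) by simp
    ultimately have "kconv k u x - u x = (\<integral>w. k w *\<^sub>R u (x - w) \<partial>lborel) - (\<integral>w. k w *\<^sub>R u x \<partial>lborel)"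
      by metis
    also have "\<dots> = (\<integral>w. k w *\<^sub>R (u (x - w) - u x) \<partial>lborel)"
      using i1 i2 by (simp add: scaleR_diff_right)
    finally have "ennreal (norm (kconv k u x - u x)) \<le> (\<integral>\<^sup>+w. ennreal (norm (k w *\<^sub>R (u (x - w) - u x))) \<partial>lborel)"
      using integral_norm_bound_ennreal[of lborel "\<lambda>w. k w *\<^sub>R (u (x - w) - u x)"] i1 i2
      by (simp add: scaleR_diff_right)
    also have "\<dots> = (\<integral>\<^sup>+w. ennreal (k w) * ennreal (norm (u (x - w) - u x)) \<partial>lborel)"
      by (intro nn_integral_cong) (simp add: ennreal_mult kD(2))
    finally show ?thesis .
  qed
  then have "(\<integral>\<^sup>+x. ennreal (norm (kconv k u x - u x)) \<partial>lborel)
     \<le> (\<integral>\<^sup>+x. \<integral>\<^sup>+w. ennreal (k w) * ennreal (norm (u (x - w) - u x)) \<partial>lborel \<partial>lborel)"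
    by (intro nn_integral_mono)
  also have "\<dots> = (\<integral>\<^sup>+w. \<integral>\<^sup>+x. ennreal (k w) * ennreal (norm (u (x - w) - u x)) \<partial>lborel \<partial>lborel)"
    by (rule lborel_pair.Fubini') simp
  also have "\<dots> \<le> (\<integral>\<^sup>+w. ennreal (k w) * E \<partial>lborel)"
  proof (rule nn_integral_mono)
    fix w
    have "(\<integral>\<^sup>+x. ennreal (k w) * ennreal (norm (u (x - w) - u x)) \<partial>lborel) =
       ennreal (k w) * (\<integral>\<^sup>+x. ennreal (norm (u (x + - w) - u x)) \<partial>lborel)"
      by (simp add: nn_integral_cmult)
    also have "\<dots> \<le> ennreal (k w) * E"
      using E[of "-w"] kD(3)[of w] by (cases "norm w \<le> r") (auto intro: mult_left_mono)
    finally show "(\<integral>\<^sup>+x. ennreal (k w) * ennreal (norm (u (x - w) - u x)) \<partial>lborel) \<le> ennreal (k w) * E" .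
  qed
  also have "\<dots> = E" using kD(4) by (simp add: nn_integral_multc)
  finally show ?thesis .
qed

lemma kconv_L1_tendsto:
  fixes u :: "'a::euclidean_space \<Rightarrow> 'b::{banach, second_countable_topology}"
  assumes k: "\<And>j. averaging_kernel (r j) (k j)" and u: "integrable lborel u" and r: "(r \<longlongrightarrow> 0) F"
  shows "((\<lambda>j. \<integral>\<^sup>+x. ennreal (norm (kconv (k j) u x - u x)) \<partial>lborel) \<longlongrightarrow> 0) F"
proof (rule order_tendstoI)
  fix a :: ennreal assume "0 < a"
  then obtain e where e: "0 < e" "ennreal e < a" by (rule ennreal_pos_obtains_real)
  from order_tendstoD(2)[OF L1_translation_tendsto[OF u], of "ennreal e"] e
  obtain d where d: "0 < d" "\<And>h. h \<noteq> 0 \<Longrightarrow> norm h < d \<Longrightarrow> (\<integral>\<^sup>+x. ennreal (norm (u (x + h) - u x)) \<partial>lborel) < ennreal e"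
    by (auto simp: eventually_at)
  \<comment> \<open>The limit at 0 says nothing about the shift h = 0, for which the integrand
    vanishes.\<close>
  have d': "(\<integral>\<^sup>+x. ennreal (norm (u (x + h) - u x)) \<partial>lborel) \<le> ennreal e" if "norm h < d" for h
    using d(2)[OF _ that] by (cases "h = 0") (auto intro: less_imp_le)
  have "eventually (\<lambda>j. r j < d) F" using order_tendstoD(2)[OF r d(1)] .
  then show "eventually (\<lambda>j. (\<integral>\<^sup>+x. ennreal (norm (kconv (k j) u x - u x)) \<partial>lborel) < a) F"
  proof eventually_elim
    case (elim j)
    have "(\<integral>\<^sup>+x. ennreal (norm (kconv (k j) u x - u x)) \<partial>lborel) \<le> ennreal e"
      using elim by (intro kconv_L1_le[OF k u] d') auto
    with e show ?case by auto
  qed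
qed simp

text \<open>From index m on the integrals are dominated by a geometric series, so by monotone
  convergence the series of the \<open>I j\<close> is finite almost everywhere, and the terms of a
  convergent series tend to 0.\<close>

lemma AE_tendsto_0_of_summable_integrals:
  fixes I :: "nat \<Rightarrow> 'a \<Rightarrow> real"
  assumes [measurable]: "\<And>j. I j \<in> borel_measurable M" and nn: "\<And>j x. 0 \<le> I j x"
    and le: "\<And>j. m \<le> j \<Longrightarrow> (\<integral>\<^sup>+x. ennreal (I j x) \<partial>M) \<le> ennreal ((1/2)^j)"
  shows "AE x in M. (\<lambda>j. I j x) \<longlonglongrightarrow> 0"
proof -
  have "(\<integral>\<^sup>+x. (\<Sum>j. ennreal (I (j + m) x)) \<partial>M) = (\<Sum>j. \<integral>\<^sup>+x. ennreal (I (j + m) x) \<partial>M)"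
    by (rule nn_integral_suminf) simp
  also have "\<dots> \<le> (\<Sum>j. ennreal ((1/2)^j))"
  proof (rule suminf_le)
    fix j
    have "(\<integral>\<^sup>+x. ennreal (I (j + m) x) \<partial>M) \<le> ennreal ((1/2)^(j+m))" by (rule le) simp
    also have "\<dots> \<le> ennreal ((1/2)^j)" by (intro ennreal_leI power_decreasing) auto
    finally show "(\<integral>\<^sup>+x. ennreal (I (j + m) x) \<partial>M) \<le> ennreal ((1/2)^j)" .
  qed auto
  also have "\<dots> = ennreal 2"
  proof (rule suminf_ennreal_eq)
    have "(\<lambda>j. (1/2::real)^j) sums (1 / (1 - 1/2))" by (rule geometric_sums) simp
    then show "(\<lambda>j. (1/2::real)^j) sums 2" by simp
  qed simp
  finally have "(\<integral>\<^sup>+x. (\<Sum>j. ennreal (I (j + m) x)) \<partial>M) < top"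
    by (rule order.strict_trans1) simp
  then have "(\<integral>\<^sup>+x. (\<Sum>j. ennreal (I (j + m) x)) \<partial>M) \<noteq> \<infinity>" by simp
  then have "AE x in M. (\<Sum>j. ennreal (I (j + m) x)) \<noteq> \<infinity>"
    by (intro nn_integral_PInf_AE) auto
  then show ?thesis
  proof eventually_elim
    case (elim x)
    have "summable (\<lambda>j. I (j + m) x)"
      using elim nn by (intro summable_suminf_not_top) auto
    then have "(\<lambda>j. I (j + m) x) \<longlonglongrightarrow> 0" by (rule summable_LIMSEQ_zero)
    then show ?case by (rule LIMSEQ_offset)
  qed
qed

text \<open>A diagonal choice over a compact exhaustion: the n-th index makes the L^1 error at most
  2^(-n) for each of the first n truncations. All truncations then converge almost everywhere along
  one subsequence, and near a given point of \<Omega> a small kernel cannot distinguish f from a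
  suitable truncation.\<close>

lemma kconv_AE_subseq:
  fixes f :: "'a::euclidean_space \<Rightarrow> 'b::{banach, second_countable_topology}"
  assumes \<Omega>: "open \<Omega>" and [measurable]: "f \<in> borel_measurable borel"
    and f: "\<And>K. compact K \<Longrightarrow> K \<subseteq> \<Omega> \<Longrightarrow> integrable lborel (\<lambda>x. indicator K x *\<^sub>R f x)"
    and k: "\<And>j. averaging_kernel (r j) (k j)" and r: "r \<longlonglongrightarrow> 0"
  shows "\<exists>s :: nat \<Rightarrow> nat. strict_mono s \<and> (AE x in lborel. x \<in> \<Omega> \<longrightarrow> (\<lambda>j. kconv (k (s j)) f x) \<longlonglongrightarrow> f x)"
proof -
  obtain C :: "nat \<Rightarrow> 'a set" where C: "\<And>n. compact (C n)" "\<And>n. C n \<subseteq> \<Omega>"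
      "\<And>K. compact K \<Longrightarrow> K \<subseteq> \<Omega> \<Longrightarrow> \<exists>N. \<forall>n\<ge>N. K \<subseteq> C n"
    using open_Union_compact_subsets[OF \<Omega>] by metis
  define u where "u m x = indicator (C m) x *\<^sub>R f x" for m x
  have [measurable]: "C m \<in> sets borel" for m using C(1) by (simp add: compact_imp_closed borel_closed)
  have [measurable]: "u m \<in> borel_measurable borel" for m unfolding u_def by measurable
  have [measurable]: "k j \<in> borel_measurable borel" for j using averaging_kernelD(1)[OF k] .
  have u: "integrable lborel (u m)" for m unfolding u_def using f C by blast
  define D where "D m j = (\<integral>\<^sup>+x. ennreal (norm (kconv (k j) (u m) x - u m x)) \<partial>lborel)" for m j
  have D: "D m \<longlonglongrightarrow> 0" for m
    unfolding D_def by (rule kconv_L1_tendsto[OF k u r])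
  have ev: "eventually (\<lambda>j. \<forall>m\<le>n. D m j \<le> ennreal ((1/2)^n)) sequentially" for n
  proof -
    have "eventually (\<lambda>j. D m j \<le> ennreal ((1/2)^n)) sequentially" for m
      using order_tendstoD(2)[OF D[of m], of "ennreal ((1/2)^n)"]
      by (auto elim: eventually_mono)
    then have "eventually (\<lambda>j. \<forall>m\<in>{..n}. D m j \<le> ennreal ((1/2)^n)) sequentially"
      by (intro eventually_ball_finite) auto
    then show ?thesis by (rule eventually_mono) auto
  qed
  have "\<exists>s :: nat \<Rightarrow> nat. \<forall>n. (\<forall>m\<le>n. D m (s n) \<le> ennreal ((1/2)^n)) \<and> s n < s (Suc n)"
  proof (rule dependent_nat_choice)
    show "\<exists>x. \<forall>m\<le>0. D m x \<le> ennreal ((1 / 2) ^ 0)"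
      using eventually_happens[OF ev[of 0]] by auto
    show "\<exists>y. (\<forall>m\<le>Suc n. D m y \<le> ennreal ((1 / 2) ^ Suc n)) \<and> x < y" for x n
      using eventually_happens[OF eventually_conj[OF ev[of "Suc n"] eventually_gt_at_top[of x]]] by auto
  qed
  then obtain s :: "nat \<Rightarrow> nat" where s: "\<And>n m. m \<le> n \<Longrightarrow> D m (s n) \<le> ennreal ((1/2)^n)" "\<And>n. s n < s (Suc n)"
    by auto
  have sm: "strict_mono s" using s(2) by (simp add: strict_mono_Suc_iff)
  have "AE x in lborel. (\<lambda>j. norm (kconv (k (s j)) (u m) x - u m x)) \<longlonglongrightarrow> 0" for m
    using s(1) by (intro AE_tendsto_0_of_summable_integrals[of _ _ m]) (auto simp: D_def)
  then have "AE x in lborel. \<forall>m. (\<lambda>j. norm (kconv (k (s j)) (u m) x - u m x)) \<longlonglongrightarrow> 0"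
    by (simp add: AE_all_countable)
  then have "AE x in lborel. x \<in> \<Omega> \<longrightarrow> (\<lambda>j. kconv (k (s j)) f x) \<longlonglongrightarrow> f x"
  proof eventually_elim
    case (elim x)
    show ?case
    proof
      assume "x \<in> \<Omega>"
      then obtain \<rho> where \<rho>: "0 < \<rho>" "cball x \<rho> \<subseteq> \<Omega>" using \<Omega> open_contains_cball by blast
      then obtain m where m: "cball x \<rho> \<subseteq> C m" using C(3)[of "cball x \<rho>"] by auto
      have "(\<lambda>j. kconv (k (s j)) (u m) x) \<longlonglongrightarrow> u m x"
        using elim Lim_null tendsto_norm_zero_iff by blast
      moreover have "x \<in> C m" using m \<rho> by (simp add: subset_iff)
      then have "u m x = f x" by (simp add: u_def)
      moreover have "eventually (\<lambda>j. r (s j) < \<rho>) sequentially"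
        using order_tendstoD(2)[OF LIMSEQ_subseq_LIMSEQ[OF r sm] \<rho>(1)] by (simp add: comp_def)
      then have "eventually (\<lambda>j. kconv (k (s j)) (u m) x = kconv (k (s j)) f x) sequentially"
      proof eventually_elim
        case (elim j)
        show ?case
        proof (rule kconv_cong_ball[OF k])
          fix y assume "y \<in> cball x (r (s j))"
          then have "y \<in> C m" using elim m by (auto simp: subset_iff)
          then show "u m y = f y" by (simp add: u_def)
        qed
      qed
      ultimately show "(\<lambda>j. kconv (k (s j)) f x) \<longlonglongrightarrow> f x"
        by (simp add: tendsto_cong)
    qed
  qed
  with sm show ?thesis by blast
qed

section \<open>Ball averages as convolutions\<close>

definition ball_kernel :: "real \<Rightarrow> 'a::euclidean_space \<Rightarrow> real" where
  "ball_kernel r w = indicator (ball 0 r) w / measure lborel (ball (0::'a) r)"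

lemma measure_ball_pos: "0 < r \<Longrightarrow> 0 < measure lborel (ball (x::'a::euclidean_space) r)"
  by (simp add: content_ball)

lemma averaging_kernel_ball: 
  assumes "0 < r" shows "averaging_kernel r (ball_kernel r :: 'a::euclidean_space \<Rightarrow> real)"
proof -
  note p = measure_ball_pos[OF assms, of "0::'a"]
  have [measurable]: "(ball_kernel r :: 'a \<Rightarrow> real) \<in> borel_measurable borel"
    unfolding ball_kernel_def[abs_def]
    by (intro borel_measurable_divide borel_measurable_indicator borel_measurable_const) simp
  have "(\<integral>\<^sup>+w. ennreal (ball_kernel r w) \<partial>(lborel :: 'a measure)) = (\<integral>\<^sup>+w. ennreal (1 / measure lborel (ball (0::'a) r)) * indicator (ball (0::'a) r) w \<partial>lborel)"
    by (rule nn_integral_cong) (simp add: ball_kernel_def indicator_def)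
  also have "\<dots> = ennreal (1 / measure lborel (ball (0::'a) r)) * emeasure lborel (ball (0::'a) r)"
    by (rule nn_integral_cmult_indicator) simp
  also have "emeasure lborel (ball (0::'a) r) = ennreal (measure lborel (ball (0::'a) r))"
    by (rule emeasure_eq_ennreal_measure)
       (metis emeasure_lborel_ball_finite infinity_ennreal_def less_irrefl)
  finally have "(\<integral>\<^sup>+w. ennreal (ball_kernel r w) \<partial>(lborel :: 'a measure)) = 1"
    using p by (simp flip: ennreal_mult')
  moreover have "ball_kernel r w \<le> 1 / measure lborel (ball (0::'a) r)" "0 \<le> ball_kernel r w"
    "r < norm w \<longrightarrow> ball_kernel r w = 0" for w :: 'a
    using p by (auto simp: ball_kernel_def indicator_def field_simps)
  ultimately show ?thesis by (auto simp: averaging_kernel_def)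
qed

lemma kconv_ball_kernel:
  fixes x :: "'a::euclidean_space"
  shows "kconv (ball_kernel r) u x = (\<integral>y. indicator (ball x r) y *\<^sub>R u y \<partial>lborel) /\<^sub>R measure lborel (ball x r)"
proof -
  have m: "measure lborel (ball x r) = measure lborel (ball (0::'a) r)"
  proof (cases "0 < r")
    case False
    then have "ball x r = {}" "ball (0::'a) r = {}" by auto
    then show ?thesis by (simp only: measure_empty)
  qed (simp add: content_ball)
  have "indicator (ball 0 r) (x - y) = (indicator (ball x r) y :: real)" for y
    by (auto simp: indicator_def dist_norm norm_minus_commute)
  then have "kconv (ball_kernel r) u x = (\<integral>y. (1 / measure lborel (ball x r)) *\<^sub>R (indicator (ball x r) y *\<^sub>R u y) \<partial>lborel)"
    by (simp add: kconv_def ball_kernel_def m)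
  also have "\<dots> = (1 / measure lborel (ball x r)) *\<^sub>R (\<integral>y. indicator (ball x r) y *\<^sub>R u y \<partial>lborel)"
    by (rule integral_scaleR_right)
  finally show ?thesis by (simp add: divide_inverse)
qed

subsection \<open>Mollifiers\<close>

text \<open>Division by \<open>s ^ m\<close> makes the family closed under differentiation up to linear combinations.\<close>

definition exp_cutoff :: "nat \<Rightarrow> real \<Rightarrow> real" where
  "exp_cutoff m s = (if s \<le> 0 then 0 else exp (- 1 / s) / s ^ m)"

lemma exp_cutoff_nonneg: "0 \<le> exp_cutoff m s"
  by (simp add: exp_cutoff_def)

lemma exp_cutoff_tendsto_0: "(exp_cutoff m \<longlongrightarrow> 0) (at 0)"
proof (rule filterlim_split_at)
  show "(exp_cutoff m \<longlongrightarrow> 0) (at_left 0)"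
    by (rule tendsto_eventually) (auto simp: eventually_at_filter exp_cutoff_def)
  have "((\<lambda>s::real. (inverse s) ^ m / exp (inverse s)) \<longlongrightarrow> 0) (at_right 0)"
    by (rule filterlim_compose[OF tendsto_power_div_exp_0 filterlim_inverse_at_top_right])
  moreover have "eventually (\<lambda>s::real. (inverse s) ^ m / exp (inverse s) = exp_cutoff m s) (at_right 0)"
    by (auto simp: eventually_at_filter exp_cutoff_def exp_minus field_simps power_inverse)
  ultimately show "(exp_cutoff m \<longlongrightarrow> 0) (at_right 0)"
    by (rule Lim_transform_eventually)
qed

lemma exp_cutoff_deriv:
  "(exp_cutoff m has_real_derivative exp_cutoff (m + 2) s - real m * exp_cutoff (m + 1) s) (at s)"
proof -
  consider "s < 0" | "s = 0" | "0 < s" by linarith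
  then show ?thesis
  proof cases
    case 1
    have "((\<lambda>_. 0) has_real_derivative 0) (at s)" by simp
    then have "(exp_cutoff m has_real_derivative 0) (at s)"
      by (rule has_field_derivative_transform_within_open[where S="{..<0}"]) (use 1 in \<open>auto simp: exp_cutoff_def\<close>)
    then show ?thesis using 1 by (simp add: exp_cutoff_def)
  next
    case 2
    \<comment> \<open>The difference quotient at 0 is the next member
      \<open>exp_cutoff (Suc m)\<close> of the family, and it tends to 0.\<close>
    have "((\<lambda>h. (exp_cutoff m (0 + h) - exp_cutoff m 0) / h) \<longlongrightarrow> 0) (at 0)"
    proof (rule Lim_transform_eventually[OF exp_cutoff_tendsto_0[of "Suc m"]])
      show "eventually (\<lambda>h. exp_cutoff (Suc m) h = (exp_cutoff m (0 + h) - exp_cutoff m 0) / h) (at 0)"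
        by (auto simp: eventually_at_filter exp_cutoff_def field_simps)
    qed
    then show ?thesis using 2 by (simp add: DERIV_def exp_cutoff_def)
  next
    case 3
    \<comment> \<open>The derivative of s ^ m is written with s ^ k where m = Suc k, so m = 0 is
      treated apart.\<close>
    have "((\<lambda>s. exp (- 1 / s) / s ^ m) has_real_derivative exp_cutoff (m + 2) s - real m * exp_cutoff (m + 1) s) (at s)"
    proof (cases m)
      case 0
      with 3 show ?thesis
        by (auto intro!: derivative_eq_intros simp: exp_cutoff_def power2_eq_square)
    next
      case (Suc k)
      have "((\<lambda>s. exp (- 1 / s) / s ^ m) has_real_derivative
         (exp (-1/s) * (1 / s^2) * s ^ m - exp (-1/s) * (real m * s ^ k)) / (s ^ m * s ^ m)) (at s)"
        using 3 Suc
        by (auto intro!: derivative_eq_intros simp: power2_eq_square; cases k; simp add: algebra_simps)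
      also have "(exp (-1/s) * (1 / s^2) * s ^ m - exp (-1/s) * (real m * s ^ k)) / (s ^ m * s ^ m) =
         exp_cutoff (m + 2) s - real m * exp_cutoff (m + 1) s"
        using 3 Suc by (simp add: exp_cutoff_def divide_simps) (simp add: algebra_simps power2_eq_square)
      finally show ?thesis .
    qed
    then show ?thesis
      by (rule has_field_derivative_transform_within_open[where S="{0<..}"]) (use 3 in \<open>auto simp: exp_cutoff_def\<close>)
  qed
qed

lemma continuous_on_exp_cutoff [continuous_intros]:
  assumes "continuous_on S g" shows "continuous_on S (\<lambda>x. exp_cutoff m (g x))"
proof -
  have "continuous_on UNIV (exp_cutoff m)"
    using exp_cutoff_deriv[of m] by (intro continuous_at_imp_continuous_on ballI DERIV_isCont) blast
  from continuous_on_compose2[OF this assms] show ?thesis by simp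
qed

lemma exp_cutoff_0_le: "exp_cutoff 0 s \<le> 1"
  by (simp add: exp_cutoff_def)

text \<open>With x = 1 / s the value is x^2 exp (- x), and x^2 / 2 is a term of the exponential
  series. This controls the gradient of the bump.\<close>

lemma exp_cutoff_2_le: "exp_cutoff 2 s \<le> 2"
proof (cases "0 < s")
  case True
  define x where "x = inverse s"
  have x: "0 < x" using True by (simp add: x_def)
  have "x ^ 2 \<le> 2 * exp x"
    using exp_lower_Taylor_quadratic[of x] x by simp
  then have "x ^ 2 * exp (- x) \<le> 2 * exp x * exp (- x)" by (intro mult_right_mono) auto
  then have "x ^ 2 * exp (- x) \<le> 2" by (simp add: mult.assoc flip: exp_add)
  moreover have "exp_cutoff 2 s = x ^ 2 * exp (- x)"
    using True by (simp add: exp_cutoff_def x_def divide_inverse power_inverse mult.commute)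
  ultimately show ?thesis by simp
qed (simp add: exp_cutoff_def)

text \<open>An algebra of functions that contains the bumps and is closed under directional
  derivatives. Differentiability of every order then follows by induction, and no higher derivative
  has to be computed.\<close>

inductive smooth_bump_class :: "'a::euclidean_space \<Rightarrow> real \<Rightarrow> ('a \<Rightarrow> real) \<Rightarrow> bool" for a r where
  const: "smooth_bump_class a r (\<lambda>x. c)"
| inner: "smooth_bump_class a r (\<lambda>x. x \<bullet> b)"
| cutoff: "smooth_bump_class a r (\<lambda>x. exp_cutoff m (1 - (x - a) \<bullet> (x - a) / r\<^sup>2))"
| add: "smooth_bump_class a r f \<Longrightarrow> smooth_bump_class a r g \<Longrightarrow> smooth_bump_class a r (\<lambda>x. f x + g x)"
| mult: "smooth_bump_class a r f \<Longrightarrow> smooth_bump_class a r g \<Longrightarrow> smooth_bump_class a r (\<lambda>x. f x * g x)"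

text \<open>The derivative is spelled with sums and products only, so that the introduction rules of
  \<open>smooth_bump_class\<close> apply to it literally.\<close>

lemma cutoff_ball_derivative:
  fixes a :: "'a::euclidean_space"
  shows "((\<lambda>x. exp_cutoff m (1 - (x - a) \<bullet> (x - a) / r\<^sup>2)) has_derivative
    (\<lambda>h. (exp_cutoff (m + 2) (1 - (x - a) \<bullet> (x - a) / r\<^sup>2) + (- real m) * exp_cutoff (m + 1) (1 - (x - a) \<bullet> (x - a) / r\<^sup>2))
        * ((- 2 / r\<^sup>2) * (x \<bullet> h + - (a \<bullet> h))))) (at x)"
proof -
  have "((\<lambda>x. 1 - (x - a) \<bullet> (x - a) / r\<^sup>2) has_derivative (\<lambda>h. (- 2 / r\<^sup>2) * ((x - a) \<bullet> h))) (at x)"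
  proof -
    have d: "((\<lambda>x. (x - a) \<bullet> (x - a)) has_derivative (\<lambda>h. 2 * ((x - a) \<bullet> h))) (at x)"
      by (auto intro!: derivative_eq_intros simp: inner_commute)
    from has_derivative_diff[OF has_derivative_const[of 1] has_derivative_mult_left[OF d, of "inverse (r\<^sup>2)"]]
    show ?thesis by (simp add: divide_inverse mult_ac)
  qed
  from has_derivative_compose[OF this has_field_derivative_imp_has_derivative[OF exp_cutoff_deriv]]
  show ?thesis by (simp add: inner_diff_left algebra_simps)
qed

lemma smooth_bump_class_derivative:
  "smooth_bump_class a r g \<Longrightarrow>
    \<exists>g'. (\<forall>x. (g has_derivative g' x) (at x)) \<and> (\<forall>h. smooth_bump_class a r (\<lambda>x. g' x h))"
proof (induction rule: smooth_bump_class.induct)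
  case (const c)
  show ?case by (intro exI[of _ "\<lambda>x h. 0"]) (auto intro: smooth_bump_class.const)
next
  case (inner b)
  show ?case by (intro exI[of _ "\<lambda>x h. h \<bullet> b"]) (auto intro: smooth_bump_class.const derivative_eq_intros)
next
  case (cutoff m)
  show ?case
    by (intro exI[where x="\<lambda>x h. (exp_cutoff (m + 2) (1 - (x - a) \<bullet> (x - a) / r\<^sup>2) + (- real m) * exp_cutoff (m + 1) (1 - (x - a) \<bullet> (x - a) / r\<^sup>2))
        * ((- 2 / r\<^sup>2) * (x \<bullet> h + - (a \<bullet> h)))"] conjI allI cutoff_ball_derivative smooth_bump_class.intros)
next
  case (add f g)
  then obtain f' g' where "\<And>x. (f has_derivative f' x) (at x)" "\<And>h. smooth_bump_class a r (\<lambda>x. f' x h)"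
    "\<And>x. (g has_derivative g' x) (at x)" "\<And>h. smooth_bump_class a r (\<lambda>x. g' x h)" by metis
  then show ?case
    by (intro exI[of _ "\<lambda>x h. f' x h + g' x h"]) (auto intro: smooth_bump_class.add has_derivative_add)
next
  case (mult f g)
  then obtain f' g' where d: "\<And>x. (f has_derivative f' x) (at x)" "\<And>h. smooth_bump_class a r (\<lambda>x. f' x h)"
    "\<And>x. (g has_derivative g' x) (at x)" "\<And>h. smooth_bump_class a r (\<lambda>x. g' x h)" by metis
  show ?case
    by (intro exI[of _ "\<lambda>x h. f x * g' x h + f' x h * g x"] conjI allI smooth_bump_class.add
        smooth_bump_class.mult has_derivative_mult d mult)
qed

lemma smooth_bump_class_cont_diff: "smooth_bump_class a r g \<Longrightarrow> k_times_cont_diff k g"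
proof (induction k arbitrary: g)
  case 0
  then obtain g' where "\<And>x. (g has_derivative g' x) (at x)" using smooth_bump_class_derivative by metis
  then show ?case
    by (auto intro!: continuous_at_imp_continuous_on has_derivative_continuous)
next
  case (Suc k)
  obtain g' where g': "\<And>x. (g has_derivative g' x) (at x)" "\<And>h. smooth_bump_class a r (\<lambda>x. g' x h)"
    using smooth_bump_class_derivative[OF Suc.prems] by metis
  have "frechet_derivative g (at x) = g' x" for x
    using frechet_derivative_at[OF g'(1)] by metis
  moreover have "g differentiable_on UNIV"
    using g'(1) by (auto simp: differentiable_on_def differentiable_def)
  ultimately show ?case using Suc.IH[OF g'(2)] by simp
qed

definition bump :: "real \<Rightarrow> 'a::euclidean_space \<Rightarrow> real" where
  "bump r z = exp_cutoff 0 (1 - z \<bullet> z / r\<^sup>2)"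

text \<open>The chain rule, with \<open>exp_cutoff 2\<close> as the derivative of
  \<open>exp_cutoff 0\<close>.\<close>

definition bump_grad :: "real \<Rightarrow> 'a::euclidean_space \<Rightarrow> 'a" where
  "bump_grad r z = (- 2 / r\<^sup>2 * exp_cutoff 2 (1 - z \<bullet> z / r\<^sup>2)) *\<^sub>R z"

lemma bump_nonneg: "0 \<le> bump r z" and bump_le: "bump r z \<le> 1"
  by (simp_all add: bump_def exp_cutoff_nonneg exp_cutoff_0_le)

lemma bump_minus: "bump r (- z) = bump r z" and bump_grad_minus: "bump_grad r (- z) = - bump_grad r z"
  by (simp_all add: bump_def bump_grad_def)

lemma bump_minus_commute: "bump r (x - y) = bump r (y - x)"
  and bump_grad_minus_commute: "bump_grad r (x - y) = - bump_grad r (y - x)"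
  using bump_minus[of r "x - y"] bump_grad_minus[of r "y - x"] by simp_all

lemma one_minus_inner_nonpos: "0 < r \<Longrightarrow> 1 - z \<bullet> z / r\<^sup>2 \<le> 0 \<longleftrightarrow> r \<le> norm z"
  using power_mono_iff[of r "norm z" 2] by (simp add: dot_square_norm field_simps)

lemma bump_eq_0_iff: "0 < r \<Longrightarrow> bump r z = 0 \<longleftrightarrow> r \<le> norm z"
  using one_minus_inner_nonpos[of r z] by (auto simp: bump_def exp_cutoff_def)

lemma bump_grad_eq_0: "0 < r \<Longrightarrow> r \<le> norm z \<Longrightarrow> bump_grad r z = 0"
  using one_minus_inner_nonpos[of r z] by (auto simp: bump_grad_def exp_cutoff_def)

lemma continuous_on_bump [continuous_intros]:
  "continuous_on S g \<Longrightarrow> continuous_on S (\<lambda>x. bump r (g x))"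
  "continuous_on S g \<Longrightarrow> continuous_on S (\<lambda>x. bump_grad r (g x))"
  unfolding bump_def bump_grad_def divide_inverse by (intro continuous_intros; assumption)+

lemma bump_measurable [measurable]:
  "bump r \<in> borel_measurable borel" "bump_grad r \<in> borel_measurable borel"
  by (intro borel_measurable_continuous_onI continuous_intros)+

lemma norm_bump_grad_le:
  assumes "0 < r" shows "norm (bump_grad r z) \<le> 4 / r"
proof (cases "r \<le> norm z")
  case False
  have "norm (bump_grad r z) = 2 / r\<^sup>2 * exp_cutoff 2 (1 - z \<bullet> z / r\<^sup>2) * norm z"
    using assms by (simp add: bump_grad_def exp_cutoff_nonneg)
  also have "\<dots> \<le> 2 / r\<^sup>2 * 2 * r"
    using False assms by (intro mult_mono exp_cutoff_2_le mult_left_mono) (auto simp: exp_cutoff_nonneg)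
  also have "\<dots> = 4 / r" using assms by (simp add: power2_eq_square)
  finally show ?thesis .
qed (use assms bump_grad_eq_0[of r z] in simp)

lemma bump_derivative:
  "((\<lambda>y. bump r (y - x)) has_derivative (\<lambda>h. bump_grad r (y - x) \<bullet> h)) (at y)"
  unfolding bump_def
  by (rule has_derivative_eq_rhs[OF cutoff_ball_derivative])
     (simp add: bump_grad_def inner_diff_left fun_eq_iff del: add_2_eq_Suc add_2_eq_Suc')

lemma bump_test_function:
  assumes "0 < r" "cball x r \<subseteq> \<Omega>"
  shows "test_function \<Omega> (\<lambda>y. bump r (y - x))"
proof -
  have "{y. bump r (y - x) \<noteq> 0} = ball x r"
    using assms(1) by (auto simp: bump_eq_0_iff dist_norm norm_minus_commute)
  moreover have "smooth_bump_class x r (\<lambda>y. bump r (y - x))"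
    unfolding bump_def by (rule smooth_bump_class.cutoff)
  ultimately show ?thesis
    using assms by (auto simp: test_function_def smooth_bump_class_cont_diff)
qed

lemma frechet_derivative_bump:
  "frechet_derivative (\<lambda>y. bump r (y - x)) (at y) = (\<lambda>h. bump_grad r (y - x) \<bullet> h)"
  by (rule frechet_derivative_at[OF bump_derivative, symmetric])

lemma integrable_bump: "0 < r \<Longrightarrow> integrable lborel (bump r :: 'a::euclidean_space \<Rightarrow> real)"
  and integrable_bump_grad: "0 < r \<Longrightarrow> integrable lborel (bump_grad r :: 'a::euclidean_space \<Rightarrow> 'a)"
proof -
  assume r: "0 < r"
  have "integrable lborel (\<lambda>x. indicator (cball (0::'a) r) x *\<^sub>R bump r x)"
    by (rule borel_integrable_compact) (auto intro!: continuous_intros)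
  moreover have "(\<lambda>x. indicator (cball (0::'a) r) x *\<^sub>R bump r x) = bump r"
    using bump_eq_0_iff[OF r] by (force simp: indicator_def fun_eq_iff)
  ultimately show "integrable lborel (bump r :: 'a \<Rightarrow> real)" by simp
  have "integrable lborel (\<lambda>x. indicator (cball (0::'a) r) x *\<^sub>R bump_grad r x)"
    by (rule borel_integrable_compact) (auto intro!: continuous_intros)
  moreover have "(\<lambda>x. indicator (cball (0::'a) r) x *\<^sub>R bump_grad r x) = bump_grad r"
    using bump_grad_eq_0[OF r] by (force simp: indicator_def fun_eq_iff)
  ultimately show "integrable lborel (bump_grad r :: 'a \<Rightarrow> 'a)" by simp
qed

text \<open>The integrand is odd. This cancellation is what allows the ball average to be subtracted
  from f, so that only the mean oscillation is left.\<close>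

lemma integral_bump_grad: "(\<integral>z. bump_grad r z \<partial>lborel) = (0 :: 'a::euclidean_space)"
proof -
  have "(\<integral>z. bump_grad r z \<partial>lborel) = (\<integral>z. bump_grad r (- z) \<partial>(lborel :: 'a measure))"
    using integral_lborel_affine[of "bump_grad r :: 'a \<Rightarrow> 'a" "-1" 0] by simp
  also have "\<dots> = - (\<integral>z. bump_grad r z \<partial>lborel)" by (simp add: bump_grad_minus)
  finally show ?thesis by (simp add: real_vector_eq_affinity eq_neg_iff_add_eq_0 flip: scaleR_2)
qed

text \<open>The mass depends on the dimension, which only the type argument carries.\<close>

definition bump_mass :: "'a::euclidean_space itself \<Rightarrow> real \<Rightarrow> real" where
  "bump_mass _ r = (\<integral>z. bump r (z :: 'a) \<partial>lborel)"

lemma bump_mass_scale: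
  assumes "0 < r" shows "bump_mass TYPE('a::euclidean_space) r = r ^ DIM('a) * bump_mass TYPE('a) 1"
proof -
  have "bump r (r *\<^sub>R z) = bump 1 z" for z :: 'a
    using assms by (simp add: bump_def power2_eq_square)
  then show ?thesis
    using integral_lborel_affine[of "bump r :: 'a \<Rightarrow> real" r 0] assms by (simp add: bump_mass_def)
qed

lemma bump_mass_pos:
  assumes "0 < r" shows "0 < bump_mass TYPE('a::euclidean_space) r"
proof -
  have "bump_mass TYPE('a) r \<noteq> 0"
  proof
    assume "bump_mass TYPE('a) r = 0"
    then have "AE z in lborel. bump r (z::'a) = 0"
      using integral_nonneg_eq_0_iff_AE[OF integrable_bump[OF assms, where 'a='a]] by (simp add: bump_mass_def bump_nonneg)
    then have "AE z in lborel. z \<notin> ball (0::'a) r"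
      by (rule AE_mp) (auto intro!: AE_I2 simp: bump_eq_0_iff assms)
    then have "emeasure lborel (ball (0::'a) r) = 0"
      by (subst (asm) AE_iff_measurable[OF _ refl]) (auto simp: ball_def)
    then show False using measure_ball_pos[OF assms, of "0::'a"] by (simp add: measure_def)
  qed
  moreover have "0 \<le> bump_mass TYPE('a) r" by (simp add: bump_mass_def bump_nonneg)
  ultimately show ?thesis by simp
qed

definition mollifier :: "real \<Rightarrow> 'a::euclidean_space \<Rightarrow> real" where
  "mollifier r z = bump r z / bump_mass TYPE('a) r"

lemma averaging_kernel_mollifier:
  assumes "0 < r" shows "averaging_kernel r (mollifier r :: 'a::euclidean_space \<Rightarrow> real)"
  unfolding averaging_kernel_def
proof (intro conjI allI impI)
  note p = bump_mass_pos[OF assms, where 'a='a]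
  show m [measurable]: "(mollifier r :: 'a \<Rightarrow> real) \<in> borel_measurable borel"
    unfolding mollifier_def[abs_def] by measurable
  show nn: "0 \<le> mollifier r w" for w :: 'a using p by (simp add: mollifier_def bump_nonneg)
  show "\<exists>B. \<forall>w::'a. mollifier r w \<le> B"
    using p by (intro exI[of _ "1 / bump_mass TYPE('a) r"]) (auto simp: mollifier_def bump_le divide_right_mono)
  show "mollifier r w = 0" if "r < norm w" for w :: 'a
    using that assms by (simp add: mollifier_def bump_eq_0_iff)
  have i: "integrable lborel (mollifier r :: 'a \<Rightarrow> real)"
    unfolding mollifier_def[abs_def] divide_inverse
    by (intro integrable_mult_left integrable_bump assms)
  have "(\<integral>z. mollifier r z \<partial>(lborel :: 'a measure)) = 1"
    using p by (simp add: mollifier_def bump_mass_def)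
  then show "(\<integral>\<^sup>+z. ennreal (mollifier r z) \<partial>(lborel :: 'a measure)) = 1"
    using nn_integral_eq_integral[OF i] nn by simp
qed

subsection \<open>Poincare inequality on balls\<close>

text \<open>What the estimates need of the weak gradient, on Borel representatives and tested only against the
  translates of one family of bumps; the normalization of the bumps cancels.\<close>

definition mollified_gradient :: "'a::euclidean_space set \<Rightarrow> ('a \<Rightarrow> real) \<Rightarrow> ('a \<Rightarrow> 'a) \<Rightarrow> bool" where
  "mollified_gradient \<Omega> f G \<longleftrightarrow> f \<in> borel_measurable borel \<and> G \<in> borel_measurable borel \<and>
     (\<forall>K. compact K \<longrightarrow> K \<subseteq> \<Omega> \<longrightarrow> integrable lborel (\<lambda>x. indicator K x *\<^sub>R f x) \<and>
        integrable lborel (\<lambda>x. indicator K x *\<^sub>R G x)) \<and>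
     (\<forall>x r. 0 < r \<longrightarrow> cball x r \<subseteq> \<Omega> \<longrightarrow>
        (\<integral>y. f y *\<^sub>R bump_grad r (x - y) \<partial>lborel) = (\<integral>y. bump r (x - y) *\<^sub>R G y \<partial>lborel))"

text \<open>A product majorant gives joint integrability by Tonelli. Every exchange of Bochner
  integrals below rests on this criterion.\<close>

lemma integrable_lborel_pair_bound:
  fixes F :: "'a::euclidean_space \<Rightarrow> 'b::euclidean_space \<Rightarrow> 'c::{banach, second_countable_topology}"
  assumes [measurable]: "case_prod F \<in> borel_measurable (lborel \<Otimes>\<^sub>M lborel)"
    and f: "integrable lborel (f :: 'a \<Rightarrow> real)" and g: "integrable lborel (g :: 'b \<Rightarrow> real)"
    and le: "\<And>x y. norm (F x y) \<le> \<bar>f x\<bar> * \<bar>g y\<bar>"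
  shows "integrable (lborel \<Otimes>\<^sub>M lborel) (case_prod F)"
  unfolding integrable_iff_bounded
proof
  have [measurable]: "f \<in> borel_measurable borel" "g \<in> borel_measurable borel"
    using f g borel_measurable_integrable by auto
  have "(\<integral>\<^sup>+p. ennreal (norm (case_prod F p)) \<partial>(lborel \<Otimes>\<^sub>M lborel)) =
     (\<integral>\<^sup>+x. \<integral>\<^sup>+y. ennreal (norm (F x y)) \<partial>lborel \<partial>lborel)"
    by (subst lborel.nn_integral_fst[symmetric]) auto
  also have "\<dots> \<le> (\<integral>\<^sup>+x. \<integral>\<^sup>+y. ennreal \<bar>f x\<bar> * ennreal \<bar>g y\<bar> \<partial>lborel \<partial>lborel)"
    using le by (intro nn_integral_mono) (simp flip: ennreal_mult)
  also have "\<dots> = (\<integral>\<^sup>+x. ennreal \<bar>f x\<bar> \<partial>lborel) * (\<integral>\<^sup>+y. ennreal \<bar>g y\<bar> \<partial>lborel)"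
    by (simp add: nn_integral_cmult nn_integral_multc)
  also have "\<dots> < \<infinity>"
    using f g by (simp add: integrable_iff_bounded ennreal_mult_less_top)
  finally show "(\<integral>\<^sup>+p. ennreal (norm (case_prod F p)) \<partial>(lborel \<Otimes>\<^sub>M lborel)) < \<infinity>" .
qed simp

text \<open>The Jacobian t^(-n) of the substitution is at most 2^n.\<close>

lemma nn_integral_affine_le:
  fixes g :: "'a::euclidean_space \<Rightarrow> ennreal"
  assumes [measurable]: "g \<in> borel_measurable borel" and t: "1/2 \<le> t"
  shows "(\<integral>\<^sup>+y. g (z + t *\<^sub>R y) \<partial>lborel) \<le> 2 ^ DIM('a) * (\<integral>\<^sup>+y. g y \<partial>lborel)"
proof -
  have "1 \<le> (2 * t) ^ DIM('a)" using t by (intro one_le_power) simp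
  then have "(\<integral>\<^sup>+y. g (z + t *\<^sub>R y) \<partial>lborel) \<le> ennreal ((2 * t) ^ DIM('a)) * (\<integral>\<^sup>+y. g (z + t *\<^sub>R y) \<partial>lborel)"
    using mult_right_mono[of 1 "ennreal ((2 * t) ^ DIM('a))"] by simp
  also have "\<dots> = 2 ^ DIM('a) * (ennreal (\<bar>t\<bar> ^ DIM('a)) * (\<integral>\<^sup>+y. g (z + t *\<^sub>R y) \<partial>lborel))"
    using t by (simp add: power_mult_distrib ennreal_mult mult.assoc flip: ennreal_power)
  also have "\<dots> = 2 ^ DIM('a) * (\<integral>\<^sup>+y. g y \<partial>lborel)"
    using t by (subst nn_integral_lborel_affine[of g t z]) auto
  finally show ?thesis .
qed

lemma segment_in_ball:
  fixes x :: "'a::real_normed_vector"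
  assumes "y \<in> ball x r" "z \<in> ball x r" "0 \<le> t" "t \<le> 1"
  shows "z + t *\<^sub>R (y - z) \<in> ball x r"
proof -
  have "(1 - t) *\<^sub>R z + t *\<^sub>R y \<in> ball x r"
    by (rule convexD_alt[OF convex_ball]) (use assms in auto)
  then show ?thesis by (simp add: algebra_simps)
qed

text \<open>For each fixed \<^term>\<open>t\<close> one substitutes in \<open>y\<close> when \<open>t \<ge> 1/2\<close> and in \<open>z\<close> otherwise, so that
  the Jacobian stays bounded.\<close>

lemma nn_integral_segments_le:
  fixes g :: "'a::euclidean_space \<Rightarrow> ennreal" and x :: 'a and r :: real
  assumes [measurable]: "g \<in> borel_measurable borel"
  defines "B \<equiv> ball x r"
  shows "(\<integral>\<^sup>+y. \<integral>\<^sup>+z. \<integral>\<^sup>+t. indicator B y * indicator B z * indicator {0..1} t * g (z + t *\<^sub>R (y - z)) \<partial>lborel \<partial>lborel \<partial>lborel)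
    \<le> 2 ^ DIM('a) * emeasure lborel B * (\<integral>\<^sup>+y. indicator B y * g y \<partial>lborel)" (is "?L \<le> ?R")
proof -
  have B [measurable]: "B \<in> sets borel" by (simp add: B_def)
  define I where "I = (\<integral>\<^sup>+y. indicator B y * g y \<partial>lborel)"
  define T where "T t = (\<integral>\<^sup>+y. \<integral>\<^sup>+z. indicator B y * indicator B z * g (z + t *\<^sub>R (y - z)) \<partial>lborel \<partial>lborel)" for t :: real
  have large: "(\<integral>\<^sup>+y. \<integral>\<^sup>+z. indicator B y * indicator B z * g (z + t *\<^sub>R (y - z)) \<partial>lborel \<partial>lborel) \<le> ?R"
    if t: "1/2 \<le> t" "t \<le> 1" for t
  proof -
    have "(\<integral>\<^sup>+y. \<integral>\<^sup>+z. indicator B y * indicator B z * g (z + t *\<^sub>R (y - z)) \<partial>lborel \<partial>lborel) =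
       (\<integral>\<^sup>+z. \<integral>\<^sup>+y. indicator B y * indicator B z * g (z + t *\<^sub>R (y - z)) \<partial>lborel \<partial>lborel)"
      by (rule lborel_pair.Fubini') simp
    also have "\<dots> \<le> (\<integral>\<^sup>+z. indicator B z * (2 ^ DIM('a) * I) \<partial>lborel)"
    proof (rule nn_integral_mono)
      fix z
      have "(\<integral>\<^sup>+y. indicator B y * indicator B z * g (z + t *\<^sub>R (y - z)) \<partial>lborel) \<le>
         (\<integral>\<^sup>+y. indicator B z * (indicator B ((z - t *\<^sub>R z) + t *\<^sub>R y) * g ((z - t *\<^sub>R z) + t *\<^sub>R y)) \<partial>lborel)"
      proof (rule nn_integral_mono)
        fix y
        have eq: "z + t *\<^sub>R (y - z) = (z - t *\<^sub>R z) + t *\<^sub>R y" by (simp add: algebra_simps)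
        show "indicator B y * indicator B z * g (z + t *\<^sub>R (y - z)) \<le> indicator B z * (indicator B ((z - t *\<^sub>R z) + t *\<^sub>R y) * g ((z - t *\<^sub>R z) + t *\<^sub>R y))"
          using segment_in_ball[of y x r z t] t unfolding eq B_def by (auto simp: indicator_def)
      qed
      also have "\<dots> = indicator B z * (\<integral>\<^sup>+y. indicator B ((z - t *\<^sub>R z) + t *\<^sub>R y) * g ((z - t *\<^sub>R z) + t *\<^sub>R y) \<partial>lborel)"
        by (rule nn_integral_cmult) simp
      also have "\<dots> \<le> indicator B z * (2 ^ DIM('a) * I)"
        unfolding I_def using t by (intro mult_left_mono nn_integral_affine_le[where g="\<lambda>y. indicator B y * g y"]) auto
      finally show "(\<integral>\<^sup>+y. indicator B y * indicator B z * g (z + t *\<^sub>R (y - z)) \<partial>lborel) \<le> indicator B z * (2 ^ DIM('a) * I)" .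
    qed
    also have "\<dots> = ?R" by (simp add: nn_integral_multc I_def mult_ac)
    finally show ?thesis .
  qed
  have T: "T t \<le> ?R" if t: "0 \<le> t" "t \<le> 1" for t
  proof (cases "1/2 \<le> t")
    case True with t large show ?thesis by (simp add: T_def)
  next
    case False
    \<comment> \<open>Renaming y and z turns t into 1 - t, which exceeds 1 / 2.\<close>
    have "T t = (\<integral>\<^sup>+y. \<integral>\<^sup>+z. indicator B y * indicator B z * g (y + t *\<^sub>R (z - y)) \<partial>lborel \<partial>lborel)"
      unfolding T_def by (subst lborel_pair.Fubini') (auto simp: mult_ac)
    also have "\<dots> = (\<integral>\<^sup>+y. \<integral>\<^sup>+z. indicator B y * indicator B z * g (z + (1 - t) *\<^sub>R (y - z)) \<partial>lborel \<partial>lborel)"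
      by (simp add: algebra_simps)
    also have "\<dots> \<le> ?R" using False t by (intro large) auto
    finally show ?thesis .
  qed
  have "?L = (\<integral>\<^sup>+y. \<integral>\<^sup>+t. \<integral>\<^sup>+z. indicator B y * indicator B z * indicator {0..1} t * g (z + t *\<^sub>R (y - z)) \<partial>lborel \<partial>lborel \<partial>lborel)"
    by (intro nn_integral_cong lborel_pair.Fubini') simp
  also have "\<dots> = (\<integral>\<^sup>+t. \<integral>\<^sup>+y. \<integral>\<^sup>+z. indicator B y * indicator B z * indicator {0..1} t * g (z + t *\<^sub>R (y - z)) \<partial>lborel \<partial>lborel \<partial>lborel)"
    by (intro lborel_pair.Fubini') simp
  also have "\<dots> = (\<integral>\<^sup>+t. indicator {0..1} t * T t \<partial>lborel)"
  proof (rule nn_integral_cong)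
    fix t :: real
    show "(\<integral>\<^sup>+y. \<integral>\<^sup>+z. indicator B y * indicator B z * indicator {0..1} t * g (z + t *\<^sub>R (y - z)) \<partial>lborel \<partial>lborel)
       = indicator {0..1} t * T t"
      by (cases "t \<in> {0..1}") (simp_all add: T_def)
  qed
  also have "\<dots> \<le> (\<integral>\<^sup>+t. ?R * indicator {0..1::real} t \<partial>lborel)"
    using T by (intro nn_integral_mono) (auto simp: indicator_def)
  also have "\<dots> = ?R" by (subst nn_integral_cmult_indicator) auto
  finally show ?thesis .
qed

lemma bump_segment:
  fixes y z w :: "'a::euclidean_space"
  shows "bump r (y - w) - bump r (z - w) =
     (\<integral>t. indicator {0..1} t *\<^sub>R (bump_grad r (z + t *\<^sub>R (y - z) - w) \<bullet> (y - z)) \<partial>lborel)"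
proof -
  have "(\<integral>t. indicator {0..1} t *\<^sub>R (bump_grad r (z + t *\<^sub>R (y - z) - w) \<bullet> (y - z)) \<partial>lborel) =
     bump r (z + 1 *\<^sub>R (y - z) - w) - bump r (z + 0 *\<^sub>R (y - z) - w)"
  proof (rule integral_FTC_Icc)
    fix t :: real
    have "((\<lambda>t. z + t *\<^sub>R (y - z)) has_derivative (\<lambda>h. h *\<^sub>R (y - z))) (at t within {0..1})"
      by (auto intro!: derivative_eq_intros)
    from has_derivative_compose[OF this bump_derivative[of r w]]
    show "((\<lambda>t. bump r (z + t *\<^sub>R (y - z) - w)) has_vector_derivative
        bump_grad r (z + t *\<^sub>R (y - z) - w) \<bullet> (y - z)) (at t within {0..1})"
      by (simp add: has_vector_derivative_def)
  qed (auto intro!: continuous_intros)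
  then show ?thesis by simp
qed

text \<open>Truncation to \<open>K\<close> makes f and \<open>G\<close> globally integrable, as the
  convolution estimates require; kernels supported in the \<delta>-ball about p do not notice
  it.\<close>

lemma mollified_gradient_local:
  assumes G: "mollified_gradient \<Omega> f G" and \<delta>: "0 < \<delta>" and p: "cball p \<delta> \<subseteq> K" and K: "K \<subseteq> \<Omega>"
  shows "(\<integral>w. (indicator K w *\<^sub>R f w) *\<^sub>R bump_grad \<delta> (p - w) \<partial>lborel) =
         (\<integral>w. bump \<delta> (p - w) *\<^sub>R (indicator K w *\<^sub>R G w) \<partial>lborel)"
proof -
  have *: "\<delta> \<le> norm (p - w)" if "w \<notin> K" for w
    using that p by (metis dist_norm less_imp_le linorder_not_le mem_cball subsetD)
  have "(\<integral>w. (indicator K w *\<^sub>R f w) *\<^sub>R bump_grad \<delta> (p - w) \<partial>lborel) = (\<integral>w. f w *\<^sub>R bump_grad \<delta> (p - w) \<partial>lborel)"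
    by (rule Bochner_Integration.integral_cong[OF refl])
       (use * bump_grad_eq_0[OF \<delta>] in \<open>auto simp: indicator_def\<close>)
  also have "\<dots> = (\<integral>w. bump \<delta> (p - w) *\<^sub>R G w \<partial>lborel)"
    using G \<delta> p K by (auto simp: mollified_gradient_def)
  also have "\<dots> = (\<integral>w. bump \<delta> (p - w) *\<^sub>R (indicator K w *\<^sub>R G w) \<partial>lborel)"
    by (rule Bochner_Integration.integral_cong[OF refl])
       (use * bump_eq_0_iff[OF \<delta>] in \<open>auto simp: indicator_def\<close>)
  finally show ?thesis .
qed

text \<open>The mean value theorem for the mollification, with its gradient expressed through
  \<open>G\<close>. The difference of two bumps is an integral of \<open>bump_grad\<close> along the
  segment; after Fubini, \<open>eq\<close> trades f against \<open>bump_grad\<close> for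
  \<open>G\<close> against \<open>bump\<close> at each point of the segment, which stays in the ball
  by convexity. The factor 2 r bounds |y - z|.\<close>

lemma mollification_segment_le:
  fixes f :: "'a::euclidean_space \<Rightarrow> real"
  assumes f: "integrable lborel f" and G: "integrable lborel G" and \<delta>: "0 < \<delta>"
    and eq: "\<And>p. p \<in> ball x r \<Longrightarrow> (\<integral>w. f w *\<^sub>R bump_grad \<delta> (p - w) \<partial>lborel) = (\<integral>w. bump \<delta> (p - w) *\<^sub>R G w \<partial>lborel)"
    and yz: "y \<in> ball x r" "z \<in> ball x r"
  shows "ennreal \<bar>kconv (mollifier \<delta>) f y - kconv (mollifier \<delta>) f z\<bar> \<le>
     ennreal (2 * r) * (\<integral>\<^sup>+t. indicator {0..1} t * ennreal (kconv (mollifier \<delta>) (\<lambda>w. norm (G w)) (z + t *\<^sub>R (y - z))) \<partial>lborel)"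
proof -
  have [measurable]: "f \<in> borel_measurable borel" "G \<in> borel_measurable borel"
    using f G borel_measurable_integrable by auto
  note M = bump_mass_pos[OF \<delta>, where 'a='a]
  note ak = averaging_kernel_mollifier[OF \<delta>, where 'a='a]
  define N where "N = bump_mass TYPE('a) \<delta>"
  define P where "P t = z + t *\<^sub>R (y - z)" for t
  define \<Phi> where "\<Phi> w t = f w * (indicator {0..1} t * (bump_grad \<delta> (P t - w) \<bullet> (y - z)))" for w and t :: real
  have yz2: "norm (y - z) \<le> 2 * r"
    using yz norm_triangle_ineq4[of "y - x" "z - x"] by (simp add: dist_norm norm_minus_commute)
  have kc: "kconv (mollifier \<delta>) u p = (\<integral>w. u w * bump \<delta> (p - w) \<partial>lborel) / N" for u :: "'a \<Rightarrow> real" and p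
    by (simp add: kconv_def mollifier_def N_def mult.commute)
  have i: "integrable lborel (\<lambda>w. f w * bump \<delta> (p - w))" for p
    using integrable_mult_right[OF integrable_kernel_mult[OF ak f, of p], of N] M
    by (simp add: mollifier_def N_def mult.commute)
  have iG: "integrable lborel (\<lambda>w. norm (G w) * bump \<delta> (p - w))" for p
    using integrable_mult_right[OF integrable_kernel_mult[OF ak integrable_norm[OF G], of p], of N] M
    by (simp add: mollifier_def N_def mult.commute)
  have "kconv (mollifier \<delta>) f y - kconv (mollifier \<delta>) f z = (\<integral>w. f w * (bump \<delta> (y - w) - bump \<delta> (z - w)) \<partial>lborel) / N"
    using i by (simp add: kc right_diff_distrib diff_divide_distrib)
  also have "(\<integral>w. f w * (bump \<delta> (y - w) - bump \<delta> (z - w)) \<partial>lborel) = (\<integral>w. \<integral>t. \<Phi> w t \<partial>lborel \<partial>lborel)"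
    by (simp add: bump_segment \<Phi>_def P_def)
  also have "\<dots> = (\<integral>t. \<integral>w. \<Phi> w t \<partial>lborel \<partial>lborel)"
  proof (rule lborel_pair.Fubini_integral[symmetric])
    show "integrable (lborel \<Otimes>\<^sub>M lborel) (case_prod \<Phi>)"
    proof (rule integrable_lborel_pair_bound[OF _ f])
      show "integrable lborel (\<lambda>t::real. indicator {0..1} t * (4 / \<delta> * norm (y - z)))"
        by (intro integrable_mult_left integrable_real_indicator) auto
      show "norm (\<Phi> w t) \<le> \<bar>f w\<bar> * \<bar>indicator {0..1} t * (4 / \<delta> * norm (y - z))\<bar>" for w t
      proof -
        have "\<bar>bump_grad \<delta> (P t - w) \<bullet> (y - z)\<bar> \<le> 4 / \<delta> * norm (y - z)"
          using Cauchy_Schwarz_ineq2[of "bump_grad \<delta> (P t - w)" "y - z"] norm_bump_grad_le[OF \<delta>, of "P t - w"]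
          by (meson mult_right_mono norm_ge_zero order_trans)
        from mult_left_mono[OF this, of "\<bar>f w\<bar>"] show ?thesis
          using \<delta> by (auto simp: \<Phi>_def abs_mult indicator_def)
      qed
      show "case_prod \<Phi> \<in> borel_measurable (lborel \<Otimes>\<^sub>M lborel)"
        unfolding \<Phi>_def[abs_def] P_def by measurable
    qed
  qed
  finally have e: "kconv (mollifier \<delta>) f y - kconv (mollifier \<delta>) f z = (\<integral>t. \<integral>w. \<Phi> w t \<partial>lborel \<partial>lborel) / N" .
  have inner: "\<bar>\<integral>w. \<Phi> w t \<partial>lborel\<bar> \<le> 2 * r * (indicator {0..1} t * (N * kconv (mollifier \<delta>) (\<lambda>w. norm (G w)) (P t)))" for t
  proof (cases "t \<in> {0..1}")
    case True
    then have p: "P t \<in> ball x r" using segment_in_ball[OF yz] by (simp add: P_def)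
    have if': "integrable lborel (\<lambda>w. f w *\<^sub>R bump_grad \<delta> (P t - w))"
    proof (rule Bochner_Integration.integrable_bound)
      show "integrable lborel (\<lambda>w. 4 / \<delta> * f w)" using f by simp
      show "AE w in lborel. norm (f w *\<^sub>R bump_grad \<delta> (P t - w)) \<le> norm (4 / \<delta> * f w)"
      proof (rule AE_I2)
        fix w
        show "norm (f w *\<^sub>R bump_grad \<delta> (P t - w)) \<le> norm (4 / \<delta> * f w)"
          using mult_left_mono[OF norm_bump_grad_le[OF \<delta>, of "P t - w"], of "\<bar>f w\<bar>"] \<delta>
          by (simp add: abs_mult mult_ac)
      qed
    qed simp
    have "(\<integral>w. \<Phi> w t \<partial>lborel) = (\<integral>w. (f w *\<^sub>R bump_grad \<delta> (P t - w)) \<bullet> (y - z) \<partial>lborel)"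
      using True by (simp add: \<Phi>_def)
    also have "\<dots> = (\<integral>w. bump \<delta> (P t - w) *\<^sub>R G w \<partial>lborel) \<bullet> (y - z)"
      using eq[OF p] if' by (subst integral_inner_left) auto
    also have "\<bar>\<dots>\<bar> \<le> norm (\<integral>w. bump \<delta> (P t - w) *\<^sub>R G w \<partial>lborel) * norm (y - z)"
      by (rule Cauchy_Schwarz_ineq2)
    also have "\<dots> \<le> (\<integral>w. norm (G w) * bump \<delta> (P t - w) \<partial>lborel) * (2 * r)"
    proof (intro mult_mono yz2)
      have "norm (\<integral>w. bump \<delta> (P t - w) *\<^sub>R G w \<partial>lborel) \<le> (\<integral>w. norm (bump \<delta> (P t - w) *\<^sub>R G w) \<partial>lborel)"
        by (rule integral_norm_bound)
      then show "norm (\<integral>w. bump \<delta> (P t - w) *\<^sub>R G w \<partial>lborel) \<le> (\<integral>w. norm (G w) * bump \<delta> (P t - w) \<partial>lborel)"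
        by (simp add: bump_nonneg mult.commute)
    qed (auto simp: bump_nonneg)
    also have "\<dots> = 2 * r * (indicator {0..1} t * (N * kconv (mollifier \<delta>) (\<lambda>w. norm (G w)) (P t)))"
      using True M by (simp add: kc N_def)
    finally show ?thesis .
  qed (simp add: \<Phi>_def)
  have k0: "0 \<le> kconv (mollifier \<delta>) (\<lambda>w. norm (G w)) p" for p
    unfolding kconv_def using averaging_kernelD(2)[OF ak] by (intro integral_nonneg_AE AE_I2) simp
  have r0: "0 \<le> r" using yz2 by (smt (verit) norm_ge_zero)
  have "ennreal \<bar>\<integral>t. \<integral>w. \<Phi> w t \<partial>lborel \<partial>lborel\<bar> \<le> (\<integral>\<^sup>+t. ennreal \<bar>\<integral>w. \<Phi> w t \<partial>lborel\<bar> \<partial>lborel)"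
    using integral_norm_bound_ennreal[of lborel "\<lambda>t. \<integral>w. \<Phi> w t \<partial>lborel"]
    by (cases "integrable lborel (\<lambda>t. \<integral>w. \<Phi> w t \<partial>lborel)") (auto simp: not_integrable_integral_eq)
  also have "\<dots> \<le> (\<integral>\<^sup>+t. ennreal (2 * r * N) * (indicator {0..1} t * ennreal (kconv (mollifier \<delta>) (\<lambda>w. norm (G w)) (P t))) \<partial>lborel)"
  proof (rule nn_integral_mono)
    fix t :: real
    have "ennreal \<bar>\<integral>w. \<Phi> w t \<partial>lborel\<bar> \<le> ennreal (2 * r * (indicator {0..1} t * (N * kconv (mollifier \<delta>) (\<lambda>w. norm (G w)) (P t))))"
      by (intro ennreal_leI inner)
    also have "\<dots> = ennreal (2 * r * N) * (indicator {0..1} t * ennreal (kconv (mollifier \<delta>) (\<lambda>w. norm (G w)) (P t)))"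
      using M k0 r0 by (simp add: N_def indicator_def flip: ennreal_mult)
    finally show "ennreal \<bar>\<integral>w. \<Phi> w t \<partial>lborel\<bar> \<le> ennreal (2 * r * N) * (indicator {0..1} t * ennreal (kconv (mollifier \<delta>) (\<lambda>w. norm (G w)) (P t)))" .
  qed
  also have "\<dots> = ennreal N * (ennreal (2 * r) * (\<integral>\<^sup>+t. indicator {0..1} t * ennreal (kconv (mollifier \<delta>) (\<lambda>w. norm (G w)) (P t)) \<partial>lborel))"
    using M r0 averaging_kernelD(1)[OF ak]
    by (subst nn_integral_cmult) (auto simp: P_def N_def ennreal_mult mult_ac)
  finally have "ennreal \<bar>\<integral>t. \<integral>w. \<Phi> w t \<partial>lborel \<partial>lborel\<bar> \<le> ennreal N * (ennreal (2 * r) * (\<integral>\<^sup>+t. indicator {0..1} t * ennreal (kconv (mollifier \<delta>) (\<lambda>w. norm (G w)) (P t)) \<partial>lborel))" .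
  then have "ennreal (1 / N) * ennreal \<bar>\<integral>t. \<integral>w. \<Phi> w t \<partial>lborel \<partial>lborel\<bar> \<le> ennreal (1 / N) * (ennreal N * (ennreal (2 * r) * (\<integral>\<^sup>+t. indicator {0..1} t * ennreal (kconv (mollifier \<delta>) (\<lambda>w. norm (G w)) (P t)) \<partial>lborel)))"
    by (rule mult_left_mono) simp
  moreover have "ennreal (1 / N) * ennreal \<bar>\<integral>t. \<integral>w. \<Phi> w t \<partial>lborel \<partial>lborel\<bar> = ennreal \<bar>kconv (mollifier \<delta>) f y - kconv (mollifier \<delta>) f z\<bar>"
    unfolding e using M by (simp add: N_def abs_divide flip: ennreal_mult)
  moreover have "ennreal (1 / N) * (ennreal N * X) = X" for X
    using M by (simp add: N_def mult.assoc[symmetric] flip: ennreal_mult)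
  ultimately show ?thesis by (simp add: P_def)
qed


text \<open>The distance from x to the closed complement is attained and therefore strictly exceeds
  r. The gain is the room in which to mollify.\<close>

lemma cball_enlarge:
  fixes \<Omega> :: "'a::euclidean_space set"
  assumes "open \<Omega>" "cball x r \<subseteq> \<Omega>" "0 < r"
  obtains \<rho> where "r < \<rho>" "cball x \<rho> \<subseteq> \<Omega>"
proof (cases "\<Omega> = UNIV")
  case True
  then show ?thesis using that[of "r + 1"] by simp
next
  case False
  then have ne: "- \<Omega> \<noteq> {}" by auto
  obtain p where p: "p \<in> - \<Omega>" "infdist x (- \<Omega>) = dist x p"
    using infdist_attains_inf[of "- \<Omega>" x] ne assms(1) by auto
  then have "r < dist x p" using assms(2) by (auto simp: subset_iff not_le)
  show ?thesis
  proof (rule that[of "(r + dist x p) / 2"])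
    show "cball x ((r + dist x p) / 2) \<subseteq> \<Omega>"
    proof (rule subsetI, rule ccontr)
      fix q assume q: "q \<in> cball x ((r + dist x p) / 2)" "q \<notin> \<Omega>"
      then have "dist x p \<le> dist x q" using infdist_le[of q "- \<Omega>" x] p by simp
      with q \<open>r < dist x p\<close> show False by simp
    qed
  qed (use \<open>r < dist x p\<close> in simp)
qed

text \<open>Transfers an estimate on pairs from the mollification g to f at the price of an L^1
  error, which each of the two variables contributes once.\<close>

lemma nn_integral_pairs_perturb:
  fixes f g :: "'a::euclidean_space \<Rightarrow> real"
  assumes [measurable]: "f \<in> borel_measurable borel" "g \<in> borel_measurable borel" "B \<in> sets borel"
  shows "(\<integral>\<^sup>+y. \<integral>\<^sup>+z. indicator B y * indicator B z * ennreal \<bar>f y - f z\<bar> \<partial>lborel \<partial>lborel) \<le>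
     (\<integral>\<^sup>+y. \<integral>\<^sup>+z. indicator B y * indicator B z * ennreal \<bar>g y - g z\<bar> \<partial>lborel \<partial>lborel) +
     2 * emeasure lborel B * (\<integral>\<^sup>+y. ennreal \<bar>g y - f y\<bar> \<partial>lborel)"
proof -
  define D where "D = (\<integral>\<^sup>+y. ennreal \<bar>g y - f y\<bar> \<partial>lborel)"
  have "(\<integral>\<^sup>+y. \<integral>\<^sup>+z. indicator B y * indicator B z * ennreal \<bar>f y - f z\<bar> \<partial>lborel \<partial>lborel) \<le>
     (\<integral>\<^sup>+y. \<integral>\<^sup>+z. indicator B y * indicator B z * ennreal \<bar>g y - g z\<bar> +
        (indicator B z * ennreal \<bar>g y - f y\<bar> + indicator B y * ennreal \<bar>g z - f z\<bar>) \<partial>lborel \<partial>lborel)"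
  proof (intro nn_integral_mono)
    fix y z
    have "ennreal \<bar>f y - f z\<bar> \<le> ennreal \<bar>g y - g z\<bar> + (ennreal \<bar>g y - f y\<bar> + ennreal \<bar>g z - f z\<bar>)"
      by (simp flip: ennreal_plus)
    then show "indicator B y * indicator B z * ennreal \<bar>f y - f z\<bar> \<le>
      indicator B y * indicator B z * ennreal \<bar>g y - g z\<bar> + (indicator B z * ennreal \<bar>g y - f y\<bar> + indicator B y * ennreal \<bar>g z - f z\<bar>)"
      by (auto simp: indicator_def)
  qed
  also have "\<dots> = (\<integral>\<^sup>+y. (\<integral>\<^sup>+z. indicator B y * indicator B z * ennreal \<bar>g y - g z\<bar> \<partial>lborel) +
        (emeasure lborel B * ennreal \<bar>g y - f y\<bar> + indicator B y * D) \<partial>lborel)"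
    by (intro nn_integral_cong) (simp add: nn_integral_add nn_integral_multc nn_integral_cmult D_def)
  also have "\<dots> = (\<integral>\<^sup>+y. \<integral>\<^sup>+z. indicator B y * indicator B z * ennreal \<bar>g y - g z\<bar> \<partial>lborel \<partial>lborel) +
     (emeasure lborel B * D + emeasure lborel B * D)"
    by (simp add: nn_integral_add nn_integral_multc nn_integral_cmult D_def)
  finally show ?thesis by (simp add: D_def mult_2 distrib_right mult.assoc)
qed

text \<open>For mollifications of radius \<delta> < \<rho> - r the segment estimate, integrated over
  all pairs, gives the inequality up to the errors collected in \<open>E\<close>. Both are L^1
  errors of mollified truncations and vanish as \<delta> tends to 0.\<close>

lemma poincare_pairs:
  fixes f :: "'a::euclidean_space \<Rightarrow> real"
  assumes \<Omega>: "open \<Omega>" and fG: "mollified_gradient \<Omega> f G" and r: "0 < r" "cball x r \<subseteq> \<Omega>"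
  defines "B \<equiv> ball x r"
  shows "(\<integral>\<^sup>+y. \<integral>\<^sup>+z. indicator B y * indicator B z * ennreal \<bar>f y - f z\<bar> \<partial>lborel \<partial>lborel) \<le>
     ennreal (2 * r) * (2 ^ DIM('a) * emeasure lborel B * (\<integral>\<^sup>+y. indicator B y * ennreal (norm (G y)) \<partial>lborel))"
    (is "?L \<le> ?R")
proof -
  have B [measurable]: "B \<in> sets borel" by (simp add: B_def)
  obtain \<rho> where \<rho>: "r < \<rho>" "cball x \<rho> \<subseteq> \<Omega>" using cball_enlarge[OF \<Omega> r(2,1)] by metis
  define K where "K = cball x \<rho>"
  define f1 where "f1 w = indicator K w *\<^sub>R f w" for w
  define G1 where "G1 w = indicator K w *\<^sub>R G w" for w
  have i: "integrable lborel f1" "integrable lborel G1"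
    using fG \<rho> by (auto simp: mollified_gradient_def f1_def[abs_def] G1_def[abs_def] K_def)
  then have [measurable]: "f1 \<in> borel_measurable borel" "G1 \<in> borel_measurable borel"
    using borel_measurable_integrable by auto
  have BK: "y \<in> K" if "y \<in> B" for y using that \<rho> by (auto simp: B_def K_def)
  define h where "h \<delta> = kconv (mollifier \<delta>) (\<lambda>w. norm (G1 w))" for \<delta>
  define C where "C = ennreal (2 * r) * (2 ^ DIM('a) * emeasure lborel B)"
  define E where "E \<delta> = C * (\<integral>\<^sup>+y. ennreal (norm (h \<delta> y - norm (G1 y))) \<partial>lborel) +
     2 * emeasure lborel B * (\<integral>\<^sup>+y. ennreal (norm (kconv (mollifier \<delta>) f1 y - f1 y)) \<partial>lborel)" for \<delta>
  have fin: "emeasure lborel B < top" using emeasure_lborel_ball_finite[of x r] by (simp add: B_def)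
  have le: "?L \<le> ?R + E \<delta>" if \<delta>: "0 < \<delta>" "\<delta> < \<rho> - r" for \<delta>
  proof -
    note ak = averaging_kernel_mollifier[OF \<delta>(1), where 'a='a]
    have [measurable]: "(mollifier \<delta> :: 'a \<Rightarrow> real) \<in> borel_measurable borel" using averaging_kernelD(1)[OF ak] .
    have [measurable]: "h \<delta> \<in> borel_measurable borel" unfolding h_def by measurable
    have eq: "(\<integral>w. f1 w *\<^sub>R bump_grad \<delta> (p - w) \<partial>lborel) = (\<integral>w. bump \<delta> (p - w) *\<^sub>R G1 w \<partial>lborel)"
      if p: "p \<in> ball x r" for p
      unfolding f1_def G1_def
    proof (rule mollified_gradient_local[OF fG \<delta>(1)])
      show "cball p \<delta> \<subseteq> K" using p \<delta> by (auto simp: K_def intro!: order_trans[OF dist_triangle[of x _ p]])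
    qed (simp add: K_def \<rho>)
    have "?L = (\<integral>\<^sup>+y. \<integral>\<^sup>+z. indicator B y * indicator B z * ennreal \<bar>f1 y - f1 z\<bar> \<partial>lborel \<partial>lborel)"
      by (intro nn_integral_cong) (auto simp: f1_def indicator_def BK)
    also have "\<dots> \<le> (\<integral>\<^sup>+y. \<integral>\<^sup>+z. indicator B y * indicator B z * ennreal \<bar>kconv (mollifier \<delta>) f1 y - kconv (mollifier \<delta>) f1 z\<bar> \<partial>lborel \<partial>lborel) +
       2 * emeasure lborel B * (\<integral>\<^sup>+y. ennreal \<bar>kconv (mollifier \<delta>) f1 y - f1 y\<bar> \<partial>lborel)"
      by (rule nn_integral_pairs_perturb) measurable
    also have "(\<integral>\<^sup>+y. \<integral>\<^sup>+z. indicator B y * indicator B z * ennreal \<bar>kconv (mollifier \<delta>) f1 y - kconv (mollifier \<delta>) f1 z\<bar> \<partial>lborel \<partial>lborel)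
       \<le> (\<integral>\<^sup>+y. \<integral>\<^sup>+z. ennreal (2 * r) * (\<integral>\<^sup>+t. indicator B y * indicator B z * indicator {0..1} t * ennreal (h \<delta> (z + t *\<^sub>R (y - z))) \<partial>lborel) \<partial>lborel \<partial>lborel)"
    proof (intro nn_integral_mono)
      fix y z
      show "indicator B y * indicator B z * ennreal \<bar>kconv (mollifier \<delta>) f1 y - kconv (mollifier \<delta>) f1 z\<bar>
        \<le> ennreal (2 * r) * (\<integral>\<^sup>+t. indicator B y * indicator B z * indicator {0..1} t * ennreal (h \<delta> (z + t *\<^sub>R (y - z))) \<partial>lborel)"
        using mollification_segment_le[OF i \<delta>(1) eq, where y=y and z=z]
        by (cases "y \<in> B \<and> z \<in> B") (auto simp: h_def B_def)
    qed
    also have "\<dots> = ennreal (2 * r) * (\<integral>\<^sup>+y. \<integral>\<^sup>+z. \<integral>\<^sup>+t. indicator B y * indicator B z * indicator {0..1} t * ennreal (h \<delta> (z + t *\<^sub>R (y - z))) \<partial>lborel \<partial>lborel \<partial>lborel)"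
      by (simp add: nn_integral_cmult)
    also have "\<dots> \<le> ennreal (2 * r) * (2 ^ DIM('a) * emeasure lborel B * (\<integral>\<^sup>+y. indicator B y * ennreal (h \<delta> y) \<partial>lborel))"
      unfolding B_def by (intro mult_left_mono nn_integral_segments_le) auto
    also have "\<dots> = C * (\<integral>\<^sup>+y. indicator B y * ennreal (h \<delta> y) \<partial>lborel)"
      by (simp add: C_def mult.assoc)
    also have "(\<integral>\<^sup>+y. indicator B y * ennreal (h \<delta> y) \<partial>lborel) \<le>
       (\<integral>\<^sup>+y. indicator B y * ennreal (norm (G y)) + ennreal (norm (h \<delta> y - norm (G1 y))) \<partial>lborel)"
    proof (rule nn_integral_mono)
      fix y
      show "indicator B y * ennreal (h \<delta> y) \<le> indicator B y * ennreal (norm (G y)) + ennreal (norm (h \<delta> y - norm (G1 y)))"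
      proof (cases "y \<in> B")
        case True
        then have "norm (G1 y) = norm (G y)" using BK by (simp add: G1_def)
        then show ?thesis using True by (auto simp flip: ennreal_plus intro!: ennreal_leI)
      qed simp
    qed
    also have "\<dots> = (\<integral>\<^sup>+y. indicator B y * ennreal (norm (G y)) \<partial>lborel) + (\<integral>\<^sup>+y. ennreal (norm (h \<delta> y - norm (G1 y))) \<partial>lborel)"
      using fG by (intro nn_integral_add) (auto simp: mollified_gradient_def)
    finally show ?thesis by (simp add: E_def C_def distrib_left mult.assoc add.assoc add_mono mult_left_mono)
  qed
  have "(E \<longlongrightarrow> C * 0 + 2 * emeasure lborel B * 0) (at_right 0)"
    unfolding E_def
  proof (intro tendsto_add ennreal_tendsto_cmult)
    have id: "((\<lambda>\<delta>::real. max \<delta> 0) \<longlongrightarrow> 0) (at_right 0)" by (auto intro!: tendsto_eq_intros)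
    \<comment> \<open>\<open>kconv_L1_tendsto\<close> expects an averaging kernel for every index.
      For \<delta> \<le> 0 any kernel serves, since the limit from the right does not see
      it.\<close>
    define \<kappa> :: "real \<Rightarrow> 'a \<Rightarrow> real" where "\<kappa> \<delta> = (if 0 < \<delta> then mollifier \<delta> else mollifier 1)" for \<delta>
    have id: "((\<lambda>\<delta>::real. if 0 < \<delta> then \<delta> else 1) \<longlongrightarrow> 0) (at_right 0)"
      by (rule Lim_transform_eventually[OF tendsto_ident_at]) (auto simp: eventually_at_filter)
    have \<kappa>: "averaging_kernel (if 0 < \<delta> then \<delta> else 1) (\<kappa> \<delta>)" for \<delta>
      by (simp add: \<kappa>_def averaging_kernel_mollifier)
    have ev: "eventually (\<lambda>\<delta>. \<kappa> \<delta> = mollifier \<delta>) (at_right 0)"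
      by (auto simp: eventually_at_filter \<kappa>_def)
    show "((\<lambda>\<delta>. \<integral>\<^sup>+y. ennreal (norm (h \<delta> y - norm (G1 y))) \<partial>lborel) \<longlongrightarrow> 0) (at_right 0)"
      by (rule Lim_transform_eventually[OF kconv_L1_tendsto[OF \<kappa> integrable_norm[OF i(2)] id]])
         (use ev in \<open>auto elim!: eventually_mono simp: h_def\<close>)
    show "((\<lambda>\<delta>. \<integral>\<^sup>+y. ennreal (norm (kconv (mollifier \<delta>) f1 y - f1 y)) \<partial>lborel) \<longlongrightarrow> 0) (at_right 0)"
      by (rule Lim_transform_eventually[OF kconv_L1_tendsto[OF \<kappa> i(1) id]])
         (use ev in \<open>auto elim!: eventually_mono\<close>)
    show "C < top" using fin r by (simp add: C_def ennreal_mult_less_top power_less_top_ennreal)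
    show "2 * emeasure lborel B < top" using fin by (simp add: ennreal_mult_less_top)
  qed
  then have "((\<lambda>\<delta>. ?R + E \<delta>) \<longlongrightarrow> ?R + 0) (at_right 0)" by (intro tendsto_intros) simp
  moreover have "eventually (\<lambda>\<delta>. ?L \<le> ?R + E \<delta>) (at_right 0)"
    unfolding eventually_at_right_field using le \<rho> by (intro exI[of _ "\<rho> - r"]) auto
  ultimately show ?thesis
    by (intro tendsto_lowerbound[where F="at_right (0::real)" and f="\<lambda>\<delta>. ?R + E \<delta>"]) auto
qed

subsection \<open>The sharp average and weak gradients\<close>

lemma sets_borel_ball [measurable]: "ball x r \<in> sets borel" and sets_borel_cball [measurable]: "cball x r \<in> sets borel"
  for x :: "'a::metric_space"
  by (simp_all add: borel_open borel_closed)

section \<open>Passage between Lebesgue measure on open sets and Borel functions\<close>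

lemma AE_lebesgue_on_iff:
  "open \<Omega> \<Longrightarrow> (AE x in lebesgue_on \<Omega>. P x) \<longleftrightarrow> (AE x in lborel. x \<in> \<Omega> \<longrightarrow> P x)"
  by (simp add: AE_restrict_space_iff AE_completion_iff)

lemma borel_measurable_lebesgue_onI:
  "g \<in> borel_measurable borel \<Longrightarrow> g \<in> borel_measurable (lebesgue_on \<Omega>)"
  by (intro measurable_restrict_space1 measurable_completion) simp

text \<open>The definitions integrate over \<open>lebesgue_on\<close>, whereas translations,
  scalings and Fubini are applied to Borel functions under \<open>lborel\<close>. A Borel
  representative connects the two.\<close>

lemma integral_lebesgue_on_borel_version:
  fixes F F0 :: "'a::euclidean_space \<Rightarrow> 'b::{banach, second_countable_topology}"
  assumes "open \<Omega>" "F \<in> borel_measurable (lebesgue_on \<Omega>)" and F0: "F0 \<in> borel_measurable borel"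
    and "AE x in lborel. x \<in> \<Omega> \<longrightarrow> F x = F0 x"
  shows "(LINT x|lebesgue_on \<Omega>. F x) = (\<integral>x. indicator \<Omega> x *\<^sub>R F0 x \<partial>lborel)"
    "integrable (lebesgue_on \<Omega>) F \<longleftrightarrow> integrable lborel (\<lambda>x. indicator \<Omega> x *\<^sub>R F0 x)"
proof -
  have [measurable]: "\<Omega> \<in> sets borel" "F0 \<in> borel_measurable borel" using assms by auto
  have ae: "AE x in lebesgue_on \<Omega>. F x = F0 x" using assms by (simp add: AE_lebesgue_on_iff)
  have "(LINT x|lebesgue_on \<Omega>. F x) = (LINT x|lebesgue_on \<Omega>. F0 x)"
    by (rule integral_cong_AE) (use assms(2) ae borel_measurable_lebesgue_onI[OF F0] in auto)
  also have "\<dots> = (\<integral>x. indicator \<Omega> x *\<^sub>R F0 x \<partial>lebesgue)"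
    using assms(1) by (subst integral_restrict_space) auto
  also have "\<dots> = (\<integral>x. indicator \<Omega> x *\<^sub>R F0 x \<partial>lborel)"
    by (rule integral_completion) simp
  finally show "(LINT x|lebesgue_on \<Omega>. F x) = (\<integral>x. indicator \<Omega> x *\<^sub>R F0 x \<partial>lborel)" .
  have "integrable (lebesgue_on \<Omega>) F \<longleftrightarrow> integrable (lebesgue_on \<Omega>) F0"
    by (rule integrable_cong_AE) (use assms(2) ae borel_measurable_lebesgue_onI[OF F0] in auto)
  also have "\<dots> \<longleftrightarrow> integrable lebesgue (\<lambda>x. indicator \<Omega> x *\<^sub>R F0 x)"
    using assms(1) by (subst integrable_restrict_space) auto
  also have "\<dots> \<longleftrightarrow> integrable lborel (\<lambda>x. indicator \<Omega> x *\<^sub>R F0 x)"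
    by (rule integrable_completion) simp
  finally show "integrable (lebesgue_on \<Omega>) F \<longleftrightarrow> integrable lborel (\<lambda>x. indicator \<Omega> x *\<^sub>R F0 x)" .
qed

lemma ball_average_eq_kconv:
  assumes "g \<in> borel_measurable borel"
  shows "ball_average g x r = kconv (ball_kernel r) g x"
  unfolding ball_average_def kconv_ball_kernel
  using integral_lebesgue_on_borel_version(1)[of "ball x r" g g] assms borel_measurable_lebesgue_onI[OF assms]
  by (simp add: divide_inverse mult.commute)

lemma ball_average_cong_AE:
  assumes "f \<in> borel_measurable (lebesgue_on (ball x r))" "g \<in> borel_measurable borel"
    and "AE y in lborel. y \<in> ball x r \<longrightarrow> f y = g y"
  shows "ball_average f x r = ball_average g x r"
  unfolding ball_average_def
  using assms borel_measurable_lebesgue_onI[OF assms(2)]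
  by (simp add: integral_lebesgue_on_borel_version(1)[of "ball x r" _ g])

lemma sharp_average_cong_AE:
  assumes f: "f \<in> borel_measurable (lebesgue_on (ball x r))" "g \<in> borel_measurable borel"
    and ae: "AE y in lborel. y \<in> ball x r \<longrightarrow> f y = g y"
  shows "sharp_average f x r = sharp_average g x r"
  unfolding sharp_average_def
proof -
  have m: "ball_average f x r = ball_average g x r" by (rule ball_average_cong_AE[OF assms])
  show "ball_average (\<lambda>y. \<bar>f y - ball_average f x r\<bar>) x r = ball_average (\<lambda>y. \<bar>g y - ball_average g x r\<bar>) x r"
    unfolding m by (rule ball_average_cong_AE) (use assms in auto)
qed

lemma emeasure_ball_eq: "emeasure lborel (ball (x::'a::euclidean_space) r) = ennreal (measure lborel (ball x r))"
  by (rule emeasure_eq_ennreal_measure) (metis emeasure_lborel_ball_finite infinity_ennreal_def less_irrefl)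

section \<open>Estimates involving the sharp average\<close>

lemma sharp_average_eq:
  fixes f :: "'a::euclidean_space \<Rightarrow> real" and x :: 'a and r :: real
  assumes [measurable]: "f \<in> borel_measurable borel" and r: "0 < r"
  defines "m \<equiv> ball_average f x r"
  shows "(\<integral>y. indicator (ball x r) y * \<bar>f y - m\<bar> \<partial>lborel) = measure lborel (ball x r) * sharp_average f x r"
  using measure_ball_pos[OF r, of x]
  by (simp add: sharp_average_def m_def[symmetric] ball_average_eq_kconv kconv_ball_kernel)

lemma integrable_ball_of_cball:
  fixes u :: "'a::euclidean_space \<Rightarrow> 'b::{banach, second_countable_topology}"
  assumes "integrable lborel (\<lambda>y. indicator (cball x r) y *\<^sub>R u y)"
  shows "integrable lborel (\<lambda>y. indicator (ball x r) y *\<^sub>R u y)"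
proof -
  have "integrable lborel (\<lambda>y. indicator (ball x r) y *\<^sub>R (indicator (cball x r) y *\<^sub>R u y))"
    by (rule integrable_mult_indicator[OF _ assms]) simp
  moreover have "(\<lambda>y. indicator (ball x r) y *\<^sub>R (indicator (cball x r) y *\<^sub>R u y)) = (\<lambda>y. indicator (ball x r) y *\<^sub>R u y)"
    by (auto simp: fun_eq_iff indicator_def)
  ultimately show ?thesis by simp
qed

lemma integrable_ball_diff_const:
  fixes f :: "'a::euclidean_space \<Rightarrow> real"
  assumes "integrable lborel (\<lambda>y. indicator (ball x r) y *\<^sub>R f y)"
  shows "integrable lborel (\<lambda>y. indicator (ball x r) y * (f y - m))"
proof -
  have "integrable lborel (\<lambda>y. indicator (ball x r) y *\<^sub>R f y - indicator (ball x r) y * m)"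
    by (intro Bochner_Integration.integrable_diff assms integrable_mult_left integrable_real_indicator)
       (auto simp: emeasure_ball_eq)
  then show ?thesis by (simp add: right_diff_distrib)
qed

lemma norm_bump_grad_integral_le:
  fixes f :: "'a::euclidean_space \<Rightarrow> real"
  assumes [measurable]: "f \<in> borel_measurable borel" and r: "0 < r"
    and i: "integrable lborel (\<lambda>y. indicator (cball x r) y *\<^sub>R f y)"
  shows "norm (\<integral>y. f y *\<^sub>R bump_grad r (x - y) \<partial>lborel) \<le> 4 / r * (measure lborel (ball x r) * sharp_average f x r)"
proof -
  define m where "m = ball_average f x r"
  note ib = integrable_ball_of_cball[OF i]
  have z: "bump_grad r (x - y) = 0" if "y \<notin> ball x r" for y
    using that by (intro bump_grad_eq_0[OF r]) (simp add: dist_norm)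
  have ig: "integrable lborel (\<lambda>y. (indicator (ball x r) y * (f y - c)) *\<^sub>R bump_grad r (x - y))" for c
  proof (rule Bochner_Integration.integrable_bound)
    show "integrable lborel (\<lambda>y. 4 / r * (indicator (ball x r) y * (f y - c)))"
      by (intro integrable_mult_right integrable_ball_diff_const ib)
    show "AE y in lborel. norm ((indicator (ball x r) y * (f y - c)) *\<^sub>R bump_grad r (x - y)) \<le> norm (4 / r * (indicator (ball x r) y * (f y - c)))"
    proof (rule AE_I2)
      fix y
      show "norm ((indicator (ball x r) y * (f y - c)) *\<^sub>R bump_grad r (x - y)) \<le> norm (4 / r * (indicator (ball x r) y * (f y - c)))"
        using mult_left_mono[OF norm_bump_grad_le[OF r, of "x - y"], of "\<bar>indicator (ball x r) y * (f y - c)\<bar>"] r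
        by (simp add: abs_mult mult_ac)
    qed
  qed simp
  have ic: "integrable lborel (\<lambda>y. m *\<^sub>R bump_grad r (x - y))"
    using integrable_lborel_affine[OF integrable_bump_grad[OF r], of "-1" x] by simp
  have "(\<integral>y. m *\<^sub>R bump_grad r (x - y) \<partial>lborel) = 0"
    using integral_lborel_affine[of "bump_grad r" "-1" x] integral_bump_grad[of r, where 'a='a] by simp
  moreover have "(\<lambda>y. f y *\<^sub>R bump_grad r (x - y)) =
    (\<lambda>y. (indicator (ball x r) y * (f y - m)) *\<^sub>R bump_grad r (x - y) + m *\<^sub>R bump_grad r (x - y))"
    using z by (auto simp: fun_eq_iff indicator_def scaleR_diff_left)
  ultimately have "(\<integral>y. f y *\<^sub>R bump_grad r (x - y) \<partial>lborel) = (\<integral>y. (indicator (ball x r) y * (f y - m)) *\<^sub>R bump_grad r (x - y) \<partial>lborel)"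
    using ig[of m] ic by simp
  also have "norm \<dots> \<le> (\<integral>y. 4 / r * (indicator (ball x r) y * \<bar>f y - m\<bar>) \<partial>lborel)"
  proof (rule order_trans[OF integral_norm_bound Bochner_Integration.integral_mono[OF integrable_norm[OF ig]]])
    show "integrable lborel (\<lambda>y. 4 / r * (indicator (ball x r) y * \<bar>f y - m\<bar>))"
      using integrable_norm[OF integrable_ball_diff_const[OF ib, of m]]
      by (intro integrable_mult_right) (simp add: abs_mult)
    fix y
    show "norm ((indicator (ball x r) y * (f y - m)) *\<^sub>R bump_grad r (x - y)) \<le> 4 / r * (indicator (ball x r) y * \<bar>f y - m\<bar>)"
      using mult_left_mono[OF norm_bump_grad_le[OF r, of "x - y"], of "\<bar>indicator (ball x r) y * (f y - m)\<bar>"]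
      by (simp add: abs_mult mult_ac)
  qed
  also have "\<dots> = 4 / r * (measure lborel (ball x r) * sharp_average f x r)"
    using sharp_average_eq[of f r x] r by (simp add: m_def)
  finally show ?thesis .
qed

lemma sharp_average_nonneg: "0 \<le> sharp_average f x r"
  unfolding sharp_average_def ball_average_def[of "\<lambda>y. \<bar>f y - ball_average f x r\<bar>"]
  by (intro divide_nonneg_nonneg Bochner_Integration.integral_nonneg) auto

text \<open>With V the volume and m the mean, V (f y - m) is the integral of f y - f z over z in the
  ball; the absolute value is then moved inside. The two factors of the volume clear both
  normalizations.\<close>

lemma sharp_average_le_pairs:
  fixes f :: "'a::euclidean_space \<Rightarrow> real"
  assumes [measurable]: "f \<in> borel_measurable borel" and r: "0 < r"
    and i: "integrable lborel (\<lambda>y. indicator (ball x r) y *\<^sub>R f y)"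
  defines "B \<equiv> ball x r"
  shows "ennreal (measure lborel B * (measure lborel B * sharp_average f x r)) \<le>
    (\<integral>\<^sup>+y. \<integral>\<^sup>+z. indicator B y * indicator B z * ennreal \<bar>f y - f z\<bar> \<partial>lborel \<partial>lborel)"
proof -
  define m where "m = ball_average f x r"
  define V where "V = measure lborel B"
  have [measurable]: "B \<in> sets borel" by (simp add: B_def)
  have V: "0 < V" using measure_ball_pos[OF r] by (simp add: V_def B_def)
  have im: "integrable lborel (\<lambda>y. indicator B y * \<bar>f y - m\<bar>)"
    using integrable_norm[OF integrable_ball_diff_const[OF i, of m]] by (simp add: abs_mult B_def)
  have "V * m = (\<integral>z. indicator B z * f z \<partial>lborel)"
    using V by (simp add: m_def ball_average_eq_kconv kconv_ball_kernel V_def B_def)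
  moreover have "V * c = (\<integral>z. indicator B z * c \<partial>lborel)" for c
    by (simp add: V_def)
  moreover have "integrable lborel (\<lambda>z. indicator B z * c)" for c :: real
    by (intro integrable_mult_left integrable_real_indicator) (auto simp: emeasure_ball_eq B_def)
  moreover have "integrable lborel (\<lambda>z. indicator B z * f z)" using i by (simp add: B_def)
  ultimately have Vm: "V * (c - m) = (\<integral>z. indicator B z * (c - f z) \<partial>lborel)" for c
    by (simp add: right_diff_distrib V_def)
  have "ennreal (V * (V * sharp_average f x r)) = ennreal V * ennreal (\<integral>y. indicator B y * \<bar>f y - m\<bar> \<partial>lborel)"
    using sharp_average_eq[of f r x] r V sharp_average_nonneg[of f x r] by (simp add: m_def V_def B_def ennreal_mult)
  also have "\<dots> = ennreal V * (\<integral>\<^sup>+y. ennreal (indicator B y * \<bar>f y - m\<bar>) \<partial>lborel)"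
    by (subst nn_integral_eq_integral[OF im]) auto
  also have "\<dots> = (\<integral>\<^sup>+y. ennreal V * ennreal (indicator B y * \<bar>f y - m\<bar>) \<partial>lborel)"
    by (simp add: nn_integral_cmult)
  also have "\<dots> \<le> (\<integral>\<^sup>+y. \<integral>\<^sup>+z. indicator B y * indicator B z * ennreal \<bar>f y - f z\<bar> \<partial>lborel \<partial>lborel)"
  proof (rule nn_integral_mono)
    fix y
    have "ennreal V * ennreal (indicator B y * \<bar>f y - m\<bar>) = indicator B y * ennreal \<bar>V * (f y - m)\<bar>"
      using V by (simp add: abs_mult indicator_def flip: ennreal_mult)
    also have "ennreal \<bar>V * (f y - m)\<bar> \<le> (\<integral>\<^sup>+z. ennreal (norm (indicator B z * (f y - f z))) \<partial>lborel)"
      unfolding Vm real_norm_def[symmetric]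
      by (cases "integrable lborel (\<lambda>z. indicator B z * (f y - f z))")
         (auto simp: not_integrable_integral_eq simp del: real_norm_def intro: integral_norm_bound_ennreal)
    also have "indicator B y * \<dots> = (\<integral>\<^sup>+z. indicator B y * indicator B z * ennreal \<bar>f y - f z\<bar> \<partial>lborel)"
      by (subst nn_integral_cmult[symmetric]) (auto intro!: nn_integral_cong simp: indicator_def)
    finally show "ennreal V * ennreal (indicator B y * \<bar>f y - m\<bar>) \<le> (\<integral>\<^sup>+z. indicator B y * indicator B z * ennreal \<bar>f y - f z\<bar> \<partial>lborel)"
      by (simp add: mult_left_mono)
  qed
  finally show ?thesis by (simp add: V_def)
qed

text \<open>Origin of the constant: chords of the ball have length at most 2 r and the Jacobian
  along segments costs 2^n. Division by the squared volume leaves one average of |G|.\<close>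

lemma sharp_poincare:
  fixes f :: "'a::euclidean_space \<Rightarrow> real"
  assumes \<Omega>: "open \<Omega>" and fG: "mollified_gradient \<Omega> f G" and r: "0 < r" "cball x r \<subseteq> \<Omega>"
  shows "1 / r * sharp_average f x r \<le> 2 ^ (DIM('a) + 1) * ball_average (\<lambda>y. norm (G y)) x r"
proof -
  define V where "V = measure lborel (ball x r)"
  have V: "0 < V" using measure_ball_pos[OF r(1)] by (simp add: V_def)
  have [measurable]: "f \<in> borel_measurable borel" "G \<in> borel_measurable borel"
    and i: "integrable lborel (\<lambda>y. indicator (ball x r) y *\<^sub>R f y)" "integrable lborel (\<lambda>y. indicator (ball x r) y *\<^sub>R G y)"
    using fG r(2) integrable_ball_of_cball[of x r f] integrable_ball_of_cball[of x r G]
    by (auto simp: mollified_gradient_def)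
  define A where "A = ball_average (\<lambda>y. norm (G y)) x r"
  have VA: "(\<integral>y. indicator (ball x r) y * norm (G y) \<partial>lborel) = V * A"
    using V by (simp add: A_def V_def ball_average_eq_kconv kconv_ball_kernel)
  have "0 \<le> (\<integral>y. indicator (ball x r) y * norm (G y) \<partial>lborel)"
    by (intro Bochner_Integration.integral_nonneg) simp
  with VA have A0: "0 \<le> V * A" by simp
  have "(\<integral>\<^sup>+y. indicator (ball x r) y * ennreal (norm (G y)) \<partial>lborel) = (\<integral>\<^sup>+y. ennreal (indicator (ball x r) y * norm (G y)) \<partial>lborel)"
    by (intro nn_integral_cong) (auto simp: indicator_def)
  also have "\<dots> = ennreal (V * A)"
    using integrable_norm[OF i(2)] by (subst nn_integral_eq_integral) (auto simp: VA)
  finally have nG: "(\<integral>\<^sup>+y. indicator (ball x r) y * ennreal (norm (G y)) \<partial>lborel) = ennreal (V * A)" .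
  have "ennreal (V * (V * sharp_average f x r)) \<le> ennreal (2 * r) * (2 ^ DIM('a) * ennreal V * ennreal (V * A))"
    using order_trans[OF sharp_average_le_pairs[OF _ r(1) i(1)] poincare_pairs[OF \<Omega> fG r]] 
    by (simp add: nG V_def emeasure_ball_eq)
  also have "\<dots> = ennreal (2 * r * (2 ^ DIM('a) * V * (V * A)))"
    using V A0 r by (simp add: ennreal_mult flip: ennreal_power)
  finally have "V * (V * sharp_average f x r) \<le> 2 * r * (2 ^ DIM('a) * V * (V * A))"
    using V A0 r by (subst (asm) ennreal_le_iff) auto
  then have "(V * V) * sharp_average f x r \<le> (V * V) * (2 * r * 2 ^ DIM('a) * A)" by (simp add: mult_ac)
  then have "sharp_average f x r \<le> 2 * r * 2 ^ DIM('a) * A"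
    using V by (simp add: mult_le_cancel_left_pos)
  then show ?thesis using r by (simp add: A_def field_simps)
qed

section \<open>Borel representatives, and bumps as test functions for weak gradients\<close>

lemma locally_integrable_measurable:
  fixes f :: "'a::euclidean_space \<Rightarrow> 'b::{banach, second_countable_topology}"
  assumes \<Omega>: "open \<Omega>" and f: "locally_integrable \<Omega> f"
  shows "f \<in> borel_measurable (lebesgue_on \<Omega>)"
proof -
  obtain C :: "nat \<Rightarrow> 'a set" where C: "\<And>n. compact (C n)" "\<And>n. C n \<subseteq> \<Omega>"
      "\<And>K. compact K \<Longrightarrow> K \<subseteq> \<Omega> \<Longrightarrow> \<exists>N. \<forall>n\<ge>N. K \<subseteq> C n"
    using open_Union_compact_subsets[OF \<Omega>] by metis
  have Cl: "C n \<in> sets lebesgue" for n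
    using C(1)[of n] by (intro sets_completionI_sets) (simp add: compact_imp_closed borel_closed)
  have "(\<lambda>x. indicator \<Omega> x *\<^sub>R f x) \<in> borel_measurable lebesgue"
  proof (rule borel_measurable_LIMSEQ_metric)
    show "(\<lambda>x. indicator (C n) x *\<^sub>R f x) \<in> borel_measurable lebesgue" for n
      using f C Cl[of n] borel_measurable_integrable[of "lebesgue_on (C n)" f]
      by (auto simp: locally_integrable_def borel_measurable_restrict_space_iff)
    fix x :: 'a
    have "eventually (\<lambda>n. indicator (C n) x *\<^sub>R f x = indicator \<Omega> x *\<^sub>R f x) sequentially"
    proof (cases "x \<in> \<Omega>")
      case True
      then obtain N where "\<forall>n\<ge>N. {x} \<subseteq> C n" using C(3)[of "{x}"] by auto
      then show ?thesis using True
        unfolding eventually_sequentially by (intro exI[of _ N]) (simp add: indicator_def)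
    next
      case False
      then have "x \<notin> C n" for n using C(2) by blast
      with False show ?thesis by simp
    qed
    then show "(\<lambda>n. indicator (C n) x *\<^sub>R f x) \<longlonglongrightarrow> indicator \<Omega> x *\<^sub>R f x"
      by (rule tendsto_eventually)
  qed
  then show ?thesis
    using \<Omega> by (simp add: borel_measurable_restrict_space_iff)
qed

lemma lebesgue_on_borel_version:
  fixes f :: "'a::euclidean_space \<Rightarrow> 'b::euclidean_space"
  assumes \<Omega>: "open \<Omega>" and f: "f \<in> borel_measurable (lebesgue_on \<Omega>)"
  obtains f0 where "f0 \<in> borel_measurable borel" "AE x in lborel. x \<in> \<Omega> \<longrightarrow> f x = f0 x"
proof -
  define F where "F x = indicator \<Omega> x *\<^sub>R f x" for x
  have F: "F \<in> borel_measurable lebesgue"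
    using f \<Omega> unfolding F_def by (simp add: borel_measurable_restrict_space_iff)
  have "\<exists>h. h \<in> borel_measurable lborel \<and> (AE x in lborel. F x \<bullet> b = h x)" for b
    using completion_ex_borel_measurable_real[of "\<lambda>x. F x \<bullet> b" lborel] F by auto
  then obtain h where h: "\<And>b. h b \<in> borel_measurable lborel" "\<And>b. AE x in lborel. F x \<bullet> b = h b x" by metis
  have "AE x in lborel. \<forall>b\<in>Basis. F x \<bullet> b = h b x" using h(2) by (simp add: AE_finite_all)
  then have "AE x in lborel. x \<in> \<Omega> \<longrightarrow> f x = (\<Sum>b\<in>Basis. h b x *\<^sub>R b)"
  proof eventually_elim
    case (elim x)
    have "F x = (\<Sum>b\<in>Basis. (F x \<bullet> b) *\<^sub>R b)" by (simp add: euclidean_representation)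
    with elim show ?case by (auto simp: F_def)
  qed
  moreover have "(\<lambda>x. \<Sum>b\<in>Basis. h b x *\<^sub>R b) \<in> borel_measurable borel" using h(1) by simp
  ultimately show ?thesis using that by blast
qed

lemma locally_integrable_borel_version:
  fixes f f0 :: "'a::euclidean_space \<Rightarrow> 'b::{banach, second_countable_topology}"
  assumes \<Omega>: "open \<Omega>" and f: "locally_integrable \<Omega> f" and f0: "f0 \<in> borel_measurable borel" 
    and ae: "AE x in lborel. x \<in> \<Omega> \<longrightarrow> f x = f0 x" and K: "compact K" "K \<subseteq> \<Omega>"
  shows "integrable lborel (\<lambda>x. indicator K x *\<^sub>R f0 x)"
proof -
  have [measurable]: "K \<in> sets borel" "f0 \<in> borel_measurable borel"
    using K f0 by (auto simp: compact_imp_closed borel_closed)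
  have Kl: "K \<in> sets lebesgue" by simp
  have "integrable lebesgue (\<lambda>x. indicator K x *\<^sub>R f x)"
    using f K Kl by (auto simp: locally_integrable_def integrable_restrict_space)
  moreover have "integrable lebesgue (\<lambda>x. indicator K x *\<^sub>R f x) \<longleftrightarrow> integrable lebesgue (\<lambda>x. indicator K x *\<^sub>R f0 x)"
  proof (rule integrable_cong_AE)
    show "AE x in lebesgue. indicator K x *\<^sub>R f x = indicator K x *\<^sub>R f0 x"
      unfolding AE_completion_iff using ae K by (auto elim!: eventually_mono simp: indicator_def)
    show "(\<lambda>x. indicator K x *\<^sub>R f0 x) \<in> borel_measurable lebesgue" by (intro measurable_completion) simp
  qed (use calculation borel_measurable_integrable in blast)
  moreover have "integrable lebesgue (\<lambda>x. indicator K x *\<^sub>R f0 x) \<longleftrightarrow> integrable lborel (\<lambda>x. indicator K x *\<^sub>R f0 x)"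
    by (rule integrable_completion) simp
  ultimately show ?thesis by simp
qed

text \<open>The definition is tested with the bump centred at x. Its gradient is odd, so passing
  from y - x to x - y absorbs the minus sign of the integration by parts.\<close>

lemma weak_gradient_imp_mollified:
  fixes f :: "'a::euclidean_space \<Rightarrow> real"
  assumes \<Omega>: "open \<Omega>" and f: "locally_integrable \<Omega> f" and G: "weak_gradient \<Omega> f G"
    and f0 [measurable]: "f0 \<in> borel_measurable borel" and f_ae: "AE x in lborel. x \<in> \<Omega> \<longrightarrow> f x = f0 x"
    and G0 [measurable]: "G0 \<in> borel_measurable borel" and G_ae: "AE x in lborel. x \<in> \<Omega> \<longrightarrow> G x = G0 x"
  shows "mollified_gradient \<Omega> f0 G0"
proof -
  have G': "locally_integrable \<Omega> G" using G by (simp add: weak_gradient_def)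
  have i: "integrable lborel (\<lambda>x. indicator K x *\<^sub>R f0 x)" "integrable lborel (\<lambda>x. indicator K x *\<^sub>R G0 x)"
    if "compact K" "K \<subseteq> \<Omega>" for K
    using that locally_integrable_borel_version[OF \<Omega> f f0 f_ae] locally_integrable_borel_version[OF \<Omega> G' G0 G_ae] by auto
  have fm: "f \<in> borel_measurable (lebesgue_on \<Omega>)" "G \<in> borel_measurable (lebesgue_on \<Omega>)"
    using locally_integrable_measurable[OF \<Omega>] f G' by auto
  have "(\<integral>y. f0 y *\<^sub>R bump_grad r (x - y) \<partial>lborel) = (\<integral>y. bump r (x - y) *\<^sub>R G0 y \<partial>lborel)"
    if r: "0 < r" and c: "cball x r \<subseteq> \<Omega>" for x r
  proof -
    note z = bump_eq_0_iff[OF r] bump_grad_eq_0[OF r]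
    have zc: "bump_grad r (x - y) = 0" "bump r (x - y) = 0" if "y \<notin> cball x r" for y
      using that z(1)[of "x - y"] z(2)[of "x - y"] by (auto simp: dist_norm not_le)
    have [measurable]: "(\<lambda>y. bump r (x - y)) \<in> borel_measurable borel" "(\<lambda>y. bump_grad r (x - y)) \<in> borel_measurable borel"
      by simp_all
    have if0: "integrable lborel (\<lambda>y. f0 y *\<^sub>R bump_grad r (x - y))"
    proof (rule Bochner_Integration.integrable_bound)
      show "integrable lborel (\<lambda>y. 4 / r * (indicator (cball x r) y *\<^sub>R f0 y))"
        by (intro integrable_mult_right i c) simp
      show "AE y in lborel. norm (f0 y *\<^sub>R bump_grad r (x - y)) \<le> norm (4 / r * (indicator (cball x r) y *\<^sub>R f0 y))"
      proof (rule AE_I2)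
        fix y
        show "norm (f0 y *\<^sub>R bump_grad r (x - y)) \<le> norm (4 / r * (indicator (cball x r) y *\<^sub>R f0 y))"
          using mult_left_mono[OF norm_bump_grad_le[OF r, of "x - y"], of "\<bar>f0 y\<bar>"] zc r
          by (cases "y \<in> cball x r") (auto simp: abs_mult mult_ac simp del: mem_cball)
      qed
    qed simp
    have iG0: "integrable lborel (\<lambda>y. bump r (x - y) *\<^sub>R G0 y)"
    proof (rule Bochner_Integration.integrable_bound)
      show "integrable lborel (\<lambda>y. indicator (cball x r) y *\<^sub>R G0 y)"
        by (intro i c) simp
      show "AE y in lborel. norm (bump r (x - y) *\<^sub>R G0 y) \<le> norm (indicator (cball x r) y *\<^sub>R G0 y)"
      proof (rule AE_I2)
        fix y
        show "norm (bump r (x - y) *\<^sub>R G0 y) \<le> norm (indicator (cball x r) y *\<^sub>R G0 y)"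
          using mult_right_mono[OF bump_le[of r "x - y"], of "norm (G0 y)"] zc
          by (cases "y \<in> cball x r") (auto simp: bump_nonneg simp del: mem_cball)
      qed
    qed simp
    have "(\<integral>y. f0 y *\<^sub>R bump_grad r (x - y) \<partial>lborel) \<bullet> b = (\<integral>y. bump r (x - y) *\<^sub>R G0 y \<partial>lborel) \<bullet> b" if b: "b \<in> Basis" for b
    proof -
      have "(LINT y|lebesgue_on \<Omega>. f y * frechet_derivative (\<lambda>y. bump r (y - x)) (at y) b) =
        - (LINT y|lebesgue_on \<Omega>. (G y \<bullet> b) * bump r (y - x))"
        using G bump_test_function[OF r c] b by (auto simp: weak_gradient_def)
      then have "(LINT y|lebesgue_on \<Omega>. f y * (bump_grad r (x - y) \<bullet> b)) = (LINT y|lebesgue_on \<Omega>. (G y \<bullet> b) * bump r (x - y))"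
        unfolding frechet_derivative_bump by (simp add: bump_minus_commute[of r x] bump_grad_minus_commute[of r x])
      moreover have "(LINT y|lebesgue_on \<Omega>. f y * (bump_grad r (x - y) \<bullet> b)) =
         (\<integral>y. indicator \<Omega> y *\<^sub>R (f0 y * (bump_grad r (x - y) \<bullet> b)) \<partial>lborel)"
      proof (rule integral_lebesgue_on_borel_version(1)[OF \<Omega>])
        show "(\<lambda>y. f y * (bump_grad r (x - y) \<bullet> b)) \<in> borel_measurable (lebesgue_on \<Omega>)"
          by (intro borel_measurable_times fm borel_measurable_lebesgue_onI) simp
        show "AE y in lborel. y \<in> \<Omega> \<longrightarrow> f y * (bump_grad r (x - y) \<bullet> b) = f0 y * (bump_grad r (x - y) \<bullet> b)"
          using f_ae by (auto elim!: eventually_mono)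
      qed simp
      moreover have "(\<lambda>y. indicator \<Omega> y *\<^sub>R (f0 y * (bump_grad r (x - y) \<bullet> b))) = (\<lambda>y. (f0 y *\<^sub>R bump_grad r (x - y)) \<bullet> b)"
        using zc c by (force simp: fun_eq_iff indicator_def)
      moreover have "(LINT y|lebesgue_on \<Omega>. (G y \<bullet> b) * bump r (x - y)) =
         (\<integral>y. indicator \<Omega> y *\<^sub>R ((G0 y \<bullet> b) * bump r (x - y)) \<partial>lborel)"
      proof (rule integral_lebesgue_on_borel_version(1)[OF \<Omega>])
        show "(\<lambda>y. (G y \<bullet> b) * bump r (x - y)) \<in> borel_measurable (lebesgue_on \<Omega>)"
          by (intro borel_measurable_times borel_measurable_inner fm borel_measurable_lebesgue_onI) simp_all
        show "AE y in lborel. y \<in> \<Omega> \<longrightarrow> (G y \<bullet> b) * bump r (x - y) = (G0 y \<bullet> b) * bump r (x - y)"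
          using G_ae by (auto elim!: eventually_mono)
      qed simp
      moreover have "(\<lambda>y. indicator \<Omega> y *\<^sub>R ((G0 y \<bullet> b) * bump r (x - y))) = (\<lambda>y. (bump r (x - y) *\<^sub>R G0 y) \<bullet> b)"
        using zc c by (force simp: fun_eq_iff indicator_def)
      ultimately show ?thesis
        using if0 iG0 by (simp only: integral_inner_left)
    qed
    then show ?thesis by (rule euclidean_eqI)
  qed
  with i show ?thesis by (auto simp: mollified_gradient_def)
qed

lemma nn_integral_cmult_le:
  fixes f :: "'a \<Rightarrow> ennreal"
  assumes "0 \<le> k"
  shows "(\<integral>\<^sup>+x. ennreal k * f x \<partial>M) \<le> ennreal k * (\<integral>\<^sup>+x. f x \<partial>M)"
proof (cases "k = 0")
  case False
  then have k: "0 < k" using assms by simp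
  have inv: "ennreal k * (ennreal (1 / k) * z) = z" "ennreal (1 / k) * (ennreal k * z) = z" for z
    using k by (simp_all add: mult.assoc[symmetric] flip: ennreal_mult)
  show ?thesis
    unfolding nn_integral_def[of M "\<lambda>x. ennreal k * f x"]
  proof (rule SUP_least)
    fix s assume "s \<in> {g. simple_function M g \<and> g \<le> (\<lambda>x. ennreal k * f x)}"
    then have s: "simple_function M s" "\<And>x. s x \<le> ennreal k * f x" by (auto simp: le_fun_def)
    have [measurable]: "s \<in> borel_measurable M" using s by (simp add: borel_measurable_simple_function)
    have "integral\<^sup>S M s = (\<integral>\<^sup>+x. ennreal k * (ennreal (1 / k) * s x) \<partial>M)"
      using s by (simp add: nn_integral_eq_simple_integral inv)
    also have "\<dots> = ennreal k * (\<integral>\<^sup>+x. ennreal (1 / k) * s x \<partial>M)"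
      by (rule nn_integral_cmult) simp
    also have "\<dots> \<le> ennreal k * (\<integral>\<^sup>+x. f x \<partial>M)"
    proof (intro mult_left_mono nn_integral_mono)
      show "ennreal (1 / k) * s x \<le> f x" for x
        using mult_left_mono[OF s(2)[of x], of "ennreal (1 / k)"] by (simp add: inv)
    qed simp
    finally show "integral\<^sup>S M s \<le> ennreal k * (\<integral>\<^sup>+x. f x \<partial>M)" .
  qed
qed simp

subsection \<open>The key estimate\<close>

text \<open>One constant \<open>c\<close> serves all almost monotonicity conditions. (A1) is used through the condition
  \<open>\<phi>(y,t) < 1/|B|\<close>, which implies \<open>t \<le> \<phi>\<^sup>-\<^sup>1(y,1/|B|)\<close>, and \<open>h\<close> in (A2) is replaced by a Borel version of \<open>|h|\<close>.\<close>

locale regular_phi =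
  fixes \<Omega> :: "'a::euclidean_space set" and \<phi> :: "'a \<Rightarrow> real \<Rightarrow> ennreal"
    and c p q \<beta> \<sigma> :: real and h :: "'a \<Rightarrow> real"
  assumes open_\<Omega>: "open \<Omega>"
    and phi_measurable: "\<And>t. 0 \<le> t \<Longrightarrow> (\<lambda>x. \<phi> x t) \<in> borel_measurable (lebesgue_on \<Omega>)"
    and phi_mono: "\<And>x s t. x \<in> \<Omega> \<Longrightarrow> 0 \<le> s \<Longrightarrow> s \<le> t \<Longrightarrow> \<phi> x s \<le> \<phi> x t"
    and phi_zero: "\<And>x. x \<in> \<Omega> \<Longrightarrow> \<phi> x 0 = 0"
    and phi_at_right_0: "\<And>x. x \<in> \<Omega> \<Longrightarrow> (\<phi> x \<longlongrightarrow> 0) (at_right 0)"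
    and c_ge: "1 \<le> c"
    and phi_quotient: "\<And>x s t. x \<in> \<Omega> \<Longrightarrow> 0 < s \<Longrightarrow> s \<le> t \<Longrightarrow> \<phi> x s \<le> ennreal (c * s / t) * \<phi> x t"
    and p_gt: "1 < p" and q_gt: "1 < q"
    and phi_inc: "AE x in lborel. x \<in> \<Omega> \<longrightarrow> (\<forall>s t. 0 < s \<longrightarrow> s \<le> t \<longrightarrow> \<phi> x s \<le> ennreal (c * (s / t) powr p) * \<phi> x t)"
    and phi_dec: "AE x in lborel. x \<in> \<Omega> \<longrightarrow> (\<forall>s t. 0 < s \<longrightarrow> s \<le> t \<longrightarrow> \<phi> x t \<le> ennreal (c * (t / s) powr q) * \<phi> x s)"
    and \<beta>_pos: "0 < \<beta>" and \<sigma>_pos: "0 < \<sigma>"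
    and A0: "\<And>x. x \<in> \<Omega> \<Longrightarrow> \<phi> x (\<beta> * \<sigma>) \<le> 1" "\<And>x. x \<in> \<Omega> \<Longrightarrow> 1 \<le> \<phi> x \<sigma>"
    and A1: "\<And>z r x y t. 0 < r \<Longrightarrow> ball z r \<subseteq> \<Omega> \<Longrightarrow> x \<in> ball z r \<Longrightarrow> y \<in> ball z r \<Longrightarrow> \<sigma> \<le> t \<Longrightarrow>
          \<phi> y t < 1 / emeasure lborel (ball z r) \<Longrightarrow> \<phi> x (\<beta> * t) \<le> \<phi> y t"
    and h_integrable: "integrable lborel h" and h_nonneg: "\<And>x. 0 \<le> h x"
    and A2: "AE x in lborel. x \<in> \<Omega> \<longrightarrow> (AE y in lborel. y \<in> \<Omega> \<longrightarrow> (\<forall>t\<in>{0..\<sigma>}.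
          \<phi> x (\<beta> * t) \<le> \<phi> y t + ennreal (h x) + ennreal (h y)))"
begin

text \<open>The map \<open>\<phi>(x, \<cdot>)\<close> need not be continuous, so \<open>x \<mapsto> \<phi>(x, g x)\<close> may fail to be measurable for measurable
  \<open>g\<close>; its right-continuous majorant, a countable infimum, does not have this defect.\<close>

definition phi_upper :: "'a \<Rightarrow> real \<Rightarrow> ennreal" where
  "phi_upper x t = (INF s\<in>{s\<in>\<rat>. t < s}. \<phi> x s)"

lemma phi_le_upper: "x \<in> \<Omega> \<Longrightarrow> 0 \<le> t \<Longrightarrow> \<phi> x t \<le> phi_upper x t"
  unfolding phi_upper_def by (rule INF_greatest) (auto intro: phi_mono)

lemma upper_le_phi:
  assumes "x \<in> \<Omega>" "0 \<le> t" "t < s" shows "phi_upper x t \<le> \<phi> x s"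
proof -
  obtain r where r: "r \<in> \<rat>" "t < r" "r < s" using Rats_dense_in_real[OF assms(3)] by auto
  then have "phi_upper x t \<le> \<phi> x r" unfolding phi_upper_def by (intro INF_lower) auto
  also have "\<dots> \<le> \<phi> x s" using assms r by (intro phi_mono) auto
  finally show ?thesis .
qed

lemma upper_mono: "s \<le> t \<Longrightarrow> phi_upper x s \<le> phi_upper x t"
  unfolding phi_upper_def by (rule INF_superset_mono) auto

lemma upper_zero:
  assumes "x \<in> \<Omega>" shows "phi_upper x 0 = 0"
proof -
  have "phi_upper x 0 \<le> 0"
  proof (rule tendsto_lowerbound[OF phi_at_right_0[OF assms]])
    show "eventually (\<lambda>s. phi_upper x 0 \<le> \<phi> x s) (at_right 0)"
      using upper_le_phi[OF assms] by (auto simp: eventually_at_filter)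
  qed simp
  then show ?thesis by simp
qed

text \<open>The index set of the infimum depends on x through g x. Assigning the value top to the
  rationals s \<le> g x makes the index set constant, and a countable infimum of measurable
  functions remains. For negative s that function is constantly top, as g is nonnegative.\<close>

lemma upper_measurable [measurable]:
  assumes g: "g \<in> borel_measurable (lebesgue_on \<Omega>)" "\<And>x. 0 \<le> g x"
  shows "(\<lambda>x. phi_upper x (g x)) \<in> borel_measurable (lebesgue_on \<Omega>)"
proof -
  have eq: "phi_upper x (g x) = (INF s\<in>\<rat>. if g x < s then \<phi> x s else top)" for x
  proof (rule antisym)
    show "phi_upper x (g x) \<le> (INF s\<in>\<rat>. if g x < s then \<phi> x s else top)"
      unfolding phi_upper_def by (rule INF_greatest) (auto intro: INF_lower)
    show "(INF s\<in>\<rat>. if g x < s then \<phi> x s else top) \<le> phi_upper x (g x)"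
      unfolding phi_upper_def
    proof (rule INF_greatest)
      fix i assume "i \<in> {s\<in>\<rat>. g x < s}"
      then show "(INF s\<in>\<rat>. if g x < s then \<phi> x s else top) \<le> \<phi> x i"
        by (intro INF_lower2[of i]) auto
    qed
  qed
  have "(\<lambda>x. if g x < s then \<phi> x s else top) \<in> borel_measurable (lebesgue_on \<Omega>)" for s
  proof (cases "0 \<le> s")
    case True
    note [measurable] = phi_measurable[OF True] g(1)
    show ?thesis by measurable
  next
    case False
    then have "\<not> g x < s" for x using g(2)[of x] by linarith
    then have "(\<lambda>x. if g x < s then \<phi> x s else top) = (\<lambda>x. top)" by simp
    then show ?thesis by simp
  qed
  then show ?thesis
    unfolding eq by (intro borel_measurable_INF) (auto simp: countable_rat)
qed

section \<open>Growth of \<phi> in its second argument\<close>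

lemma phi_scale_down:
  assumes "x \<in> \<Omega>" "0 \<le> t" "1 \<le> K" shows "\<phi> x (t / K) \<le> ennreal (c / K) * \<phi> x t"
proof (cases "t = 0")
  case False
  then show ?thesis using phi_quotient[of x "t / K" t] assms by (simp add: field_simps)
qed (use assms phi_zero in simp)

text \<open>The doubling constant from (aDec). The maximum with 1 covers shrinking factors too,
  where monotonicity suffices.\<close>

definition scale_const :: "real \<Rightarrow> real" where
  "scale_const \<kappa> = c * (max 1 \<kappa>) powr q"

lemma scale_const_ge: "1 \<le> scale_const \<kappa>"
proof -
  have "1 \<le> (max 1 \<kappa>) powr q" using q_gt by (intro ge_one_powr_ge_zero) auto
  then show ?thesis using c_ge mult_mono[of 1 c 1 "(max 1 \<kappa>) powr q"] by (simp add: scale_const_def)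
qed

lemma phi_scale:
  "AE x in lborel. x \<in> \<Omega> \<longrightarrow> (\<forall>\<kappa> t. 0 \<le> \<kappa> \<longrightarrow> 0 \<le> t \<longrightarrow> \<phi> x (\<kappa> * t) \<le> ennreal (scale_const \<kappa>) * \<phi> x t)"
  using phi_dec
proof eventually_elim
  case (elim x)
  show ?case
  proof (intro impI allI)
    fix \<kappa> t :: real assume x: "x \<in> \<Omega>" and \<kappa>: "0 \<le> \<kappa>" and t: "0 \<le> t"
    show "\<phi> x (\<kappa> * t) \<le> ennreal (scale_const \<kappa>) * \<phi> x t"
    proof (cases "t = 0")
      case True with x show ?thesis by (simp add: phi_zero)
    next
      case False
      have "\<phi> x (\<kappa> * t) \<le> \<phi> x (max 1 \<kappa> * t)"
        using x \<kappa> t by (intro phi_mono mult_right_mono) auto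
      also have "\<dots> \<le> ennreal (c * (max 1 \<kappa> * t / t) powr q) * \<phi> x t"
        using elim[THEN mp, OF x, rule_format, of t "max 1 \<kappa> * t"] False t mult_right_mono[of 1 "max 1 \<kappa>" t]
        by simp
      also have "c * (max 1 \<kappa> * t / t) powr q = scale_const \<kappa>" using False by (simp add: scale_const_def)
      finally show ?thesis .
    qed
  qed
qed

text \<open>A jump of \<phi> is bridged by enlarging the argument, here from \<kappa> t to 2
  \<kappa> t, and doubling pays for the enlargement. This makes \<phi> and \<open>phi_upper\<close>
  comparable. The enlargement is strict only for \<kappa> t > 0, so the value at 0 is treated
  apart.\<close>

lemma upper_scale:
  "AE x in lborel. x \<in> \<Omega> \<longrightarrow> (\<forall>\<kappa> t. 0 \<le> \<kappa> \<longrightarrow> 0 \<le> t \<longrightarrow> phi_upper x (\<kappa> * t) \<le> ennreal (scale_const (2 * \<kappa>)) * \<phi> x t)"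
  using phi_scale
proof eventually_elim
  case (elim x)
  show ?case
  proof (intro impI allI)
    fix \<kappa> t :: real assume x: "x \<in> \<Omega>" and \<kappa>: "0 \<le> \<kappa>" and t: "0 \<le> t"
    show "phi_upper x (\<kappa> * t) \<le> ennreal (scale_const (2 * \<kappa>)) * \<phi> x t"
    proof (cases "\<kappa> * t = 0")
      case True
      show ?thesis unfolding True upper_zero[OF x] by simp
    next
      case False
      then have "phi_upper x (\<kappa> * t) \<le> \<phi> x (2 * \<kappa> * t)"
        using x \<kappa> t by (intro upper_le_phi) (auto simp: zero_less_mult_iff)
      also have "\<dots> \<le> ennreal (scale_const (2 * \<kappa>)) * \<phi> x t"
        using elim[THEN mp, OF x, rule_format, of "2 * \<kappa>" t] \<kappa> t by simp
      finally show ?thesis .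
    qed
  qed
qed

text \<open>For t > M, (aInc) between \<sigma> and t together with 1 \<le>
  \<open>\<phi> x \<sigma>\<close> bounds t by c \<sigma>^p t^(1 - p) times
  \<open>\<phi> x t\<close>. Since p > 1 the factor decreases in t and tends to 0 as M grows:
  superlinear growth in the form that yields uniform integrability.\<close>

lemma t_le_phi:
  assumes M: "\<sigma> \<le> M"
  shows "AE x in lborel. x \<in> \<Omega> \<longrightarrow> (\<forall>t\<ge>0. ennreal t \<le> ennreal M + ennreal (c * \<sigma> powr p * M powr (1 - p)) * \<phi> x t)"
  using phi_inc
proof eventually_elim
  case (elim x)
  show ?case
  proof (intro impI allI)
    fix t :: real assume x: "x \<in> \<Omega>" and t: "0 \<le> t"
    show "ennreal t \<le> ennreal M + ennreal (c * \<sigma> powr p * M powr (1 - p)) * \<phi> x t"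
    proof (cases "t \<le> M")
      case True
      then show ?thesis by (intro order_trans[OF ennreal_leI[OF True]]) simp
    next
      case False
      then have tM: "M < t" and t0: "0 < t" "0 < M" using M \<sigma>_pos by auto
      have "ennreal t * 1 \<le> ennreal t * (ennreal (c * (\<sigma> / t) powr p) * \<phi> x t)"
        using A0(2)[OF x] elim x M tM \<sigma>_pos by (intro mult_left_mono) (auto intro: order_trans)
      also have "\<dots> = ennreal (c * \<sigma> powr p * t powr (1 - p)) * \<phi> x t"
      proof -
        have "t * (c * (\<sigma> / t) powr p) = c * \<sigma> powr p * t powr (1 - p)"
          using t0 \<sigma>_pos by (simp add: powr_divide powr_diff)
        then have "ennreal t * ennreal (c * (\<sigma> / t) powr p) = ennreal (c * \<sigma> powr p * t powr (1 - p))"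
          using t0 c_ge by (subst ennreal_mult[symmetric]) auto
        then show ?thesis by (simp only: mult.assoc[symmetric])
      qed
      also have "\<dots> \<le> ennreal (c * \<sigma> powr p * M powr (1 - p)) * \<phi> x t"
        using tM t0 c_ge p_gt by (intro mult_right_mono ennreal_leI mult_left_mono powr_mono2') auto
      finally show ?thesis by (simp add: add_increasing)
    qed
  qed
qed

text \<open>A Jensen inequality without convexity: on \<open>{a \<le> g}\<close>, with \<open>a\<close> half the average of \<open>g\<close>, the
  quotient \<open>g y / a\<close> has average at least one, and almost monotonicity of \<open>t \<mapsto> \<phi> y t / t\<close> absorbs it.
  For \<open>a \<ge> \<sigma>\<close> the balls are compared by (A1), for \<open>a < \<sigma>\<close> by (A2).\<close>

lemma average_superlevel_ge:
  fixes g :: "'a \<Rightarrow> real"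
  assumes [measurable]: "g \<in> borel_measurable borel" and r: "0 < r"
    and i: "integrable lborel (\<lambda>y. indicator (ball x r) y *\<^sub>R g y)" and a: "0 < a" "ball_average g x r = 2 * a"
  shows "emeasure lborel (ball x r) \<le> (\<integral>\<^sup>+y. indicator (ball x r) y * (indicator {a..} (g y) * ennreal (g y / a)) \<partial>lborel)"
proof -
  define V where "V = measure lborel (ball x r)"
  have V: "0 < V" using measure_ball_pos[OF r] by (simp add: V_def)
  have "(\<integral>y. indicator (ball x r) y * g y \<partial>lborel) = V * (2 * a)"
    using a(2) V by (simp add: ball_average_eq_kconv kconv_ball_kernel V_def field_simps)
  moreover have ii: "integrable lborel (\<lambda>y. indicator (ball x r) y * (g y - a))"
    by (rule integrable_ball_diff_const[OF i])
  moreover have "integrable lborel (\<lambda>y::'a. indicator (ball x r) y * a)"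
    by (intro integrable_mult_left integrable_real_indicator) (auto simp: emeasure_ball_eq)
  ultimately have e: "(\<integral>y. indicator (ball x r) y * (g y - a) \<partial>lborel) = V * a"
    using i by (simp add: right_diff_distrib V_def)
  define F where "F y = indicator (ball x r) y * (indicator {a..} (g y) * (g y / a))" for y
  have Fi: "integrable lborel F"
  proof (rule Bochner_Integration.integrable_bound)
    show "integrable lborel (\<lambda>y. (1 / a) * (indicator (ball x r) y *\<^sub>R g y))" by (intro integrable_mult_right i)
    show "AE y in lborel. norm (F y) \<le> norm ((1 / a) * (indicator (ball x r) y *\<^sub>R g y))"
      using a by (auto simp: F_def indicator_def intro!: AE_I2)
    show "F \<in> borel_measurable lborel" unfolding F_def by measurable
  qed
  \<comment> \<open>As g / a has average 2, (g - a) / a has average 1. The latter is negative off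
    the superlevel set and at most g / a on it.\<close>
  have "V = (\<integral>y. (1 / a) * (indicator (ball x r) y * (g y - a)) \<partial>lborel)"
    using e a by simp
  also have "\<dots> \<le> (\<integral>y. F y \<partial>lborel)"
  proof (intro integral_mono Fi integrable_mult_right ii)
    show "1 / a * (indicator (ball x r) y * (g y - a)) \<le> F y" for y
      using a by (auto simp: F_def indicator_def field_simps)
  qed
  finally have "ennreal V \<le> ennreal (\<integral>y. F y \<partial>lborel)" by (rule ennreal_leI)
  also have "\<dots> = (\<integral>\<^sup>+y. ennreal (F y) \<partial>lborel)"
    by (rule nn_integral_eq_integral[symmetric, OF Fi]) (use a in \<open>auto simp: F_def indicator_def\<close>)
  also have "\<dots> = (\<integral>\<^sup>+y. indicator (ball x r) y * (indicator {a..} (g y) * ennreal (g y / a)) \<partial>lborel)"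
    by (intro nn_integral_cong) (auto simp: F_def indicator_def)
  finally show ?thesis by (simp add: V_def emeasure_ball_eq)
qed

text \<open>The common step of the two comparisons below: a lower bound for R on the superlevel set,
  proportional to g / a, integrates to the volume times \<mu>. The integral is over
  \<open>lebesgue\<close> because \<open>R\<close> will contain \<open>phi_upper\<close>, which is
  only Lebesgue measurable in the space variable.\<close>

lemma superlevel_bound:
  fixes g :: "'a \<Rightarrow> real"
  assumes g [measurable]: "g \<in> borel_measurable borel" and r: "0 < r"
    and i: "integrable lborel (\<lambda>y. indicator (ball x r) y *\<^sub>R g y)" and a: "0 < a" "ball_average g x r = 2 * a"
    and le: "AE y in lborel. y \<in> ball x r \<longrightarrow> a \<le> g y \<longrightarrow> ennreal (g y / a) * \<mu> \<le> R y"
  shows "emeasure lborel (ball x r) * \<mu> \<le> (\<integral>\<^sup>+y. indicator (ball x r) y * R y \<partial>lebesgue)"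
proof -
  have "emeasure lborel (ball x r) * \<mu> \<le> (\<integral>\<^sup>+y. indicator (ball x r) y * (indicator {a..} (g y) * ennreal (g y / a)) \<partial>lborel) * \<mu>"
    by (intro mult_right_mono average_superlevel_ge assms) simp
  also have "\<dots> = (\<integral>\<^sup>+y. indicator (ball x r) y * (indicator {a..} (g y) * ennreal (g y / a)) * \<mu> \<partial>lborel)"
    by (simp add: nn_integral_multc)
  also have "\<dots> = (\<integral>\<^sup>+y. indicator (ball x r) y * (indicator {a..} (g y) * ennreal (g y / a)) * \<mu> \<partial>lebesgue)"
    by (simp add: nn_integral_completion)
  also have "\<dots> \<le> (\<integral>\<^sup>+y. indicator (ball x r) y * R y \<partial>lebesgue)"
    using AE_completion[OF le] by (intro nn_integral_mono_AE) (auto elim!: eventually_mono simp: indicator_def)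
  finally show ?thesis .
qed

text \<open>Let V be the volume of the ball. (A1) is available only where
  \<open>\<phi> y a < 1 / V\<close>; elsewhere \<open>\<phi> y a\<close> is at least 1 / V. With
  \<mu> the minimum of 1 / V and \<open>\<phi> x (\<beta> * a)\<close>, the bound \<mu> \<le>
  \<open>\<phi> y a\<close> thus holds throughout. The superlevel bound and the smallness of the
  modular then give V \<mu> < 1, which excludes \<mu> = 1 / V, so \<mu> is the desired
  value.\<close>

lemma key_estimate_large:
  fixes g :: "'a \<Rightarrow> real"
  assumes x: "x \<in> \<Omega>" and r: "0 < r" "ball x r \<subseteq> \<Omega>" and g [measurable]: "g \<in> borel_measurable borel" 
    and i: "integrable lborel (\<lambda>y. indicator (ball x r) y *\<^sub>R g y)"
    and small: "ennreal c * (\<integral>\<^sup>+y. phi_upper y (g y) \<partial>lebesgue_on \<Omega>) < 1"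
    and g0: "\<And>y. 0 \<le> g y"
    and a: "\<sigma> \<le> a" "ball_average g x r = 2 * a"
  shows "emeasure lborel (ball x r) * \<phi> x (\<beta> * a) \<le> ennreal c * (\<integral>\<^sup>+y. indicator (ball x r) y * phi_upper y (g y) \<partial>lebesgue)"
proof -
  define V where "V = emeasure lborel (ball x r)"
  have V: "V \<noteq> 0" "V \<noteq> top" using measure_ball_pos[OF r(1), of x] by (auto simp: V_def emeasure_ball_eq)
  have a0: "0 < a" using a \<sigma>_pos by simp
  define \<mu> where "\<mu> = min (1 / V) (\<phi> x (\<beta> * a))"
  note [measurable] = borel_measurable_lebesgue_onI[OF g]
  have um [measurable]: "(\<lambda>y. phi_upper y (g y)) \<in> borel_measurable (lebesgue_on \<Omega>)"
    by (rule upper_measurable) (use g0 in auto)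
  have b: "V * \<mu> \<le> (\<integral>\<^sup>+y. indicator (ball x r) y * (ennreal c * phi_upper y (g y)) \<partial>lebesgue)"
    unfolding V_def
  proof (rule superlevel_bound[OF g r(1) i a0 a(2)], intro AE_I2 impI)
    fix y assume y: "y \<in> ball x r" "a \<le> g y"
    then have y\<Omega>: "y \<in> \<Omega>" using r by auto
    have "\<mu> \<le> \<phi> y a"
    proof (cases "\<phi> y a < 1 / V")
      case True
      then have "\<phi> x (\<beta> * a) \<le> \<phi> y a"
        using A1[OF r(1,2) _ y(1) a(1)] r(1) by (simp add: V_def)
      then show ?thesis by (simp add: \<mu>_def min.coboundedI2)
    qed (simp add: \<mu>_def min.coboundedI1)
    also have "\<dots> \<le> ennreal (c * a / g y) * \<phi> y (g y)" using phi_quotient[OF y\<Omega> a0 y(2)] .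
    finally have "ennreal (g y / a) * \<mu> \<le> ennreal (g y / a) * (ennreal (c * a / g y) * \<phi> y (g y))"
      by (rule mult_left_mono) simp
    also have "\<dots> = ennreal c * \<phi> y (g y)"
      using a0 y(2) c_ge by (simp add: mult.assoc[symmetric] flip: ennreal_mult)
    also have "\<dots> \<le> ennreal c * phi_upper y (g y)"
      by (intro mult_left_mono phi_le_upper y\<Omega> g0) simp
    finally show "ennreal (g y / a) * \<mu> \<le> ennreal c * phi_upper y (g y)" .
  qed
  also have "\<dots> \<le> (\<integral>\<^sup>+y. ennreal c * (indicator (ball x r) y * phi_upper y (g y)) \<partial>lebesgue)"
    by (simp add: mult_ac)
  also have "\<dots> \<le> ennreal c * (\<integral>\<^sup>+y. indicator (ball x r) y * phi_upper y (g y) \<partial>lebesgue)"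
    using c_ge by (intro nn_integral_cmult_le) simp
  finally have b: "V * \<mu> \<le> ennreal c * (\<integral>\<^sup>+y. indicator (ball x r) y * phi_upper y (g y) \<partial>lebesgue)" .
  have "(\<integral>\<^sup>+y. indicator (ball x r) y * phi_upper y (g y) \<partial>lebesgue) \<le> (\<integral>\<^sup>+y. phi_upper y (g y) * indicator \<Omega> y \<partial>lebesgue)"
    using r(2) by (intro nn_integral_mono) (auto simp: indicator_def)
  also have "\<dots> = (\<integral>\<^sup>+y. phi_upper y (g y) \<partial>lebesgue_on \<Omega>)"
    using open_\<Omega> by (subst nn_integral_restrict_space) auto
  finally have "V * \<mu> < 1"
    using b small by (meson mult_left_mono order.strict_trans1 zero_le)
  then have "\<mu> \<noteq> 1 / V" using V by (auto simp: ennreal_times_divide ennreal_divide_self less_top)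
  then have "\<mu> = \<phi> x (\<beta> * a)" by (auto simp: \<mu>_def min_def)
  with b show ?thesis by (simp add: V_def)
qed

text \<open>On the superlevel set there are two cases. If g y \<le> \<sigma>, almost monotonicity
  raises the argument to \<beta> g y and (A2) applies at t = g y. Otherwise (A0) links the points by
  \<open>\<phi> x (\<beta> * \<sigma>)\<close> \<le> 1 \<le> \<open>\<phi> y \<sigma>\<close>, with
  almost monotonicity on both sides; these two uses give c^2.\<close>

lemma key_estimate_small:
  fixes g :: "'a \<Rightarrow> real"
  assumes x: "x \<in> \<Omega>" and A2x: "AE y in lborel. y \<in> \<Omega> \<longrightarrow> (\<forall>t\<in>{0..\<sigma>}. \<phi> x (\<beta> * t) \<le> \<phi> y t + ennreal (h x) + ennreal (h y))"
    and r: "0 < r" "ball x r \<subseteq> \<Omega>" and g [measurable]: "g \<in> borel_measurable borel" 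
    and i: "integrable lborel (\<lambda>y. indicator (ball x r) y *\<^sub>R g y)"
    and g0: "\<And>y. 0 \<le> g y"
    and a: "0 < a" "a < \<sigma>" "ball_average g x r = 2 * a"
  shows "emeasure lborel (ball x r) * \<phi> x (\<beta> * a) \<le>
    (\<integral>\<^sup>+y. indicator (ball x r) y * (ennreal (c\<^sup>2) * (phi_upper y (g y) + ennreal (h x) + ennreal (h y))) \<partial>lebesgue)"
proof (rule superlevel_bound[OF g r(1) i a(1,3)])
  show "AE y in lborel. y \<in> ball x r \<longrightarrow> a \<le> g y \<longrightarrow>
      ennreal (g y / a) * \<phi> x (\<beta> * a) \<le> ennreal (c\<^sup>2) * (phi_upper y (g y) + ennreal (h x) + ennreal (h y))"
    using A2x
  proof eventually_elim
    case (elim y)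
    show ?case
    proof (intro impI)
      assume y: "y \<in> ball x r" "a \<le> g y"
      then have y\<Omega>: "y \<in> \<Omega>" and gy: "0 < g y" using r a by auto
      show "ennreal (g y / a) * \<phi> x (\<beta> * a) \<le> ennreal (c\<^sup>2) * (phi_upper y (g y) + ennreal (h x) + ennreal (h y))"
      proof (cases "g y \<le> \<sigma>")
        case True
        have "\<phi> x (\<beta> * a) \<le> ennreal (c * (\<beta> * a) / (\<beta> * g y)) * \<phi> x (\<beta> * g y)"
          using a y \<beta>_pos by (intro phi_quotient x) auto
        then have "ennreal (g y / a) * \<phi> x (\<beta> * a) \<le> ennreal (g y / a) * (ennreal (c * (\<beta> * a) / (\<beta> * g y)) * \<phi> x (\<beta> * g y))"
          by (rule mult_left_mono) simp
        also have "\<dots> = ennreal c * \<phi> x (\<beta> * g y)"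
          using a gy c_ge \<beta>_pos by (simp add: mult.assoc[symmetric] flip: ennreal_mult)
        also have "\<dots> \<le> ennreal (c\<^sup>2) * (\<phi> y (g y) + ennreal (h x) + ennreal (h y))"
          using elim y\<Omega> True gy c_ge by (intro mult_mono ennreal_leI) (auto simp: power2_eq_square)
        also have "\<dots> \<le> ennreal (c\<^sup>2) * (phi_upper y (g y) + ennreal (h x) + ennreal (h y))"
          by (intro mult_left_mono add_right_mono phi_le_upper y\<Omega> g0) simp
        finally show ?thesis .
      next
        case False
        have "\<phi> x (\<beta> * a) \<le> ennreal (c * (\<beta> * a) / (\<beta> * \<sigma>)) * \<phi> x (\<beta> * \<sigma>)"
          using a y \<beta>_pos by (intro phi_quotient x) auto
        also have "\<dots> \<le> ennreal (c * (\<beta> * a) / (\<beta> * \<sigma>)) * 1"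
          by (intro mult_left_mono A0 x) simp
        also have "\<dots> \<le> ennreal (c * (\<beta> * a) / (\<beta> * \<sigma>)) * (ennreal (c * \<sigma> / g y) * \<phi> y (g y))"
          using order_trans[OF A0(2)[OF y\<Omega>] phi_quotient[OF y\<Omega> \<sigma>_pos]] False by (intro mult_left_mono) auto
        finally have "ennreal (g y / a) * \<phi> x (\<beta> * a) \<le> ennreal (g y / a) * (ennreal (c * (\<beta> * a) / (\<beta> * \<sigma>)) * (ennreal (c * \<sigma> / g y) * \<phi> y (g y)))"
          by (rule mult_left_mono) simp
        also have "\<dots> = ennreal (c\<^sup>2) * \<phi> y (g y)"
          using a gy c_ge \<beta>_pos \<sigma>_pos by (simp add: mult.assoc[symmetric] power2_eq_square flip: ennreal_mult)
        also have "\<dots> \<le> ennreal (c\<^sup>2) * (phi_upper y (g y) + ennreal (h x) + ennreal (h y))"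
          using phi_le_upper[OF y\<Omega> g0, of y] by (intro mult_left_mono) (auto simp: add_increasing2)
        finally show ?thesis .
      qed
    qed
  qed
qed

text \<open>The exceptional null set stems from (A2) alone. Quantifying over r and g inside the
  almost-everywhere statement keeps it independent of the radius, which later runs through
  uncountably many values.\<close>

lemma key_estimate:
  "AE x in lborel. x \<in> \<Omega> \<longrightarrow> (\<forall>r g. 0 < r \<longrightarrow> ball x r \<subseteq> \<Omega> \<longrightarrow> g \<in> borel_measurable borel \<longrightarrow> (\<forall>y. 0 \<le> g y) \<longrightarrow>
     integrable lborel (\<lambda>y. indicator (ball x r) y *\<^sub>R g y) \<longrightarrow>
     ennreal c * (\<integral>\<^sup>+y. phi_upper y (g y) \<partial>lebesgue_on \<Omega>) < 1 \<longrightarrow>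
     emeasure lborel (ball x r) * \<phi> x (\<beta> * ball_average g x r / 2) \<le>
       ennreal (c\<^sup>2) * (\<integral>\<^sup>+y. indicator (ball x r) y * (phi_upper y (g y) + ennreal (h x) + ennreal (h y)) \<partial>lebesgue))"
  using A2
proof eventually_elim
  case (elim x)
  show ?case
  proof (intro impI allI)
    fix r g assume x: "x \<in> \<Omega>" and r: "0 < r" "ball x r \<subseteq> \<Omega>" and g: "g \<in> borel_measurable borel" and g0: "\<forall>y. 0 \<le> g y"
      and i: "integrable lborel (\<lambda>y. indicator (ball x r) y *\<^sub>R g y)"
      and small: "ennreal c * (\<integral>\<^sup>+y. phi_upper y (g y) \<partial>lebesgue_on \<Omega>) < 1"
    define a where "a = ball_average g x r / 2"
    have a: "ball_average g x r = 2 * a" by (simp add: a_def)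
    have "0 \<le> ball_average g x r"
      using g0 by (simp add: ball_average_def)
    then consider "a = 0" | "0 < a" "a < \<sigma>" | "\<sigma> \<le> a" using a by linarith
    then have "emeasure lborel (ball x r) * \<phi> x (\<beta> * a) \<le>
       ennreal (c\<^sup>2) * (\<integral>\<^sup>+y. indicator (ball x r) y * (phi_upper y (g y) + ennreal (h x) + ennreal (h y)) \<partial>lebesgue)"
    proof cases
      case 1
      then show ?thesis using x by (simp add: phi_zero)
    next
      case 2
      have "emeasure lborel (ball x r) * \<phi> x (\<beta> * a) \<le>
        (\<integral>\<^sup>+y. indicator (ball x r) y * (ennreal (c\<^sup>2) * (phi_upper y (g y) + ennreal (h x) + ennreal (h y))) \<partial>lebesgue)"
        using elim x g0 by (intro key_estimate_small r g i 2 a) auto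
      also have "\<dots> = (\<integral>\<^sup>+y. ennreal (c\<^sup>2) * (indicator (ball x r) y * (phi_upper y (g y) + ennreal (h x) + ennreal (h y))) \<partial>lebesgue)"
        by (simp add: mult_ac)
      also have "\<dots> \<le> ennreal (c\<^sup>2) * (\<integral>\<^sup>+y. indicator (ball x r) y * (phi_upper y (g y) + ennreal (h x) + ennreal (h y)) \<partial>lebesgue)"
        by (rule nn_integral_cmult_le) simp
      finally show ?thesis .
    next
      case 3
      have "emeasure lborel (ball x r) * \<phi> x (\<beta> * a) \<le> ennreal c * (\<integral>\<^sup>+y. indicator (ball x r) y * phi_upper y (g y) \<partial>lebesgue)"
        using g0 by (intro key_estimate_large x r g i small 3 a) auto
      also have "\<dots> \<le> ennreal (c\<^sup>2) * (\<integral>\<^sup>+y. indicator (ball x r) y * (phi_upper y (g y) + ennreal (h x) + ennreal (h y)) \<partial>lebesgue)"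
        using c_ge by (intro mult_mono nn_integral_mono ennreal_leI) (auto simp: power2_eq_square indicator_def add_increasing2)
      finally show ?thesis .
    qed
    then show "emeasure lborel (ball x r) * \<phi> x (\<beta> * ball_average g x r / 2) \<le>
       ennreal (c\<^sup>2) * (\<integral>\<^sup>+y. indicator (ball x r) y * (phi_upper y (g y) + ennreal (h x) + ennreal (h y)) \<partial>lebesgue)"
      by (simp add: a_def)
  qed
qed

end

subsection \<open>Limits of the slice integrals\<close>

text \<open>A connected ball that meets \<Omega> and its complement meets the frontier.\<close>

lemma cball_subset_of_inner_part:
  assumes \<Omega>: "open \<Omega>" and x: "x \<in> inner_part \<Omega> r" and r: "0 < r"
  shows "cball x r \<subseteq> \<Omega>"
proof (cases "\<Omega> = UNIV")
  case False
  with x have x: "x \<in> \<Omega>" "r < infdist x (frontier \<Omega>)" by (auto simp: inner_part_def)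
  show ?thesis
  proof (rule ccontr)
    assume "\<not> cball x r \<subseteq> \<Omega>"
    moreover have "cball x r \<inter> \<Omega> \<noteq> {}"
      using r x(1) centre_in_cball[of x r] by (metis IntI emptyE less_imp_le)
    ultimately have "cball x r \<inter> frontier \<Omega> \<noteq> {}"
      by (intro connected_Int_frontier) auto
    then obtain z where "z \<in> cball x r" "z \<in> frontier \<Omega>" by auto
    then show False using infdist_le[of z "frontier \<Omega>" x] x(2) by simp
  qed
qed simp

lemma inner_partI:
  assumes \<Omega>: "open \<Omega>" and c: "cball x R \<subseteq> \<Omega>" and r: "0 < r" "r < R"
  shows "x \<in> inner_part \<Omega> r"
proof (cases "\<Omega> = UNIV")
  case False
  have x: "x \<in> \<Omega>" using c r by auto
  then have "frontier \<Omega> \<noteq> {}" using False frontier_eq_empty by blast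
  then obtain z where z: "z \<in> frontier \<Omega>" "infdist x (frontier \<Omega>) = dist x z"
    using infdist_attains_inf[OF frontier_closed] by metis
  then have "z \<notin> \<Omega>" using \<Omega> frontier_disjoint_eq by blast
  then have "R < dist x z" using c by (auto simp: subset_iff not_le)
  with z x r False show ?thesis by (simp add: inner_part_def)
qed (simp add: inner_part_def)

lemma open_inner_part: "open \<Omega> \<Longrightarrow> open (inner_part \<Omega> r)"
  by (auto simp: inner_part_def Collect_conj_eq intro!: open_Int open_Collect_less continuous_intros)

lemma inner_part_subset: "inner_part \<Omega> r \<subseteq> \<Omega>"
  by (auto simp: inner_part_def)

lemma nn_integral_lebesgue_on_subset:
  assumes "open U" "open \<Omega>" "U \<subseteq> \<Omega>"
  shows "(\<integral>\<^sup>+x. F x \<partial>lebesgue_on U) = (\<integral>\<^sup>+x. indicator U x * F x \<partial>lebesgue_on \<Omega>)"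
proof -
  have "(\<integral>\<^sup>+x. F x \<partial>lebesgue_on U) = (\<integral>\<^sup>+x. F x * indicator U x \<partial>lebesgue)"
    using assms by (subst nn_integral_restrict_space) auto
  also have "\<dots> = (\<integral>\<^sup>+x. indicator U x * F x * indicator \<Omega> x \<partial>lebesgue)"
    using assms by (intro nn_integral_cong) (auto simp: indicator_def)
  also have "\<dots> = (\<integral>\<^sup>+x. indicator U x * F x \<partial>lebesgue_on \<Omega>)"
    using assms by (subst nn_integral_restrict_space) auto
  finally show ?thesis .
qed

lemma nn_integral_lebesgue_on_mono_AE:
  assumes "open \<Omega>" "AE x in lborel. x \<in> \<Omega> \<longrightarrow> F x \<le> H x"
  shows "(\<integral>\<^sup>+x. F x \<partial>lebesgue_on \<Omega>) \<le> (\<integral>\<^sup>+x. H x \<partial>lebesgue_on \<Omega>)"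
  using assms by (intro nn_integral_mono_AE) (simp add: AE_lebesgue_on_iff)

lemma nn_integral_lebesgue_on_le_lborel:
  assumes "open \<Omega>" shows "(\<integral>\<^sup>+x. F x \<partial>lebesgue_on \<Omega>) \<le> (\<integral>\<^sup>+x. F x \<partial>lborel)"
proof -
  have "(\<integral>\<^sup>+x. F x \<partial>lebesgue_on \<Omega>) = (\<integral>\<^sup>+x. F x * indicator \<Omega> x \<partial>lebesgue)"
    using assms by (subst nn_integral_restrict_space) auto
  also have "\<dots> \<le> (\<integral>\<^sup>+x. F x \<partial>lebesgue)" by (intro nn_integral_mono) (auto simp: indicator_def)
  finally show ?thesis by (simp add: nn_integral_completion)
qed

section \<open>Upper and lower limits at 0 through sequences\<close>

lemma frequently_at_right_seq:
  assumes "frequently P (at_right (0::real))"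
  obtains r where "\<And>j::nat. 0 < r j" "r \<longlonglongrightarrow> 0" "\<And>j. P (r j)"
proof -
  have "\<exists>r. 0 < r \<and> r < 1 / real (Suc n) \<and> P r" for n
  proof (rule ccontr)
    assume *: "\<not> ?thesis"
    have "eventually (\<lambda>r. \<not> P r) (at_right 0)"
      unfolding eventually_at_right_field by (intro exI[of _ "1 / real (Suc n)"]) (use * in auto)
    with assms show False by (simp add: frequently_def)
  qed
  then obtain r where r: "\<And>n. 0 < r n" "\<And>n. r n < 1 / real (Suc n)" "\<And>n. P (r n)" by metis
  have "r \<longlonglongrightarrow> 0"
    by (rule tendsto_sandwich[OF _ _ tendsto_const lim_1_over_n[THEN LIMSEQ_Suc]])
       (use r in \<open>auto intro!: always_eventually less_imp_le\<close>)
  with r that show ?thesis by blast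
qed

text \<open>If F stayed at or above some y > T for arbitrarily small radii, a sequence of such radii
  would have no subsequence below y. The form is adapted to convergence in L^1, which gives
  pointwise convergence only along subsequences.\<close>

lemma Limsup_at_right_le_subseq:
  fixes F :: "real \<Rightarrow> ennreal"
  assumes *: "\<And>r. (\<And>j::nat. 0 < r j) \<Longrightarrow> r \<longlonglongrightarrow> 0 \<Longrightarrow>
    \<exists>s. strict_mono s \<and> (\<forall>y>T. eventually (\<lambda>j. F (r (s j)) < y) sequentially)"
  shows "Limsup (at_right 0) F \<le> T"
  unfolding Limsup_le_iff
proof (intro allI impI, rule ccontr)
  fix y assume y: "T < y" "\<not> eventually (\<lambda>r. F r < y) (at_right 0)"
  then have "frequently (\<lambda>r. y \<le> F r) (at_right 0)" by (simp add: frequently_def not_le)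
  then obtain r where r: "\<And>j::nat. 0 < r j" "r \<longlonglongrightarrow> 0" "\<And>j. y \<le> F (r j)"
    by (rule frequently_at_right_seq) (rule that)
  from *[OF r(1,2)] y(1) obtain s where "eventually (\<lambda>j. F (r (s j)) < y) sequentially" by blast
  then obtain j where "F (r (s j)) < y" using eventually_happens by force
  with r(3)[of "s j"] show False by simp
qed

lemma Liminf_at_right_ge_subseq:
  fixes F :: "real \<Rightarrow> ennreal"
  assumes *: "\<And>r. (\<And>j::nat. 0 < r j) \<Longrightarrow> r \<longlonglongrightarrow> 0 \<Longrightarrow>
    \<exists>s. strict_mono s \<and> T \<le> liminf (\<lambda>j. F (r (s j)))"
  shows "T \<le> Liminf (at_right 0) F"
  unfolding le_Liminf_iff
proof (intro allI impI, rule ccontr)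
  fix y assume y: "y < T" "\<not> eventually (\<lambda>r. y < F r) (at_right 0)"
  then have "frequently (\<lambda>r. F r \<le> y) (at_right 0)" by (simp add: frequently_def not_le)
  then obtain r where r: "\<And>j::nat. 0 < r j" "r \<longlonglongrightarrow> 0" "\<And>j. F (r j) \<le> y"
    by (rule frequently_at_right_seq) (rule that)
  from *[OF r(1,2)] obtain s where s: "T \<le> liminf (\<lambda>j. F (r (s j)))" by blast
  have "liminf (\<lambda>j. F (r (s j))) \<le> y"
    using r(3) by (intro order_trans[OF Liminf_le_Limsup Limsup_bounded]) (auto intro: always_eventually)
  with s y(1) show False by simp
qed

text \<open>The gradient of the mollification of f, with the derivative on the kernel. It is thus
  available before f is known to have a weak gradient.\<close>

definition mollified_grad :: "('a::euclidean_space \<Rightarrow> real) \<Rightarrow> real \<Rightarrow> 'a \<Rightarrow> 'a" where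
  "mollified_grad f r x = (\<integral>y. f y *\<^sub>R bump_grad r (x - y) \<partial>lborel) /\<^sub>R bump_mass TYPE('a) r"

text \<open>The bound 4 / r for \<open>bump_grad\<close> times the volume of the ball of radius r
  over \<open>bump_mass\<close>; the powers of the radius in volume and mass cancel.\<close>

definition grad_const :: "'a::euclidean_space itself \<Rightarrow> real" where
  "grad_const _ = 4 * measure lborel (ball (0::'a) 1) / bump_mass TYPE('a) 1"

lemma grad_const_pos: "0 < grad_const TYPE('a::euclidean_space)"
  using measure_ball_pos[of 1 "0::'a"] bump_mass_pos[of 1, where 'a='a] by (simp add: grad_const_def)

lemma mollified_grad_measurable [measurable]:
  assumes [measurable]: "f \<in> borel_measurable borel"
  shows "mollified_grad f r \<in> borel_measurable borel"
  unfolding mollified_grad_def[abs_def] by measurable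

lemma norm_mollified_grad_le:
  fixes f :: "'a::euclidean_space \<Rightarrow> real"
  assumes f: "f \<in> borel_measurable borel" and r: "0 < r"
    and i: "integrable lborel (\<lambda>y. indicator (cball x r) y *\<^sub>R f y)"
  shows "norm (mollified_grad f r x) \<le> grad_const TYPE('a) * (1 / r * sharp_average f x r)"
proof -
  note M = bump_mass_pos[OF r, where 'a='a]
  have "norm (mollified_grad f r x) = norm (\<integral>y. f y *\<^sub>R bump_grad r (x - y) \<partial>lborel) / bump_mass TYPE('a) r"
    using M by (simp add: mollified_grad_def divide_inverse)
  also have "\<dots> \<le> (4 / r * (measure lborel (ball x r) * sharp_average f x r)) / bump_mass TYPE('a) r"
    using M norm_bump_grad_integral_le[OF f r i] by (intro divide_right_mono) auto
  also have "\<dots> = grad_const TYPE('a) * (1 / r * sharp_average f x r)"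
    using r by (simp add: grad_const_def content_ball bump_mass_scale[OF r, where 'a='a] mult_ac)
  finally show ?thesis .
qed

lemma mollified_grad_eq_kconv:
  fixes f :: "'a::euclidean_space \<Rightarrow> real"
  assumes "mollified_gradient \<Omega> f G" "0 < r" "cball x r \<subseteq> \<Omega>"
  shows "mollified_grad f r x = kconv (mollifier r) G x"
proof -
  have "mollified_grad f r x = (\<integral>y. bump r (x - y) *\<^sub>R G y \<partial>lborel) /\<^sub>R bump_mass TYPE('a) r"
    using assms by (simp add: mollified_grad_def mollified_gradient_def)
  also have "\<dots> = (\<integral>y. (1 / bump_mass TYPE('a) r) *\<^sub>R (bump r (x - y) *\<^sub>R G y) \<partial>lborel)"
    by (subst integral_scaleR_right) (simp add: divide_inverse)
  also have "\<dots> = kconv (mollifier r) G x"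
    by (simp add: kconv_def mollifier_def)
  finally show ?thesis .
qed

lemma ennreal_less_add_obtains:
  assumes "T < (y::ennreal)" obtains y' e where "T < y'" "0 < e" "y' + ennreal e \<le> y"
proof -
  obtain z where z: "T < z" "z < y" using dense[OF assms] by blast
  then obtain z' where z': "z = ennreal z'" "0 \<le> z'" by (cases z) auto
  show ?thesis
  proof (cases y)
    case (real y')
    then have "z' < y'" using z z' by (simp add: ennreal_less_iff)
    then show ?thesis using that[OF z(1), of "y' - z'"] real z' by (simp flip: ennreal_plus)
  qed (use that[OF z(1), of 1] in simp)
qed

context regular_phi
begin

definition sharp_slice :: "('a \<Rightarrow> real) \<Rightarrow> real \<Rightarrow> ennreal" where
  "sharp_slice f r = (\<integral>\<^sup>+x. \<phi> x (1 / r * sharp_average f x r) \<partial>lebesgue_on (inner_part \<Omega> r))"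

lemma sharp_slice_eq:
  "sharp_slice f r = (\<integral>\<^sup>+x. indicator (inner_part \<Omega> r) x * \<phi> x (1 / r * sharp_average f x r) \<partial>lebesgue_on \<Omega>)"
  unfolding sharp_slice_def
  by (rule nn_integral_lebesgue_on_subset[OF open_inner_part[OF open_\<Omega>] open_\<Omega> inner_part_subset])

text \<open>\<open>key_estimate\<close> requires a small modular, so it is applied to g =
  \<open>lam\<close> |G| with a small factor \<open>lam\<close>, and doubling restores the original
  size afterwards. The resulting u does not depend on the radius.\<close>

lemma slice_dominated:
  assumes fG: "mollified_gradient \<Omega> f G" and l: "0 < l" "(\<integral>\<^sup>+x. \<phi> x (l * norm (G x)) \<partial>lebesgue_on \<Omega>) < \<infinity>"
  obtains u E where "integrable lborel u" "\<And>x. 0 \<le> u x" "0 \<le> E"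
    "AE x in lborel. x \<in> \<Omega> \<longrightarrow> (\<forall>r>0. cball x r \<subseteq> \<Omega> \<longrightarrow>
       phi_upper x (2 ^ (DIM('a) + 1) * ball_average (\<lambda>y. norm (G y)) x r) \<le> ennreal (E * (ball_average u x r + u x)))"
proof -
  have [measurable]: "G \<in> borel_measurable borel" using fG by (simp add: mollified_gradient_def)
  note [measurable] = borel_measurable_lebesgue_onI[of "\<lambda>x. norm (G x)" \<Omega>]
  define S where "S = scale_const 2"
  obtain i where i: "0 \<le> i" "(\<integral>\<^sup>+x. \<phi> x (l * norm (G x)) \<partial>lebesgue_on \<Omega>) = ennreal i"
    using l(2) by (cases "\<integral>\<^sup>+x. \<phi> x (l * norm (G x)) \<partial>lebesgue_on \<Omega>") auto
  \<comment> \<open>Dividing the argument by \<open>K\<close> gains c / K, replacing \<phi> by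
    \<open>phi_upper\<close> costs S, and the smallness condition carries another c. The summand 1
    makes c S c i / K strictly less than 1.\<close>
  define K where "K = 1 + c * S * c * i"
  have S: "1 \<le> S" unfolding S_def by (rule scale_const_ge)
  have csci: "0 \<le> c * S * c * i" using c_ge S i by simp
  then have K: "1 \<le> K" by (simp add: K_def)
  define lam where "lam = l / K"
  have lam: "0 < lam" using l K by (simp add: lam_def)
  define g where "g y = lam * norm (G y)" for y
  have gm [measurable]: "g \<in> borel_measurable borel" unfolding g_def by measurable
  have g0: "0 \<le> g y" for y using lam by (simp add: g_def)
  have "(\<integral>\<^sup>+x. phi_upper x (g x) \<partial>lebesgue_on \<Omega>) \<le> (\<integral>\<^sup>+x. ennreal (S * (c / K)) * \<phi> x (l * norm (G x)) \<partial>lebesgue_on \<Omega>)"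
  proof (rule nn_integral_lebesgue_on_mono_AE[OF open_\<Omega>])
    show "AE x in lborel. x \<in> \<Omega> \<longrightarrow> phi_upper x (g x) \<le> ennreal (S * (c / K)) * \<phi> x (l * norm (G x))"
      using upper_scale
    proof eventually_elim
      case (elim x)
      show ?case
      proof
        assume x: "x \<in> \<Omega>"
        have "phi_upper x (1 * g x) \<le> ennreal (scale_const (2 * 1)) * \<phi> x (g x)"
          using elim x g0[of x] by (simp only: zero_le_one)
        also have "\<phi> x (g x) = \<phi> x ((l * norm (G x)) / K)" by (simp add: g_def lam_def)
        also have "\<dots> \<le> ennreal (c / K) * \<phi> x (l * norm (G x))"
          using x K l by (intro phi_scale_down) auto
        moreover have "ennreal (S * (c / K)) = ennreal S * ennreal (c / K)"
          using S c_ge K by (intro ennreal_mult) auto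
        ultimately show "phi_upper x (g x) \<le> ennreal (S * (c / K)) * \<phi> x (l * norm (G x))"
          by (simp add: S_def mult.assoc mult_left_mono order_trans)
      qed
    qed
  qed
  also have "\<dots> \<le> ennreal (S * (c / K)) * ennreal i"
    unfolding i(2)[symmetric] using S c_ge K by (intro nn_integral_cmult_le) simp
  finally have "ennreal c * (\<integral>\<^sup>+x. phi_upper x (g x) \<partial>lebesgue_on \<Omega>) \<le> ennreal c * (ennreal (S * (c / K)) * ennreal i)"
    by (rule mult_left_mono) simp
  also have "\<dots> = ennreal (c * S * c * i / K)"
    using S c_ge K i by (simp add: mult.assoc flip: ennreal_mult)
  also have "\<dots> < 1"
    using csci K by (simp add: K_def ennreal_less_one_iff)
  finally have small: "ennreal c * (\<integral>\<^sup>+x. phi_upper x (g x) \<partial>lebesgue_on \<Omega>) < 1" .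
  have um: "(\<lambda>x. phi_upper x (g x)) \<in> borel_measurable (lebesgue_on \<Omega>)"
    by (rule upper_measurable[OF borel_measurable_lebesgue_onI[OF gm] g0])
  then have "(\<lambda>x. phi_upper x (g x) * indicator \<Omega> x) \<in> borel_measurable lebesgue"
    using open_\<Omega> by (subst (asm) borel_measurable_restrict_space_iff_ennreal) auto
  \<comment> \<open>A Borel version of \<open>phi_upper x (g x)\<close>, so that averages of u can
    be treated as convolutions.\<close>
  then obtain v where v [measurable]: "v \<in> borel_measurable lborel" and v_eq: "AE x in lborel. phi_upper x (g x) * indicator \<Omega> x = v x"
    using completion_ex_borel_measurable by blast
  have "(\<integral>\<^sup>+x. v x \<partial>lborel) = (\<integral>\<^sup>+x. phi_upper x (g x) * indicator \<Omega> x \<partial>lborel)"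
    using v_eq by (intro nn_integral_cong_AE) (auto elim: eventually_mono)
  also have "\<dots> = (\<integral>\<^sup>+x. phi_upper x (g x) \<partial>lebesgue_on \<Omega>)"
    using open_\<Omega> by (subst nn_integral_restrict_space) (auto simp: nn_integral_completion)
  finally have v_int: "(\<integral>\<^sup>+x. v x \<partial>lborel) = (\<integral>\<^sup>+x. phi_upper x (g x) \<partial>lebesgue_on \<Omega>)" .
  have v_fin: "(\<integral>\<^sup>+x. v x \<partial>lborel) < \<infinity>"
    unfolding v_int
  proof (rule ccontr)
    assume "\<not> (\<integral>\<^sup>+x. phi_upper x (g x) \<partial>lebesgue_on \<Omega>) < \<infinity>"
    then have "(\<integral>\<^sup>+x. phi_upper x (g x) \<partial>lebesgue_on \<Omega>) = top" by (simp flip: less_top)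
    then show False using small c_ge by (simp add: ennreal_mult_top)
  qed
  then have "AE x in lborel. v x \<noteq> \<infinity>" by (intro nn_integral_PInf_AE) auto
  then have u_eq: "AE x in lborel. x \<in> \<Omega> \<longrightarrow> ennreal (enn2real (v x)) = phi_upper x (g x)"
    using v_eq by eventually_elim (auto simp: less_top)
  \<comment> \<open>One function covers all terms of the key estimate: the average of u contains
    those of \<open>phi_upper\<close> and h, and h x is at most u x.\<close>
  define u where "u x = enn2real (v x) + h x" for x
  have "integrable lborel (\<lambda>x. enn2real (v x))"
    unfolding integrable_iff_bounded
  proof
    have "(\<integral>\<^sup>+x. ennreal (norm (enn2real (v x))) \<partial>lborel) \<le> (\<integral>\<^sup>+x. v x \<partial>lborel)"
    proof (rule nn_integral_mono)
      show "ennreal (norm (enn2real (v x))) \<le> v x" for x by (cases "v x") auto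
    qed
    then show "(\<integral>\<^sup>+x. ennreal (norm (enn2real (v x))) \<partial>lborel) < \<infinity>" using v_fin by (rule order.strict_trans1)
  qed simp
  then have u: "integrable lborel u" unfolding u_def using h_integrable by simp
  have u0: "0 \<le> u x" for x by (simp add: u_def h_nonneg)
  have [measurable]: "u \<in> borel_measurable borel" using borel_measurable_integrable[OF u] by simp
  \<comment> \<open>Chosen so that \<kappa> times \<beta> \<open>lam\<close> A / 2, the argument in
    the key estimate, is the Poincare bound 2^(n + 1) A.\<close>
  define \<kappa> where "\<kappa> = 2 ^ (DIM('a) + 2) / (\<beta> * lam)"
  have \<kappa>: "0 < \<kappa>" using \<beta>_pos lam by (simp add: \<kappa>_def)
  define E where "E = scale_const (2 * \<kappa>) * c\<^sup>2"
  have E: "0 \<le> E" using scale_const_ge[of "2 * \<kappa>"] by (simp add: E_def)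
  have "AE x in lborel. x \<in> \<Omega> \<longrightarrow> (\<forall>r>0. cball x r \<subseteq> \<Omega> \<longrightarrow>
       phi_upper x (2 ^ (DIM('a) + 1) * ball_average (\<lambda>y. norm (G y)) x r) \<le> ennreal (E * (ball_average u x r + u x)))"
    using key_estimate upper_scale
  proof eventually_elim
    case (elim x)
    show ?case
    proof (intro impI allI)
      fix r :: real assume x: "x \<in> \<Omega>" and r: "0 < r" and cb: "cball x r \<subseteq> \<Omega>"
      define A where "A = ball_average (\<lambda>y. norm (G y)) x r"
      define V where "V = measure lborel (ball x r)"
      have V: "0 < V" using measure_ball_pos[OF r] by (simp add: V_def)
      have iG: "integrable lborel (\<lambda>y. indicator (ball x r) y *\<^sub>R G y)"
        using fG cb by (intro integrable_ball_of_cball) (auto simp: mollified_gradient_def)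
      have ig: "integrable lborel (\<lambda>y. indicator (ball x r) y *\<^sub>R g y)"
        using integrable_mult_right[OF integrable_norm[OF iG], of lam] by (simp add: g_def mult_ac)
      have iu: "integrable lborel (\<lambda>y. indicator (ball x r) y * u y)"
        using integrable_mult_indicator[OF _ u, of "ball x r"] by simp
      have gA: "ball_average g x r = lam * A"
        unfolding A_def g_def ball_average_def by simp
      have A0: "0 \<le> A" unfolding A_def ball_average_def by simp
      have Au: "(\<integral>y. indicator (ball x r) y * u y \<partial>lborel) = V * ball_average u x r"
        using V by (simp add: ball_average_eq_kconv kconv_ball_kernel V_def)
      have Au0: "0 \<le> ball_average u x r" unfolding ball_average_def using u0 by simp
      have "ennreal V * \<phi> x (\<beta> * (lam * A) / 2) \<le>
         ennreal (c\<^sup>2) * (\<integral>\<^sup>+y. indicator (ball x r) y * (phi_upper y (g y) + ennreal (h x) + ennreal (h y)) \<partial>lebesgue)"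
        using elim(1)[THEN mp, OF x, rule_format, of r g] r order_trans[OF ball_subset_cball cb] gm g0 ig small
        by (simp add: gA V_def emeasure_ball_eq)
      also have "(\<integral>\<^sup>+y. indicator (ball x r) y * (phi_upper y (g y) + ennreal (h x) + ennreal (h y)) \<partial>lebesgue) =
          (\<integral>\<^sup>+y. indicator (ball x r) y * (phi_upper y (g y) + ennreal (h x) + ennreal (h y)) \<partial>lborel)"
        by (rule nn_integral_completion)
      also have "\<dots> = (\<integral>\<^sup>+y. ennreal (indicator (ball x r) y * u y) + indicator (ball x r) y * ennreal (h x) \<partial>lborel)"
      proof (rule nn_integral_cong_AE, use u_eq in eventually_elim)
        case (elim y)
        show ?case
        proof (cases "y \<in> ball x r")
          case True
          then have y: "y \<in> \<Omega>" using cb by auto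
          have "ennreal (u y) = phi_upper y (g y) + ennreal (h y)"
            using elim y by (simp add: u_def ennreal_plus h_nonneg)
          then show ?thesis using True by (simp add: add_ac)
        qed simp
      qed
      also have "\<dots> = (\<integral>\<^sup>+y. ennreal (indicator (ball x r) y * u y) \<partial>lborel) + (\<integral>\<^sup>+y. indicator (ball x r) y * ennreal (h x) \<partial>lborel)"
        by (rule nn_integral_add) auto
      also have "(\<integral>\<^sup>+y. ennreal (indicator (ball x r) y * u y) \<partial>lborel) = ennreal (V * ball_average u x r)"
        using u0 by (subst nn_integral_eq_integral[OF iu]) (auto simp: Au)
      also have "(\<integral>\<^sup>+y. indicator (ball x r) y * ennreal (h x) \<partial>lborel) = ennreal (V * h x)"
        using V h_nonneg[of x] by (subst nn_integral_multc) (auto simp: emeasure_ball_eq V_def ennreal_mult)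
      also have "ennreal (c\<^sup>2) * (ennreal (V * ball_average u x r) + ennreal (V * h x)) = ennreal V * ennreal (c\<^sup>2 * (ball_average u x r + h x))"
        using V Au0 h_nonneg[of x] by (simp add: algebra_simps flip: ennreal_plus ennreal_mult)
      finally have "ennreal V * \<phi> x (\<beta> * (lam * A) / 2) \<le> ennreal V * ennreal (c\<^sup>2 * (ball_average u x r + h x))" .
      then have "\<phi> x (\<beta> * (lam * A) / 2) \<le> ennreal (c\<^sup>2 * (ball_average u x r + h x))"
        using V by (subst (asm) ennreal_mult_le_mult_iff) auto
      also have "\<dots> \<le> ennreal (c\<^sup>2 * (ball_average u x r + u x))"
        by (intro ennreal_leI mult_left_mono) (auto simp: u_def)
      finally have le: "\<phi> x (\<beta> * (lam * A) / 2) \<le> ennreal (c\<^sup>2 * (ball_average u x r + u x))" .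
      have "2 ^ (DIM('a) + 1) * A = \<kappa> * (\<beta> * (lam * A) / 2)"
        using \<beta>_pos lam by (simp add: \<kappa>_def)
      then have "phi_upper x (2 ^ (DIM('a) + 1) * A) = phi_upper x (\<kappa> * (\<beta> * (lam * A) / 2))" by (rule arg_cong)
      also have "\<dots> \<le> ennreal (scale_const (2 * \<kappa>)) * \<phi> x (\<beta> * (lam * A) / 2)"
        using elim(2)[THEN mp, OF x, rule_format, of \<kappa> "\<beta> * (lam * A) / 2"] \<kappa> \<beta>_pos lam A0 by simp
      also have "\<dots> \<le> ennreal (scale_const (2 * \<kappa>)) * ennreal (c\<^sup>2 * (ball_average u x r + u x))"
        by (intro mult_left_mono le) simp
      also have "\<dots> = ennreal (E * (ball_average u x r + u x))"
        using scale_const_ge[of "2 * \<kappa>"] Au0 u0 by (simp add: E_def mult.assoc flip: ennreal_mult)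
      finally show "phi_upper x (2 ^ (DIM('a) + 1) * ball_average (\<lambda>y. norm (G y)) x r) \<le> ennreal (E * (ball_average u x r + u x))"
        by (simp add: A_def)
    qed
  qed
  with u u0 E that show ?thesis by blast
qed

lemma sharp_slice_le:
  assumes fG: "mollified_gradient \<Omega> f G" and r: "0 < r"
  shows "sharp_slice f r \<le> (\<integral>\<^sup>+x. indicator (inner_part \<Omega> r) x * phi_upper x (2 ^ (DIM('a) + 1) * ball_average (\<lambda>y. norm (G y)) x r) \<partial>lebesgue_on \<Omega>)"
  unfolding sharp_slice_eq
proof (rule nn_integral_mono)
  fix x
  show "indicator (inner_part \<Omega> r) x * \<phi> x (1 / r * sharp_average f x r)
     \<le> indicator (inner_part \<Omega> r) x * phi_upper x (2 ^ (DIM('a) + 1) * ball_average (\<lambda>y. norm (G y)) x r)"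
  proof (cases "x \<in> inner_part \<Omega> r")
    case True
    then have x: "x \<in> \<Omega>" using inner_part_subset by blast
    have p: "1 / r * sharp_average f x r \<le> 2 ^ (DIM('a) + 1) * ball_average (\<lambda>y. norm (G y)) x r"
      by (rule sharp_poincare[OF open_\<Omega> fG r cball_subset_of_inner_part[OF open_\<Omega> True r]])
    have s: "0 \<le> 1 / r * sharp_average f x r" using sharp_average_nonneg[of f x r] r by simp
    have "\<phi> x (1 / r * sharp_average f x r) \<le> \<phi> x (2 ^ (DIM('a) + 1) * ball_average (\<lambda>y. norm (G y)) x r)"
      by (rule phi_mono[OF x s p])
    also have "\<dots> \<le> phi_upper x (2 ^ (DIM('a) + 1) * ball_average (\<lambda>y. norm (G y)) x r)"
      by (rule phi_le_upper[OF x order_trans[OF s p]])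
    finally show ?thesis by (simp add: mult_left_mono)
  qed simp
qed

lemma nn_integral_ball_average_le:
  assumes u: "integrable lborel u" "\<And>x. 0 \<le> u x" and r: "0 < r"
  shows "(\<integral>\<^sup>+x. ennreal (ball_average u x r) \<partial>lborel) \<le> (\<integral>\<^sup>+x. ennreal (u x) \<partial>(lborel :: 'a measure))"
proof -
  have [measurable]: "u \<in> borel_measurable borel" using borel_measurable_integrable[OF u(1)] by simp
  note ak = averaging_kernel_ball[OF r, where 'a='a]
  have "(\<integral>\<^sup>+x. ennreal (ball_average u x r) \<partial>lborel) \<le> (\<integral>\<^sup>+x. \<integral>\<^sup>+y. ennreal (ball_kernel r (x - y)) * ennreal (u y) \<partial>lborel \<partial>lborel)"
  proof (rule nn_integral_mono)
    fix x
    have "ennreal (ball_average u x r) \<le> ennreal (norm (kconv (ball_kernel r) u x))"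
      by (simp add: ball_average_eq_kconv ennreal_leI)
    also have "\<dots> \<le> (\<integral>\<^sup>+y. ennreal (\<bar>ball_kernel r (x - y)\<bar> * norm (u y)) \<partial>lborel)" by (rule norm_kconv_le)
    also have "\<dots> = (\<integral>\<^sup>+y. ennreal (ball_kernel r (x - y)) * ennreal (u y) \<partial>lborel)"
      using averaging_kernelD(2)[OF ak] u(2) by (intro nn_integral_cong) (simp add: ennreal_mult)
    finally show "ennreal (ball_average u x r) \<le> (\<integral>\<^sup>+y. ennreal (ball_kernel r (x - y)) * ennreal (u y) \<partial>lborel)" .
  qed
  also have "\<dots> = (\<integral>\<^sup>+x. ennreal (u x) \<partial>lborel)"
    by (rule nn_integral_kernel_average[OF ak]) simp
  finally show ?thesis .
qed

lemma ball_average_measurable [measurable]: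
  assumes [measurable]: "u \<in> borel_measurable borel" and r: "0 < r"
  shows "(\<lambda>x. ball_average u x r) \<in> borel_measurable (borel :: 'a measure)"
proof -
  have [measurable]: "(ball_kernel r :: 'a \<Rightarrow> real) \<in> borel_measurable borel"
    using averaging_kernelD(1)[OF averaging_kernel_ball[OF r]] .
  have "kconv (ball_kernel r) u \<in> borel_measurable (borel :: 'a measure)" by measurable
  then show ?thesis by (simp add: ball_average_eq_kconv)
qed

text \<open>A bound for all radii, not only for small ones, is what controls the tails of the
  weights in \<open>weighted_Limsup_le\<close>.\<close>

lemma slice_bounded:
  assumes fG: "mollified_gradient \<Omega> f G" and l: "0 < l" "(\<integral>\<^sup>+x. \<phi> x (l * norm (G x)) \<partial>lebesgue_on \<Omega>) < \<infinity>"
  obtains M where "M < \<infinity>" "\<And>r. 0 < r \<Longrightarrow> sharp_slice f r \<le> M"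
proof -
  obtain u E where u: "integrable lborel u" "\<And>x. 0 \<le> u x" "0 \<le> E" and
    dom: "AE x in lborel. x \<in> \<Omega> \<longrightarrow> (\<forall>r>0. cball x r \<subseteq> \<Omega> \<longrightarrow>
       phi_upper x (2 ^ (DIM('a) + 1) * ball_average (\<lambda>y. norm (G y)) x r) \<le> ennreal (E * (ball_average u x r + u x)))"
    by (rule slice_dominated[OF fG l]) (rule that)
  have [measurable]: "u \<in> borel_measurable borel" using borel_measurable_integrable[OF u(1)] by simp
  define M where "M = ennreal E * (2 * (\<integral>\<^sup>+x. ennreal (u x) \<partial>lborel))"
  have "sharp_slice f r \<le> M" if r: "0 < r" for r
  proof -
    have [measurable]: "(\<lambda>x. ball_average u x r) \<in> borel_measurable borel" using r by simp
    have u0: "0 \<le> ball_average u x r" for x unfolding ball_average_def using u(2) by simp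
    have "sharp_slice f r \<le> (\<integral>\<^sup>+x. indicator (inner_part \<Omega> r) x * phi_upper x (2 ^ (DIM('a) + 1) * ball_average (\<lambda>y. norm (G y)) x r) \<partial>lebesgue_on \<Omega>)"
      by (rule sharp_slice_le[OF fG r])
    also have "\<dots> \<le> (\<integral>\<^sup>+x. ennreal E * (ennreal (ball_average u x r) + ennreal (u x)) \<partial>lebesgue_on \<Omega>)"
    proof (rule nn_integral_lebesgue_on_mono_AE[OF open_\<Omega>], use dom in eventually_elim)
      case (elim x)
      then show ?case
        using cball_subset_of_inner_part[OF open_\<Omega> _ r, of x] r u u0
        by (cases "x \<in> inner_part \<Omega> r") (auto simp flip: ennreal_plus ennreal_mult)
    qed
    also have "\<dots> \<le> (\<integral>\<^sup>+x. ennreal E * (ennreal (ball_average u x r) + ennreal (u x)) \<partial>lborel)"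
      by (rule nn_integral_lebesgue_on_le_lborel[OF open_\<Omega>])
    also have "\<dots> = ennreal E * ((\<integral>\<^sup>+x. ennreal (ball_average u x r) \<partial>lborel) + (\<integral>\<^sup>+x. ennreal (u x) \<partial>lborel))"
      by (simp add: nn_integral_cmult nn_integral_add)
    also have "\<dots> \<le> M"
      unfolding M_def mult_2 by (intro mult_left_mono add_mono nn_integral_ball_average_le u r) auto
    finally show ?thesis .
  qed
  moreover have "M < \<infinity>"
    using u nn_integral_eq_integral[OF u(1)] by (simp add: M_def ennreal_mult_less_top)
  ultimately show ?thesis using that by blast
qed


text \<open>The majorant E (avg u + u) varies with j. Subtracting \<open>d j\<close> = E |avg u - u|
  leaves the fixed majorant 2 E u, so the reverse Fatou lemma applies to \<open>H j - d j\<close>,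
  while the integral of \<open>d j\<close> tends to 0 by the L^1 convergence of averages.\<close>

lemma slice_limsup_subseq:
  assumes fG: "mollified_gradient \<Omega> f G" and l: "0 < l" "(\<integral>\<^sup>+x. \<phi> x (l * norm (G x)) \<partial>lebesgue_on \<Omega>) < \<infinity>"
    and r: "\<And>j::nat. 0 < r j" "r \<longlonglongrightarrow> 0"
  defines "T \<equiv> \<integral>\<^sup>+x. phi_upper x (2 ^ (DIM('a) + 2) * norm (G x)) \<partial>lebesgue_on \<Omega>"
  shows "\<exists>s. strict_mono s \<and> (\<forall>y>T. eventually (\<lambda>j. sharp_slice f (r (s j)) < y) sequentially)"
proof -
  obtain u E where u: "integrable lborel u" "\<And>x. 0 \<le> u x" "0 \<le> E" and
    dom: "AE x in lborel. x \<in> \<Omega> \<longrightarrow> (\<forall>r>0. cball x r \<subseteq> \<Omega> \<longrightarrow>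
       phi_upper x (2 ^ (DIM('a) + 1) * ball_average (\<lambda>y. norm (G y)) x r) \<le> ennreal (E * (ball_average u x r + u x)))"
    by (rule slice_dominated[OF fG l]) (rule that)
  have um [measurable]: "u \<in> borel_measurable borel" using borel_measurable_integrable[OF u(1)] by simp
  have Gm [measurable]: "G \<in> borel_measurable borel" using fG by (simp add: mollified_gradient_def)
  have Gn: "integrable lborel (\<lambda>x. indicator K x *\<^sub>R norm (G x))" if "compact K" "K \<subseteq> \<Omega>" for K
    using fG that integrable_norm[of lborel "\<lambda>x. indicator K x *\<^sub>R G x"] by (auto simp: mollified_gradient_def)
  obtain s :: "nat \<Rightarrow> nat" where s: "strict_mono s"
      "AE x in lborel. x \<in> \<Omega> \<longrightarrow> (\<lambda>j. kconv (ball_kernel (r (s j))) (\<lambda>x. norm (G x)) x) \<longlonglongrightarrow> norm (G x)"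
    using kconv_AE_subseq[OF open_\<Omega> _ Gn averaging_kernel_ball[OF r(1)] r(2)] by auto
  define \<rho> where "\<rho> j = r (s j)" for j
  have \<rho>: "\<And>j. 0 < \<rho> j" "\<rho> \<longlonglongrightarrow> 0"
    using r LIMSEQ_subseq_LIMSEQ[OF r(2) s(1)] by (auto simp: \<rho>_def[abs_def] comp_def)
  define A where "A j x = ball_average (\<lambda>y. norm (G y)) x (\<rho> j)" for j x
  have A_meas [measurable]: "A j \<in> borel_measurable borel" for j unfolding A_def using \<rho> by simp
  have A0: "0 \<le> A j x" for j x by (simp add: A_def ball_average_def)
  have A_lim: "AE x in lborel. x \<in> \<Omega> \<longrightarrow> (\<lambda>j. A j x) \<longlonglongrightarrow> norm (G x)"
    using s(2) by (simp add: A_def \<rho>_def ball_average_eq_kconv)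
  define k where "k = (2::real) ^ (DIM('a) + 1)"
  have k: "0 < k" by (simp add: k_def)
  define H where "H j x = indicator (inner_part \<Omega> (\<rho> j)) x * phi_upper x (k * A j x)" for j x
  define d where "d j x = ennreal E * ennreal \<bar>ball_average u x (\<rho> j) - u x\<bar>" for j x
  have d_meas [measurable]: "d j \<in> borel_measurable borel" for j unfolding d_def using \<rho> by simp
  note [measurable] = borel_measurable_lebesgue_onI[OF d_meas] borel_measurable_lebesgue_onI[OF um]
  have [measurable]: "(\<lambda>x. phi_upper x (k * A j x)) \<in> borel_measurable (lebesgue_on \<Omega>)" for j
    by (rule upper_measurable[OF borel_measurable_lebesgue_onI]) (use k A0 in auto)
  have [measurable]: "indicator (inner_part \<Omega> (\<rho> j)) \<in> borel_measurable (lebesgue_on \<Omega>)" for j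
    using open_inner_part[OF open_\<Omega>, of "\<rho> j"] by (intro borel_measurable_lebesgue_onI borel_measurable_indicator) auto
  have [measurable]: "H j \<in> borel_measurable (lebesgue_on \<Omega>)" for j unfolding H_def by measurable
  have H_dom: "AE x in lebesgue_on \<Omega>. H j x - d j x \<le> ennreal (2 * E * u x)" for j
    unfolding AE_lebesgue_on_iff[OF open_\<Omega>] using dom
  proof eventually_elim
    case (elim x)
    show ?case
    proof
      assume x: "x \<in> \<Omega>"
      show "H j x - d j x \<le> ennreal (2 * E * u x)"
      proof (cases "x \<in> inner_part \<Omega> (\<rho> j)")
        case True
        have "H j x \<le> ennreal (E * (ball_average u x (\<rho> j) + u x))"
          using elim x True \<rho>(1) cball_subset_of_inner_part[OF open_\<Omega> True \<rho>(1)] by (simp add: H_def k_def A_def)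
        also have "\<dots> \<le> ennreal (E * \<bar>ball_average u x (\<rho> j) - u x\<bar> + 2 * E * u x)"
        proof (rule ennreal_leI)
          have "E * (ball_average u x (\<rho> j) + u x) \<le> E * (\<bar>ball_average u x (\<rho> j) - u x\<bar> + 2 * u x)"
            using u(3) by (intro mult_left_mono) auto
          then show "E * (ball_average u x (\<rho> j) + u x) \<le> E * \<bar>ball_average u x (\<rho> j) - u x\<bar> + 2 * E * u x"
            by (simp add: algebra_simps)
        qed
        also have "\<dots> = d j x + ennreal (2 * E * u x)"
          using u by (simp add: d_def ennreal_plus ennreal_mult)
        finally have "H j x \<le> d j x + ennreal (2 * E * u x)" .
        moreover have "d j x \<noteq> top" by (simp add: d_def ennreal_mult_eq_top_iff)
        ultimately show ?thesis by (simp add: ennreal_minus_le_iff)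
      qed (simp add: H_def)
    qed
  qed
  have H_lim: "AE x in lebesgue_on \<Omega>. limsup (\<lambda>j. H j x - d j x) \<le> phi_upper x (2 ^ (DIM('a) + 2) * norm (G x))"
    unfolding AE_lebesgue_on_iff[OF open_\<Omega>] using A_lim
  proof eventually_elim
    case (elim x)
    show ?case
    proof
      assume x: "x \<in> \<Omega>"
      have HA: "H j x - d j x \<le> phi_upper x (k * A j x)" for j
        by (rule order_trans[OF diff_le_self_ennreal]) (auto simp: H_def indicator_def)
      show "limsup (\<lambda>j. H j x - d j x) \<le> phi_upper x (2 ^ (DIM('a) + 2) * norm (G x))"
      \<comment> \<open>The target has 2^(n + 2) instead of 2^(n + 1): the averages are eventually
        below 2 |G x|. Where G x = 0 this leaves no room, and the right limit of \<phi> at 0 takes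
        over.\<close>
      proof (cases "G x = 0")
        case False
        have "eventually (\<lambda>j. A j x < 2 * norm (G x)) sequentially"
          using elim x False by (intro order_tendstoD(2)[of _ "norm (G x)"]) auto
        then have "eventually (\<lambda>j. H j x - d j x \<le> phi_upper x (2 ^ (DIM('a) + 2) * norm (G x))) sequentially"
        proof eventually_elim
          case (elim j)
          have "k * A j x \<le> k * (2 * norm (G x))" using elim k by (intro mult_left_mono) auto
          also have "\<dots> = 2 ^ (DIM('a) + 2) * norm (G x)" by (simp add: k_def)
          finally show ?case using HA[of j] upper_mono order_trans by blast
        qed
        then show ?thesis by (rule Limsup_bounded)
      next
        case True
        have "limsup (\<lambda>j. H j x - d j x) \<le> \<phi> x t" if t: "0 < t" for t
        proof (rule Limsup_bounded)
          have "(\<lambda>j. k * A j x) \<longlonglongrightarrow> k * 0" using elim x True by (intro tendsto_mult) auto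
          then have "eventually (\<lambda>j. k * A j x < t) sequentially" using t by (intro order_tendstoD(2)) auto
          then show "eventually (\<lambda>j. H j x - d j x \<le> \<phi> x t) sequentially"
          proof eventually_elim
            case (elim j)
            have "phi_upper x (k * A j x) \<le> \<phi> x t" using elim k A0 x by (intro upper_le_phi) auto
            with HA[of j] show ?case by (rule order_trans)
          qed
        qed
        then have "eventually (\<lambda>t. limsup (\<lambda>j. H j x - d j x) \<le> \<phi> x t) (at_right 0)"
          by (auto simp: eventually_at_filter)
        then have "limsup (\<lambda>j. H j x - d j x) \<le> 0"
          by (rule tendsto_lowerbound[OF phi_at_right_0[OF x]]) simp
        then show ?thesis by (simp add: order_trans)
      qed
    qed
  qed
  have "limsup (\<lambda>j. \<integral>\<^sup>+x. H j x - d j x \<partial>lebesgue_on \<Omega>) \<le> (\<integral>\<^sup>+x. limsup (\<lambda>j. H j x - d j x) \<partial>lebesgue_on \<Omega>)"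
  proof (rule nn_integral_limsup[where w="\<lambda>x. ennreal (2 * E * u x)"])
    have "(\<integral>\<^sup>+x. ennreal (2 * E * u x) \<partial>lebesgue_on \<Omega>) \<le> (\<integral>\<^sup>+x. ennreal (2 * E * u x) \<partial>lborel)"
      by (rule nn_integral_lebesgue_on_le_lborel[OF open_\<Omega>])
    also have "\<dots> < \<infinity>"
      using nn_integral_eq_integral[of lborel "\<lambda>x. 2 * E * u x"] u by simp
    finally show "(\<integral>\<^sup>+x. ennreal (2 * E * u x) \<partial>lebesgue_on \<Omega>) < \<infinity>" .
  qed (use H_dom in auto)
  also have "\<dots> \<le> T" unfolding T_def by (rule nn_integral_mono_AE[OF H_lim])
  finally have lim: "limsup (\<lambda>j. \<integral>\<^sup>+x. H j x - d j x \<partial>lebesgue_on \<Omega>) \<le> T" .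
  have "(\<lambda>j. ennreal E * (\<integral>\<^sup>+x. ennreal (norm (kconv (ball_kernel (\<rho> j)) u x - u x)) \<partial>lborel)) \<longlonglongrightarrow> ennreal E * 0"
    by (intro ennreal_tendsto_cmult kconv_L1_tendsto[OF averaging_kernel_ball[OF \<rho>(1)] u(1) \<rho>(2)]) simp
  moreover have "ennreal E * (\<integral>\<^sup>+x. ennreal (norm (kconv (ball_kernel (\<rho> j)) u x - u x)) \<partial>lborel) = (\<integral>\<^sup>+x. d j x \<partial>lborel)" for j
    using \<rho>(1)[of j] unfolding d_def by (subst nn_integral_cmult[symmetric]) (auto simp flip: ball_average_eq_kconv)
  ultimately have d_lim: "(\<lambda>j. \<integral>\<^sup>+x. d j x \<partial>lborel) \<longlonglongrightarrow> 0" by simp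
  have slice: "sharp_slice f (\<rho> j) \<le> (\<integral>\<^sup>+x. H j x - d j x \<partial>lebesgue_on \<Omega>) + (\<integral>\<^sup>+x. d j x \<partial>lborel)" for j
  proof -
    have "sharp_slice f (\<rho> j) \<le> (\<integral>\<^sup>+x. H j x \<partial>lebesgue_on \<Omega>)"
      using sharp_slice_le[OF fG \<rho>(1), of j] by (simp add: H_def A_def k_def)
    also have "\<dots> \<le> (\<integral>\<^sup>+x. (H j x - d j x) + d j x \<partial>lebesgue_on \<Omega>)"
    proof (rule nn_integral_mono)
      fix x
      \<comment> \<open>Subtraction of extended nonnegative reals is truncated at 0, hence only an
        inequality.\<close>
      show "H j x \<le> (H j x - d j x) + d j x"
        by (cases "d j x \<le> H j x") (auto simp: diff_add_cancel_ennreal add_increasing)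
    qed
    also have "\<dots> = (\<integral>\<^sup>+x. H j x - d j x \<partial>lebesgue_on \<Omega>) + (\<integral>\<^sup>+x. d j x \<partial>lebesgue_on \<Omega>)"
      by (rule nn_integral_add) auto
    also have "\<dots> \<le> (\<integral>\<^sup>+x. H j x - d j x \<partial>lebesgue_on \<Omega>) + (\<integral>\<^sup>+x. d j x \<partial>lborel)"
      by (intro add_left_mono nn_integral_lebesgue_on_le_lborel open_\<Omega>)
    finally show ?thesis .
  qed
  have "\<forall>y>T. eventually (\<lambda>j. sharp_slice f (\<rho> j) < y) sequentially"
  proof (intro allI impI)
    fix y assume "T < y"
    then obtain y' e where y': "T < y'" "0 < e" "y' + ennreal e \<le> y" by (rule ennreal_less_add_obtains)
    have "eventually (\<lambda>j. (\<integral>\<^sup>+x. H j x - d j x \<partial>lebesgue_on \<Omega>) < y') sequentially"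
      using lim y'(1) unfolding Limsup_le_iff by blast
    moreover have "eventually (\<lambda>j. (\<integral>\<^sup>+x. d j x \<partial>lborel) < ennreal e) sequentially"
      using order_tendstoD(2)[OF d_lim, of "ennreal e"] y'(2) by simp
    ultimately show "eventually (\<lambda>j. sharp_slice f (\<rho> j) < y) sequentially"
    proof eventually_elim
      case (elim j)
      have "(\<integral>\<^sup>+x. H j x - d j x \<partial>lebesgue_on \<Omega>) + (\<integral>\<^sup>+x. d j x \<partial>lborel) < y' + ennreal e"
        by (rule add_strict_mono[OF elim])
      with slice[of j] y'(3) show ?case by (meson order.strict_trans1 order.strict_trans2)
    qed
  qed
  with s(1) show ?thesis unfolding \<rho>_def by blast
qed

lemma slice_Limsup_le:
  assumes "mollified_gradient \<Omega> f G" "0 < l" "(\<integral>\<^sup>+x. \<phi> x (l * norm (G x)) \<partial>lebesgue_on \<Omega>) < \<infinity>"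
  shows "Limsup (at_right 0) (sharp_slice f) \<le> (\<integral>\<^sup>+x. phi_upper x (2 ^ (DIM('a) + 2) * norm (G x)) \<partial>lebesgue_on \<Omega>)"
  by (rule Limsup_at_right_le_subseq) (rule slice_limsup_subseq[OF assms])

text \<open>The factor 2 makes the argument on the left strictly smaller than the one on the right
  unless it is 0, and a strict gap is what puts \<open>phi_upper\<close> below \<phi>. The left side
  needs \<open>phi_upper\<close> because Fatou's lemma is applied to it.\<close>

lemma mollified_grad_slice_le:
  assumes f: "f \<in> borel_measurable borel" and r: "0 < r"
    and i: "\<And>K. compact K \<Longrightarrow> K \<subseteq> \<Omega> \<Longrightarrow> integrable lborel (\<lambda>y. indicator K y *\<^sub>R f y)"
  shows "(\<integral>\<^sup>+x. indicator (inner_part \<Omega> r) x * phi_upper x (norm (mollified_grad f r x) / (2 * grad_const TYPE('a))) \<partial>lebesgue_on \<Omega>) \<le> sharp_slice f r"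
  unfolding sharp_slice_eq
proof (rule nn_integral_mono)
  fix x
  show "indicator (inner_part \<Omega> r) x * phi_upper x (norm (mollified_grad f r x) / (2 * grad_const TYPE('a)))
    \<le> indicator (inner_part \<Omega> r) x * \<phi> x (1 / r * sharp_average f x r)"
  proof (cases "x \<in> inner_part \<Omega> r")
    case True
    then have x: "x \<in> \<Omega>" using inner_part_subset by blast
    note C = grad_const_pos[where 'a='a]
    define t where "t = norm (mollified_grad f r x)"
    have t: "t / grad_const TYPE('a) \<le> 1 / r * sharp_average f x r"
      using norm_mollified_grad_le[OF f r i[OF compact_cball cball_subset_of_inner_part[OF open_\<Omega> True r]]] C
      by (simp add: t_def field_simps)
    have "phi_upper x (t / (2 * grad_const TYPE('a))) \<le> \<phi> x (1 / r * sharp_average f x r)"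
    proof (cases "t = 0")
      case False
      then have "0 < t / (2 * grad_const TYPE('a))" using C by (simp add: t_def)
      then have "t / (2 * grad_const TYPE('a)) < t / grad_const TYPE('a)" by (simp add: field_simps)
      with t have "t / (2 * grad_const TYPE('a)) < 1 / r * sharp_average f x r" by linarith
      then show ?thesis using \<open>0 < t / (2 * grad_const TYPE('a))\<close> by (intro upper_le_phi x) auto
    qed (simp add: upper_zero x)
    then show ?thesis by (simp add: t_def mult_left_mono)
  qed simp
qed

text \<open>The constant 4 is the 2 from \<open>mollified_grad_slice_le\<close> times a second 2:
  the mollified gradients converge to G x along a subsequence, so their norms eventually exceed |G
  x| / 2. Where G x = 0 the left side vanishes.\<close>

lemma slice_liminf_subseq:
  assumes fG: "mollified_gradient \<Omega> f G" and r: "\<And>j::nat. 0 < r j" "r \<longlonglongrightarrow> 0"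
  shows "\<exists>s. strict_mono s \<and>
    (\<integral>\<^sup>+x. \<phi> x (norm (G x) / (4 * grad_const TYPE('a))) \<partial>lebesgue_on \<Omega>) \<le> liminf (\<lambda>j. sharp_slice f (r (s j)))"
proof -
  have fm: "f \<in> borel_measurable borel" and Gm [measurable]: "G \<in> borel_measurable borel"
    and fi: "\<And>K. compact K \<Longrightarrow> K \<subseteq> \<Omega> \<Longrightarrow> integrable lborel (\<lambda>y. indicator K y *\<^sub>R f y)"
    and Gi: "\<And>K. compact K \<Longrightarrow> K \<subseteq> \<Omega> \<Longrightarrow> integrable lborel (\<lambda>y. indicator K y *\<^sub>R G y)"
    using fG by (auto simp: mollified_gradient_def)
  note C = grad_const_pos[where 'a='a]
  obtain s :: "nat \<Rightarrow> nat" where s: "strict_mono s"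
      "AE x in lborel. x \<in> \<Omega> \<longrightarrow> (\<lambda>j. kconv (mollifier (r (s j))) G x) \<longlonglongrightarrow> G x"
    using kconv_AE_subseq[OF open_\<Omega> Gm Gi averaging_kernel_mollifier[OF r(1)] r(2)] by auto
  define \<rho> where "\<rho> j = r (s j)" for j
  have \<rho>: "\<And>j. 0 < \<rho> j" "\<rho> \<longlonglongrightarrow> 0"
    using r LIMSEQ_subseq_LIMSEQ[OF r(2) s(1)] by (auto simp: \<rho>_def[abs_def] comp_def)
  define H where "H j x = indicator (inner_part \<Omega> (\<rho> j)) x * phi_upper x (norm (mollified_grad f (\<rho> j) x) / (2 * grad_const TYPE('a)))" for j x
  have [measurable]: "(\<lambda>x. phi_upper x (norm (mollified_grad f (\<rho> j) x) / (2 * grad_const TYPE('a)))) \<in> borel_measurable (lebesgue_on \<Omega>)" for j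
    by (rule upper_measurable[OF borel_measurable_lebesgue_onI]) (use C mollified_grad_measurable[OF fm, of "\<rho> j"] in auto)
  have [measurable]: "indicator (inner_part \<Omega> (\<rho> j)) \<in> borel_measurable (lebesgue_on \<Omega>)" for j
    using open_inner_part[OF open_\<Omega>, of "\<rho> j"] by (intro borel_measurable_lebesgue_onI borel_measurable_indicator) auto
  have [measurable]: "H j \<in> borel_measurable (lebesgue_on \<Omega>)" for j unfolding H_def by measurable
  have "(\<integral>\<^sup>+x. \<phi> x (norm (G x) / (4 * grad_const TYPE('a))) \<partial>lebesgue_on \<Omega>) \<le> (\<integral>\<^sup>+x. liminf (\<lambda>j. H j x) \<partial>lebesgue_on \<Omega>)"
  proof (rule nn_integral_lebesgue_on_mono_AE[OF open_\<Omega>], use s(2) in eventually_elim)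
    case (elim x)
    show ?case
    proof
      assume x: "x \<in> \<Omega>"
      show "\<phi> x (norm (G x) / (4 * grad_const TYPE('a))) \<le> liminf (\<lambda>j. H j x)"
      proof (cases "G x = 0")
        case False
        obtain R where R: "0 < R" "cball x R \<subseteq> \<Omega>" using x open_\<Omega> open_contains_cball by blast
        have "eventually (\<lambda>j. \<rho> j < R) sequentially" by (rule order_tendstoD(2)[OF \<rho>(2) R(1)])
        moreover have "(\<lambda>j. norm (kconv (mollifier (\<rho> j)) G x)) \<longlonglongrightarrow> norm (G x)"
          unfolding \<rho>_def using elim x by (intro tendsto_norm) auto
        then have "eventually (\<lambda>j. norm (G x) / 2 < norm (kconv (mollifier (\<rho> j)) G x)) sequentially"
          using False by (intro order_tendstoD(1)) auto
        ultimately have "eventually (\<lambda>j. \<phi> x (norm (G x) / (4 * grad_const TYPE('a))) \<le> H j x) sequentially"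
        proof eventually_elim
          case (elim j)
          have "x \<in> inner_part \<Omega> (\<rho> j)" using inner_partI[OF open_\<Omega> R(2) \<rho>(1) elim(1)] .
          moreover have "mollified_grad f (\<rho> j) x = kconv (mollifier (\<rho> j)) G x"
            using elim(1) R(2) by (intro mollified_grad_eq_kconv[OF fG \<rho>(1)]) (meson cball_subset_cball_iff less_imp_le subset_cball order_trans)
          moreover have "norm (G x) / (4 * grad_const TYPE('a)) \<le> norm (kconv (mollifier (\<rho> j)) G x) / (2 * grad_const TYPE('a))"
            using elim(2) C by (simp add: field_simps)
          then have "phi_upper x (norm (G x) / (4 * grad_const TYPE('a))) \<le> phi_upper x (norm (kconv (mollifier (\<rho> j)) G x) / (2 * grad_const TYPE('a)))"
            by (rule upper_mono)
          moreover have "\<phi> x (norm (G x) / (4 * grad_const TYPE('a))) \<le> phi_upper x (norm (G x) / (4 * grad_const TYPE('a)))"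
            using C by (intro phi_le_upper x) simp
          ultimately show ?case by (simp add: H_def)
        qed
        then show ?thesis by (rule Liminf_bounded)
      qed (simp add: phi_zero x)
    qed
  qed
  also have "\<dots> \<le> liminf (\<lambda>j. \<integral>\<^sup>+x. H j x \<partial>lebesgue_on \<Omega>)"
    by (rule nn_integral_liminf) simp
  also have "\<dots> \<le> liminf (\<lambda>j. sharp_slice f (\<rho> j))"
    by (intro Liminf_mono always_eventually allI) (unfold H_def, rule mollified_grad_slice_le[OF fm \<rho>(1) fi])
  finally show ?thesis using s(1) unfolding \<rho>_def by blast
qed

lemma slice_Liminf_ge:
  assumes "mollified_gradient \<Omega> f G"
  shows "(\<integral>\<^sup>+x. \<phi> x (norm (G x) / (4 * grad_const TYPE('a))) \<partial>lebesgue_on \<Omega>) \<le> Liminf (at_right 0) (sharp_slice f)"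
  by (rule Liminf_at_right_ge_subseq) (rule slice_liminf_subseq[OF assms])

end

subsection \<open>Weak compactness in \<open>L\<^sup>1\<close>\<close>

text \<open>A product over uncountably many coordinates need not be sequentially compact, so a
  cluster point cannot be expected as the limit of a subsequence. The filter generated by the tails
  of the sequence and the preimages of the neighbourhoods of a cluster point replaces the
  subsequence.\<close>

lemma compact_sequence_cluster_filter:
  fixes X :: "nat \<Rightarrow> 'b::topological_space"
  assumes "compact U" "\<And>j. X j \<in> U"
  obtains F x where "F \<le> sequentially" "F \<noteq> bot" "x \<in> U" "(X \<longlongrightarrow> x) F"
proof -
  have "filtermap X sequentially \<noteq> bot" by (simp add: filtermap_bot_iff)
  moreover have "eventually (\<lambda>y. y \<in> U) (filtermap X sequentially)"
    using assms(2) by (simp add: eventually_filtermap)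
  ultimately obtain x where x: "x \<in> U" "inf (nhds x) (filtermap X sequentially) \<noteq> bot"
    using assms(1) unfolding compact_filter by blast
  define F where "F = inf sequentially (filtercomap X (nhds x))"
  have "F \<noteq> bot"
  proof
    assume "F = bot"
    then have "eventually (\<lambda>_. False) F" by simp
    then obtain P Q where PQ: "eventually P sequentially" "eventually Q (filtercomap X (nhds x))" "\<And>j. P j \<Longrightarrow> Q j \<Longrightarrow> False"
      unfolding F_def eventually_inf by blast
    from PQ(2) obtain R where R: "eventually R (nhds x)" "\<And>j. R (X j) \<Longrightarrow> Q j"
      unfolding eventually_filtercomap by blast
    have "eventually (\<lambda>j. \<not> R (X j)) sequentially"
      using PQ(1) by (rule eventually_mono) (use PQ(3) R(2) in blast)
    then have "eventually (\<lambda>y. \<not> R y) (filtermap X sequentially)" by (simp add: eventually_filtermap)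
    with R(1) have "eventually (\<lambda>_. False) (inf (nhds x) (filtermap X sequentially))"
      unfolding eventually_inf by blast
    with x(2) show False by (simp add: eventually_False)
  qed
  moreover have "(X \<longlongrightarrow> x) F"
    unfolding F_def filterlim_iff_le_filtercomap by simp
  ultimately show ?thesis using that[of F x] x(1) by (simp add: F_def)
qed

lemma compact_real_functions: "compact {x :: 'i \<Rightarrow> real. \<forall>i. x i \<in> {0..K}}"
proof -
  have "compactin (product_topology (\<lambda>i::'i. euclideanreal) UNIV) (PiE UNIV (\<lambda>i. {0..K}))"
    by (subst compactin_PiE) auto
  then show ?thesis
    by (simp add: euclidean_product_topology PiE_UNIV_domain Pi_def)
qed

text \<open>Uniform integrability makes the setwise cluster point (Tychonoff) a countably additive,
  absolutely continuous set function, so that the Radon--Nikodym theorem applies.\<close>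

lemma uniformly_integrable_weak_cluster:
  fixes g :: "'i \<Rightarrow> nat \<Rightarrow> 'a \<Rightarrow> ennreal"
  assumes M: "finite_measure M" and g [measurable]: "\<And>i j. g i j \<in> borel_measurable M"
    and UI: "\<And>e. 0 < e \<Longrightarrow> \<exists>C. \<forall>i j. \<forall>A\<in>sets M. (\<integral>\<^sup>+x. g i j x * indicator A x \<partial>M) \<le> ennreal C * emeasure M A + ennreal e"
  obtains F h where "F \<le> sequentially" "F \<noteq> bot" "\<And>i. h i \<in> borel_measurable M" "\<And>i. (\<integral>\<^sup>+x. h i x \<partial>M) < \<infinity>"
    "\<And>i A. A \<in> sets M \<Longrightarrow> ((\<lambda>j. \<integral>\<^sup>+x. g i j x * indicator A x \<partial>M) \<longlongrightarrow> (\<integral>\<^sup>+x. h i x * indicator A x \<partial>M)) F"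
proof -
  interpret finite_measure M by fact
  define I where "I i j A = (\<integral>\<^sup>+x. g i j x * indicator A x \<partial>M)" for i j A
  obtain C1 where C1: "\<And>i j A. A \<in> sets M \<Longrightarrow> I i j A \<le> ennreal C1 * emeasure M A + ennreal 1"
    using UI[of 1] unfolding I_def by auto
  define K where "K = enn2real (ennreal C1 * emeasure M (space M) + ennreal 1)"
  have Kfin: "ennreal C1 * emeasure M (space M) + ennreal 1 < top"
    using finite_emeasure_space by (simp add: ennreal_mult_eq_top_iff less_top[symmetric])
  have IK: "I i j A \<le> ennreal K" if A: "A \<in> sets M" for i j A
  proof -
    have "I i j A \<le> ennreal C1 * emeasure M A + ennreal 1" by (rule C1[OF A])
    also have "\<dots> \<le> ennreal C1 * emeasure M (space M) + ennreal 1"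
      by (intro add_right_mono mult_left_mono emeasure_space) simp
    also have "\<dots> = ennreal K" unfolding K_def using Kfin by simp
    finally show ?thesis .
  qed
  \<comment> \<open>All indices and all measurable sets become coordinates of one point, so that a
    single filter serves every component of the vector field.\<close>
  define X where "X j = (\<lambda>(i, A). if A \<in> sets M then enn2real (I i j A) else 0)" for j
  have K0: "0 \<le> K" by (simp add: K_def)
  have "X j \<in> {x. \<forall>i. x i \<in> {0..K}}" for j
    using IK K0 by (auto simp: X_def enn2real_leI)
  then obtain F x where F: "F \<le> sequentially" "F \<noteq> bot" and x: "x \<in> {x. \<forall>i. x i \<in> {0..K}}" "(X \<longlongrightarrow> x) F"
    using compact_sequence_cluster_filter[OF compact_real_functions, of X K] by metis
  define \<nu> where "\<nu> i A = ennreal (x (i, A))" for i A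
  have lim: "((\<lambda>j. I i j A) \<longlongrightarrow> \<nu> i A) F" if A: "A \<in> sets M" for i A
  proof -
    have "((\<lambda>j. X j (i, A)) \<longlongrightarrow> x (i, A)) F"
      by (rule continuous_on_tendsto_compose[OF continuous_on_product_coordinates x(2)]) auto
    then have "((\<lambda>j. ennreal (X j (i, A))) \<longlongrightarrow> \<nu> i A) F" unfolding \<nu>_def by (rule tendsto_ennrealI)
    moreover have "ennreal (X j (i, A)) = I i j A" for j
    proof -
      have "I i j A < top" by (rule le_less_trans[OF IK[OF A] ennreal_less_top])
      with A show ?thesis by (simp add: X_def)
    qed
    ultimately show ?thesis by simp
  qed
  have bound: "\<exists>C. \<forall>i. \<forall>A\<in>sets M. \<nu> i A \<le> ennreal C * emeasure M A + ennreal e" if e: "0 < e" for e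
  proof -
    obtain C where "\<forall>i j. \<forall>A\<in>sets M. I i j A \<le> ennreal C * emeasure M A + ennreal e"
      using UI[OF e] unfolding I_def by auto
    then have "\<nu> i A \<le> ennreal C * emeasure M A + ennreal e" if "A \<in> sets M" for i A
      using that by (intro tendsto_upperbound[OF lim _ F(2)]) auto
    then show ?thesis by blast
  qed
  have "\<exists>h. h \<in> borel_measurable M \<and> (\<forall>A\<in>sets M. \<nu> i A = (\<integral>\<^sup>+x. h x * indicator A x \<partial>M))" for i
  proof -
    have pos: "positive (sets M) (\<nu> i)"
    proof -
      have "I i j {} = 0" for j by (simp add: I_def)
      then have "((\<lambda>j. 0) \<longlongrightarrow> \<nu> i {}) F" using lim[of "{}" i] by simp
      then have "\<nu> i {} = 0" using tendsto_unique[OF F(2)] tendsto_const by blast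
      then show ?thesis by (simp add: positive_def)
    qed
    have add: "additive (sets M) (\<nu> i)"
      unfolding additive_def
    proof (intro ballI impI)
      fix A B assume A: "A \<in> sets M" and B: "B \<in> sets M" and AB: "A \<inter> B = {}"
      have "I i j (A \<union> B) = I i j A + I i j B" for j
        unfolding I_def using A B AB
        by (subst nn_integral_add[symmetric]) (auto intro!: nn_integral_cong simp: indicator_def)
      then have "((\<lambda>j. I i j (A \<union> B)) \<longlongrightarrow> \<nu> i A + \<nu> i B) F"
        using tendsto_add[OF lim[OF A] lim[OF B]] by simp
      then show "\<nu> i (A \<union> B) = \<nu> i A + \<nu> i B"
        using tendsto_unique[OF F(2) lim[of "A \<union> B" i]] A B by auto
    qed
    \<comment> \<open>Continuity at the empty set suffices for a finite additive set function, and
      it follows from the uniform bound, which survives the limit.\<close>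
    have ca: "countably_additive (sets M) (\<nu> i)"
    proof (rule sets.empty_continuous_imp_countably_additive[OF pos add])
      show "\<forall>A\<in>sets M. \<nu> i A \<noteq> \<infinity>" by (simp add: \<nu>_def)
      fix A :: "nat \<Rightarrow> 'a set" assume A: "range A \<subseteq> sets M" "decseq A" "(\<Inter>n. A n) = {}"
      have "(\<lambda>n. emeasure M (A n)) \<longlonglongrightarrow> emeasure M (\<Inter>n. A n)"
        by (rule Lim_emeasure_decseq) (use A in auto)
      then have A0: "(\<lambda>n. emeasure M (A n)) \<longlonglongrightarrow> 0" using A(3) by simp
      show "(\<lambda>n. \<nu> i (A n)) \<longlonglongrightarrow> 0"
      proof (rule order_tendstoI)
        fix a :: ennreal assume "0 < a"
        then obtain e where e: "0 < e" "ennreal e < a" by (rule ennreal_pos_obtains_real)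
        obtain C where C: "\<forall>i. \<forall>A\<in>sets M. \<nu> i A \<le> ennreal C * emeasure M A + ennreal (e / 2)"
          using bound[of "e / 2"] e by auto
        have "(\<lambda>n. ennreal C * emeasure M (A n) + ennreal (e / 2)) \<longlonglongrightarrow> ennreal C * 0 + ennreal (e / 2)"
          by (intro tendsto_add ennreal_tendsto_cmult A0 tendsto_const) simp
        moreover have "ennreal (e / 2) < a" using e by (intro order.strict_trans1[OF ennreal_leI e(2)]) simp
        ultimately have "eventually (\<lambda>n. ennreal C * emeasure M (A n) + ennreal (e / 2) < a) sequentially"
          by (intro order_tendstoD(2)) auto
        then show "eventually (\<lambda>n. \<nu> i (A n) < a) sequentially"
        proof eventually_elim
          case (elim n)
          have "A n \<in> sets M" using A(1) by auto
          with C have "\<nu> i (A n) \<le> ennreal C * emeasure M (A n) + ennreal (e / 2)" by blast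
          with elim show ?case by (rule le_less_trans[rotated])
        qed
      qed simp
    qed
    define N where "N = measure_of (space M) (sets M) (\<nu> i)"
    have sN: "sets N = sets M" by (simp add: N_def)
    have eN: "emeasure N A = \<nu> i A" if "A \<in> sets M" for A
      unfolding N_def by (rule emeasure_measure_of_sigma[OF sets.sigma_algebra_axioms pos ca that])
    have "absolutely_continuous M N"
      unfolding absolutely_continuous_def
    proof
      fix A assume A: "A \<in> null_sets M"
      then have As: "A \<in> sets M" by auto
      have "\<nu> i A \<le> 0"
      proof (rule ennreal_le_epsilon)
        fix e :: real assume "0 < e"
        then obtain C where "\<forall>i. \<forall>A\<in>sets M. \<nu> i A \<le> ennreal C * emeasure M A + ennreal e" using bound by blast
        then have "\<nu> i A \<le> ennreal C * emeasure M A + ennreal e" using As by blast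
        then show "\<nu> i A \<le> 0 + ennreal e" using null_setsD1[OF A] by simp
      qed
      then show "A \<in> null_sets N" using As sN eN[OF As] by auto
    qed
    from Radon_Nikodym[OF this sN] obtain h where h: "h \<in> borel_measurable M" "density M h = N" by blast
    have "\<nu> i A = (\<integral>\<^sup>+x. h x * indicator A x \<partial>M)" if "A \<in> sets M" for A
      using eN[OF that] h that by (metis emeasure_density)
    with h show ?thesis by blast
  qed
  then obtain h where h: "\<And>i. h i \<in> borel_measurable M" "\<And>i A. A \<in> sets M \<Longrightarrow> \<nu> i A = (\<integral>\<^sup>+x. h i x * indicator A x \<partial>M)"
    by metis
  have "(\<integral>\<^sup>+x. h i x \<partial>M) < \<infinity>" for i
  proof -
    have "(\<integral>\<^sup>+x. h i x \<partial>M) = (\<integral>\<^sup>+x. h i x * indicator (space M) x \<partial>M)" by (intro nn_integral_cong) simp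
    also have "\<dots> = \<nu> i (space M)" using h by simp
    also have "\<dots> < \<infinity>" by (simp add: \<nu>_def)
    finally show ?thesis .
  qed
  show ?thesis
  proof (rule that[OF F h(1)])
    show "(\<integral>\<^sup>+x. h i x \<partial>M) < \<infinity>" for i by fact
    show "((\<lambda>j. \<integral>\<^sup>+x. g i j x * indicator A x \<partial>M) \<longlongrightarrow> (\<integral>\<^sup>+x. h i x * indicator A x \<partial>M)) F" if "A \<in> sets M" for i A
      using lim[OF that, of i] unfolding I_def h(2)[OF that] .
  qed
qed

text \<open>Rounding n b down to integers approximates b within 1 / n by a simple function with
  finitely many level sets, on each of which the measures converge. With masses at most
  \<open>K\<close> the rounding costs at most K / n in either integral.\<close>

lemma setwise_convergence_integral:
  fixes N :: "nat \<Rightarrow> 'a measure" and b :: "'a \<Rightarrow> real"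
  assumes N: "\<And>j. finite_measure (N j)" "finite_measure N'" and s: "\<And>j. sets (N j) = sets N'"
    and K: "\<And>j. measure (N j) (space N') \<le> K" "measure N' (space N') \<le> K"
    and lim: "\<And>A. A \<in> sets N' \<Longrightarrow> ((\<lambda>j. measure (N j) A) \<longlongrightarrow> measure N' A) F"
    and b [measurable]: "b \<in> borel_measurable N'" and B: "\<And>x. \<bar>b x\<bar> \<le> B"
  shows "((\<lambda>j. \<integral>x. b x \<partial>N j) \<longlongrightarrow> (\<integral>x. b x \<partial>N')) F"
proof (rule tendstoI)
  fix e :: real assume e: "0 < e"
  \<comment> \<open>Each of the two rounding errors becomes less than e / 3; K + 1 in place of K
    keeps n positive when K = 0.\<close>
  obtain n :: nat where n: "3 * (K + 1) / e < real n" using reals_Archimedean2 by blast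
  have K0: "0 \<le> K" using K(2) measure_nonneg order_trans by blast
  have B0: "0 \<le> B" using B[of undefined] by linarith
  have "0 < 3 * (K + 1) / e" using e K0 by simp
  with n have n0: "0 < real n" by linarith
  have "3 * (K + 1) < real n * e" using n e by (simp only: pos_divide_less_eq)
  then have "K < e / 3 * real n" by (simp add: mult.commute)
  then have Kn: "K / real n < e / 3" using n0 by (simp only: pos_divide_less_eq)
  define m where "m = \<lceil>real n * B\<rceil> + 1"
  define A where "A k = {x \<in> space N'. \<lfloor>real n * b x\<rfloor> = k}" for k
  have A [measurable]: "A k \<in> sets N'" for k unfolding A_def by measurable
  define S where "S x = (\<Sum>k\<in>{-m..m}. (real_of_int k / real n) * indicator (A k) x)" for x
  have S_eq: "S x = real_of_int \<lfloor>real n * b x\<rfloor> / real n" if x: "x \<in> space N'" for x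
  proof -
    have "\<bar>real n * b x\<bar> \<le> real n * B" using B[of x] n0 by (simp add: abs_mult mult_left_mono)
    then have k: "\<lfloor>real n * b x\<rfloor> \<in> {-m..m}" unfolding m_def by simp linarith
    have "S x = (\<Sum>k\<in>{-m..m}. if k = \<lfloor>real n * b x\<rfloor> then real_of_int k / real n else 0)"
      unfolding S_def using x by (intro sum.cong) (auto simp: A_def indicator_def)
    with k show ?thesis by simp
  qed
  have S_close: "\<bar>b x - S x\<bar> \<le> 1 / real n" if x: "x \<in> space N'" for x
  proof -
    have "\<bar>real n * b x - real_of_int \<lfloor>real n * b x\<rfloor>\<bar> \<le> 1" by linarith
    then have "\<bar>real n * (b x - S x)\<bar> \<le> 1" using n0 by (simp add: S_eq[OF x] right_diff_distrib)
    moreover have "\<bar>real n * (b x - S x)\<bar> = real n * \<bar>b x - S x\<bar>" by (simp only: abs_mult abs_of_nat)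
    ultimately have "\<bar>b x - S x\<bar> * real n \<le> 1" by (simp only: mult.commute)
    then show ?thesis using n0 by (simp only: pos_le_divide_eq)
  qed
  have close: "\<bar>(\<integral>x. b x \<partial>Q) - (\<Sum>k\<in>{-m..m}. (real_of_int k / real n) * measure Q (A k))\<bar> \<le> K / real n"
    if Q: "finite_measure Q" "sets Q = sets N'" "measure Q (space N') \<le> K" for Q
  proof -
    interpret Q: finite_measure Q by fact
    have sp: "space Q = space N'" using Q(2) by (rule sets_eq_imp_space_eq)
    have AQ: "A k \<in> sets Q" for k using A Q(2) by simp
    have bQ: "b \<in> borel_measurable Q" using b Q(2) measurable_cong_sets by blast
    have ib: "integrable Q b" using B by (intro Q.integrable_const_bound[where B=B] bQ) auto
    have iA: "integrable Q (indicator (A k) :: 'a \<Rightarrow> real)" for k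
      using AQ Q.emeasure_finite[of "A k"] by (intro integrable_real_indicator) (auto simp: less_top[symmetric])
    then have iS: "integrable Q S" unfolding S_def by (intro Bochner_Integration.integrable_sum integrable_mult_right)
    have "(\<integral>x. S x \<partial>Q) = (\<Sum>k\<in>{-m..m}. (real_of_int k / real n) * measure Q (A k))"
      unfolding S_def using iA AQ by (subst Bochner_Integration.integral_sum) (auto simp: sets.Int_space_eq2)
    then have "\<bar>(\<integral>x. b x \<partial>Q) - (\<Sum>k\<in>{-m..m}. (real_of_int k / real n) * measure Q (A k))\<bar> = \<bar>\<integral>x. b x - S x \<partial>Q\<bar>"
      using ib iS by simp
    also have "\<dots> \<le> (\<integral>x. \<bar>b x - S x\<bar> \<partial>Q)" by (rule integral_abs_bound)
    also have "\<dots> \<le> (\<integral>x. 1 / real n \<partial>Q)"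
      using ib iS S_close by (intro Bochner_Integration.integral_mono) (auto simp: sp)
    also have "\<dots> \<le> K / real n" using Q(3) n0 by (simp add: sp divide_right_mono)
    finally show ?thesis .
  qed
  have "((\<lambda>j. \<Sum>k\<in>{-m..m}. (real_of_int k / real n) * measure (N j) (A k)) \<longlongrightarrow> (\<Sum>k\<in>{-m..m}. (real_of_int k / real n) * measure N' (A k))) F"
    by (intro tendsto_sum tendsto_mult tendsto_const lim A)
  then have "eventually (\<lambda>j. dist (\<Sum>k\<in>{-m..m}. (real_of_int k / real n) * measure (N j) (A k)) (\<Sum>k\<in>{-m..m}. (real_of_int k / real n) * measure N' (A k)) < e / 3) F"
    by (rule tendstoD) (use e in simp)
  then show "eventually (\<lambda>j. dist (\<integral>x. b x \<partial>N j) (\<integral>x. b x \<partial>N') < e) F"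
  proof eventually_elim
    case (elim j)
    define S1 where "S1 = (\<Sum>k\<in>{-m..m}. (real_of_int k / real n) * measure (N j) (A k))"
    define S2 where "S2 = (\<Sum>k\<in>{-m..m}. (real_of_int k / real n) * measure N' (A k))"
    show ?case
      using elim close[OF N(1) s K(1), of j] close[OF N(2) refl K(2)] Kn
      unfolding dist_real_def S1_def[symmetric] S2_def[symmetric] by linarith
  qed
qed

lemma ennreal_le_suminf: "f k \<le> (\<Sum>m. f m :: ennreal)"
  using sum_le_suminf[of f "{k}"] by simp

text \<open>Weak compactness is formulated for finite measures, while \<Omega> may have infinite
  volume; this weight is the density of a finite substitute. It is constant on the shells m \<le>
  |x| < m + 1, with value 2^(-m) over the volume of the ball of radius m + 1. Its lower bounds on
  balls allow a return to Lebesgue measure on compact sets.\<close>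

lemma integrable_weight_exists:
  "\<exists>w :: 'a::euclidean_space \<Rightarrow> real. integrable lborel w \<and> (\<forall>x. 0 < w x) \<and> (\<exists>W. \<forall>x. w x \<le> W) \<and> (\<forall>R. \<exists>d>0. \<forall>x. norm x \<le> R \<longrightarrow> d \<le> w x)"
proof -
  define V where "V m = measure lborel (ball (0::'a) (real m + 1))" for m :: nat
  have V: "0 < V m" for m unfolding V_def by (rule measure_ball_pos) simp
  have Vm: "V m \<le> V m'" if "m \<le> m'" for m m'
    unfolding V_def using that by (simp add: content_ball power_mono mult_left_mono)
  define v where "v m = (1/2) ^ m / V m" for m
  have v: "0 < v m" for m using V by (simp add: v_def)
  have v_anti: "v m' \<le> v m" if "m \<le> m'" for m m'
    unfolding v_def using that V Vm by (intro frac_le power_decreasing) auto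
  define w where "w x = v (nat \<lfloor>norm x\<rfloor>)" for x :: 'a
  have [measurable]: "w \<in> borel_measurable borel" unfolding w_def by measurable
  have "(\<integral>\<^sup>+x. ennreal (norm (w x)) \<partial>lborel) \<le> (\<integral>\<^sup>+x. (\<Sum>m. ennreal (v m) * indicator (ball (0::'a) (real m + 1)) x) \<partial>lborel)"
  proof (rule nn_integral_mono)
    fix x :: 'a
    define m where "m = nat \<lfloor>norm x\<rfloor>"
    have "norm x < real m + 1" unfolding m_def by (simp add: floor_less_iff)
    then have "ennreal (norm (w x)) = ennreal (v m) * indicator (ball 0 (real m + 1)) x"
      using v[of m] by (simp add: w_def m_def[symmetric])
    also have "\<dots> \<le> (\<Sum>m. ennreal (v m) * indicator (ball 0 (real m + 1)) x)"
      by (rule ennreal_le_suminf)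
    finally show "ennreal (norm (w x)) \<le> (\<Sum>m. ennreal (v m) * indicator (ball 0 (real m + 1)) x)" .
  qed
  also have "\<dots> = (\<Sum>m. \<integral>\<^sup>+x. ennreal (v m) * indicator (ball (0::'a) (real m + 1)) x \<partial>lborel)"
    by (rule nn_integral_suminf) simp
  also have "\<dots> = (\<Sum>m. ennreal ((1/2) ^ m))"
  proof (rule suminf_cong)
    fix m
    have "(\<integral>\<^sup>+x. ennreal (v m) * indicator (ball (0::'a) (real m + 1)) x \<partial>lborel) = ennreal (v m) * ennreal (V m)"
      by (subst nn_integral_cmult_indicator) (auto simp: emeasure_ball_eq V_def)
    also have "\<dots> = ennreal ((1/2) ^ m)"
      using V[of m] v[of m] by (simp add: v_def flip: ennreal_mult)
    finally show "(\<integral>\<^sup>+x. ennreal (v m) * indicator (ball (0::'a) (real m + 1)) x \<partial>lborel) = ennreal ((1/2) ^ m)" .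
  qed
  also have "\<dots> = ennreal 2"
  proof (rule suminf_ennreal_eq)
    have "(\<lambda>j. (1/2::real)^j) sums (1 / (1 - 1/2))" by (rule geometric_sums) simp
    then show "(\<lambda>j. (1/2::real)^j) sums 2" by simp
  qed simp
  also have "\<dots> < \<infinity>" by simp
  finally have "integrable lborel w" by (simp add: integrable_iff_bounded)
  moreover have "\<exists>d>0. \<forall>x. norm x \<le> R \<longrightarrow> d \<le> w x" for R
    unfolding w_def by (intro exI[of _ "v (nat \<lfloor>R\<rfloor>)"]) (auto intro!: v v_anti nat_mono floor_mono)
  moreover have "w x \<le> v 0" for x unfolding w_def by (rule v_anti) simp
  ultimately show ?thesis using v by (intro exI[of _ w]) (auto simp: w_def)
qed

subsection \<open>Existence of the weak gradient\<close>

text \<open>By translation invariance F (x + b) - F x has integral 0. By the fundamental theorem and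
  Fubini the same integral is the mean over t in [0, 1] of the integrals of D (x + t b), each of
  which equals the integral of D.\<close>

lemma integral_directional_derivative_eq_0:
  fixes F D :: "'a::euclidean_space \<Rightarrow> real"
  assumes F: "continuous_on UNIV F" and D: "continuous_on UNIV D"
    and deriv: "\<And>x t. ((\<lambda>t. F (x + t *\<^sub>R b)) has_real_derivative D (x + t *\<^sub>R b)) (at t)"
    and supp: "\<And>x. R < norm x \<Longrightarrow> F x = 0" "\<And>x. R < norm x \<Longrightarrow> D x = 0"
  shows "(\<integral>x. D x \<partial>lborel) = 0"
proof -
  have [measurable]: "F \<in> borel_measurable borel" "D \<in> borel_measurable borel"
    using F D by (auto intro: borel_measurable_continuous_onI)
  have int: "integrable lborel u" if u: "continuous_on UNIV u" "\<And>x. R < norm x \<Longrightarrow> u x = 0" for u :: "'a \<Rightarrow> real"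
  proof -
    have "integrable lborel (\<lambda>x. indicator (cball (0::'a) R) x *\<^sub>R u x)"
      by (rule borel_integrable_compact) (auto intro: continuous_on_subset[OF u(1)])
    moreover have "(\<lambda>x. indicator (cball (0::'a) R) x *\<^sub>R u x) = u"
      using u(2) by (force simp: indicator_def fun_eq_iff)
    ultimately show ?thesis by simp
  qed
  note iF = int[OF F supp(1)] and iD = int[OF D supp(2)]
  have shift: "(\<integral>x. u (x + y) \<partial>lborel) = (\<integral>x. u x \<partial>lborel)" if "u \<in> borel_measurable borel" for u :: "'a \<Rightarrow> real" and y
    using integral_lborel_affine[OF that, of 1 y] by (simp add: add.commute)
  have "compact (D ` cball 0 R)" by (intro compact_continuous_image continuous_on_subset[OF D]) auto
  then have "bounded (D ` cball 0 R)" by (rule compact_imp_bounded)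
  then obtain B0 where "\<forall>y\<in>D ` cball 0 R. norm y \<le> B0" unfolding bounded_iff by blast
  then have B0: "\<bar>D x\<bar> \<le> B0" if "x \<in> cball 0 R" for x using that by simp
  define B where "B = max B0 0"
  have B: "\<bar>D x\<bar> \<le> B" "0 \<le> B" for x
  proof -
    show "0 \<le> B" by (simp add: B_def)
    then show "\<bar>D x\<bar> \<le> B"
      using B0[of x] supp(2)[of x] by (cases "norm x \<le> R") (simp_all add: B_def)
  qed
  have FTC: "F (x + b) - F x = (\<integral>t. indicator {0..1} t *\<^sub>R D (x + t *\<^sub>R b) \<partial>lborel)" for x
  proof -
    have "(\<integral>t. indicator {0..1} t *\<^sub>R D (x + t *\<^sub>R b) \<partial>lborel) = F (x + 1 *\<^sub>R b) - F (x + 0 *\<^sub>R b)"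
    proof (rule integral_FTC_Icc)
      show "((\<lambda>t. F (x + t *\<^sub>R b)) has_vector_derivative D (x + t *\<^sub>R b)) (at t within {0..1})" for t :: real
        by (rule has_vector_derivative_at_within[OF deriv[unfolded has_real_derivative_iff_has_vector_derivative]])
      show "continuous_on {0..1} (\<lambda>t. D (x + t *\<^sub>R b))"
        by (intro continuous_on_compose2[OF D] continuous_intros) auto
    qed simp
    then show ?thesis by simp
  qed
  have "0 = (\<integral>x. F (x + b) - F x \<partial>lborel)"
    using shift[of F b] iF integrable_lborel_affine[OF iF, of 1 b] by (simp add: add.commute)
  also have "\<dots> = (\<integral>x. \<integral>t. indicator {0..1} t * D (x + t *\<^sub>R b) \<partial>lborel \<partial>lborel)"
    by (simp add: FTC)
  also have "\<dots> = (\<integral>t. \<integral>x. indicator {0..1} t * D (x + t *\<^sub>R b) \<partial>lborel \<partial>lborel)"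
  proof (rule lborel_pair.Fubini_integral[symmetric, OF integrable_lborel_pair_bound])
    show "integrable lborel (\<lambda>x::'a. indicator (cball 0 (R + norm b)) x * B)"
      by (intro integrable_mult_left integrable_real_indicator) (use emeasure_lborel_cball_finite[of "0::'a" "R + norm b"] in auto)
    show "integrable lborel (indicator {0..1} :: real \<Rightarrow> real)" by (intro integrable_real_indicator) auto
    \<comment> \<open>For t in [0, 1] the shift moves x by at most |b|, so D vanishes on the whole
      segment once |x| exceeds R + |b|.\<close>
    show "norm (indicator {0..1} t * D (x + t *\<^sub>R b)) \<le> \<bar>indicator (cball 0 (R + norm b)) x * B\<bar> * \<bar>indicator {0..1} t\<bar>" for x and t :: real
    proof (cases "t \<in> {0..1} \<and> norm x > R + norm b")
      case True
      then have "norm (t *\<^sub>R b) \<le> norm b" by (simp add: mult_left_le_one_le)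
      then have "R < norm (x + t *\<^sub>R b)" using True norm_triangle_ineq4[of "x + t *\<^sub>R b" "t *\<^sub>R b"] by simp
      then show ?thesis using supp(2) by simp
    next
      case False
      then show ?thesis using B by (auto simp: indicator_def)
    qed
  qed measurable
  also have "\<dots> = (\<integral>t. indicator {0..1::real} t * (\<integral>x. D x \<partial>lborel) \<partial>lborel)"
    using shift[of D] by simp
  also have "\<dots> = (\<integral>x. D x \<partial>lborel)" by simp
  finally show ?thesis by simp
qed

lemma test_function_facts:
  assumes "test_function \<Omega> \<eta>"
  shows "continuous_on UNIV \<eta>" "\<And>x. (\<eta> has_derivative frechet_derivative \<eta> (at x)) (at x)"
    "\<And>b. b \<in> Basis \<Longrightarrow> continuous_on UNIV (\<lambda>x. frechet_derivative \<eta> (at x) b)"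
    "\<And>x b. x \<notin> closure {x. \<eta> x \<noteq> 0} \<Longrightarrow> frechet_derivative \<eta> (at x) b = 0"
proof -
  have k: "k_times_cont_diff n \<eta>" for n using assms by (simp add: test_function_def)
  have k1: "k_times_cont_diff (Suc 0) \<eta>" by (rule k)
  show "continuous_on UNIV \<eta>" using k[of 0] by simp
  show d: "(\<eta> has_derivative frechet_derivative \<eta> (at x)) (at x)" for x
    using k1 by (auto simp: differentiable_on_def frechet_derivative_works)
  show "continuous_on UNIV (\<lambda>x. frechet_derivative \<eta> (at x) b)" if "b \<in> Basis" for b
    using k1 that by simp
  show "frechet_derivative \<eta> (at x) b = 0" if x: "x \<notin> closure {x. \<eta> x \<noteq> 0}" for x b
  proof -
    have "((\<lambda>_. 0) has_derivative (\<lambda>_. 0)) (at x)" by simp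
    then have "(\<eta> has_derivative (\<lambda>_. 0)) (at x)"
    proof (rule has_derivative_transform_within_open[where s="- closure {x. \<eta> x \<noteq> 0}"])
      show "0 = \<eta> y" if "y \<in> - closure {x. \<eta> x \<noteq> 0}" for y
        using that closure_subset[of "{x. \<eta> x \<noteq> 0}"] by auto
    qed (use x in auto)
    then show ?thesis using frechet_derivative_at[of \<eta> "\<lambda>_. 0" x] by metis
  qed
qed

lemma continuous_compact_support:
  fixes u :: "'a::euclidean_space \<Rightarrow> real"
  assumes u: "continuous_on UNIV u" "\<And>x. x \<notin> S \<Longrightarrow> u x = 0" and S: "compact S"
  shows "integrable lborel u" "\<exists>B\<ge>0. \<forall>x. \<bar>u x\<bar> \<le> B" "u \<in> borel_measurable borel"
proof -
  have "integrable lborel (\<lambda>x. indicator S x *\<^sub>R u x)"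
    by (rule borel_integrable_compact[OF S]) (auto intro: continuous_on_subset[OF u(1)])
  moreover have "(\<lambda>x. indicator S x *\<^sub>R u x) = u"
    using u(2) by (force simp: indicator_def fun_eq_iff)
  ultimately show "integrable lborel u" by simp
  have "bounded (u ` S)"
    by (intro compact_imp_bounded compact_continuous_image S continuous_on_subset[OF u(1)]) auto
  then obtain B where "\<forall>y\<in>u ` S. norm y \<le> B" unfolding bounded_iff by blast
  then have B: "\<bar>u x\<bar> \<le> max B 0" for x using u(2)[of x] by (cases "x \<in> S") (auto simp: le_max_iff_disj)
  show "\<exists>B\<ge>0. \<forall>x. \<bar>u x\<bar> \<le> B" using B by (intro exI[of _ "max B 0"]) auto
  show "u \<in> borel_measurable borel" by (rule borel_measurable_continuous_onI[OF u(1)])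
qed

lemma test_function_support:
  assumes "test_function \<Omega> \<eta>" and b: "b \<in> Basis"
  defines "S \<equiv> closure {x. \<eta> x \<noteq> 0}"
  shows "compact S" "S \<subseteq> \<Omega>" "\<And>x. x \<notin> S \<Longrightarrow> \<eta> x = 0" "\<And>x. x \<notin> S \<Longrightarrow> frechet_derivative \<eta> (at x) b = 0"
proof -
  show "compact S" "S \<subseteq> \<Omega>" using assms(1) by (auto simp: test_function_def S_def)
  show "\<eta> x = 0" if "x \<notin> S" for x using that closure_subset[of "{x. \<eta> x \<noteq> 0}"] by (auto simp: S_def)
  show "frechet_derivative \<eta> (at x) b = 0" if "x \<notin> S" for x
    using test_function_facts(4)[OF assms(1)] that by (simp add: S_def)
qed

text \<open>The product of the bump and \<eta> has compact support, so its directional derivative,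
  given by the product rule, integrates to 0.\<close>

lemma bump_integration_by_parts:
  fixes \<eta> :: "'a::euclidean_space \<Rightarrow> real"
  assumes \<eta>: "test_function \<Omega> \<eta>" and b: "b \<in> Basis"
  shows "(\<integral>x. (bump_grad r (x - y) \<bullet> b) * \<eta> x \<partial>lborel) = - (\<integral>x. bump r (x - y) * frechet_derivative \<eta> (at x) b \<partial>lborel)"
proof -
  define D where "D x = frechet_derivative \<eta> (at x) b" for x
  note supp = test_function_support[OF \<eta> b]
  obtain R where R: "\<And>x. x \<in> closure {x. \<eta> x \<noteq> 0} \<Longrightarrow> norm x \<le> R"
    using compact_imp_bounded[OF supp(1)] unfolding bounded_iff by blast
  have S: "\<eta> x = 0" "D x = 0" if "R < norm x" for x
    using supp(3,4)[of x] R[of x] that by (auto simp: D_def)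
  have c: "continuous_on UNIV \<eta>" "continuous_on UNIV D"
    unfolding D_def using test_function_facts[OF \<eta>] b by auto
  have i1: "integrable lborel (\<lambda>x. (bump_grad r (x - y) \<bullet> b) * \<eta> x)"
    by (rule continuous_compact_support(1)[OF _ _ compact_cball[of 0 R]]) (auto intro!: continuous_intros c simp: S)
  have i2: "integrable lborel (\<lambda>x. bump r (x - y) * D x)"
    by (rule continuous_compact_support(1)[OF _ _ compact_cball[of 0 R]]) (auto intro!: continuous_intros c simp: S)
  have "(\<integral>x. (bump_grad r (x - y) \<bullet> b) * \<eta> x + bump r (x - y) * D x \<partial>lborel) = 0"
  proof (rule integral_directional_derivative_eq_0[where F="\<lambda>x. bump r (x - y) * \<eta> x" and b=b and R=R])
    show "continuous_on UNIV (\<lambda>x. bump r (x - y) * \<eta> x)"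
      "continuous_on UNIV (\<lambda>x. (bump_grad r (x - y) \<bullet> b) * \<eta> x + bump r (x - y) * D x)"
      by (intro continuous_intros c)+
    fix x t
    have l: "((\<lambda>t. x + t *\<^sub>R b) has_derivative (\<lambda>s. s *\<^sub>R b)) (at t)"
      by (auto intro!: derivative_eq_intros)
    have d1: "((\<lambda>t. bump r (x + t *\<^sub>R b - y)) has_derivative (\<lambda>s. bump_grad r (x + t *\<^sub>R b - y) \<bullet> (s *\<^sub>R b))) (at t)"
      by (rule has_derivative_compose[OF l bump_derivative])
    have d2: "((\<lambda>t. \<eta> (x + t *\<^sub>R b)) has_derivative (\<lambda>s. frechet_derivative \<eta> (at (x + t *\<^sub>R b)) (s *\<^sub>R b))) (at t)"
      by (rule has_derivative_compose[OF l test_function_facts(2)[OF \<eta>]])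
    have lin: "frechet_derivative \<eta> (at z) (s *\<^sub>R b) = s * D z" for z s
      unfolding D_def using linear_scale[OF has_derivative_linear[OF test_function_facts(2)[OF \<eta>]]] by simp
    have "((\<lambda>t. bump r (x + t *\<^sub>R b - y) * \<eta> (x + t *\<^sub>R b)) has_derivative
       (\<lambda>s. ((bump_grad r (x + t *\<^sub>R b - y) \<bullet> b) * \<eta> (x + t *\<^sub>R b) + bump r (x + t *\<^sub>R b - y) * D (x + t *\<^sub>R b)) * s)) (at t)"
      by (rule has_derivative_eq_rhs[OF has_derivative_mult[OF d1 d2]]) (simp add: fun_eq_iff lin algebra_simps)
    then show "((\<lambda>t. bump r (x + t *\<^sub>R b - y) * \<eta> (x + t *\<^sub>R b)) has_real_derivative
       (bump_grad r (x + t *\<^sub>R b - y) \<bullet> b) * \<eta> (x + t *\<^sub>R b) + bump r (x + t *\<^sub>R b - y) * D (x + t *\<^sub>R b)) (at t)"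
      unfolding has_field_derivative_def .
  qed (simp_all add: S)
  then show ?thesis using i1 i2 by (simp add: D_def)
qed

text \<open>Fubini on both sides of an integration by parts in x for fixed y.\<close>

lemma mollified_grad_duality:
  fixes f :: "'a::euclidean_space \<Rightarrow> real"
  assumes f: "integrable lborel f" and \<eta>: "test_function \<Omega> \<eta>" and b: "b \<in> Basis" and r: "0 < r"
  shows "(\<integral>x. (mollified_grad f r x \<bullet> b) * \<eta> x \<partial>lborel) = - (\<integral>x. kconv (mollifier r) f x * frechet_derivative \<eta> (at x) b \<partial>lborel)"
proof -
  define D where "D x = frechet_derivative \<eta> (at x) b" for x
  define N where "N = bump_mass TYPE('a) r"
  have fm [measurable]: "f \<in> borel_measurable borel" using borel_measurable_integrable[OF f] by simp
  note supp = test_function_support[OF \<eta> b]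
  have \<eta>f: "integrable lborel \<eta>" "\<eta> \<in> borel_measurable borel"
    using continuous_compact_support[OF test_function_facts(1)[OF \<eta>] supp(3,1)] by auto
  have Df: "integrable lborel D" "D \<in> borel_measurable borel"
    using continuous_compact_support[OF test_function_facts(3)[OF \<eta> b] supp(4,1)] by (auto simp: D_def[abs_def])
  note [measurable] = \<eta>f(2) Df(2)
  have iG: "integrable lborel (\<lambda>y. f y *\<^sub>R bump_grad r (x - y))" for x
  proof (rule Bochner_Integration.integrable_bound)
    show "integrable lborel (\<lambda>y. 4 / r * f y)" using f by simp
    show "AE y in lborel. norm (f y *\<^sub>R bump_grad r (x - y)) \<le> norm (4 / r * f y)"
    proof (rule AE_I2)
      fix y
      show "norm (f y *\<^sub>R bump_grad r (x - y)) \<le> norm (4 / r * f y)"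
        using mult_left_mono[OF norm_bump_grad_le[OF r, of "x - y"], of "\<bar>f y\<bar>"] r by (simp add: abs_mult mult_ac)
    qed
  qed simp
  define \<Phi> where "\<Phi> x y = f y * ((bump_grad r (x - y) \<bullet> b) * \<eta> x)" for x y
  define \<Psi> where "\<Psi> x y = f y * (bump r (x - y) * D x)" for x y
  have i\<Phi>: "integrable (lborel \<Otimes>\<^sub>M lborel) (case_prod \<Phi>)"
  proof (rule integrable_lborel_pair_bound[OF _ _ f])
    show "integrable lborel (\<lambda>x. 4 / r * \<eta> x)" using \<eta>f by simp
    show "case_prod \<Phi> \<in> borel_measurable (lborel \<Otimes>\<^sub>M lborel)" unfolding \<Phi>_def by measurable
    show "norm (\<Phi> x y) \<le> \<bar>4 / r * \<eta> x\<bar> * \<bar>f y\<bar>" for x y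
    proof -
      have "\<bar>bump_grad r (x - y) \<bullet> b\<bar> \<le> 4 / r"
        using Basis_le_norm[OF b, of "bump_grad r (x - y)"] norm_bump_grad_le[OF r, of "x - y"] by linarith
      from mult_right_mono[OF this, of "\<bar>\<eta> x\<bar> * \<bar>f y\<bar>"] show ?thesis
        using r by (simp add: \<Phi>_def abs_mult mult_ac)
    qed
  qed
  have i\<Psi>: "integrable (lborel \<Otimes>\<^sub>M lborel) (case_prod \<Psi>)"
  proof (rule integrable_lborel_pair_bound[OF _ Df(1) f])
    show "case_prod \<Psi> \<in> borel_measurable (lborel \<Otimes>\<^sub>M lborel)" unfolding \<Psi>_def by measurable
    show "norm (\<Psi> x y) \<le> \<bar>D x\<bar> * \<bar>f y\<bar>" for x y
      using mult_right_mono[OF bump_le[of r "x - y"], of "\<bar>D x\<bar> * \<bar>f y\<bar>"] bump_nonneg[of r "x - y"]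
      by (simp add: \<Psi>_def abs_mult mult_ac)
  qed
  have "(mollified_grad f r x \<bullet> b) * \<eta> x = (1 / N) * (\<integral>y. \<Phi> x y \<partial>lborel)" for x
  proof -
    have "(\<integral>y. f y *\<^sub>R bump_grad r (x - y) \<partial>lborel) \<bullet> b = (\<integral>y. (f y *\<^sub>R bump_grad r (x - y)) \<bullet> b \<partial>lborel)"
      using iG by (subst integral_inner_left) auto
    then have "(mollified_grad f r x \<bullet> b) * \<eta> x = (1 / N) * ((\<integral>y. (f y *\<^sub>R bump_grad r (x - y)) \<bullet> b \<partial>lborel) * \<eta> x)"
      by (simp add: mollified_grad_def N_def divide_inverse)
    also have "(\<integral>y. (f y *\<^sub>R bump_grad r (x - y)) \<bullet> b \<partial>lborel) * \<eta> x = (\<integral>y. ((f y *\<^sub>R bump_grad r (x - y)) \<bullet> b) * \<eta> x \<partial>lborel)"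
      by simp
    finally show ?thesis by (simp add: \<Phi>_def mult.assoc)
  qed
  then have "(\<integral>x. (mollified_grad f r x \<bullet> b) * \<eta> x \<partial>lborel) = (1 / N) * (\<integral>x. \<integral>y. \<Phi> x y \<partial>lborel \<partial>lborel)"
    by simp
  also have "(\<integral>x. \<integral>y. \<Phi> x y \<partial>lborel \<partial>lborel) = (\<integral>y. \<integral>x. \<Phi> x y \<partial>lborel \<partial>lborel)"
    by (rule lborel_pair.Fubini_integral[symmetric, OF i\<Phi>])
  also have "\<dots> = (\<integral>y. - (\<integral>x. \<Psi> x y \<partial>lborel) \<partial>lborel)"
    using bump_integration_by_parts[OF \<eta> b, of r] by (simp add: \<Phi>_def \<Psi>_def D_def)
  also have "\<dots> = - (\<integral>y. \<integral>x. \<Psi> x y \<partial>lborel \<partial>lborel)" by (rule integral_minus)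
  also have "(\<integral>y. \<integral>x. \<Psi> x y \<partial>lborel \<partial>lborel) = (\<integral>x. \<integral>y. \<Psi> x y \<partial>lborel \<partial>lborel)"
    by (rule lborel_pair.Fubini_integral[OF i\<Psi>])
  also have "(1 / N) * - (\<integral>x. \<integral>y. \<Psi> x y \<partial>lborel \<partial>lborel) = - (\<integral>x. (1 / N) * (\<integral>y. \<Psi> x y \<partial>lborel) \<partial>lborel)"
    by simp
  also have "(\<lambda>x. (1 / N) * (\<integral>y. \<Psi> x y \<partial>lborel)) = (\<lambda>x. kconv (mollifier r) f x * D x)"
  proof
    fix x
    have "(\<integral>y. \<Psi> x y \<partial>lborel) = (\<integral>y. (bump r (x - y) * f y) * D x \<partial>lborel)"
      by (rule Bochner_Integration.integral_cong[OF refl]) (simp add: \<Psi>_def mult_ac)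
    then have "(\<integral>y. \<Psi> x y \<partial>lborel) = (\<integral>y. bump r (x - y) * f y \<partial>lborel) * D x"
      by (simp only: integral_mult_left_zero)
    moreover have "kconv (mollifier r) f x = (1 / N) * (\<integral>y. bump r (x - y) * f y \<partial>lborel)"
      by (simp add: kconv_def mollifier_def N_def)
    ultimately show "(1 / N) * (\<integral>y. \<Psi> x y \<partial>lborel) = kconv (mollifier r) f x * D x" by simp
  qed
  finally show ?thesis by (simp add: D_def)
qed

lemma integrable_kconv:
  fixes u :: "'a::euclidean_space \<Rightarrow> 'b::{banach, second_countable_topology}"
  assumes k: "averaging_kernel r k" and u: "integrable lborel u"
  shows "integrable lborel (kconv k u)"
  unfolding integrable_iff_bounded
proof
  have [measurable]: "k \<in> borel_measurable borel" "u \<in> borel_measurable borel"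
    using averaging_kernelD[OF k] borel_measurable_integrable[OF u] by auto
  show "kconv k u \<in> borel_measurable lborel" by simp
  have "(\<integral>\<^sup>+x. ennreal (norm (kconv k u x)) \<partial>lborel) \<le> (\<integral>\<^sup>+x. \<integral>\<^sup>+y. ennreal (k (x - y)) * ennreal (norm (u y)) \<partial>lborel \<partial>lborel)"
  proof (rule nn_integral_mono)
    fix x
    have "ennreal (norm (kconv k u x)) \<le> (\<integral>\<^sup>+y. ennreal (\<bar>k (x - y)\<bar> * norm (u y)) \<partial>lborel)" by (rule norm_kconv_le)
    also have "\<dots> = (\<integral>\<^sup>+y. ennreal (k (x - y)) * ennreal (norm (u y)) \<partial>lborel)"
      using averaging_kernelD(2)[OF k] by (intro nn_integral_cong) (simp add: ennreal_mult)
    finally show "ennreal (norm (kconv k u x)) \<le> (\<integral>\<^sup>+y. ennreal (k (x - y)) * ennreal (norm (u y)) \<partial>lborel)" .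
  qed
  also have "\<dots> = (\<integral>\<^sup>+y. ennreal (norm (u y)) \<partial>lborel)"
    by (rule nn_integral_kernel_average[OF k]) simp
  also have "\<dots> < \<infinity>" using u by (simp add: integrable_iff_bounded)
  finally show "(\<integral>\<^sup>+x. ennreal (norm (kconv k u x)) \<partial>lborel) < \<infinity>" .
qed

text \<open>Duality puts the derivative on \<eta>, and mollifications converge in L^1. The support
  of \<eta> keeps a positive distance from the complement of \<Omega>, so for small radii neither
  the truncation of f nor the restriction to \<open>inner_part\<close> is visible under the
  integral.\<close>

lemma mollified_grad_distributional_limit:
  fixes f :: "'a::euclidean_space \<Rightarrow> real"
  assumes \<Omega>: "open \<Omega>" and fm [measurable]: "f \<in> borel_measurable borel"
    and f: "\<And>K. compact K \<Longrightarrow> K \<subseteq> \<Omega> \<Longrightarrow> integrable lborel (\<lambda>x. indicator K x *\<^sub>R f x)"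
    and r: "\<And>j::nat. 0 < r j" "r \<longlonglongrightarrow> 0" and \<eta>: "test_function \<Omega> \<eta>" and b: "b \<in> Basis"
  shows "(\<lambda>j. \<integral>x. ((indicator (inner_part \<Omega> (r j)) x *\<^sub>R mollified_grad f (r j) x) \<bullet> b) * \<eta> x \<partial>lborel)
     \<longlonglongrightarrow> - (\<integral>x. f x * frechet_derivative \<eta> (at x) b \<partial>lborel)"
proof -
  define D where "D x = frechet_derivative \<eta> (at x) b" for x
  define S where "S = closure {x. \<eta> x \<noteq> 0}"
  note supp = test_function_support[OF \<eta> b, folded S_def]
  obtain \<rho> where \<rho>: "0 < \<rho>" "(\<Union>x\<in>S. cball x \<rho>) \<subseteq> \<Omega>"
    using compact_subset_open_imp_cball_epsilon_subset[OF supp(1) \<Omega> supp(2)] by metis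
  \<comment> \<open>A neighbourhood of the support that still lies in \<Omega>, and compact as the
    sum of two compact sets.\<close>
  define K where "K = {x + y | x y. x \<in> S \<and> y \<in> cball 0 \<rho>}"
  have cK: "compact K" unfolding K_def by (rule compact_sums[OF supp(1) compact_cball])
  have cb: "cball x \<rho> \<subseteq> K" if "x \<in> S" for x
  proof
    fix z assume "z \<in> cball x \<rho>"
    then have "z = x + (z - x) \<and> x \<in> S \<and> z - x \<in> cball 0 \<rho>" using that by (simp add: dist_norm norm_minus_commute)
    then show "z \<in> K" unfolding K_def by blast
  qed
  have "K \<subseteq> (\<Union>x\<in>S. cball x \<rho>)" unfolding K_def by (force simp: dist_norm)
  then have K\<Omega>: "K \<subseteq> \<Omega>" using \<rho>(2) by blast
  define f1 where "f1 x = indicator K x *\<^sub>R f x" for x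
  have f1: "integrable lborel f1" unfolding f1_def by (rule f[OF cK K\<Omega>])
  have [measurable]: "f1 \<in> borel_measurable borel" using borel_measurable_integrable[OF f1] by simp
  obtain B where Dm [measurable]: "D \<in> borel_measurable borel" and B: "0 \<le> B" "\<And>x. \<bar>D x\<bar> \<le> B"
    using continuous_compact_support[OF test_function_facts(3)[OF \<eta> b] supp(4,1)] by (auto simp: D_def[abs_def])
  have iD: "integrable lborel (\<lambda>x. u x * D x)" if "integrable lborel u" for u :: "'a \<Rightarrow> real"
  proof (rule Bochner_Integration.integrable_bound)
    show "integrable lborel (\<lambda>x. B * u x)" using that by simp
    show "(\<lambda>x. u x * D x) \<in> borel_measurable lborel" using borel_measurable_integrable[OF that] by simp
    show "AE x in lborel. norm (u x * D x) \<le> norm (B * u x)"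
    proof (rule AE_I2)
      fix x
      show "norm (u x * D x) \<le> norm (B * u x)"
        using mult_right_mono[OF B(2)[of x], of "\<bar>u x\<bar>"] B(1) by (simp add: abs_mult mult_ac)
    qed
  qed
  note ak = averaging_kernel_mollifier[OF r(1), where 'a='a]
  have [measurable]: "(mollifier (r j) :: 'a \<Rightarrow> real) \<in> borel_measurable borel" for j using averaging_kernelD(1)[OF ak] .
  have "(\<lambda>j. \<integral>x. kconv (mollifier (r j)) f1 x * D x \<partial>lborel) \<longlonglongrightarrow> (\<integral>x. f1 x * D x \<partial>lborel)"
  proof (rule tendsto_L1_int)
    show "integrable lborel (\<lambda>x. kconv (mollifier (r j)) f1 x * D x)" for j
      by (rule iD[OF integrable_kconv[OF ak f1]])
    show "integrable lborel (\<lambda>x. f1 x * D x)" by (rule iD[OF f1])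
    have "(\<lambda>j. ennreal B * (\<integral>\<^sup>+x. ennreal (norm (kconv (mollifier (r j)) f1 x - f1 x)) \<partial>lborel)) \<longlonglongrightarrow> ennreal B * 0"
      by (intro ennreal_tendsto_cmult kconv_L1_tendsto[OF ak f1 r(2)]) simp
    then have lim0: "(\<lambda>j. ennreal B * (\<integral>\<^sup>+x. ennreal (norm (kconv (mollifier (r j)) f1 x - f1 x)) \<partial>lborel)) \<longlonglongrightarrow> 0" by simp
    show "(\<lambda>j. \<integral>\<^sup>+x. ennreal (norm (kconv (mollifier (r j)) f1 x * D x - f1 x * D x)) \<partial>lborel) \<longlonglongrightarrow> 0"
    proof (rule tendsto_0_le_ennreal[OF _ lim0])
      fix j
      have "(\<integral>\<^sup>+x. ennreal (norm (kconv (mollifier (r j)) f1 x * D x - f1 x * D x)) \<partial>lborel) \<le>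
         (\<integral>\<^sup>+x. ennreal B * ennreal (norm (kconv (mollifier (r j)) f1 x - f1 x)) \<partial>lborel)"
      proof (rule nn_integral_mono)
        fix x
        show "ennreal (norm (kconv (mollifier (r j)) f1 x * D x - f1 x * D x)) \<le> ennreal B * ennreal (norm (kconv (mollifier (r j)) f1 x - f1 x))"
        proof -
          have eq: "kconv (mollifier (r j)) f1 x * D x - f1 x * D x = D x * (kconv (mollifier (r j)) f1 x - f1 x)"
            by (simp add: algebra_simps)
          have "ennreal (\<bar>D x\<bar> * \<bar>kconv (mollifier (r j)) f1 x - f1 x\<bar>) \<le> ennreal (B * \<bar>kconv (mollifier (r j)) f1 x - f1 x\<bar>)"
            by (intro ennreal_leI mult_right_mono B) simp
          then show ?thesis unfolding eq using B(1) by (simp add: abs_mult ennreal_mult)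
        qed
      qed
      then show "(\<integral>\<^sup>+x. ennreal (norm (kconv (mollifier (r j)) f1 x * D x - f1 x * D x)) \<partial>lborel) \<le>
         ennreal B * (\<integral>\<^sup>+x. ennreal (norm (kconv (mollifier (r j)) f1 x - f1 x)) \<partial>lborel)"
        by (simp add: nn_integral_cmult)
    qed
  qed
  then have "(\<lambda>j. - (\<integral>x. kconv (mollifier (r j)) f1 x * D x \<partial>lborel)) \<longlonglongrightarrow> - (\<integral>x. f1 x * D x \<partial>lborel)"
    by (rule tendsto_minus)
  moreover have "(\<lambda>x. f1 x * D x) = (\<lambda>x. f x * D x)"
  proof
    fix x
    show "f1 x * D x = f x * D x"
    proof (cases "x \<in> S")
      case True
      then have "x \<in> K" using cb[OF True] \<rho>(1) by auto
      then show ?thesis by (simp add: f1_def)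
    qed (use supp(4) in \<open>simp add: D_def\<close>)
  qed
  moreover have "eventually (\<lambda>j. r j < \<rho>) sequentially" by (rule order_tendstoD(2)[OF r(2) \<rho>(1)])
  then have "eventually (\<lambda>j. - (\<integral>x. kconv (mollifier (r j)) f1 x * D x \<partial>lborel) =
     (\<integral>x. ((indicator (inner_part \<Omega> (r j)) x *\<^sub>R mollified_grad f (r j) x) \<bullet> b) * \<eta> x \<partial>lborel)) sequentially"
  proof eventually_elim
    case (elim j)
    have "((indicator (inner_part \<Omega> (r j)) x *\<^sub>R mollified_grad f (r j) x) \<bullet> b) * \<eta> x = (mollified_grad f1 (r j) x \<bullet> b) * \<eta> x" for x
    proof (cases "x \<in> S")
      case True
      have "x \<in> inner_part \<Omega> (r j)"
        using inner_partI[OF \<Omega> order_trans[OF cb[OF True] K\<Omega>] r(1) elim] .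
      moreover have "mollified_grad f (r j) x = mollified_grad f1 (r j) x"
      proof -
        have "f y *\<^sub>R bump_grad (r j) (x - y) = f1 y *\<^sub>R bump_grad (r j) (x - y)" for y
        proof (cases "y \<in> K")
          case False
          then have "y \<notin> cball x \<rho>" using cb[OF True] by blast
          then have "r j \<le> norm (x - y)" using elim by (simp add: dist_norm)
          then show ?thesis by (simp add: bump_grad_eq_0[OF r(1)])
        qed (simp add: f1_def)
        then show ?thesis unfolding mollified_grad_def by (simp only:)
      qed
      ultimately show ?thesis by simp
    qed (use supp(3) in simp)
    then have "(\<integral>x. ((indicator (inner_part \<Omega> (r j)) x *\<^sub>R mollified_grad f (r j) x) \<bullet> b) * \<eta> x \<partial>lborel) =
        (\<integral>x. (mollified_grad f1 (r j) x \<bullet> b) * \<eta> x \<partial>lborel)"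
      by (simp only:)
    then show ?case unfolding D_def mollified_grad_duality[OF f1 \<eta> b r(1), of j] by (rule sym)
  qed
  ultimately show ?thesis
    unfolding D_def by (auto intro: Lim_transform_eventually)
qed

section \<open>From bounded slice integrals to a weak gradient\<close>

context regular_phi
begin

text \<open>The norm is split at height M by \<open>t_le_phi\<close>. The part below M costs a
  multiple of the weighted measure of \<open>A\<close>; the remainder is at most a multiple of a(M)
  times the slice integral, and a(M) tends to 0 because p > 1. The bound W on the weight makes this
  independent of \<open>A\<close> and r.\<close>

lemma mollified_grad_uniformly_integrable:
  assumes fm: "f \<in> borel_measurable borel"
    and f: "\<And>K. compact K \<Longrightarrow> K \<subseteq> \<Omega> \<Longrightarrow> integrable lborel (\<lambda>x. indicator K x *\<^sub>R f x)"
    and w: "w \<in> borel_measurable borel" "\<And>x. 0 < w x" "\<And>x. w x \<le> W" and e: "0 < e" and K: "0 \<le> K"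
  obtains C where "\<And>r A. 0 < r \<Longrightarrow> sharp_slice f r \<le> ennreal K \<Longrightarrow> A \<in> sets borel \<Longrightarrow>
    (\<integral>\<^sup>+x. ennreal (w x) * (ennreal (norm (indicator (inner_part \<Omega> r) x *\<^sub>R mollified_grad f r x)) * indicator A x) \<partial>lborel)
      \<le> ennreal C * (\<integral>\<^sup>+x. ennreal (w x) * indicator A x \<partial>lborel) + ennreal e"
proof -
  note [measurable] = w(1) fm
  define c0 where "c0 = 2 * grad_const TYPE('a)"
  have c0: "0 < c0" using grad_const_pos[where 'a='a] by (simp add: c0_def)
  have W: "0 < W" using w(2,3)[of undefined] by linarith
  define a where "a M = c * \<sigma> powr p * M powr (1 - p)" for M
  have a0: "0 \<le> a M" for M using c_ge by (simp add: a_def)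
  have "((\<lambda>M. W * (c0 * (c * \<sigma> powr p * M powr (1 - p)) * K)) \<longlongrightarrow> W * (c0 * (c * \<sigma> powr p * 0) * K)) at_top"
    using p_gt by (intro tendsto_mult tendsto_const tendsto_neg_powr filterlim_ident) simp
  then have "eventually (\<lambda>M. W * (c0 * a M * K) < e) at_top"
    unfolding a_def using e by (intro order_tendstoD(2)) auto
  with eventually_ge_at_top[of \<sigma>] have "eventually (\<lambda>M. \<sigma> \<le> M \<and> W * (c0 * a M * K) < e) at_top" by eventually_elim simp
  then obtain M where M: "\<sigma> \<le> M" "W * (c0 * a M * K) < e" 
    using eventually_happens by force
  have M0: "0 < M" using M(1) \<sigma>_pos by linarith
  show ?thesis
  proof (rule that[of "c0 * M"])
    fix r and A :: "'a set" assume r: "0 < r" and sl: "sharp_slice f r \<le> ennreal K" and A [measurable]: "A \<in> sets borel"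
    define P where "P x = indicator (inner_part \<Omega> r) x * phi_upper x (norm (mollified_grad f r x) / c0)" for x
    have [measurable]: "inner_part \<Omega> r \<in> sets borel" using open_inner_part[OF open_\<Omega>] by simp
    have [measurable]: "(\<lambda>x. phi_upper x (norm (mollified_grad f r x) / c0)) \<in> borel_measurable (lebesgue_on \<Omega>)"
      by (rule upper_measurable[OF borel_measurable_lebesgue_onI]) (use c0 in auto)
    have [measurable]: "indicator (inner_part \<Omega> r) \<in> borel_measurable (lebesgue_on \<Omega>)"
      by (intro borel_measurable_lebesgue_onI borel_measurable_indicator) simp
    have "P \<in> borel_measurable (lebesgue_on \<Omega>)" unfolding P_def by measurable
    then have Pm [measurable]: "(\<lambda>x. P x * indicator \<Omega> x) \<in> borel_measurable lebesgue"
      using open_\<Omega> by (subst (asm) borel_measurable_restrict_space_iff_ennreal) auto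
    have "(\<integral>\<^sup>+x. P x * indicator \<Omega> x \<partial>lebesgue) = (\<integral>\<^sup>+x. P x \<partial>lebesgue_on \<Omega>)"
      using open_\<Omega> by (subst nn_integral_restrict_space) auto
    also have "\<dots> \<le> sharp_slice f r"
      using mollified_grad_slice_le[OF fm r f] by (simp add: P_def c0_def)
    finally have PK: "(\<integral>\<^sup>+x. P x * indicator \<Omega> x \<partial>lebesgue) \<le> ennreal K" using sl by (rule order_trans)
    have "(\<integral>\<^sup>+x. ennreal (w x) * (ennreal (norm (indicator (inner_part \<Omega> r) x *\<^sub>R mollified_grad f r x)) * indicator A x) \<partial>lborel) =
       (\<integral>\<^sup>+x. ennreal (w x) * (ennreal (norm (indicator (inner_part \<Omega> r) x *\<^sub>R mollified_grad f r x)) * indicator A x) \<partial>lebesgue)"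
      by (simp add: nn_integral_completion)
    also have "\<dots> \<le> (\<integral>\<^sup>+x. ennreal (c0 * M) * (ennreal (w x) * indicator A x) + ennreal (W * (c0 * a M)) * (P x * indicator \<Omega> x) \<partial>lebesgue)"
    proof (rule nn_integral_mono_AE, unfold AE_completion_iff, use t_le_phi[OF M(1)] in eventually_elim)
      case (elim x)
      show ?case
      proof (cases "x \<in> inner_part \<Omega> r \<and> x \<in> A")
        case True
        then have x: "x \<in> \<Omega>" using inner_part_subset by blast
        define t where "t = norm (mollified_grad f r x) / c0"
        have t: "0 \<le> t" "norm (mollified_grad f r x) = c0 * t" using c0 by (simp_all add: t_def)
        have "ennreal t \<le> ennreal M + ennreal (a M) * \<phi> x t" using elim x t by (simp add: a_def)
        also have "\<dots> \<le> ennreal M + ennreal (a M) * phi_upper x t" by (intro add_left_mono mult_left_mono phi_le_upper x t) simp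
        finally have "ennreal (w x) * (ennreal c0 * ennreal t) \<le> ennreal (w x) * (ennreal c0 * (ennreal M + ennreal (a M) * phi_upper x t))"
          by (intro mult_left_mono) auto
        also have "\<dots> = ennreal (c0 * M) * ennreal (w x) + ennreal (w x) * (ennreal (c0 * a M) * phi_upper x t)"
          using c0 M0 a0 by (simp add: ennreal_mult distrib_left mult_ac)
        also have "\<dots> \<le> ennreal (c0 * M) * ennreal (w x) + ennreal W * (ennreal (c0 * a M) * phi_upper x t)"
          using w(3) by (intro add_left_mono mult_right_mono ennreal_leI) auto
        also have "ennreal W * (ennreal (c0 * a M) * phi_upper x t) = ennreal (W * (c0 * a M)) * (P x * indicator \<Omega> x)"
          using True x W c0 a0 by (simp add: P_def t_def ennreal_mult mult.assoc)
        finally show ?thesis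
          using True t c0 by (simp add: ennreal_mult)
      qed auto
    qed
    also have "\<dots> = ennreal (c0 * M) * (\<integral>\<^sup>+x. ennreal (w x) * indicator A x \<partial>lebesgue) + ennreal (W * (c0 * a M)) * (\<integral>\<^sup>+x. P x * indicator \<Omega> x \<partial>lebesgue)"
    proof -
      have wm [measurable]: "(\<lambda>x. ennreal (w x) * indicator A x) \<in> borel_measurable lebesgue"
        by (intro measurable_completion) simp
      show ?thesis by (simp add: nn_integral_add nn_integral_cmult)
    qed
    also have "\<dots> \<le> ennreal (c0 * M) * (\<integral>\<^sup>+x. ennreal (w x) * indicator A x \<partial>lborel) + ennreal e"
    proof -
      have "ennreal (W * (c0 * a M)) * (\<integral>\<^sup>+x. P x * indicator \<Omega> x \<partial>lebesgue) \<le> ennreal (W * (c0 * a M)) * ennreal K"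
        by (intro mult_left_mono PK) simp
      also have "\<dots> = ennreal (W * (c0 * a M * K))" using W c0 a0 K by (simp add: mult.assoc flip: ennreal_mult)
      also have "\<dots> \<le> ennreal e" using M(2) by (intro ennreal_leI) simp
      finally show ?thesis by (simp add: nn_integral_completion add_left_mono)
    qed
    finally show "(\<integral>\<^sup>+x. ennreal (w x) * (ennreal (norm (indicator (inner_part \<Omega> r) x *\<^sub>R mollified_grad f r x)) * indicator A x) \<partial>lborel)
      \<le> ennreal (c0 * M) * (\<integral>\<^sup>+x. ennreal (w x) * indicator A x \<partial>lborel) + ennreal e" .
  qed
qed


text \<open>Positive and negative parts of the components of the mollified gradients have weak
  cluster points with respect to the weighted measure. Their differences form G, and the limit of
  the distributional identity shows that G is the gradient of f.\<close>

lemma weak_gradient_exists: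
  assumes fm: "f \<in> borel_measurable borel"
    and f: "\<And>K. compact K \<Longrightarrow> K \<subseteq> \<Omega> \<Longrightarrow> integrable lborel (\<lambda>x. indicator K x *\<^sub>R f x)"
    and r: "\<And>j::nat. 0 < r j" "r \<longlonglongrightarrow> 0" and K: "0 \<le> K" "\<And>j. sharp_slice f (r j) \<le> ennreal K"
  obtains G where "G \<in> borel_measurable borel"
    "\<And>K. compact K \<Longrightarrow> K \<subseteq> \<Omega> \<Longrightarrow> integrable lborel (\<lambda>x. indicator K x *\<^sub>R G x)"
    "\<And>\<eta> b. test_function \<Omega> \<eta> \<Longrightarrow> b \<in> Basis \<Longrightarrow>
      (\<integral>x. f x * frechet_derivative \<eta> (at x) b \<partial>lborel) = - (\<integral>x. (G x \<bullet> b) * \<eta> x \<partial>lborel)"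
proof -
  obtain w :: "'a \<Rightarrow> real" and W where w: "integrable lborel w" "\<And>x. 0 < w x" "\<And>x. w x \<le> W"
    and w_lower: "\<And>R. \<exists>d>0. \<forall>x. norm x \<le> R \<longrightarrow> d \<le> w x"
    using integrable_weight_exists by blast
  have wm [measurable]: "w \<in> borel_measurable borel" using borel_measurable_integrable[OF w(1)] by simp
  have w0: "0 \<le> w x" for x using w(2)[of x] by linarith
  define M where "M = density lborel (\<lambda>x. ennreal (w x))"
  have sM [measurable_cong]: "sets M = sets borel" by (simp add: M_def)
  have M_int: "(\<integral>\<^sup>+x. g x \<partial>M) = (\<integral>\<^sup>+x. ennreal (w x) * g x \<partial>lborel)" if "g \<in> borel_measurable borel" for g
    unfolding M_def using that by (subst nn_integral_density) auto
  have "emeasure M (space M) = (\<integral>\<^sup>+x. ennreal (w x) \<partial>lborel)"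
    using M_int[of "\<lambda>_. 1"] by simp
  also have "\<dots> < \<infinity>" using w0 nn_integral_eq_integral[OF w(1)] by simp
  finally have finM: "finite_measure M" by (intro finite_measureI) auto
  interpret M: finite_measure M by fact
  define v where "v j x = indicator (inner_part \<Omega> (r j)) x *\<^sub>R mollified_grad f (r j) x" for j x
  have im [measurable]: "inner_part \<Omega> (r j) \<in> sets borel" for j using open_inner_part[OF open_\<Omega>] by simp
  note [measurable] = mollified_grad_measurable[OF fm]
  have vm [measurable]: "v j \<in> borel_measurable borel" for j unfolding v_def by measurable
  \<comment> \<open>The cluster lemma speaks of nonnegative functions, hence one index for each
    component and sign. The index type also contains vectors outside \<open>Basis\<close>, for which
    0 is a harmless value.\<close>
  define \<gamma> :: "'a \<times> bool \<Rightarrow> nat \<Rightarrow> 'a \<Rightarrow> real" where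
    "\<gamma> i j x = (case i of (b, s) \<Rightarrow> if b \<in> Basis then max 0 (if s then v j x \<bullet> b else - (v j x \<bullet> b)) else 0)" for i j x
  have \<gamma>m [measurable]: "\<gamma> i j \<in> borel_measurable borel" for i j
    unfolding \<gamma>_def by (cases i; cases "fst i \<in> Basis"; cases "snd i") simp_all
  have \<gamma>0: "0 \<le> \<gamma> i j x" for i j x unfolding \<gamma>_def by (cases i) simp
  have \<gamma>le: "\<gamma> i j x \<le> norm (v j x)" for i j x
    unfolding \<gamma>_def using Basis_le_norm[of "fst i" "v j x"] by (cases i) (auto simp: abs_le_iff)
  have UI: "\<exists>C. \<forall>i j. \<forall>A\<in>sets M. (\<integral>\<^sup>+x. ennreal (\<gamma> i j x) * indicator A x \<partial>M) \<le> ennreal C * emeasure M A + ennreal e" if e: "0 < e" for e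
  proof -
    obtain C where C: "\<And>r A. 0 < r \<Longrightarrow> sharp_slice f r \<le> ennreal K \<Longrightarrow> A \<in> sets borel \<Longrightarrow>
      (\<integral>\<^sup>+x. ennreal (w x) * (ennreal (norm (indicator (inner_part \<Omega> r) x *\<^sub>R mollified_grad f r x)) * indicator A x) \<partial>lborel)
        \<le> ennreal C * (\<integral>\<^sup>+x. ennreal (w x) * indicator A x \<partial>lborel) + ennreal e"
      by (rule mollified_grad_uniformly_integrable[OF fm f wm w(2,3) e K(1)]) (assumption | rule that)+
    have "(\<integral>\<^sup>+x. ennreal (\<gamma> i j x) * indicator A x \<partial>M) \<le> ennreal C * emeasure M A + ennreal e" if A: "A \<in> sets M" for i j A
    proof -
      have [measurable]: "A \<in> sets borel" using A sM by simp
      have "(\<integral>\<^sup>+x. ennreal (\<gamma> i j x) * indicator A x \<partial>M) = (\<integral>\<^sup>+x. ennreal (w x) * (ennreal (\<gamma> i j x) * indicator A x) \<partial>lborel)"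
        by (rule M_int) simp
      also have "\<dots> \<le> (\<integral>\<^sup>+x. ennreal (w x) * (ennreal (norm (v j x)) * indicator A x) \<partial>lborel)"
        by (intro nn_integral_mono mult_left_mono mult_right_mono ennreal_leI \<gamma>le) auto
      also have "\<dots> \<le> ennreal C * (\<integral>\<^sup>+x. ennreal (w x) * indicator A x \<partial>lborel) + ennreal e"
        unfolding v_def by (rule C[OF r(1) K(2)]) simp
      also have "(\<integral>\<^sup>+x. ennreal (w x) * indicator A x \<partial>lborel) = emeasure M A"
        by (simp add: M_def emeasure_density)
      finally show ?thesis .
    qed
    then show ?thesis by blast
  qed
  have \<gamma>mM: "(\<lambda>x. ennreal (\<gamma> i j x)) \<in> borel_measurable M" for i j by measurable
  obtain F h where F: "F \<le> sequentially" "F \<noteq> bot" and h: "\<And>i. h i \<in> borel_measurable M" "\<And>i. (\<integral>\<^sup>+x. h i x \<partial>M) < \<infinity>"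
    and lim: "\<And>i A. A \<in> sets M \<Longrightarrow> ((\<lambda>j. \<integral>\<^sup>+x. ennreal (\<gamma> i j x) * indicator A x \<partial>M) \<longlongrightarrow> (\<integral>\<^sup>+x. h i x * indicator A x \<partial>M)) F"
    by (rule uniformly_integrable_weak_cluster[where g="\<lambda>i j x. ennreal (\<gamma> i j x)", OF finM \<gamma>mM UI]) (assumption | rule that)+
  define H where "H i x = enn2real (h i x)" for i x
  have Hm [measurable]: "H i \<in> borel_measurable borel" for i
  proof -
    have "H i \<in> borel_measurable M" unfolding H_def using h(1) by simp
    then show ?thesis unfolding measurable_cong_sets[OF sM refl] .
  qed
  have H0: "0 \<le> H i x" for i x by (simp add: H_def)
  have hH: "AE x in M. h i x = ennreal (H i x)" for i
  proof -
    have "AE x in M. h i x \<noteq> \<infinity>" using h(1)[of i] h(2)[of i] by (intro nn_integral_PInf_AE) auto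
    then show ?thesis by eventually_elim (simp add: H_def less_top)
  qed
  have hH_int: "(\<integral>\<^sup>+x. h i x * indicator A x \<partial>M) = (\<integral>\<^sup>+x. ennreal (H i x) * indicator A x \<partial>M)" for i A
    using hH[of i] by (intro nn_integral_cong_AE) (auto elim: eventually_mono)
  define N where "N i j = density M (\<lambda>x. ennreal (\<gamma> i j x))" for i j
  define N' where "N' i = density M (\<lambda>x. ennreal (H i x))" for i
  have sN: "sets (N i j) = sets borel" "sets (N' i) = sets borel" for i j by (simp_all add: N_def N'_def sM)
  have spN: "space (N i j) = UNIV" "space (N' i) = UNIV" "space M = UNIV" for i j by (simp_all add: N_def N'_def M_def)
  have eN: "emeasure (N i j) A = (\<integral>\<^sup>+x. ennreal (\<gamma> i j x) * indicator A x \<partial>M)"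
    "emeasure (N' i) A = (\<integral>\<^sup>+x. ennreal (H i x) * indicator A x \<partial>M)" if "A \<in> sets borel" for i j A
    using that unfolding N_def N'_def by (simp_all add: emeasure_density sM)
  obtain C1 where C1: "\<And>i j A. A \<in> sets M \<Longrightarrow> (\<integral>\<^sup>+x. ennreal (\<gamma> i j x) * indicator A x \<partial>M) \<le> ennreal C1 * emeasure M A + ennreal 1"
    using UI[OF zero_less_one] by blast
  define K1 where "K1 = enn2real (ennreal C1 * emeasure M (space M) + ennreal 1)"
  have fin1: "ennreal C1 * emeasure M (space M) + ennreal 1 < top"
    using M.finite_emeasure_space by (simp add: ennreal_mult_eq_top_iff less_top[symmetric])
  have NK: "emeasure (N i j) UNIV \<le> ennreal K1" for i j
    using C1[of UNIV i j] eN(1)[of UNIV i j] fin1 by (simp add: K1_def sM spN)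
  have N'top: "emeasure (N' i) UNIV < top" for i
  proof -
    have "emeasure (N' i) UNIV = (\<integral>\<^sup>+x. h i x * indicator UNIV x \<partial>M)" unfolding hH_int by (rule eN(2)) simp
    also have "\<dots> < top" using h(2)[of i] by simp
    finally show ?thesis .
  qed
  have fN: "finite_measure (N i j)" for i j
    using NK[of i j] by (intro finite_measureI) (auto simp: spN top_unique)
  have fN': "finite_measure (N' i)" for i
    using N'top[of i] by (intro finite_measureI) (auto simp: spN)
  have mlim: "((\<lambda>j. measure (N i j) A) \<longlongrightarrow> measure (N' i) A) F" if A: "A \<in> sets borel" for i A
  proof -
    interpret N': finite_measure "N' i" by (rule fN')
    have "((\<lambda>j. emeasure (N i j) A) \<longlongrightarrow> emeasure (N' i) A) F"
      using lim[of A i] A unfolding eN[OF A] hH_int[symmetric] by (simp add: sM)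
    then show ?thesis
      unfolding N'.emeasure_eq_measure by (simp add: measure_def) (rule tendsto_enn2real, auto simp: measure_def[symmetric])
  qed
  define G where "G x = (\<Sum>b\<in>Basis. (H (b, True) x - H (b, False) x) *\<^sub>R b)" for x
  have Gb: "G x \<bullet> b = H (b, True) x - H (b, False) x" if "b \<in> Basis" for x b
    unfolding G_def using that by (simp add: inner_sum_left_Basis)
  have Gm: "G \<in> borel_measurable borel" unfolding G_def[abs_def] by measurable
  have iwH: "integrable lborel (\<lambda>x. w x * H i x)" for i
  proof -
    have "(\<integral>\<^sup>+x. ennreal (norm (w x * H i x)) \<partial>lborel) = emeasure (N' i) UNIV"
      using M_int[of "\<lambda>x. ennreal (H i x)"] eN(2)[of UNIV i] w0 H0 by (simp add: ennreal_mult abs_mult)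
    then show ?thesis using N'top[of i] by (simp add: integrable_iff_bounded)
  qed
  have iw\<gamma>: "integrable lborel (\<lambda>x. w x * \<gamma> i j x)" for i j
  proof -
    have "(\<integral>\<^sup>+x. ennreal (norm (w x * \<gamma> i j x)) \<partial>lborel) = emeasure (N i j) UNIV"
      using M_int[of "\<lambda>x. ennreal (\<gamma> i j x)"] eN(1)[of UNIV i j] w0 \<gamma>0 by (simp add: ennreal_mult abs_mult)
    then show ?thesis using le_less_trans[OF NK[of i j]] by (simp add: integrable_iff_bounded)
  qed
  \<comment> \<open>A function integrable against w may be multiplied by anything bounded by a
    multiple of w. Indicators of compact sets and test functions qualify, by the lower bounds on
    w.\<close>
  have bounded_mult: "integrable lborel (\<lambda>x. g x * u x)" 
    if g: "integrable lborel (\<lambda>x. w x * g x)" "g \<in> borel_measurable borel" and u: "u \<in> borel_measurable borel" "\<And>x. \<bar>u x\<bar> \<le> B * w x"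
    for g u :: "'a \<Rightarrow> real" and B
  proof (rule Bochner_Integration.integrable_bound)
    show "integrable lborel (\<lambda>x. B * (w x * g x))" using g by (intro integrable_mult_right)
    show "AE x in lborel. norm (g x * u x) \<le> norm (B * (w x * g x))"
    proof (rule AE_I2)
      fix x
      have "\<bar>u x\<bar> \<le> \<bar>B * w x\<bar>" using u(2)[of x] by linarith
      from mult_right_mono[OF this, of "\<bar>g x\<bar>"] show "norm (g x * u x) \<le> norm (B * (w x * g x))"
        by (simp add: abs_mult mult_ac)
    qed
  qed (use g u in simp)
  show ?thesis
  proof (rule that[OF Gm])
    fix K :: "'a set" assume K: "compact K" "K \<subseteq> \<Omega>"
    have [measurable]: "K \<in> sets borel" using K by (simp add: compact_imp_closed borel_closed)
    obtain R where R: "\<And>x. x \<in> K \<Longrightarrow> norm x \<le> R" using compact_imp_bounded[OF K(1)] unfolding bounded_iff by blast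
    obtain d where d: "0 < d" "\<And>x. norm x \<le> R \<Longrightarrow> d \<le> w x" using w_lower[of R] by blast
    have "\<bar>indicator K x\<bar> \<le> (1 / d) * w x" for x
      using R[of x] d w0[of x] by (cases "x \<in> K") (simp_all add: pos_le_divide_eq)
    then have iH: "integrable lborel (\<lambda>x. H i x * indicator K x)" for i
      by (intro bounded_mult[OF iwH Hm, where B="1 / d"]) auto
    have "integrable lborel (\<lambda>x. \<Sum>b\<in>Basis. (H (b, True) x * indicator K x - H (b, False) x * indicator K x) *\<^sub>R b)"
      by (intro Bochner_Integration.integrable_sum integrable_scaleR_left Bochner_Integration.integrable_diff iH)
    moreover have "(\<Sum>b\<in>Basis. (H (b, True) x * indicator K x - H (b, False) x * indicator K x) *\<^sub>R b) = indicator K x *\<^sub>R G x" for x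
      unfolding G_def scaleR_sum_right by (intro sum.cong) (auto simp: algebra_simps)
    ultimately show "integrable lborel (\<lambda>x. indicator K x *\<^sub>R G x)" by simp
  next
    fix \<eta> b assume \<eta>: "test_function \<Omega> \<eta>" and b: "b \<in> (Basis :: 'a set)"
    note supp = test_function_support[OF \<eta> b]
    obtain B where \<eta>m [measurable]: "\<eta> \<in> borel_measurable borel" and B: "0 \<le> B" "\<And>x. \<bar>\<eta> x\<bar> \<le> B"
      using continuous_compact_support[OF test_function_facts(1)[OF \<eta>] supp(3,1)] by auto
    obtain R where R: "\<And>x. x \<in> closure {x. \<eta> x \<noteq> 0} \<Longrightarrow> norm x \<le> R"
      using compact_imp_bounded[OF supp(1)] unfolding bounded_iff by blast
    obtain d where d: "0 < d" "\<And>x. norm x \<le> R \<Longrightarrow> d \<le> w x" using w_lower[of R] by blast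
    have \<eta>w: "\<bar>\<eta> x\<bar> \<le> (B / d) * w x" for x
    proof (cases "x \<in> closure {x. \<eta> x \<noteq> 0}")
      case True
      have "\<bar>\<eta> x\<bar> \<le> (B / d) * d" using B d by simp
      also have "\<dots> \<le> (B / d) * w x" using True R d B by (intro mult_left_mono) auto
      finally show ?thesis .
    next
      case False
      then have "\<eta> x = 0" by (rule supp(3))
      moreover have "0 \<le> (B / d) * w x" using B(1) d(1) w0[of x] by (intro mult_nonneg_nonneg divide_nonneg_pos)
      ultimately show ?thesis by (simp only: abs_zero)
    qed
    \<comment> \<open>The weight is moved from the measure to the test function. On the support of
      \<eta> the weight is bounded below, so the quotient is bounded, as setwise convergence
      requires.\<close>
    define u where "u x = \<eta> x / w x" for x
    have um [measurable]: "u \<in> borel_measurable borel" unfolding u_def by measurable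
    have u_bound: "\<bar>u x\<bar> \<le> B / d" for x
      using \<eta>w[of x] w(2)[of x] by (simp add: u_def pos_divide_le_eq)
    have wu: "w x * (g * u x) = g * \<eta> x" for g x using w(2)[of x] by (simp add: u_def)
    have conv: "((\<lambda>j. \<integral>x. \<gamma> i j x * \<eta> x \<partial>lborel) \<longlongrightarrow> (\<integral>x. H i x * \<eta> x \<partial>lborel)) F" for i
    proof -
      have umN: "u \<in> borel_measurable (N' i)" using um unfolding measurable_cong_sets[OF sN(2) refl] .
      have umM: "u \<in> borel_measurable M" "\<gamma> i j \<in> borel_measurable M" "H i \<in> borel_measurable M" for j
        unfolding measurable_cong_sets[OF sM refl] by (rule um \<gamma>m Hm)+
      have MK: "measure (N i j) (space (N' i)) \<le> max K1 (measure (N' i) UNIV)" for j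
        using NK[of i j] by (simp add: spN measure_def le_max_iff_disj enn2real_leI K1_def)
      have "((\<lambda>j. \<integral>x. u x \<partial>N i j) \<longlongrightarrow> (\<integral>x. u x \<partial>N' i)) F"
      proof (rule setwise_convergence_integral[OF fN fN' _ MK _ _ umN u_bound])
        show "((\<lambda>j. measure (N i j) A) \<longlongrightarrow> measure (N' i) A) F" if "A \<in> sets (N' i)" for A
          using that mlim by (simp add: sN)
      qed (simp_all add: sN spN)
      moreover have "(\<integral>x. u x \<partial>N i j) = (\<integral>x. \<gamma> i j x * \<eta> x \<partial>lborel)" for j
      proof -
        have "(\<integral>x. u x \<partial>N i j) = (\<integral>x. \<gamma> i j x * u x \<partial>M)"
          unfolding N_def using umM \<gamma>0 by (subst integral_density) auto
        also have "\<dots> = (\<integral>x. w x * (\<gamma> i j x * u x) \<partial>lborel)"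
          unfolding M_def using w0 by (subst integral_density) auto
        finally show ?thesis by (simp add: wu)
      qed
      moreover have "(\<integral>x. u x \<partial>N' i) = (\<integral>x. H i x * \<eta> x \<partial>lborel)"
      proof -
        have "(\<integral>x. u x \<partial>N' i) = (\<integral>x. H i x * u x \<partial>M)"
          unfolding N'_def using umM H0 by (subst integral_density) auto
        also have "\<dots> = (\<integral>x. w x * (H i x * u x) \<partial>lborel)"
          unfolding M_def using w0 by (subst integral_density) auto
        finally show ?thesis by (simp add: wu)
      qed
      ultimately show ?thesis by simp
    qed
    have i\<gamma>: "integrable lborel (\<lambda>x. \<gamma> i j x * \<eta> x)" for i j by (rule bounded_mult[OF iw\<gamma> \<gamma>m \<eta>m \<eta>w])
    have iH: "integrable lborel (\<lambda>x. H i x * \<eta> x)" for i by (rule bounded_mult[OF iwH Hm \<eta>m \<eta>w])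
    have "v j x \<bullet> b = \<gamma> (b, True) j x - \<gamma> (b, False) j x" for j x
      using b by (simp add: \<gamma>_def)
    then have "(\<integral>x. (v j x \<bullet> b) * \<eta> x \<partial>lborel) = (\<integral>x. \<gamma> (b, True) j x * \<eta> x \<partial>lborel) - (\<integral>x. \<gamma> (b, False) j x * \<eta> x \<partial>lborel)" for j
      using i\<gamma> by (simp add: left_diff_distrib)
    moreover have "(\<integral>x. (G x \<bullet> b) * \<eta> x \<partial>lborel) = (\<integral>x. H (b, True) x * \<eta> x \<partial>lborel) - (\<integral>x. H (b, False) x * \<eta> x \<partial>lborel)"
      using iH b by (simp add: Gb left_diff_distrib)
    ultimately have "((\<lambda>j. \<integral>x. (v j x \<bullet> b) * \<eta> x \<partial>lborel) \<longlongrightarrow> (\<integral>x. (G x \<bullet> b) * \<eta> x \<partial>lborel)) F"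
      using tendsto_diff[OF conv[of "(b, True)"] conv[of "(b, False)"]] by simp
    \<comment> \<open>The filter is finer than \<open>sequentially\<close>, so the distributional
      limit also holds along it, and uniqueness of limits identifies the two expressions.\<close>
    moreover have "((\<lambda>j. \<integral>x. (v j x \<bullet> b) * \<eta> x \<partial>lborel) \<longlongrightarrow> - (\<integral>x. f x * frechet_derivative \<eta> (at x) b \<partial>lborel)) F"
      using mollified_grad_distributional_limit[OF open_\<Omega> fm f r \<eta> b] F(1) unfolding v_def by (rule tendsto_mono[rotated])
    ultimately have "(\<integral>x. (G x \<bullet> b) * \<eta> x \<partial>lborel) = - (\<integral>x. f x * frechet_derivative \<eta> (at x) b \<partial>lborel)"
      by (rule tendsto_unique[OF F(2)])
    then show "(\<integral>x. f x * frechet_derivative \<eta> (at x) b \<partial>lborel) = - (\<integral>x. (G x \<bullet> b) * \<eta> x \<partial>lborel)" by simp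
  qed
qed

end

subsection \<open>Averaging over the radius\<close>

lemma frequently_less_of_Liminf_less:
  fixes F :: "'a \<Rightarrow> ennreal"
  assumes "Liminf A F < y" shows "frequently (\<lambda>x. F x < y) A"
proof (rule ccontr)
  assume "\<not> ?thesis"
  then have "eventually (\<lambda>x. y \<le> F x) A" by (simp add: frequently_def not_less)
  then have "y \<le> Liminf A F" by (rule Liminf_bounded)
  with assms show False by simp
qed

locale approximate_weights =
  fixes \<psi> :: "real \<Rightarrow> real \<Rightarrow> real"
  assumes weight_integrable: "\<And>\<epsilon>. 0 < \<epsilon> \<Longrightarrow> integrable (lebesgue_on {0<..}) (\<psi> \<epsilon>)"
    and weight_nonneg: "\<And>\<epsilon> r. 0 < \<epsilon> \<Longrightarrow> 0 < r \<Longrightarrow> 0 \<le> \<psi> \<epsilon> r"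
    and weight_total: "\<And>\<epsilon>. 0 < \<epsilon> \<Longrightarrow> (LINT r|lebesgue_on {0<..}. \<psi> \<epsilon> r) = 1"
    and weight_tail: "\<And>\<gamma>. 0 < \<gamma> \<Longrightarrow> ((\<lambda>\<epsilon>. LINT r|lebesgue_on {\<gamma><..}. \<psi> \<epsilon> r) \<longlongrightarrow> 0) (at_right 0)"
begin

definition weighted :: "(real \<Rightarrow> ennreal) \<Rightarrow> real \<Rightarrow> ennreal" where
  "weighted F \<epsilon> = (\<integral>\<^sup>+r. F r * ennreal (\<psi> \<epsilon> r) \<partial>lebesgue_on {0<..})"

definition tail :: "real \<Rightarrow> real \<Rightarrow> real" where
  "tail \<gamma> \<epsilon> = (LINT r|lebesgue_on {\<gamma><..}. \<psi> \<epsilon> r)"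

lemma weight_measurable [measurable]: "0 < \<epsilon> \<Longrightarrow> \<psi> \<epsilon> \<in> borel_measurable (lebesgue_on {0<..})"
  using borel_measurable_integrable[OF weight_integrable] .

lemma nn_integral_weight: "0 < \<epsilon> \<Longrightarrow> (\<integral>\<^sup>+r. ennreal (\<psi> \<epsilon> r) \<partial>lebesgue_on {0<..}) = 1"
  using nn_integral_eq_integral[OF weight_integrable, of \<epsilon>] weight_nonneg weight_total
  by (auto simp: AE_lebesgue_on_iff)

lemma indicator_tail_measurable [measurable]: 
  "indicator {\<gamma><..} \<in> borel_measurable (lebesgue_on {(0::real)<..})"
  by (intro borel_measurable_lebesgue_onI borel_measurable_indicator) simp

lemma nn_integral_tail:
  assumes \<epsilon>: "0 < \<epsilon>" and \<gamma>: "0 < \<gamma>"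
  shows "(\<integral>\<^sup>+r. indicator {\<gamma><..} r * ennreal (\<psi> \<epsilon> r) \<partial>lebesgue_on {0<..}) = ennreal (tail \<gamma> \<epsilon>)"
    "0 \<le> tail \<gamma> \<epsilon>"
proof -
  have i: "integrable (lebesgue_on {\<gamma><..}) (\<psi> \<epsilon>)"
  proof -
    have "integrable lebesgue (\<lambda>r. indicator {0<..} r *\<^sub>R \<psi> \<epsilon> r)"
      using weight_integrable[OF \<epsilon>] by (simp add: integrable_restrict_space)
    from integrable_mult_indicator[OF _ this, of "{\<gamma><..}"]
    have "integrable lebesgue (\<lambda>r. indicator {\<gamma><..} r *\<^sub>R (indicator {0<..} r *\<^sub>R \<psi> \<epsilon> r))"
      by simp
    moreover have "(\<lambda>r. indicator {\<gamma><..} r *\<^sub>R (indicator {0<..} r *\<^sub>R \<psi> \<epsilon> r)) = (\<lambda>r. indicator {\<gamma><..} r *\<^sub>R \<psi> \<epsilon> r)"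
      using \<gamma> by (auto simp: fun_eq_iff indicator_def)
    ultimately have "integrable lebesgue (\<lambda>r. indicator {\<gamma><..} r *\<^sub>R \<psi> \<epsilon> r)" by (simp only:)
    then show ?thesis by (subst integrable_restrict_space) auto
  qed
  have nn: "AE r in lebesgue_on {\<gamma><..}. 0 \<le> \<psi> \<epsilon> r"
    using weight_nonneg[OF \<epsilon>] \<gamma> by (auto simp: AE_lebesgue_on_iff)
  have "(\<integral>\<^sup>+r. ennreal (\<psi> \<epsilon> r) \<partial>lebesgue_on {\<gamma><..}) = ennreal (tail \<gamma> \<epsilon>)"
    unfolding tail_def by (rule nn_integral_eq_integral[OF i nn])
  moreover have "(\<integral>\<^sup>+r. ennreal (\<psi> \<epsilon> r) \<partial>lebesgue_on {\<gamma><..}) = (\<integral>\<^sup>+r. indicator {\<gamma><..} r * ennreal (\<psi> \<epsilon> r) \<partial>lebesgue_on {0<..})"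
    by (rule nn_integral_lebesgue_on_subset) (use \<gamma> in auto)
  ultimately show "(\<integral>\<^sup>+r. indicator {\<gamma><..} r * ennreal (\<psi> \<epsilon> r) \<partial>lebesgue_on {0<..}) = ennreal (tail \<gamma> \<epsilon>)" by simp
  show "0 \<le> tail \<gamma> \<epsilon>" unfolding tail_def by (rule integral_nonneg_AE[OF nn])
qed

lemma nn_integral_head:
  assumes \<epsilon>: "0 < \<epsilon>" and \<gamma>: "0 < \<gamma>"
  shows "(\<integral>\<^sup>+r. (1 - indicator {\<gamma><..} r) * ennreal (\<psi> \<epsilon> r) \<partial>lebesgue_on {0<..}) = ennreal (1 - tail \<gamma> \<epsilon>)"
proof -
  note [measurable] = weight_measurable[OF \<epsilon>]
  define A where "A = (\<integral>\<^sup>+r. (1 - indicator {\<gamma><..} r) * ennreal (\<psi> \<epsilon> r) \<partial>lebesgue_on {0<..})"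
  have "1 = (\<integral>\<^sup>+r. (1 - indicator {\<gamma><..} r) * ennreal (\<psi> \<epsilon> r) + indicator {\<gamma><..} r * ennreal (\<psi> \<epsilon> r) \<partial>lebesgue_on {0<..})"
  proof -
    have "(\<integral>\<^sup>+r. (1 - indicator {\<gamma><..} r) * ennreal (\<psi> \<epsilon> r) + indicator {\<gamma><..} r * ennreal (\<psi> \<epsilon> r) \<partial>lebesgue_on {0<..})
        = (\<integral>\<^sup>+r. ennreal (\<psi> \<epsilon> r) \<partial>lebesgue_on {0<..})"
      by (intro nn_integral_cong) (auto simp: indicator_def)
    then show ?thesis by (simp add: nn_integral_weight[OF \<epsilon>])
  qed
  also have "\<dots> = A + ennreal (tail \<gamma> \<epsilon>)"
    unfolding A_def nn_integral_tail(1)[OF \<epsilon> \<gamma>, symmetric] by (rule nn_integral_add) auto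
  finally have "A + ennreal (tail \<gamma> \<epsilon>) = 1" by simp
  then have "A = 1 - ennreal (tail \<gamma> \<epsilon>)" by (metis ennreal_add_diff_cancel_right ennreal_neq_top)
  also have "\<dots> = ennreal (1 - tail \<gamma> \<epsilon>)"
    using nn_integral_tail(2)[OF \<epsilon> \<gamma>] by (subst ennreal_1[symmetric], subst ennreal_minus) auto
  finally show ?thesis by (simp add: A_def)
qed

lemma eventually_at_right_pos: "eventually (\<lambda>\<epsilon>::real. 0 < \<epsilon>) (at_right 0)"
  by (simp add: eventually_at_filter)

text \<open>Below \<gamma> the function F is near its upper limit and the weight has mass at most 1;
  above \<gamma> it is at most M while the mass of the weight vanishes. Comparison with a step
  function also covers an F that is not measurable in r.\<close>

lemma weighted_Limsup_le:
  assumes M: "M < \<infinity>" "\<And>r. 0 < r \<Longrightarrow> F r \<le> M"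
  shows "Limsup (at_right 0) (weighted F) \<le> Limsup (at_right 0) F"
  unfolding Limsup_le_iff
proof (intro allI impI)
  fix y assume "Limsup (at_right 0) F < y"
  then obtain y' e where y': "Limsup (at_right 0) F < y'" "0 < e" "y' + ennreal e \<le> y" by (rule ennreal_less_add_obtains)
  obtain y1 where y1: "Limsup (at_right 0) F < y1" "y1 < y'" using dense[OF y'(1)] by blast
  have "eventually (\<lambda>r. F r < y1) (at_right 0)" using Limsup_lessD[OF y1(1)] .
  then obtain \<gamma>' where \<gamma>': "0 < \<gamma>'" "\<And>r. 0 < r \<Longrightarrow> r < \<gamma>' \<Longrightarrow> F r < y1" unfolding eventually_at_right_field by auto
  define \<gamma> where "\<gamma> = \<gamma>' / 2"
  have \<gamma>: "0 < \<gamma>" "\<And>r. 0 < r \<Longrightarrow> r \<le> \<gamma> \<Longrightarrow> F r < y1" using \<gamma>' by (auto simp: \<gamma>_def)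
  have "((\<lambda>\<epsilon>. M * ennreal (tail \<gamma> \<epsilon>)) \<longlongrightarrow> M * ennreal 0) (at_right 0)"
    using M(1) weight_tail[OF \<gamma>(1)] unfolding tail_def by (intro ennreal_tendsto_cmult tendsto_ennrealI) auto
  then have "eventually (\<lambda>\<epsilon>. M * ennreal (tail \<gamma> \<epsilon>) < ennreal e) (at_right 0)"
    by (rule order_tendstoD(2)) (use y'(2) in simp)
  with eventually_at_right_pos show "eventually (\<lambda>\<epsilon>. weighted F \<epsilon> < y) (at_right 0)"
  proof eventually_elim
    case (elim \<epsilon>)
    note [measurable] = weight_measurable[OF elim(1)]
    have "weighted F \<epsilon> \<le> (\<integral>\<^sup>+r. y1 * ennreal (\<psi> \<epsilon> r) + M * (indicator {\<gamma><..} r * ennreal (\<psi> \<epsilon> r)) \<partial>lebesgue_on {0<..})"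
      unfolding weighted_def
    proof (rule nn_integral_mono)
      fix r :: real assume "r \<in> space (lebesgue_on {0<..})"
      then have r: "0 < r" by simp
      show "F r * ennreal (\<psi> \<epsilon> r) \<le> y1 * ennreal (\<psi> \<epsilon> r) + M * (indicator {\<gamma><..} r * ennreal (\<psi> \<epsilon> r))"
      proof (cases "r \<le> \<gamma>")
        case True
        then have "F r \<le> y1" using \<gamma>(2)[OF r] by simp
        then show ?thesis using True by (simp add: mult_right_mono)
      next
        case False
        then show ?thesis using mult_right_mono[OF M(2)[OF r], of "ennreal (\<psi> \<epsilon> r)"] by (simp add: add_increasing)
      qed
    qed
    also have "\<dots> = y1 * (\<integral>\<^sup>+r. ennreal (\<psi> \<epsilon> r) \<partial>lebesgue_on {0<..}) + M * (\<integral>\<^sup>+r. indicator {\<gamma><..} r * ennreal (\<psi> \<epsilon> r) \<partial>lebesgue_on {0<..})"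
      by (simp add: nn_integral_add nn_integral_cmult)
    also have "\<dots> = y1 + M * ennreal (tail \<gamma> \<epsilon>)"
      by (simp add: nn_integral_weight[OF elim(1)] nn_integral_tail[OF elim(1) \<gamma>(1)])
    also have "\<dots> < y' + ennreal e" by (rule add_strict_mono[OF y1(2) elim(2)])
    finally show ?case using y'(3) by (rule less_le_trans)
  qed
qed

text \<open>Only the radii up to \<gamma> are kept; their mass under the weight tends to 1.\<close>

lemma weighted_Liminf_ge: "Liminf (at_right 0) F \<le> Liminf (at_right 0) (weighted F)"
  unfolding le_Liminf_iff
proof (intro allI impI)
  fix y assume "y < Liminf (at_right 0) F"
  then obtain y' where y': "y < y'" "y' < Liminf (at_right 0) F" using dense by blast
  have y'top: "y' < top" by (rule less_le_trans[OF y'(2) top_greatest])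
  have "eventually (\<lambda>r. y' < F r) (at_right 0)" using less_LiminfD[OF y'(2)] .
  then obtain \<gamma>' where \<gamma>': "0 < \<gamma>'" "\<And>r. 0 < r \<Longrightarrow> r < \<gamma>' \<Longrightarrow> y' < F r" unfolding eventually_at_right_field by auto
  define \<gamma> where "\<gamma> = \<gamma>' / 2"
  have \<gamma>: "0 < \<gamma>" "\<And>r. 0 < r \<Longrightarrow> r \<le> \<gamma> \<Longrightarrow> y' < F r" using \<gamma>' by (auto simp: \<gamma>_def)
  have "((\<lambda>\<epsilon>. y' * ennreal (1 - tail \<gamma> \<epsilon>)) \<longlongrightarrow> y' * ennreal (1 - 0)) (at_right 0)"
    using y'top weight_tail[OF \<gamma>(1)] unfolding tail_def by (intro ennreal_tendsto_cmult tendsto_ennrealI tendsto_diff tendsto_const) auto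
  then have "eventually (\<lambda>\<epsilon>. y < y' * ennreal (1 - tail \<gamma> \<epsilon>)) (at_right 0)"
    by (rule order_tendstoD(1)) (use y'(1) in simp)
  with eventually_at_right_pos show "eventually (\<lambda>\<epsilon>. y < weighted F \<epsilon>) (at_right 0)"
  proof eventually_elim
    case (elim \<epsilon>)
    note [measurable] = weight_measurable[OF elim(1)]
    have "y' * ennreal (1 - tail \<gamma> \<epsilon>) = (\<integral>\<^sup>+r. y' * ((1 - indicator {\<gamma><..} r) * ennreal (\<psi> \<epsilon> r)) \<partial>lebesgue_on {0<..})"
      by (subst nn_integral_cmult) (auto simp: nn_integral_head[OF elim(1) \<gamma>(1)])
    also have "\<dots> \<le> weighted F \<epsilon>"
      unfolding weighted_def
    proof (rule nn_integral_mono)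
      fix r :: real assume "r \<in> space (lebesgue_on {0<..})"
      then have r: "0 < r" by simp
      show "y' * ((1 - indicator {\<gamma><..} r) * ennreal (\<psi> \<epsilon> r)) \<le> F r * ennreal (\<psi> \<epsilon> r)"
      proof (cases "r \<le> \<gamma>")
        case True
        then have "y' \<le> F r" using \<gamma>(2)[OF r] by simp
        then show ?thesis using True by (simp add: mult_right_mono)
      qed simp
    qed
    finally show ?case using elim(2) by (rule less_le_trans[rotated])
  qed
qed

end

subsection \<open>Bounds for the sharp modular and norm\<close>

lemma mollified_gradient_scale:
  assumes "mollified_gradient \<Omega> f G"
  shows "mollified_gradient \<Omega> (\<lambda>x. f x / l) (\<lambda>x. G x /\<^sub>R l)"
proof -
  have [measurable]: "f \<in> borel_measurable borel" "G \<in> borel_measurable borel"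
    using assms by (auto simp: mollified_gradient_def)
  have 1: "integrable lborel (\<lambda>x. indicator K x *\<^sub>R (f x / l))" "integrable lborel (\<lambda>x. indicator K x *\<^sub>R (G x /\<^sub>R l))"
    if "compact K" "K \<subseteq> \<Omega>" for K
  proof -
    have i: "integrable lborel (\<lambda>x. indicator K x *\<^sub>R f x)" "integrable lborel (\<lambda>x. indicator K x *\<^sub>R G x)"
      using assms that by (auto simp: mollified_gradient_def)
    show "integrable lborel (\<lambda>x. indicator K x *\<^sub>R (f x / l))"
      using integrable_mult_right[OF i(1), of "inverse l"] by (simp add: divide_inverse mult_ac)
    have "integrable lborel (\<lambda>x. inverse l *\<^sub>R (indicator K x *\<^sub>R G x))" by (rule integrable_scaleR_right[OF i(2)])
    then show "integrable lborel (\<lambda>x. indicator K x *\<^sub>R (G x /\<^sub>R l))" by (simp add: mult.commute)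
  qed
  have 2: "(\<integral>y. (f y / l) *\<^sub>R bump_grad r (x - y) \<partial>lborel) = (\<integral>y. bump r (x - y) *\<^sub>R (G y /\<^sub>R l) \<partial>lborel)"
    if "0 < r" "cball x r \<subseteq> \<Omega>" for x r
  proof -
    have "(\<integral>y. (f y / l) *\<^sub>R bump_grad r (x - y) \<partial>lborel) = (\<integral>y. inverse l *\<^sub>R (f y *\<^sub>R bump_grad r (x - y)) \<partial>lborel)"
      by (simp add: divide_inverse mult.commute)
    also have "\<dots> = inverse l *\<^sub>R (\<integral>y. f y *\<^sub>R bump_grad r (x - y) \<partial>lborel)" by (rule integral_scaleR_right)
    also have "\<dots> = inverse l *\<^sub>R (\<integral>y. bump r (x - y) *\<^sub>R G y \<partial>lborel)"
      using assms that by (simp add: mollified_gradient_def)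
    also have "\<dots> = (\<integral>y. inverse l *\<^sub>R (bump r (x - y) *\<^sub>R G y) \<partial>lborel)" by (rule integral_scaleR_right[symmetric])
    finally show ?thesis by (simp add: mult.commute)
  qed
  show ?thesis unfolding mollified_gradient_def using 1 2 by simp
qed

lemma ball_average_divide: "ball_average (\<lambda>y. f y / l) x r = ball_average f x r / l"
  unfolding ball_average_def by simp

lemma sharp_average_divide: "0 < l \<Longrightarrow> sharp_average (\<lambda>y. f y / l) x r = sharp_average f x r / l"
proof -
  assume l: "0 < l"
  have "(\<lambda>y. \<bar>f y / l - ball_average f x r / l\<bar>) = (\<lambda>y. \<bar>f y - ball_average f x r\<bar> / l)"
    using l by (simp add: fun_eq_iff abs_divide flip: diff_divide_distrib)
  then show ?thesis unfolding sharp_average_def ball_average_divide by (simp only: ball_average_divide)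
qed

lemma weak_gradientI_borel:
  fixes f f0 :: "'a::euclidean_space \<Rightarrow> real"
  assumes \<Omega>: "open \<Omega>" and f: "locally_integrable \<Omega> f"
    and f0: "f0 \<in> borel_measurable borel" "AE x in lborel. x \<in> \<Omega> \<longrightarrow> f x = f0 x"
    and Gm: "G \<in> borel_measurable borel"
    and G: "\<And>K. compact K \<Longrightarrow> K \<subseteq> \<Omega> \<Longrightarrow> integrable lborel (\<lambda>x. indicator K x *\<^sub>R G x)"
    and eq: "\<And>\<eta> b. test_function \<Omega> \<eta> \<Longrightarrow> b \<in> Basis \<Longrightarrow>
      (\<integral>x. f0 x * frechet_derivative \<eta> (at x) b \<partial>lborel) = - (\<integral>x. (G x \<bullet> b) * \<eta> x \<partial>lborel)"
  shows "weak_gradient \<Omega> f G"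
  unfolding weak_gradient_def
proof (intro conjI allI impI ballI)
  show "locally_integrable \<Omega> G"
    unfolding locally_integrable_def
  proof (intro allI impI)
    fix K assume K: "compact K \<and> K \<subseteq> \<Omega>"
    then have [measurable]: "K \<in> sets borel" by (simp add: compact_imp_closed borel_closed)
    note [measurable] = Gm
    have "integrable lebesgue (\<lambda>x. indicator K x *\<^sub>R G x) \<longleftrightarrow> integrable lborel (\<lambda>x. indicator K x *\<^sub>R G x)"
      by (rule integrable_completion) simp
    then have "integrable lebesgue (\<lambda>x. indicator K x *\<^sub>R G x)" using G K by simp
    then show "integrable (lebesgue_on K) G" by (subst integrable_restrict_space) auto
  qed
  fix \<eta> and b :: 'a assume \<eta>: "test_function \<Omega> \<eta>" and b: "b \<in> Basis"
  define D where "D x = frechet_derivative \<eta> (at x) b" for x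
  note supp = test_function_support[OF \<eta> b]
  have \<eta>m: "\<eta> \<in> borel_measurable borel"
    using continuous_compact_support(3)[OF test_function_facts(1)[OF \<eta>] supp(3,1)] by simp
  have Dm: "D \<in> borel_measurable borel"
    using continuous_compact_support(3)[OF test_function_facts(3)[OF \<eta> b] supp(4,1)] by (simp add: D_def[abs_def])
  note [measurable] = \<eta>m Dm f0(1) Gm
  have z: "\<eta> x = 0" "D x = 0" if "x \<notin> \<Omega>" for x
    using supp(3)[of x] supp(4)[of x] supp(2) that unfolding D_def by blast+
  have "(LINT x|lebesgue_on \<Omega>. f x * D x) = (\<integral>x. indicator \<Omega> x *\<^sub>R (f0 x * D x) \<partial>lborel)"
  proof (rule integral_lebesgue_on_borel_version(1)[OF \<Omega>])
    show "(\<lambda>x. f x * D x) \<in> borel_measurable (lebesgue_on \<Omega>)"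
      by (intro borel_measurable_times locally_integrable_measurable[OF \<Omega> f] borel_measurable_lebesgue_onI Dm)
    show "AE x in lborel. x \<in> \<Omega> \<longrightarrow> f x * D x = f0 x * D x" using f0(2) by eventually_elim simp
  qed simp
  also have "(\<lambda>x. indicator \<Omega> x *\<^sub>R (f0 x * D x)) = (\<lambda>x. f0 x * D x)"
  proof
    fix x show "indicator \<Omega> x *\<^sub>R (f0 x * D x) = f0 x * D x" by (cases "x \<in> \<Omega>") (simp_all add: z)
  qed
  also have "(\<integral>x. f0 x * D x \<partial>lborel) = - (\<integral>x. (G x \<bullet> b) * \<eta> x \<partial>lborel)"
    unfolding D_def by (rule eq[OF \<eta> b])
  also have "(\<lambda>x. (G x \<bullet> b) * \<eta> x) = (\<lambda>x. indicator \<Omega> x *\<^sub>R ((G x \<bullet> b) * \<eta> x))"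
  proof
    fix x show "(G x \<bullet> b) * \<eta> x = indicator \<Omega> x *\<^sub>R ((G x \<bullet> b) * \<eta> x)" by (cases "x \<in> \<Omega>") (simp_all add: z)
  qed
  also have "(\<integral>x. indicator \<Omega> x *\<^sub>R ((G x \<bullet> b) * \<eta> x) \<partial>lborel) = (LINT x|lebesgue_on \<Omega>. (G x \<bullet> b) * \<eta> x)"
  proof (rule integral_lebesgue_on_borel_version(1)[OF \<Omega>, symmetric])
    show "(\<lambda>x. (G x \<bullet> b) * \<eta> x) \<in> borel_measurable (lebesgue_on \<Omega>)" by (rule borel_measurable_lebesgue_onI) simp
  qed simp_all
  finally show "(LINT x|lebesgue_on \<Omega>. f x * frechet_derivative \<eta> (at x) b) = - (LINT x|lebesgue_on \<Omega>. (G x \<bullet> b) * \<eta> x)"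
    by (simp add: D_def)
qed

text \<open>With a the unit vector in question, the ball of radius 1 / 4 about a / 2 lies in the
  unit ball, and the integrand is at least 1 / 4 on it.\<close>

lemma c_dim_pos: "0 < c_dim (k :: 'n::finite)"
proof -
  define a :: "real ^ 'n" where "a = axis k 1"
  have a: "norm a = 1" "a \<bullet> a = 1" by (simp_all add: a_def norm_axis_1 inner_axis_axis)
  have i: "integrable lborel (\<lambda>x. indicator (ball (0 :: real ^ 'n) 1) x *\<^sub>R \<bar>x \<bullet> a\<bar>)"
    by (intro integrable_ball_of_cball borel_integrable_compact continuous_intros compact_cball)
  have "(1/4) * measure lborel (ball (a /\<^sub>R 2) (1/4)) = (\<integral>x. indicator (ball (a /\<^sub>R 2) (1/4)) x * (1/4) \<partial>lborel)"
    by simp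
  also have "\<dots> \<le> (\<integral>x. indicator (ball 0 1) x *\<^sub>R \<bar>x \<bullet> a\<bar> \<partial>lborel)"
  proof (rule Bochner_Integration.integral_mono[OF _ i])
    show "integrable lborel (\<lambda>x. indicator (ball (a /\<^sub>R 2) (1/4)) x * (1/4 :: real))"
      by (intro integrable_mult_left integrable_real_indicator) (auto simp: emeasure_ball_eq)
    fix x
    show "indicator (ball (a /\<^sub>R 2) (1/4)) x * (1/4) \<le> indicator (ball 0 1) x *\<^sub>R \<bar>x \<bullet> a\<bar>"
    proof (cases "x \<in> ball (a /\<^sub>R 2) (1/4)")
      case True
      then have d: "norm (x - a /\<^sub>R 2) < 1/4" by (simp add: dist_norm norm_minus_commute)
      have "x \<bullet> a = (x - a /\<^sub>R 2) \<bullet> a + 1/2" using a by (simp add: inner_diff_left)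
      moreover have "\<bar>(x - a /\<^sub>R 2) \<bullet> a\<bar> \<le> norm (x - a /\<^sub>R 2)" using Cauchy_Schwarz_ineq2[of "x - a /\<^sub>R 2" a] a by simp
      ultimately have "1/4 \<le> \<bar>x \<bullet> a\<bar>" using d by linarith
      moreover have "norm x < 1" using norm_triangle_ineq[of "x - a /\<^sub>R 2" "a /\<^sub>R 2"] d a by simp
      ultimately show ?thesis using True by simp
    qed simp
  qed
  finally have "0 < (\<integral>x. indicator (ball 0 1) x *\<^sub>R \<bar>x \<bullet> a\<bar> \<partial>lborel)"
    using measure_ball_pos[of "1/4" "a /\<^sub>R 2"] by linarith
  moreover have "0 < measure lborel (ball (0 :: real ^ 'n) 1)" by (rule measure_ball_pos) simp
  ultimately show ?thesis
    unfolding c_dim_def by (subst ball_average_eq_kconv) (simp_all add: kconv_ball_kernel a_def[symmetric] divide_inverse)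
qed

section \<open>Rescaling of modulars and slice integrals\<close>

context regular_phi
begin

lemma phi_int_scale:
  assumes "0 \<le> \<kappa>" "\<And>x. 0 \<le> g x"
  shows "(\<integral>\<^sup>+x. \<phi> x (\<kappa> * g x) \<partial>lebesgue_on \<Omega>) \<le> ennreal (scale_const \<kappa>) * (\<integral>\<^sup>+x. \<phi> x (g x) \<partial>lebesgue_on \<Omega>)"
proof -
  have "(\<integral>\<^sup>+x. \<phi> x (\<kappa> * g x) \<partial>lebesgue_on \<Omega>) \<le> (\<integral>\<^sup>+x. ennreal (scale_const \<kappa>) * \<phi> x (g x) \<partial>lebesgue_on \<Omega>)"
    by (rule nn_integral_lebesgue_on_mono_AE[OF open_\<Omega>]) (use phi_scale assms in \<open>auto elim!: eventually_mono\<close>)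
  also have "\<dots> \<le> ennreal (scale_const \<kappa>) * (\<integral>\<^sup>+x. \<phi> x (g x) \<partial>lebesgue_on \<Omega>)"
    using scale_const_ge[of \<kappa>] by (intro nn_integral_cmult_le) simp
  finally show ?thesis .
qed

lemma upper_int_scale:
  assumes "0 \<le> \<kappa>" "\<And>x. 0 \<le> g x"
  shows "(\<integral>\<^sup>+x. phi_upper x (\<kappa> * g x) \<partial>lebesgue_on \<Omega>) \<le> ennreal (scale_const (2 * \<kappa>)) * (\<integral>\<^sup>+x. \<phi> x (g x) \<partial>lebesgue_on \<Omega>)"
proof -
  have "(\<integral>\<^sup>+x. phi_upper x (\<kappa> * g x) \<partial>lebesgue_on \<Omega>) \<le> (\<integral>\<^sup>+x. ennreal (scale_const (2 * \<kappa>)) * \<phi> x (g x) \<partial>lebesgue_on \<Omega>)"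
    by (rule nn_integral_lebesgue_on_mono_AE[OF open_\<Omega>]) (use upper_scale assms in \<open>auto elim!: eventually_mono\<close>)
  also have "\<dots> \<le> ennreal (scale_const (2 * \<kappa>)) * (\<integral>\<^sup>+x. \<phi> x (g x) \<partial>lebesgue_on \<Omega>)"
    using scale_const_ge[of "2 * \<kappa>"] by (intro nn_integral_cmult_le) simp
  finally show ?thesis .
qed

text \<open>Passing from \<open>phi_upper\<close> to \<phi> costs \<open>scale_const 2\<close>, and
  dividing the argument by S gains c / S; the product is 1 / 2. A value strictly below 1 is wanted
  because an upper limit below 1 forces the modular below 1 eventually.\<close>

lemma upper_int_small:
  assumes "\<And>x. 0 \<le> g x"
  defines "S \<equiv> 2 * scale_const 2 * c"
  shows "(\<integral>\<^sup>+x. phi_upper x (g x / S) \<partial>lebesgue_on \<Omega>) \<le> ennreal (1/2) * (\<integral>\<^sup>+x. \<phi> x (g x) \<partial>lebesgue_on \<Omega>)"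
proof -
  have sc: "1 \<le> scale_const 2" by (rule scale_const_ge)
  then have "1 * 1 \<le> scale_const 2 * c" using c_ge by (intro mult_mono) auto
  then have S: "1 \<le> S" by (simp add: S_def)
  have "(\<integral>\<^sup>+x. phi_upper x (g x / S) \<partial>lebesgue_on \<Omega>) \<le> (\<integral>\<^sup>+x. ennreal (1/2) * \<phi> x (g x) \<partial>lebesgue_on \<Omega>)"
  proof (rule nn_integral_lebesgue_on_mono_AE[OF open_\<Omega>], use upper_scale in eventually_elim)
    case (elim x)
    show ?case
    proof
      assume x: "x \<in> \<Omega>"
      have "phi_upper x (1 * (g x / S)) \<le> ennreal (scale_const (2 * 1)) * \<phi> x (g x / S)"
        using elim[THEN mp, OF x, rule_format, of 1 "g x / S"] assms(1)[of x] S by simp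
      also have "\<dots> \<le> ennreal (scale_const 2) * (ennreal (c / S) * \<phi> x (g x))"
        using phi_scale_down[OF x assms(1) S] by (simp add: mult_left_mono)
      also have "\<dots> = ennreal (1/2) * \<phi> x (g x)"
      proof -
        have "ennreal (scale_const 2) * ennreal (c / S) = ennreal (scale_const 2 * (c / S))"
          using sc c_ge S by (intro ennreal_mult[symmetric]) auto
        also have "scale_const 2 * (c / S) = 1/2" using sc c_ge by (simp add: S_def)
        finally show ?thesis by (simp only: mult.assoc[symmetric])
      qed
      finally show "phi_upper x (g x / S) \<le> ennreal (1/2) * \<phi> x (g x)" by simp
    qed
  qed
  also have "\<dots> \<le> ennreal (1/2) * (\<integral>\<^sup>+x. \<phi> x (g x) \<partial>lebesgue_on \<Omega>)" by (intro nn_integral_cmult_le) simp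
  finally show ?thesis .
qed

lemma sharp_slice_cong_AE:
  assumes f: "f \<in> borel_measurable (lebesgue_on \<Omega>)" "f0 \<in> borel_measurable borel"
    and ae: "AE x in lborel. x \<in> \<Omega> \<longrightarrow> f x = f0 x" and r: "0 < r"
  shows "sharp_slice f r = sharp_slice f0 r"
  unfolding sharp_slice_def
proof (rule nn_integral_cong)
  fix x assume "x \<in> space (lebesgue_on (inner_part \<Omega> r))"
  then have "x \<in> inner_part \<Omega> r" by simp
  then have b: "ball x r \<subseteq> \<Omega>" using cball_subset_of_inner_part[OF open_\<Omega> _ r] ball_subset_cball by blast
  have "sharp_average f x r = sharp_average f0 x r"
  proof (rule sharp_average_cong_AE)
    show "f \<in> borel_measurable (lebesgue_on (ball x r))" by (rule measurable_restrict_mono[OF f(1) b])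
    show "AE y in lborel. y \<in> ball x r \<longrightarrow> f y = f0 y" using ae by eventually_elim (use b in auto)
  qed (rule f)
  then show "\<phi> x (1 / r * sharp_average f x r) = \<phi> x (1 / r * sharp_average f0 x r)" by simp
qed

lemma sharp_slice_antimono:
  assumes "0 < l" "l \<le> l'" "0 < r"
  shows "sharp_slice (\<lambda>x. f x / l') r \<le> sharp_slice (\<lambda>x. f x / l) r"
  unfolding sharp_slice_def
proof (rule nn_integral_mono)
  fix x assume "x \<in> space (lebesgue_on (inner_part \<Omega> r))"
  then have x: "x \<in> \<Omega>" using inner_part_subset by auto
  have s0: "0 \<le> sharp_average f x r" by (rule sharp_average_nonneg)
  have "sharp_average f x r / l' \<le> sharp_average f x r / l"
    using assms s0 by (intro divide_left_mono) auto
  then have "1 / r * (sharp_average f x r / l') \<le> 1 / r * (sharp_average f x r / l)"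
    using assms by (intro mult_left_mono) auto
  moreover have "0 \<le> 1 / r * (sharp_average f x r / l')" using assms s0 by simp
  moreover have "0 < l'" using assms by linarith
  ultimately show "\<phi> x (1 / r * sharp_average (\<lambda>x. f x / l') x r) \<le> \<phi> x (1 / r * sharp_average (\<lambda>x. f x / l) x r)"
    using x assms(1) by (simp only: sharp_average_divide phi_mono)
qed

end

locale regular_phi_weights = regular_phi \<Omega> \<phi> c p q \<beta> \<sigma> h + approximate_weights \<psi>
  for \<Omega> :: "'a::euclidean_space set" and \<phi> c p q \<beta> \<sigma> h \<psi>
begin

lemma sharp_modular_eq: "sharp_modular \<Omega> \<phi> (\<psi> \<epsilon>) f = weighted (sharp_slice f) \<epsilon>"
  by (simp add: sharp_modular_def weighted_def sharp_slice_def)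

lemma weighted_slice_cong:
  assumes "f \<in> borel_measurable (lebesgue_on \<Omega>)" "f0 \<in> borel_measurable borel" "AE x in lborel. x \<in> \<Omega> \<longrightarrow> f x = f0 x"
  shows "weighted (sharp_slice f) = weighted (sharp_slice f0)"
  unfolding weighted_def by (intro ext nn_integral_cong) (simp add: sharp_slice_cong_AE[OF assms])

lemma Limsup_weighted_le:
  assumes fG: "mollified_gradient \<Omega> f G" and l: "0 < l" "(\<integral>\<^sup>+x. \<phi> x (l * norm (G x)) \<partial>lebesgue_on \<Omega>) < \<infinity>"
  shows "Limsup (at_right 0) (weighted (sharp_slice f)) \<le> (\<integral>\<^sup>+x. phi_upper x (2 ^ (DIM('a) + 2) * norm (G x)) \<partial>lebesgue_on \<Omega>)"
proof -
  obtain M where M: "M < \<infinity>" "\<And>r. 0 < r \<Longrightarrow> sharp_slice f r \<le> M" by (rule slice_bounded[OF fG l]) (rule that)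
  from weighted_Limsup_le[OF M] slice_Limsup_le[OF fG l] show ?thesis by (rule order_trans)
qed

lemma Liminf_weighted_ge:
  assumes "mollified_gradient \<Omega> f G"
  shows "(\<integral>\<^sup>+x. \<phi> x (norm (G x) / (4 * grad_const TYPE('a))) \<partial>lebesgue_on \<Omega>) \<le> Liminf (at_right 0) (weighted (sharp_slice f))"
  using slice_Liminf_ge[OF assms] weighted_Liminf_ge by (rule order_trans)

text \<open>Dividing f by L brings the upper limit of the sharp modular down to at most 1 / 2, so L
  is eventually admissible in the infimum that defines the norm. The power of 2 in L compensates the
  factor in \<open>Limsup_weighted_le\<close>, and S is the one from
  \<open>upper_int_small\<close>.\<close>

lemma Limsup_sharp_norm_le:
  assumes fm: "f \<in> borel_measurable (lebesgue_on \<Omega>)" and f0: "AE x in lborel. x \<in> \<Omega> \<longrightarrow> f x = f0 x"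
    and fG: "mollified_gradient \<Omega> f0 G" and l: "0 < l" "(\<integral>\<^sup>+x. \<phi> x (norm (G x) / l) \<partial>lebesgue_on \<Omega>) \<le> 1"
  shows "Limsup (at_right 0) (\<lambda>\<epsilon>. sharp_norm \<Omega> \<phi> (\<psi> \<epsilon>) f) \<le> ennreal (2 ^ (DIM('a) + 3) * scale_const 2 * c * l)"
proof -
  define S where "S = 2 * scale_const 2 * c"
  define L where "L = 2 ^ (DIM('a) + 2) * S * l"
  have S: "0 < S" using c_ge scale_const_ge[of 2] by (simp add: S_def)
  then have L: "0 < L" using l by (simp add: L_def)
  have f0m [measurable]: "f0 \<in> borel_measurable borel" using fG by (simp add: mollified_gradient_def)
  note sG = mollified_gradient_scale[OF fG, of L]
  have e1: "(L / l) * norm (G x /\<^sub>R L) = norm (G x) / l" for x using L l by (simp add: divide_inverse)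
  have fin: "(\<integral>\<^sup>+x. \<phi> x ((L / l) * norm (G x /\<^sub>R L)) \<partial>lebesgue_on \<Omega>) < \<infinity>"
    unfolding e1 using l(2) by (rule order.strict_trans1) simp
  have "Limsup (at_right 0) (weighted (sharp_slice (\<lambda>x. f0 x / L))) \<le> (\<integral>\<^sup>+x. phi_upper x (2 ^ (DIM('a) + 2) * norm (G x /\<^sub>R L)) \<partial>lebesgue_on \<Omega>)"
    using L l by (intro Limsup_weighted_le[OF sG _ fin]) simp
  also have "\<dots> = (\<integral>\<^sup>+x. phi_upper x ((norm (G x) / l) / S) \<partial>lebesgue_on \<Omega>)"
  proof -
    have "2 ^ (DIM('a) + 2) * norm (G x /\<^sub>R L) = (norm (G x) / l) / S" for x
    proof -
      have "K * (z / (K * S * l)) = (z / l) / S" if "0 < K" for K z :: real using that l(1) S by (simp add: field_simps)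
      from this[of "2 ^ (DIM('a) + 2)" "norm (G x)"] have "2 ^ (DIM('a) + 2) * (norm (G x) / L) = (norm (G x) / l) / S"
        unfolding L_def by simp
      moreover have "norm (G x /\<^sub>R L) = norm (G x) / L" using L by (simp add: divide_inverse mult.commute)
      ultimately show ?thesis by (simp only:)
    qed
    then show ?thesis by (simp only:)
  qed
  also have "\<dots> \<le> ennreal (1/2) * (\<integral>\<^sup>+x. \<phi> x (norm (G x) / l) \<partial>lebesgue_on \<Omega>)"
    unfolding S_def using l by (intro upper_int_small) simp
  also have "\<dots> \<le> ennreal (1/2) * 1" by (intro mult_left_mono l) simp
  also have "\<dots> < 1"
  proof -
    have "ennreal (1/2) < ennreal 1" by (subst ennreal_less_iff) auto
    then show ?thesis by (simp only: ennreal_1 mult_1_right)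
  qed
  finally have "eventually (\<lambda>\<epsilon>. weighted (sharp_slice (\<lambda>x. f0 x / L)) \<epsilon> < 1) (at_right 0)" by (rule Limsup_lessD)
  then have "eventually (\<lambda>\<epsilon>. sharp_norm \<Omega> \<phi> (\<psi> \<epsilon>) f \<le> ennreal L) (at_right 0)"
  proof eventually_elim
    case (elim \<epsilon>)
    have "weighted (sharp_slice (\<lambda>x. f x / L)) = weighted (sharp_slice (\<lambda>x. f0 x / L))"
      by (rule weighted_slice_cong) (use fm f0 in \<open>auto elim!: eventually_mono\<close>)
    then have "sharp_modular \<Omega> \<phi> (\<psi> \<epsilon>) (\<lambda>x. f x / L) \<le> 1" using elim by (simp add: sharp_modular_eq)
    then show ?case unfolding sharp_norm_def using L by (intro Inf_lower) auto
  qed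
  then have "Limsup (at_right 0) (\<lambda>\<epsilon>. sharp_norm \<Omega> \<phi> (\<psi> \<epsilon>) f) \<le> ennreal L" by (rule Limsup_bounded)
  also have "L = 2 ^ (DIM('a) + 3) * scale_const 2 * c * l" by (simp add: L_def S_def power_add)
  finally show ?thesis .
qed

text \<open>For arbitrarily small \<epsilon> some l < y is admissible for the sharp norm. Slices
  decrease when f is divided by more, so y is admissible too, and the lower bound for the modular of
  f / y gives the claim.\<close>

lemma Liminf_sharp_norm_ge:
  assumes fm: "f \<in> borel_measurable (lebesgue_on \<Omega>)" and f0: "AE x in lborel. x \<in> \<Omega> \<longrightarrow> f x = f0 x"
    and fG: "mollified_gradient \<Omega> f0 G" and y: "Liminf (at_right 0) (\<lambda>\<epsilon>. sharp_norm \<Omega> \<phi> (\<psi> \<epsilon>) f) < ennreal y"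
  shows "0 < y" "(\<integral>\<^sup>+x. \<phi> x (norm (G x) / (4 * grad_const TYPE('a) * y)) \<partial>lebesgue_on \<Omega>) \<le> 1"
proof -
  show y0: "0 < y"
  proof (rule ccontr)
    assume "\<not> 0 < y" then have "ennreal y = 0" by (simp add: ennreal_neg)
    with y show False by simp
  qed
  have fr: "frequently (\<lambda>\<epsilon>. weighted (sharp_slice (\<lambda>x. f x / y)) \<epsilon> \<le> 1) (at_right 0)"
  proof (rule frequently_mono[OF _ frequently_less_of_Liminf_less[OF y]], intro allI impI)
    fix \<epsilon> assume "sharp_norm \<Omega> \<phi> (\<psi> \<epsilon>) f < ennreal y"
    then obtain l where l: "0 < l" "sharp_modular \<Omega> \<phi> (\<psi> \<epsilon>) (\<lambda>x. f x / l) \<le> 1" "ennreal l < ennreal y"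
      unfolding sharp_norm_def Inf_less_iff by auto
    then have ly: "l \<le> y" using y0 by (simp add: ennreal_less_iff)
    have "weighted (sharp_slice (\<lambda>x. f x / y)) \<epsilon> \<le> weighted (sharp_slice (\<lambda>x. f x / l)) \<epsilon>"
      unfolding weighted_def by (intro nn_integral_mono mult_right_mono sharp_slice_antimono l ly) auto
    with l(2) show "weighted (sharp_slice (\<lambda>x. f x / y)) \<epsilon> \<le> 1" by (simp add: sharp_modular_eq)
  qed
  have f0m [measurable]: "f0 \<in> borel_measurable borel" using fG by (simp add: mollified_gradient_def)
  have eq: "weighted (sharp_slice (\<lambda>x. f x / y)) = weighted (sharp_slice (\<lambda>x. f0 x / y))"
    by (rule weighted_slice_cong) (use fm f0 in \<open>auto elim!: eventually_mono\<close>)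
  have "Liminf (at_right 0) (weighted (sharp_slice (\<lambda>x. f0 x / y))) \<le> 1"
  proof (rule ccontr)
    assume "\<not> ?thesis"
    then have "1 < Liminf (at_right 0) (weighted (sharp_slice (\<lambda>x. f0 x / y)))" by simp
    then have "eventually (\<lambda>\<epsilon>. 1 < weighted (sharp_slice (\<lambda>x. f0 x / y)) \<epsilon>) (at_right 0)" by (rule less_LiminfD)
    then have "eventually (\<lambda>\<epsilon>. \<not> weighted (sharp_slice (\<lambda>x. f x / y)) \<epsilon> \<le> 1) (at_right 0)"
      unfolding eq by (rule eventually_mono) simp
    with fr show False by (simp add: frequently_def)
  qed
  then have "(\<integral>\<^sup>+x. \<phi> x (norm (G x /\<^sub>R y) / (4 * grad_const TYPE('a))) \<partial>lebesgue_on \<Omega>) \<le> 1"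
    by (rule order_trans[rotated]) (rule Liminf_weighted_ge[OF mollified_gradient_scale[OF fG]])
  moreover have "norm (G x /\<^sub>R y) / (4 * grad_const TYPE('a)) = norm (G x) / (4 * grad_const TYPE('a) * y)" for x
  proof -
    have "norm (G x /\<^sub>R y) = norm (G x) / y" using y0 by (simp add: divide_inverse mult.commute)
    then show ?thesis by (simp only: divide_divide_eq_left mult.commute)
  qed
  ultimately show "(\<integral>\<^sup>+x. \<phi> x (norm (G x) / (4 * grad_const TYPE('a) * y)) \<partial>lebesgue_on \<Omega>) \<le> 1" by (simp only:)
qed

lemma weak_gradient_iff:
  assumes f: "locally_integrable \<Omega> f"
  shows "(\<exists>G. weak_gradient \<Omega> f G \<and> G \<in> Lphi \<Omega> \<phi>) \<longleftrightarrow> Limsup (at_right 0) (\<lambda>\<epsilon>. sharp_modular \<Omega> \<phi> (\<psi> \<epsilon>) f) < \<infinity>"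
proof -
  note fm = locally_integrable_measurable[OF open_\<Omega> f]
  obtain f0 where f0: "f0 \<in> borel_measurable borel" "AE x in lborel. x \<in> \<Omega> \<longrightarrow> f x = f0 x"
    by (rule lebesgue_on_borel_version[OF open_\<Omega> fm])
  note eq = weighted_slice_cong[OF fm f0]
  show ?thesis
    unfolding sharp_modular_eq eq
  proof
    assume "\<exists>G. weak_gradient \<Omega> f G \<and> G \<in> Lphi \<Omega> \<phi>"
    then obtain G l where G: "weak_gradient \<Omega> f G" "G \<in> borel_measurable (lebesgue_on \<Omega>)"
        and l: "0 < l" "modular \<Omega> \<phi> (\<lambda>x. l *\<^sub>R G x) < \<infinity>" by (auto simp: Lphi_def)
    obtain G0 where G0: "G0 \<in> borel_measurable borel" "AE x in lborel. x \<in> \<Omega> \<longrightarrow> G x = G0 x"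
      by (rule lebesgue_on_borel_version[OF open_\<Omega> G(2)])
    have fG: "mollified_gradient \<Omega> f0 G0" by (rule weak_gradient_imp_mollified[OF open_\<Omega> f G(1) f0 G0])
    have "(\<integral>\<^sup>+x. \<phi> x (l * norm (G0 x)) \<partial>lebesgue_on \<Omega>) \<le> modular \<Omega> \<phi> (\<lambda>x. l *\<^sub>R G x)"
      unfolding modular_def
      by (rule nn_integral_lebesgue_on_mono_AE[OF open_\<Omega>]) (use G0(2) l in \<open>auto elim!: eventually_mono\<close>)
    with l(2) have fin: "(\<integral>\<^sup>+x. \<phi> x (l * norm (G0 x)) \<partial>lebesgue_on \<Omega>) < \<infinity>" by (rule le_less_trans[rotated])
    have "Limsup (at_right 0) (weighted (sharp_slice f0)) \<le> (\<integral>\<^sup>+x. phi_upper x (2 ^ (DIM('a) + 2) * norm (G0 x)) \<partial>lebesgue_on \<Omega>)"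
      by (rule Limsup_weighted_le[OF fG l(1) fin])
    also have "\<dots> = (\<integral>\<^sup>+x. phi_upper x ((2 ^ (DIM('a) + 2) / l) * (l * norm (G0 x))) \<partial>lebesgue_on \<Omega>)"
    proof -
      have "(2 ^ (DIM('a) + 2) / l) * (l * norm (G0 x)) = 2 ^ (DIM('a) + 2) * norm (G0 x)" for x using l by simp
      then show ?thesis by (simp only:)
    qed
    also have "\<dots> \<le> ennreal (scale_const (2 * (2 ^ (DIM('a) + 2) / l))) * (\<integral>\<^sup>+x. \<phi> x (l * norm (G0 x)) \<partial>lebesgue_on \<Omega>)"
      using l by (intro upper_int_scale) auto
    also have "\<dots> < \<infinity>" using fin by (simp add: ennreal_mult_less_top)
    finally show "Limsup (at_right 0) (weighted (sharp_slice f0)) < \<infinity>" .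
  next
    assume L: "Limsup (at_right 0) (weighted (sharp_slice f0)) < \<infinity>"
    \<comment> \<open>A finite upper limit of the weighted averages forces a finite lower limit of
      the slices, hence radii tending to 0 along which the slices are bounded.\<close>
    have "Liminf (at_right 0) (sharp_slice f0) \<le> Limsup (at_right 0) (weighted (sharp_slice f0))"
      by (rule order_trans[OF weighted_Liminf_ge Liminf_le_Limsup]) simp
    with L have lt: "Liminf (at_right 0) (sharp_slice f0) < top" by simp
    then obtain y where y: "Liminf (at_right 0) (sharp_slice f0) < y" "y < top" using dense by blast
    obtain K where K: "y = ennreal K" "0 \<le> K" using y(2) by (cases y) auto
    have "frequently (\<lambda>r. sharp_slice f0 r < ennreal K) (at_right 0)"
      using frequently_less_of_Liminf_less[OF y(1)] K by simp
    then obtain r where r: "\<And>j::nat. 0 < r j" "r \<longlonglongrightarrow> 0" "\<And>j. sharp_slice f0 (r j) < ennreal K"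
      by (rule frequently_at_right_seq) (rule that)
    obtain G where G: "G \<in> borel_measurable borel"
      "\<And>K. compact K \<Longrightarrow> K \<subseteq> \<Omega> \<Longrightarrow> integrable lborel (\<lambda>x. indicator K x *\<^sub>R G x)"
      "\<And>\<eta> b. test_function \<Omega> \<eta> \<Longrightarrow> b \<in> Basis \<Longrightarrow>
        (\<integral>x. f0 x * frechet_derivative \<eta> (at x) b \<partial>lborel) = - (\<integral>x. (G x \<bullet> b) * \<eta> x \<partial>lborel)"
      by (rule weak_gradient_exists[OF f0(1) locally_integrable_borel_version[OF open_\<Omega> f f0] r(1,2) K(2) less_imp_le[OF r(3)]])
         (assumption | rule that)+
    have wG: "weak_gradient \<Omega> f G" by (rule weak_gradientI_borel[OF open_\<Omega> f f0 G])
    have fG: "mollified_gradient \<Omega> f0 G" by (rule weak_gradient_imp_mollified[OF open_\<Omega> f wG f0 G(1)]) simp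
    have "modular \<Omega> \<phi> (\<lambda>x. (1 / (4 * grad_const TYPE('a))) *\<^sub>R G x) = (\<integral>\<^sup>+x. \<phi> x (norm (G x) / (4 * grad_const TYPE('a))) \<partial>lebesgue_on \<Omega>)"
      using grad_const_pos[where 'a='a] by (simp add: modular_def)
    also have "\<dots> \<le> Liminf (at_right 0) (weighted (sharp_slice f0))" by (rule Liminf_weighted_ge[OF fG])
    also have "\<dots> \<le> Limsup (at_right 0) (weighted (sharp_slice f0))" by (rule Liminf_le_Limsup) simp
    finally have "modular \<Omega> \<phi> (\<lambda>x. (1 / (4 * grad_const TYPE('a))) *\<^sub>R G x) < \<infinity>" using L by (rule le_less_trans)
    then have "G \<in> Lphi \<Omega> \<phi>"
      using grad_const_pos[where 'a='a] borel_measurable_lebesgue_onI[OF G(1)]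
      by (auto simp: Lphi_def intro!: exI[of _ "1 / (4 * grad_const TYPE('a))"])
    with wG show "\<exists>G. weak_gradient \<Omega> f G \<and> G \<in> Lphi \<Omega> \<phi>" by blast
  qed
qed

lemma sharp_modular_bounds:
  assumes cn: "0 < cn" and f: "locally_integrable \<Omega> f" and G: "weak_gradient \<Omega> f G" "G \<in> Lphi \<Omega> \<phi>"
  shows "modular \<Omega> \<phi> (\<lambda>x. cn * norm (G x)) \<le> ennreal (scale_const (4 * grad_const TYPE('a) * cn)) * Liminf (at_right 0) (\<lambda>\<epsilon>. sharp_modular \<Omega> \<phi> (\<psi> \<epsilon>) f)"
    "Limsup (at_right 0) (\<lambda>\<epsilon>. sharp_modular \<Omega> \<phi> (\<psi> \<epsilon>) f) \<le> ennreal (scale_const (2 * (2 ^ (DIM('a) + 2) / cn))) * modular \<Omega> \<phi> (\<lambda>x. cn * norm (G x))"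
    "Lphi_norm \<Omega> \<phi> G \<le> ennreal (4 * grad_const TYPE('a)) * Liminf (at_right 0) (\<lambda>\<epsilon>. sharp_norm \<Omega> \<phi> (\<psi> \<epsilon>) f)"
    "Limsup (at_right 0) (\<lambda>\<epsilon>. sharp_norm \<Omega> \<phi> (\<psi> \<epsilon>) f) \<le> ennreal (2 ^ (DIM('a) + 3) * scale_const 2 * c) * Lphi_norm \<Omega> \<phi> G"
proof -
  note fm = locally_integrable_measurable[OF open_\<Omega> f]
  obtain f0 where f0: "f0 \<in> borel_measurable borel" "AE x in lborel. x \<in> \<Omega> \<longrightarrow> f x = f0 x"
    by (rule lebesgue_on_borel_version[OF open_\<Omega> fm])
  note eq = weighted_slice_cong[OF fm f0]
  obtain l where Gm: "G \<in> borel_measurable (lebesgue_on \<Omega>)" and l: "0 < l" "modular \<Omega> \<phi> (\<lambda>x. l *\<^sub>R G x) < \<infinity>"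
    using G(2) by (auto simp: Lphi_def)
  obtain G0 where G0: "G0 \<in> borel_measurable borel" "AE x in lborel. x \<in> \<Omega> \<longrightarrow> G x = G0 x"
    by (rule lebesgue_on_borel_version[OF open_\<Omega> Gm])
  have fG: "mollified_gradient \<Omega> f0 G0" by (rule weak_gradient_imp_mollified[OF open_\<Omega> f G(1) f0 G0])
  have int_eq: "(\<integral>\<^sup>+x. \<phi> x (F (G x)) \<partial>lebesgue_on \<Omega>) = (\<integral>\<^sup>+x. \<phi> x (F (G0 x)) \<partial>lebesgue_on \<Omega>)" for F
    by (intro antisym nn_integral_lebesgue_on_mono_AE[OF open_\<Omega>]) (use G0(2) in \<open>auto elim!: eventually_mono\<close>)
  have m_eq: "modular \<Omega> \<phi> (\<lambda>x. cn * norm (G x)) = (\<integral>\<^sup>+x. \<phi> x (cn * norm (G0 x)) \<partial>lebesgue_on \<Omega>)"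
    using cn int_eq[of "\<lambda>g. cn * norm g"] by (simp add: modular_def abs_mult)
  have fin: "(\<integral>\<^sup>+x. \<phi> x (l * norm (G0 x)) \<partial>lebesgue_on \<Omega>) < \<infinity>"
    using l int_eq[of "\<lambda>g. l * norm g"] by (simp add: modular_def)
  define C0 where "C0 = 4 * grad_const TYPE('a)"
  have C0: "0 < C0" using grad_const_pos[where 'a='a] by (simp add: C0_def)
  have "(\<integral>\<^sup>+x. \<phi> x (cn * norm (G0 x)) \<partial>lebesgue_on \<Omega>) = (\<integral>\<^sup>+x. \<phi> x ((C0 * cn) * (norm (G0 x) / C0)) \<partial>lebesgue_on \<Omega>)"
    using C0 by simp
  also have "\<dots> \<le> ennreal (scale_const (C0 * cn)) * (\<integral>\<^sup>+x. \<phi> x (norm (G0 x) / C0) \<partial>lebesgue_on \<Omega>)"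
    using C0 cn by (intro phi_int_scale) auto
  also have "\<dots> \<le> ennreal (scale_const (C0 * cn)) * Liminf (at_right 0) (weighted (sharp_slice f0))"
    unfolding C0_def by (intro mult_left_mono Liminf_weighted_ge[OF fG]) simp
  finally show "modular \<Omega> \<phi> (\<lambda>x. cn * norm (G x)) \<le> ennreal (scale_const (4 * grad_const TYPE('a) * cn)) * Liminf (at_right 0) (\<lambda>\<epsilon>. sharp_modular \<Omega> \<phi> (\<psi> \<epsilon>) f)"
    by (simp add: m_eq sharp_modular_eq eq C0_def)
  have "Limsup (at_right 0) (weighted (sharp_slice f0)) \<le> (\<integral>\<^sup>+x. phi_upper x (2 ^ (DIM('a) + 2) * norm (G0 x)) \<partial>lebesgue_on \<Omega>)"
    by (rule Limsup_weighted_le[OF fG l(1) fin])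
  also have "\<dots> = (\<integral>\<^sup>+x. phi_upper x ((2 ^ (DIM('a) + 2) / cn) * (cn * norm (G0 x))) \<partial>lebesgue_on \<Omega>)"
  proof -
    have "(2 ^ (DIM('a) + 2) / cn) * (cn * norm (G0 x)) = 2 ^ (DIM('a) + 2) * norm (G0 x)" for x using cn by simp
    then show ?thesis by (simp only:)
  qed
  also have "\<dots> \<le> ennreal (scale_const (2 * (2 ^ (DIM('a) + 2) / cn))) * (\<integral>\<^sup>+x. \<phi> x (cn * norm (G0 x)) \<partial>lebesgue_on \<Omega>)"
    using cn by (intro upper_int_scale) auto
  finally show "Limsup (at_right 0) (\<lambda>\<epsilon>. sharp_modular \<Omega> \<phi> (\<psi> \<epsilon>) f) \<le> ennreal (scale_const (2 * (2 ^ (DIM('a) + 2) / cn))) * modular \<Omega> \<phi> (\<lambda>x. cn * norm (G x))"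
    by (simp add: m_eq sharp_modular_eq eq)
  have norm_eq: "modular \<Omega> \<phi> (\<lambda>x. G x /\<^sub>R m) = (\<integral>\<^sup>+x. \<phi> x (norm (G0 x) / m) \<partial>lebesgue_on \<Omega>)" if "0 < m" for m
    using that int_eq[of "\<lambda>g. norm g / m"] by (simp add: modular_def divide_inverse mult.commute)
  define L where "L = Liminf (at_right 0) (\<lambda>\<epsilon>. sharp_norm \<Omega> \<phi> (\<psi> \<epsilon>) f)"
  have inv: "ennreal C0 * (ennreal (inverse C0) * z) = z" for z
  proof -
    have "ennreal C0 * ennreal (inverse C0) = 1" using C0 by (subst ennreal_mult[symmetric]) auto
    then show ?thesis by (simp only: mult.assoc[symmetric] mult_1_left)
  qed
  have "ennreal (inverse C0) * Lphi_norm \<Omega> \<phi> G \<le> L"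
  proof (rule ccontr)
    assume "\<not> ?thesis"
    then have "L < ennreal (inverse C0) * Lphi_norm \<Omega> \<phi> G" by simp
    \<comment> \<open>A finite number in between: C0 times it is admissible for the norm of G, which
      contradicts its choice.\<close>
    then obtain y where y: "L < y" "y < ennreal (inverse C0) * Lphi_norm \<Omega> \<phi> G" using dense by blast
    then obtain y' where y': "y = ennreal y'" by (cases y) auto
    note ge = Liminf_sharp_norm_ge[OF fm f0(2) fG y(1)[unfolded L_def y']]
    have m0: "0 < C0 * y'" using C0 ge(1) by simp
    have "modular \<Omega> \<phi> (\<lambda>x. G x /\<^sub>R (C0 * y')) \<le> 1" unfolding norm_eq[OF m0] using ge(2) by (simp add: C0_def)
    then have "Lphi_norm \<Omega> \<phi> G \<le> ennreal (C0 * y')" unfolding Lphi_norm_def using m0 by (intro Inf_lower) auto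
    then have "ennreal (inverse C0) * Lphi_norm \<Omega> \<phi> G \<le> ennreal (inverse C0) * ennreal (C0 * y')" by (rule mult_left_mono) simp
    also have "\<dots> = y" unfolding y' using C0 ge(1) by (subst ennreal_mult[symmetric]) auto
    finally show False using y(2) by simp
  qed
  then have "ennreal C0 * (ennreal (inverse C0) * Lphi_norm \<Omega> \<phi> G) \<le> ennreal C0 * L" by (rule mult_left_mono) simp
  then show "Lphi_norm \<Omega> \<phi> G \<le> ennreal (4 * grad_const TYPE('a)) * Liminf (at_right 0) (\<lambda>\<epsilon>. sharp_norm \<Omega> \<phi> (\<psi> \<epsilon>) f)"
    by (simp only: inv) (simp only: C0_def L_def)
  define B where "B = 2 ^ (DIM('a) + 3) * scale_const 2 * c"
  have B: "0 < B" using scale_const_ge[of 2] c_ge by (simp add: B_def)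
  define U where "U = Limsup (at_right 0) (\<lambda>\<epsilon>. sharp_norm \<Omega> \<phi> (\<psi> \<epsilon>) f)"
  have "ennreal (inverse B) * U \<le> Lphi_norm \<Omega> \<phi> G"
    unfolding Lphi_norm_def
  proof (rule Inf_greatest)
    fix z assume "z \<in> {ennreal l | l. 0 < l \<and> modular \<Omega> \<phi> (\<lambda>x. G x /\<^sub>R l) \<le> 1}"
    then obtain m where m: "z = ennreal m" "0 < m" "modular \<Omega> \<phi> (\<lambda>x. G x /\<^sub>R m) \<le> 1" by auto
    have "U \<le> ennreal (B * m)"
      unfolding U_def B_def using m(3) by (intro Limsup_sharp_norm_le[OF fm f0(2) fG m(2)]) (simp only: norm_eq[OF m(2)])
    then have "ennreal (inverse B) * U \<le> ennreal (inverse B) * ennreal (B * m)" by (rule mult_left_mono) simp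
    also have "\<dots> = z" unfolding m(1) using B m(2) by (subst ennreal_mult[symmetric]) auto
    finally show "ennreal (inverse B) * U \<le> z" .
  qed
  then have "ennreal B * (ennreal (inverse B) * U) \<le> ennreal B * Lphi_norm \<Omega> \<phi> G" by (rule mult_left_mono) simp
  moreover have "ennreal B * (ennreal (inverse B) * U) = U"
  proof -
    have "ennreal B * ennreal (inverse B) = 1" using B by (subst ennreal_mult[symmetric]) auto
    then show ?thesis by (simp only: mult.assoc[symmetric] mult_1_left)
  qed
  ultimately show "Limsup (at_right 0) (\<lambda>\<epsilon>. sharp_norm \<Omega> \<phi> (\<psi> \<epsilon>) f) \<le> ennreal (2 ^ (DIM('a) + 3) * scale_const 2 * c) * Lphi_norm \<Omega> \<phi> G"
    by (simp add: U_def B_def)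
qed

end

section \<open>From the hypotheses of the theorem to the working assumptions\<close>

lemma ennreal_mult_le_mult_cancel:
  assumes "ennreal a * X \<le> ennreal b * Y" "0 < a" "0 \<le> b" "b / a \<le> d"
  shows "X \<le> ennreal d * Y"
proof -
  have "ennreal (1 / a) * ennreal a = 1" using assms(2) by (subst ennreal_mult[symmetric]) auto
  then have "X = ennreal (1 / a) * (ennreal a * X)" by (simp only: mult.assoc[symmetric] mult_1_left)
  also have "\<dots> \<le> ennreal (1 / a) * (ennreal b * Y)" using assms(1) by (rule mult_left_mono) simp
  also have "\<dots> = ennreal (b / a) * Y"
  proof -
    have "ennreal (1 / a) * ennreal b = ennreal (b / a)" using assms(2,3) by (subst ennreal_mult[symmetric]) auto
    then show ?thesis by (simp only: mult.assoc[symmetric])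
  qed
  also have "\<dots> \<le> ennreal d * Y" using assms(4) by (intro mult_right_mono ennreal_leI) auto
  finally show ?thesis .
qed

lemma almost_increasing_quotientD:
  assumes "almost_increasing_on {0<..} c1 (\<lambda>t. g t / ennreal t)" "0 < c1" "c1 \<le> c" "0 < s" "s \<le> t"
  shows "g s \<le> ennreal (c * s / t) * g t"
proof (rule ennreal_mult_le_mult_cancel)
  have "g s / ennreal s \<le> ennreal c1 * (g t / ennreal t)"
    using assms by (auto simp: almost_increasing_on_def)
  also have "g s / ennreal s = ennreal (1 / s) * g s"
    using assms by (simp add: divide_ennreal_def inverse_ennreal divide_inverse mult.commute)
  also have "ennreal c1 * (g t / ennreal t) = (ennreal c1 * ennreal (1 / t)) * g t"
    using assms by (simp add: divide_ennreal_def inverse_ennreal divide_inverse mult_ac)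
  also have "ennreal c1 * ennreal (1 / t) = ennreal (c1 / t)"
    using assms by (subst ennreal_mult[symmetric]) auto
  finally show "ennreal (1 / s) * g s \<le> ennreal (c1 / t) * g t" .
  have "c1 * s / t \<le> c * s / t" using assms by (intro divide_right_mono mult_right_mono) auto
  then show "c1 / t / (1 / s) \<le> c * s / t" by simp
qed (use assms in auto)

lemma almost_increasing_powrD:
  assumes "almost_increasing_on {0<..} c1 (\<lambda>t. ennreal (t powr - p) * g t)" "0 < c1" "c1 \<le> c" "0 < s" "s \<le> t"
  shows "g s \<le> ennreal (c * (s / t) powr p) * g t"
proof (rule ennreal_mult_le_mult_cancel)
  have "ennreal (s powr - p) * g s \<le> ennreal c1 * (ennreal (t powr - p) * g t)"
    using assms by (auto simp: almost_increasing_on_def)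
  also have "\<dots> = ennreal (c1 * t powr - p) * g t"
    using assms by (subst ennreal_mult) (auto simp: mult.assoc)
  finally show "ennreal (s powr - p) * g s \<le> ennreal (c1 * t powr - p) * g t" .
  have "c1 * t powr - p / s powr - p = c1 * (s / t) powr p"
    using assms by (simp add: powr_minus powr_divide field_simps)
  also have "\<dots> \<le> c * (s / t) powr p" using assms by (intro mult_right_mono) auto
  finally show "c1 * t powr - p / s powr - p \<le> c * (s / t) powr p" .
qed (use assms in auto)

text \<open>The constant of almost decrease multiplies the smaller side, so it enters through its
  reciprocal.\<close>

lemma almost_decreasing_powrD:
  assumes "almost_decreasing_on {0<..} c1 (\<lambda>t. ennreal (t powr - q) * g t)" "0 < c1" "1 / c1 \<le> c" "0 < s" "s \<le> t"
  shows "g t \<le> ennreal (c * (t / s) powr q) * g s"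
proof (rule ennreal_mult_le_mult_cancel)
  have "ennreal (c1 * t powr - q) * g t = ennreal c1 * (ennreal (t powr - q) * g t)"
    using assms by (subst ennreal_mult) (auto simp: mult.assoc)
  also have "\<dots> \<le> ennreal (s powr - q) * g s"
    using assms by (auto simp: almost_decreasing_on_def)
  finally show "ennreal (c1 * t powr - q) * g t \<le> ennreal (s powr - q) * g s" .
  have "s powr - q / (c1 * t powr - q) = 1 / c1 * (t / s) powr q"
    using assms by (simp add: powr_minus powr_divide field_simps)
  also have "\<dots> \<le> c * (t / s) powr q" using assms by (intro mult_right_mono) auto
  finally show "s powr - q / (c1 * t powr - q) \<le> c * (t / s) powr q" .
qed (use assms in auto)

lemma le_left_inverse:
  assumes "mono_on {0..} (\<phi> y)" "0 \<le> t" "\<phi> y t < s"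
  shows "ennreal t \<le> left_inverse \<phi> y s"
  unfolding left_inverse_def
proof (rule Inf_greatest)
  fix z assume "z \<in> {ennreal t | t. 0 \<le> t \<and> s \<le> \<phi> y t}"
  then obtain t' where t': "z = ennreal t'" "0 \<le> t'" "s \<le> \<phi> y t'" by auto
  have "t \<le> t'"
  proof (rule ccontr)
    assume "\<not> t \<le> t'"
    then have "\<phi> y t' \<le> \<phi> y t" using t'(2) assms(2) by (intro mono_onD[OF assms(1)]) auto
    with t'(3) assms(3) show False by simp
  qed
  then show "ennreal t \<le> z" unfolding t'(1) by (rule ennreal_leI)
qed

lemma enn2ereal_le_add_abs:
  assumes "enn2ereal A \<le> enn2ereal B + ereal a + ereal b"
  shows "A \<le> B + ennreal \<bar>a\<bar> + ennreal \<bar>b\<bar>"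
proof -
  have "enn2ereal B + ereal a + ereal b \<le> enn2ereal B + ereal \<bar>a\<bar> + ereal \<bar>b\<bar>"
    by (intro add_mono) auto
  with assms have "enn2ereal A \<le> enn2ereal B + ereal \<bar>a\<bar> + ereal \<bar>b\<bar>" by (rule order_trans)
  then show ?thesis by (simp add: less_eq_ennreal.rep_eq plus_ennreal.rep_eq enn2ereal_ennreal)
qed

lemma assm_A2_borel:
  fixes \<Omega> :: "'a::euclidean_space set"
  assumes \<Omega>: "open \<Omega>" and "assm_A2 \<Omega> \<phi> \<beta> \<sigma>"
  obtains h :: "'a \<Rightarrow> real" where "integrable lborel h" "\<And>x. 0 \<le> h x"
    "AE x in lborel. x \<in> \<Omega> \<longrightarrow> (AE y in lborel. y \<in> \<Omega> \<longrightarrow> (\<forall>t\<in>{0..\<sigma>}.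
          \<phi> x (\<beta> * t) \<le> \<phi> y t + ennreal (h x) + ennreal (h y)))"
proof -
  obtain h0 :: "'a \<Rightarrow> real" where h0: "integrable (lebesgue_on \<Omega>) h0"
    and A2: "AE x in lebesgue_on \<Omega>. AE y in lebesgue_on \<Omega>. \<forall>t\<in>{0..\<sigma>}.
           enn2ereal (\<phi> x (\<beta> * t)) \<le> enn2ereal (\<phi> y t) + ereal (h0 x) + ereal (h0 y)"
    using assms(2) unfolding assm_A2_def by blast
  have h0m: "h0 \<in> borel_measurable (lebesgue_on \<Omega>)" using h0 by simp
  obtain h1 where h1: "h1 \<in> borel_measurable borel" "AE x in lborel. x \<in> \<Omega> \<longrightarrow> h0 x = h1 x"
    by (rule lebesgue_on_borel_version[OF \<Omega> h0m])
  have i: "integrable lborel (\<lambda>x. indicator \<Omega> x *\<^sub>R h1 x)"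
    using h0 integral_lebesgue_on_borel_version(2)[OF \<Omega> h0m h1] by simp
  show ?thesis
  \<comment> \<open>The absolute value settles the sign, and the indicator makes the function
    integrable on the whole space.\<close>
  proof (rule that[of "\<lambda>x. \<bar>indicator \<Omega> x *\<^sub>R h1 x\<bar>"])
    show "integrable lborel (\<lambda>x. \<bar>indicator \<Omega> x *\<^sub>R h1 x\<bar>)" using i by (rule integrable_abs)
    from A2 have "AE x in lborel. x \<in> \<Omega> \<longrightarrow> (AE y in lborel. y \<in> \<Omega> \<longrightarrow> (\<forall>t\<in>{0..\<sigma>}.
           enn2ereal (\<phi> x (\<beta> * t)) \<le> enn2ereal (\<phi> y t) + ereal (h0 x) + ereal (h0 y)))"
      unfolding AE_lebesgue_on_iff[OF \<Omega>] .
    then show "AE x in lborel. x \<in> \<Omega> \<longrightarrow> (AE y in lborel. y \<in> \<Omega> \<longrightarrow> (\<forall>t\<in>{0..\<sigma>}.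
          \<phi> x (\<beta> * t) \<le> \<phi> y t + ennreal \<bar>indicator \<Omega> x *\<^sub>R h1 x\<bar> + ennreal \<bar>indicator \<Omega> y *\<^sub>R h1 y\<bar>))"
      using h1(2)
    proof eventually_elim
      case (elim x)
      show ?case
      proof
        assume x: "x \<in> \<Omega>"
        from elim(1)[rule_format, OF x] h1(2)
        show "AE y in lborel. y \<in> \<Omega> \<longrightarrow> (\<forall>t\<in>{0..\<sigma>}.
          \<phi> x (\<beta> * t) \<le> \<phi> y t + ennreal \<bar>indicator \<Omega> x *\<^sub>R h1 x\<bar> + ennreal \<bar>indicator \<Omega> y *\<^sub>R h1 y\<bar>)"
        proof eventually_elim
          case (elim y)
          have "h0 x = h1 x" using \<open>x \<in> \<Omega> \<longrightarrow> h0 x = h1 x\<close> x by simp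
          with elim x show ?case by (auto intro!: enn2ereal_le_add_abs)
        qed
      qed
    qed
  qed simp
qed

lemma regular_phi_exists:
  fixes \<Omega> :: "'a::euclidean_space set"
  assumes \<Omega>: "open \<Omega>" and phi: "\<phi> \<in> Phi_w \<Omega>" "assm_A \<Omega> \<phi>" "aInc \<Omega> \<phi>" "aDec \<Omega> \<phi>"
  obtains c p q \<beta> \<sigma> h where "regular_phi \<Omega> \<phi> c p q \<beta> \<sigma> h"
proof -
  obtain c1 where c1: "0 < c1" "\<And>x. x \<in> \<Omega> \<Longrightarrow> weak_Phi_function_with c1 (\<phi> x)"
    and meas: "\<And>t. 0 \<le> t \<Longrightarrow> (\<lambda>x. \<phi> x t) \<in> borel_measurable (lebesgue_on \<Omega>)"
    using phi(1) by (auto simp: Phi_w_def)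
  note W = c1(2)[unfolded weak_Phi_function_with_def]
  obtain p c2 where p: "1 < p" "0 < c2" "AE x in lborel. x \<in> \<Omega> \<longrightarrow>
      almost_increasing_on {0<..} c2 (\<lambda>s. ennreal (s powr (- p)) * \<phi> x s)"
    using phi(3) unfolding aInc_def AE_lebesgue_on_iff[OF \<Omega>] by blast
  obtain q c3 where q: "1 < q" "0 < c3" "AE x in lborel. x \<in> \<Omega> \<longrightarrow>
      almost_decreasing_on {0<..} c3 (\<lambda>s. ennreal (s powr (- q)) * \<phi> x s)"
    using phi(4) unfolding aDec_def AE_lebesgue_on_iff[OF \<Omega>] by blast
  obtain \<beta> \<sigma> where pos: "0 < \<beta>" "0 < \<sigma>" and A: "assm_A0 \<Omega> \<phi> \<beta> \<sigma>" "assm_A1 \<Omega> \<phi> \<beta> \<sigma>" "assm_A2 \<Omega> \<phi> \<beta> \<sigma>"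
    using phi(2) by (auto simp: assm_A_def)
  obtain h :: "'a \<Rightarrow> real" where h: "integrable lborel h" "\<And>x. 0 \<le> h x"
    "AE x in lborel. x \<in> \<Omega> \<longrightarrow> (AE y in lborel. y \<in> \<Omega> \<longrightarrow> (\<forall>t\<in>{0..\<sigma>}.
          \<phi> x (\<beta> * t) \<le> \<phi> y t + ennreal (h x) + ennreal (h y)))"
    by (rule assm_A2_borel[OF \<Omega> A(3)]) (rule that)
  define c where "c = max 1 (max c1 (max c2 (1 / c3)))"
  have c: "1 \<le> c" "c1 \<le> c" "c2 \<le> c" "1 / c3 \<le> c" by (auto simp: c_def)
  have "regular_phi \<Omega> \<phi> c p q \<beta> \<sigma> h"
  proof
    show "\<phi> x s \<le> \<phi> x t" if "x \<in> \<Omega>" "0 \<le> s" "s \<le> t" for x s t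
      by (rule mono_onD[OF conjunct1[OF W[OF that(1)]]]) (use that in auto)
    show "\<phi> x 0 = 0" "(\<phi> x \<longlongrightarrow> 0) (at_right 0)" if "x \<in> \<Omega>" for x
      using W[OF that] by auto
    show "\<phi> x s \<le> ennreal (c * s / t) * \<phi> x t" if "x \<in> \<Omega>" "0 < s" "s \<le> t" for x s t
      by (rule almost_increasing_quotientD[OF _ c1(1) c(2) that(2,3)]) (use W[OF that(1)] in blast)
    show "AE x in lborel. x \<in> \<Omega> \<longrightarrow> (\<forall>s t. 0 < s \<longrightarrow> s \<le> t \<longrightarrow> \<phi> x s \<le> ennreal (c * (s / t) powr p) * \<phi> x t)"
      using p(3) by eventually_elim (intro allI impI almost_increasing_powrD[OF _ p(2) c(3)], auto)
    show "AE x in lborel. x \<in> \<Omega> \<longrightarrow> (\<forall>s t. 0 < s \<longrightarrow> s \<le> t \<longrightarrow> \<phi> x t \<le> ennreal (c * (t / s) powr q) * \<phi> x s)"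
      using q(3) by eventually_elim (intro allI impI almost_decreasing_powrD[OF _ q(2) c(4)], auto)
    show "\<phi> x (\<beta> * \<sigma>) \<le> 1" "1 \<le> \<phi> x \<sigma>" if "x \<in> \<Omega>" for x
      using A(1) that by (auto simp: assm_A0_def)
    fix z x y and r t :: real
    assume *: "0 < r" "ball z r \<subseteq> \<Omega>" "x \<in> ball z r" "y \<in> ball z r" "\<sigma> \<le> t" "\<phi> y t < 1 / emeasure lborel (ball z r)"
    have "y \<in> \<Omega>" using *(2,4) by auto
    then have "ennreal t \<le> left_inverse \<phi> y (1 / emeasure lborel (ball z r))"
      using W[of y] * pos(2) by (intro le_left_inverse) auto
    moreover have "emeasure lebesgue (ball z r) = emeasure lborel (ball z r)" by simp
    ultimately have "ennreal t \<le> left_inverse \<phi> y (1 / emeasure lebesgue (ball z r))" by (simp only:)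
    then show "\<phi> x (\<beta> * t) \<le> \<phi> y t" using A(2) *(1-5) unfolding assm_A1_def by blast
  qed (fact \<Omega> meas c(1) p(1) q(1) pos h)+
  then show ?thesis by (rule that)
qed

theorem theorem4p6:
  fixes \<Omega> :: "(real ^ 'n) set"
    and \<phi> :: "real ^ 'n \<Rightarrow> real \<Rightarrow> ennreal"
    and \<psi> :: "real \<Rightarrow> real \<Rightarrow> real"
    and k :: 'n
  assumes "open \<Omega>"
    and "\<phi> \<in> Phi_w \<Omega>"
    and "assm_A \<Omega> \<phi>" and "aInc \<Omega> \<phi>" and "aDec \<Omega> \<phi>"
    and "\<And>\<epsilon>. 0 < \<epsilon> \<Longrightarrow> integrable (lebesgue_on {0<..}) (\<psi> \<epsilon>)"
    and "\<And>\<epsilon> r. 0 < \<epsilon> \<Longrightarrow> 0 < r \<Longrightarrow> 0 \<le> \<psi> \<epsilon> r"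
    and "\<And>\<epsilon>. 0 < \<epsilon> \<Longrightarrow> (LINT r|lebesgue_on {0<..}. \<psi> \<epsilon> r) = 1"
    and "\<And>\<gamma>. 0 < \<gamma> \<Longrightarrow> ((\<lambda>\<epsilon>. LINT r|lebesgue_on {\<gamma><..}. \<psi> \<epsilon> r) \<longlongrightarrow> 0) (at_right 0)"
  shows "(\<forall>f. locally_integrable \<Omega> f \<longrightarrow>
            ((\<exists>G. weak_gradient \<Omega> f G \<and> G \<in> Lphi \<Omega> \<phi>) \<longleftrightarrow>
             Limsup (at_right 0) (\<lambda>\<epsilon>. sharp_modular \<Omega> \<phi> (\<psi> \<epsilon>) f) < \<infinity>)) \<and>
         (\<exists>C\<ge>1. \<forall>f G. locally_integrable \<Omega> f \<and> weak_gradient \<Omega> f G \<and> G \<in> Lphi \<Omega> \<phi> \<longrightarrow>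
            ennreal (1 / C) * modular \<Omega> \<phi> (\<lambda>x. c_dim k * norm (G x))
              \<le> Liminf (at_right 0) (\<lambda>\<epsilon>. sharp_modular \<Omega> \<phi> (\<psi> \<epsilon>) f) \<and>
            Liminf (at_right 0) (\<lambda>\<epsilon>. sharp_modular \<Omega> \<phi> (\<psi> \<epsilon>) f)
              \<le> Limsup (at_right 0) (\<lambda>\<epsilon>. sharp_modular \<Omega> \<phi> (\<psi> \<epsilon>) f) \<and>
            Limsup (at_right 0) (\<lambda>\<epsilon>. sharp_modular \<Omega> \<phi> (\<psi> \<epsilon>) f)
              \<le> ennreal C * modular \<Omega> \<phi> (\<lambda>x. c_dim k * norm (G x)) \<and>
            ennreal (1 / C) * (ennreal (c_dim k) * Lphi_norm \<Omega> \<phi> G)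
              \<le> Liminf (at_right 0) (\<lambda>\<epsilon>. sharp_norm \<Omega> \<phi> (\<psi> \<epsilon>) f) \<and>
            Liminf (at_right 0) (\<lambda>\<epsilon>. sharp_norm \<Omega> \<phi> (\<psi> \<epsilon>) f)
              \<le> Limsup (at_right 0) (\<lambda>\<epsilon>. sharp_norm \<Omega> \<phi> (\<psi> \<epsilon>) f) \<and>
            Limsup (at_right 0) (\<lambda>\<epsilon>. sharp_norm \<Omega> \<phi> (\<psi> \<epsilon>) f)
              \<le> ennreal C * (ennreal (c_dim k) * Lphi_norm \<Omega> \<phi> G))"
proof -
  obtain c p q \<beta> \<sigma> h where "regular_phi \<Omega> \<phi> c p q \<beta> \<sigma> h"
    by (rule regular_phi_exists[OF assms(1-5)])
  then interpret regular_phi \<Omega> \<phi> c p q \<beta> \<sigma> h .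
  interpret approximate_weights \<psi> by standard (fact assms(6-9))+
  interpret regular_phi_weights \<Omega> \<phi> c p q \<beta> \<sigma> h \<psi> ..
  define cn where "cn = c_dim k"
  have cn: "0 < cn" unfolding cn_def by (rule c_dim_pos)
  define K1 where "K1 = scale_const (4 * grad_const TYPE(real ^ 'n) * cn)"
  define K2 where "K2 = scale_const (2 * (2 ^ (DIM(real ^ 'n) + 2) / cn))"
  define K3 where "K3 = 4 * grad_const TYPE(real ^ 'n)"
  define K4 where "K4 = 2 ^ (DIM(real ^ 'n) + 3) * scale_const 2 * c"
  have K: "0 \<le> K3" "0 \<le> K4"
    using grad_const_pos[where 'a="real ^ 'n"] scale_const_ge[of 2] c_ge by (auto simp: K3_def K4_def)
  \<comment> \<open>Dominates the constants of all four bounds. In the norm bounds c_n is explicit,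
    so the lower constant is multiplied by it and the upper one divided.\<close>
  define C where "C = max 1 (max (max K1 K2) (max (cn * K3) (K4 / cn)))"
  have C: "1 \<le> C" "K1 \<le> C" "K2 \<le> C" "cn * K3 \<le> C" "K4 / cn \<le> C" by (auto simp: C_def)
  have le: "X \<le> ennreal C * Y" if "X \<le> ennreal K * Y" "K \<le> C" for K X Y
    using that(1) mult_right_mono[OF ennreal_leI[OF that(2)], of Y] by (rule order_trans) simp
  have ge: "ennreal (1 / C) * X \<le> Y" if "X \<le> ennreal K * Y" "K \<le> C" for K X Y
  proof -
    have "ennreal (1 / C) * X \<le> ennreal (1 / C) * (ennreal C * Y)" using le[OF that] by (rule mult_left_mono) simp
    also have "\<dots> = Y"
    proof -
      have "ennreal (1 / C) * ennreal C = 1" using C(1) by (subst ennreal_mult[symmetric]) auto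
      then show ?thesis by (simp only: mult.assoc[symmetric] mult_1_left)
    qed
    finally show ?thesis .
  qed
  have bounds:
    "ennreal (1 / C) * modular \<Omega> \<phi> (\<lambda>x. cn * norm (G x)) \<le> Liminf (at_right 0) (\<lambda>\<epsilon>. sharp_modular \<Omega> \<phi> (\<psi> \<epsilon>) f)"
    "Limsup (at_right 0) (\<lambda>\<epsilon>. sharp_modular \<Omega> \<phi> (\<psi> \<epsilon>) f) \<le> ennreal C * modular \<Omega> \<phi> (\<lambda>x. cn * norm (G x))"
    "ennreal (1 / C) * (ennreal cn * Lphi_norm \<Omega> \<phi> G) \<le> Liminf (at_right 0) (\<lambda>\<epsilon>. sharp_norm \<Omega> \<phi> (\<psi> \<epsilon>) f)"
    "Limsup (at_right 0) (\<lambda>\<epsilon>. sharp_norm \<Omega> \<phi> (\<psi> \<epsilon>) f) \<le> ennreal C * (ennreal cn * Lphi_norm \<Omega> \<phi> G)"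
    if f: "locally_integrable \<Omega> f" "weak_gradient \<Omega> f G" "G \<in> Lphi \<Omega> \<phi>" for f G
  proof -
    note b = sharp_modular_bounds[OF cn f, folded K1_def K2_def K3_def K4_def]
    show "ennreal (1 / C) * modular \<Omega> \<phi> (\<lambda>x. cn * norm (G x)) \<le> Liminf (at_right 0) (\<lambda>\<epsilon>. sharp_modular \<Omega> \<phi> (\<psi> \<epsilon>) f)"
      using b(1) C(2) by (rule ge)
    show "Limsup (at_right 0) (\<lambda>\<epsilon>. sharp_modular \<Omega> \<phi> (\<psi> \<epsilon>) f) \<le> ennreal C * modular \<Omega> \<phi> (\<lambda>x. cn * norm (G x))"
      using b(2) C(3) by (rule le)
    have "ennreal cn * Lphi_norm \<Omega> \<phi> G \<le> ennreal cn * (ennreal K3 * Liminf (at_right 0) (\<lambda>\<epsilon>. sharp_norm \<Omega> \<phi> (\<psi> \<epsilon>) f))"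
      using b(3) by (rule mult_left_mono) simp
    also have "\<dots> = ennreal (cn * K3) * Liminf (at_right 0) (\<lambda>\<epsilon>. sharp_norm \<Omega> \<phi> (\<psi> \<epsilon>) f)"
      using cn K by (subst ennreal_mult) (auto simp: mult.assoc)
    finally show "ennreal (1 / C) * (ennreal cn * Lphi_norm \<Omega> \<phi> G) \<le> Liminf (at_right 0) (\<lambda>\<epsilon>. sharp_norm \<Omega> \<phi> (\<psi> \<epsilon>) f)"
      using C(4) by (rule ge)
    have "ennreal K4 * Lphi_norm \<Omega> \<phi> G = ennreal (K4 / cn) * (ennreal cn * Lphi_norm \<Omega> \<phi> G)"
    proof -
      have "ennreal (K4 / cn) * ennreal cn = ennreal K4" using cn K by (subst ennreal_mult[symmetric]) auto
      then show ?thesis by (simp only: mult.assoc[symmetric])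
    qed
    with b(4) have "Limsup (at_right 0) (\<lambda>\<epsilon>. sharp_norm \<Omega> \<phi> (\<psi> \<epsilon>) f) \<le> ennreal (K4 / cn) * (ennreal cn * Lphi_norm \<Omega> \<phi> G)"
      by (simp only:)
    then show "Limsup (at_right 0) (\<lambda>\<epsilon>. sharp_norm \<Omega> \<phi> (\<psi> \<epsilon>) f) \<le> ennreal C * (ennreal cn * Lphi_norm \<Omega> \<phi> G)"
      using C(5) by (rule le)
  qed
  show ?thesis
  proof (intro conjI exI[of _ C] C(1))
    show "\<forall>f. locally_integrable \<Omega> f \<longrightarrow> ((\<exists>G. weak_gradient \<Omega> f G \<and> G \<in> Lphi \<Omega> \<phi>) \<longleftrightarrow>
        Limsup (at_right 0) (\<lambda>\<epsilon>. sharp_modular \<Omega> \<phi> (\<psi> \<epsilon>) f) < \<infinity>)"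
      by (intro allI impI weak_gradient_iff)
  qed (intro allI impI, elim conjE, intro conjI bounds[unfolded cn_def] Liminf_le_Limsup, (assumption | simp)+)
qed

end
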